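(* The Atiyah–Bott and hypercohomology symplectic forms on $\mathcal L(\varepsilon,D)_{\mathrm{cf}}^\eta$ agree. That is, at each point $(P,s,\nabla)\in\mathcal L(\varepsilon,D)^\eta_{\mathrm{cf}}$, under the identification of the two descriptions of the tangent space $T_{(P,s,\nabla)}\mathcal L(\varepsilon,D)^\eta_{\mathrm{cf}}$ induced by $\phi\mapsto(\phi^{0,1},\phi^{1,0})$, one has $\omega_{AB}=\omega_{\mathbb H}$.
   Context: $G$ is a semisimple complex algebraic group with Lie algebra $\mathfrak g$, Killing form $\kappa$ (extended to $\operatorname{ad}P$-valued forms by combining with the wedge product), maximal torus $T$ with Lie algebra $\mathfrak t$, roots $\Phi$; $\mathfrak t_{\mathrm{reg}}=\mathfrak t\setminus\bigcup_{\alpha\in\Phi}\ker\alpha$. $X$ is a compact Riemann surface with canonical bundle $K$, $D=\sum_{j=1}^mk_jx_j$ an effective divisor ($x_j$ distinct), $D_{\mathrm{red}}=\sum_jx_j$, with a local coordinate $z$ fixed at each $x_j$. An irregular type is $\eta=(\eta_j)_{j=1}^m$, $\eta_j=\sum_{i=-k_j}^{-2}A^{(j)}_iz^i\,dz$, $A_i^{(j)}\in\mathfrak t$. $\mathcal L(\varepsilon,D)_{\mathrm{cf}}^\eta$ is the moduli space of triples $(P,s,\nabla)$: $P$ a holomorphic principal $G$-bundle of topological type $\varepsilon\in\pi_1(G)$, $\nabla$ a meromorphic connection on $P$ with poles bounded by $D$, and $s$ a trivialization of $P|_{D_{\mathrm{red}}}$ that is a generic compatible framing (the leading coefficient of $\nabla$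 at each $x_j$ with respect to $s$ lies in $\mathfrak t_{\mathrm{reg}}$), such that at each $x_j$ the irregular type of $\nabla$ is $\eta_j$ (after a formal change of trivialization extending $s$, $\nabla$ becomes $\eta_j+\Lambda_j\,dz/z$ with $\Lambda_j\in\mathfrak t$ not fixed). **Hypercohomology form.** Let $(\operatorname{ad}P\otimes K(D_{\mathrm{red}}))^{s,\mathfrak t}\subseteq\operatorname{ad}P\otimes K(D_{\mathrm{red}})$ be the subsheaf of sections whose logarithmic term with respect to $s$ lies in $\mathfrak t$, and let $\operatorname{ad}P(-D_{\mathrm{red}})^{s,\mathfrak t}\subseteq\operatorname{ad}P(-D_{\mathrm{red}})$ be its preimage under $-\nabla$. The tangent space at $(P,s,\nabla)$ is the first hypercohomology of $$\operatorname{ad}P(-D_{\mathrm{red}})^{s,\mathfrak t}\xrightarrow{-\nabla}(\operatorname{ad}P\otimes K(D_{\mathrm{red}}))^{s,\mathfrak t}.$$ In a Dolbeault resolution a class is represented by $(\tau,\nu)\in\Omega^{0,1}(\operatorname{ad}P(-D_{\mathrm{red}})^{s,\mathfrak t})\oplus C^\infty((\operatorname{ad}P\otimes K(D_{\mathrm{red}}))^{s,\mathfrak t})$ with $-\nabla\tau=\bar\partial\nu$, and $$\omega_{\mathbb H}\big((\tau_1,\nu_1),(\tau_2,\nu_2)\big)=\int_X\kappa(\tau_1,\nu_2)-\kappa(\tau_2,\nu_1).$$ **Atiyah–Bott form.** Regard $P$ as a $C^\infty$ bundle. Let $\mathcal A(\eta)$ be the set of singular $C^\infty$ connections on $P$ whose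 Taylor (Laurent) expansion at each $x_j$, with respect to a smooth trivialization extending $s$, is $\eta_j$ up to a logarithmic term in $\mathfrak t\,dz/z$. Its tangent space at $\nabla$ is $$T_\nabla\mathcal A(\eta)=\{\phi\in\Omega^1(\operatorname{ad}P(D)):\ L_i(\phi)\in\mathfrak t\,dz/z,\ 1\le i\le m\},$$ where $L_i(\phi)$ is the Taylor expansion of $\phi$ at $x_i$ in a trivialization in which $\nabla$ is represented by its normal form; on it $\omega_{AB}(\phi,\psi)=\int_X\kappa(\phi,\psi)$. Let $\mathcal A(\eta)_{\mathrm{fl}}$ be the flat connections in $\mathcal A(\eta)$; then $T_\nabla\mathcal A(\eta)_{\mathrm{fl}}=\{\phi:\nabla\phi=0\}$. A flat $\nabla\in\mathcal A(\eta)_{\mathrm{fl}}$ determines a holomorphic structure on $P$ by $\nabla^{0,1}$ and a meromorphic connection by $\nabla^{1,0}$ (in a holomorphic frame). The group $\mathcal G_1$ of $C^\infty$ gauge transformations whose Taylor expansion at each $x_j$ is the identity acts on $\mathcal A(\eta)$ in a Hamiltonian way with moment map the curvature, and $\mathcal L(\varepsilon,D)_{\mathrm{cf}}^\eta=\mathcal A(\eta)_{\mathrm{fl}}/\mathcal G_1$ as a symplectic quotient; the induced form is also denoted $\omega_{AB}$. Thus the tangent space is also $T_\nabla\mathcal A(\eta)_{\mathrm{fl}}$ modulo $\{-\nabla\mu:\mu\in\operatorname{Lie}\mathcal G_1\}$, and $\phi\mapsto(\phi^{0,1},\phi^{1,0})$ (decomposition into types) sends $T_\nabla\mathcal A(\eta)_{\mathrm{fl}}$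 to Dolbeault hypercocycles and the infinitesimal $\mathcal G_1$-action to coboundaries, inducing the identification of the two descriptions of the tangent space. *)

theory Defs
  imports "HOL-Complex_Analysis.Complex_Analysis" "HOL-Algebra.Solvable_Groups"
begin

section \<open>Complex linear algebraic groups\<close>

text \<open>
  Affine algebraic groups over the complex numbers are linear, so they are taken to be
  Zariski closed subgroups of some \<open>GL\<^sub>n\<close>.
\<close>

type_synonym 'n cmat = "complex^'n^'n"

definition cscale :: "complex \<Rightarrow> 'n::finite cmat \<Rightarrow> 'n cmat" where
  "cscale t X = (\<chi> i j. t * X $ i $ j)"

interpretation cmat: vector_space "cscale :: complex \<Rightarrow> 'n::finite cmat \<Rightarrow> 'n cmat"
  by unfold_locales (simp_all add: cscale_def vec_eq_iff algebra_simps)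

definition lie :: "'n::finite cmat \<Rightarrow> 'n cmat \<Rightarrow> 'n cmat" where
  "lie X Y = X ** Y - Y ** X"

text \<open>Polynomials in the matrix entries, to be evaluated over any complex algebra \<open>\<iota>\<close>.\<close>

datatype 'n pexp = PConst complex | PEntry 'n 'n | PAdd "'n pexp" "'n pexp" | PMul "'n pexp" "'n pexp"

primrec peval :: "(complex \<Rightarrow> 'r::comm_ring_1) \<Rightarrow> 'r^'n^'n \<Rightarrow> 'n::finite pexp \<Rightarrow> 'r" where
  "peval \<iota> M (PConst c) = \<iota> c"
| "peval \<iota> M (PEntry i j) = M $ i $ j"
| "peval \<iota> M (PAdd f g) = peval \<iota> M f + peval \<iota> M g"
| "peval \<iota> M (PMul f g) = peval \<iota> M f * peval \<iota> M g"

definition linear_algebraic_group :: "'n::finite cmat set \<Rightarrow> bool" where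
  "linear_algebraic_group G \<longleftrightarrow>
     (\<exists>F. G = {g. invertible g \<and> (\<forall>f\<in>F. peval id g f = 0)}) \<and>
     mat 1 \<in> G \<and> (\<forall>g\<in>G. \<forall>h\<in>G. g ** h \<in> G) \<and> (\<forall>g\<in>G. matrix_inv g \<in> G)"

definition vanishing_ideal :: "'n::finite cmat set \<Rightarrow> 'n pexp set" where
  "vanishing_ideal G = {f. \<forall>g\<in>G. peval id g f = 0}"

text \<open>Elements of \<open>G(\<complex>[[z]])\<close> which reduce to the identity modulo \<open>z\<close>.\<close>

definition formal_gauge :: "'n::finite cmat set \<Rightarrow> (complex fps^'n^'n) set" where
  "formal_gauge G = {M. (\<forall>f\<in>vanishing_ideal G. peval fps_const M f = 0) \<and>
     (\<forall>i j. fps_nth (M $ i $ j) 0 = mat 1 $ i $ j)}"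

text \<open>The Zariski tangent space at the identity.\<close>

definition lie_alg :: "'n::finite cmat set \<Rightarrow> 'n cmat set" where
  "lie_alg G = {X. \<forall>f\<in>vanishing_ideal G. deriv (\<lambda>t. peval id (mat 1 + cscale t X) f) 0 = 0}"

definition group_of :: "'n::finite cmat set \<Rightarrow> 'n cmat monoid" where
  "group_of G = \<lparr>carrier = G, monoid.mult = (**), one = mat 1\<rparr>"

text \<open>
  Connected with trivial radical. For complex algebraic groups, being connected in the Euclidean
  topology (used here) and in the Zariski topology are the same.
\<close>

definition semisimple_group :: "'n::finite cmat set \<Rightarrow> bool" where
  "semisimple_group G \<longleftrightarrow> linear_algebraic_group G \<and> connected G \<and>
     (\<forall>N. N \<lhd> group_of G \<and> linear_algebraic_group N \<and> connected N \<and> solvable (group_of N)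
        \<longrightarrow> N = {mat 1})"

text \<open>The trace over \<open>\<complex>\<close> of \<open>ad X \<circ> ad Y\<close> on the Lie algebra, computed in an arbitrary basis.\<close>

definition killing :: "'n::finite cmat set \<Rightarrow> 'n cmat \<Rightarrow> 'n cmat \<Rightarrow> complex" where
  "killing G X Y =
     (let B = (SOME B. cmat.independent B \<and> cmat.span B = lie_alg G)
      in \<Sum>b\<in>B. cmat.representation B (lie X (lie Y b)) b)"

definition algebraic_torus :: "'n::finite cmat set \<Rightarrow> bool" where
  "algebraic_torus T \<longleftrightarrow> linear_algebraic_group T \<and> connected T \<and>
     (\<exists>S :: 'n cmat. invertible S \<and> (\<forall>t\<in>T. \<forall>i j. i \<noteq> j \<longrightarrow> (S ** t ** matrix_inv S) $ i $ j = 0))"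

definition maximal_torus :: "'n::finite cmat set \<Rightarrow> 'n cmat set \<Rightarrow> bool" where
  "maximal_torus G T \<longleftrightarrow> algebraic_torus T \<and> T \<subseteq> G \<and>
     (\<forall>T'. algebraic_torus T' \<and> T \<subseteq> T' \<and> T' \<subseteq> G \<longrightarrow> T' = T)"

text \<open>Roots as functions supported on the Lie algebra of the torus.\<close>

definition roots :: "'n::finite cmat set \<Rightarrow> 'n cmat set \<Rightarrow> ('n cmat \<Rightarrow> complex) set" where
  "roots G T = {\<alpha>. (\<exists>H\<in>lie_alg T. \<alpha> H \<noteq> 0) \<and> (\<forall>H. H \<notin> lie_alg T \<longrightarrow> \<alpha> H = 0) \<and>
     (\<exists>X\<in>lie_alg G. X \<noteq> 0 \<and> (\<forall>H\<in>lie_alg T. lie H X = cscale (\<alpha> H) X))}"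

definition t_reg :: "'n::finite cmat set \<Rightarrow> 'n cmat set \<Rightarrow> 'n cmat set" where
  "t_reg G T = lie_alg T - (\<Union>\<alpha>\<in>roots G T. {H. \<alpha> H = 0})"

text \<open>An element of \<open>\<pi>\<^sub>1(G, 1)\<close> is a set of loops.\<close>

definition pi1 :: "'n::finite cmat set \<Rightarrow> (real \<Rightarrow> 'n cmat) set set" where
  "pi1 G = {{q. homotopic_paths G p q} | p.
     path p \<and> path_image p \<subseteq> G \<and> pathstart p = mat 1 \<and> pathfinish p = mat 1}"


section \<open>Smooth functions of a complex variable\<close>

primrec pderivs :: "complex list \<Rightarrow> (complex \<Rightarrow> 'b::real_normed_vector) \<Rightarrow> complex \<Rightarrow> 'b" where
  "pderivs [] f = f"
| "pderivs (v # vs) f = (\<lambda>w. frechet_derivative (pderivs vs f) (at w) v)"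

text \<open>All iterated partial derivatives in the directions \<open>1\<close> and \<open>\<i>\<close> exist; only used on open sets.\<close>

definition smooth_on :: "complex set \<Rightarrow> (complex \<Rightarrow> 'b::real_normed_vector) \<Rightarrow> bool" where
  "smooth_on S f \<longleftrightarrow> (\<forall>vs\<in>lists {1, \<i>}. pderivs vs f differentiable_on S)"

definition smooth_extends :: "(complex \<Rightarrow> 'b::real_normed_vector) \<Rightarrow> bool" where
  "smooth_extends f \<longleftrightarrow> (\<exists>e>0. \<exists>F. smooth_on (ball 0 e) F \<and> (\<forall>w\<in>ball 0 e - {0}. F w = f w))"

text \<open>
  \<open>f\<close>, defined on a punctured neighbourhood of 0, extends smoothly with zero Taylor expansion at 0.
  A function with a pole (a smooth function divided by a power of \<open>w\<close>) has Laurent expansion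
  \<open>p\<close>, where \<open>p\<close> is a finite Laurent polynomial in \<open>w\<close>, iff \<open>f - p\<close> is flat in this sense.
\<close>

definition flat0 :: "(complex \<Rightarrow> 'b::real_normed_vector) \<Rightarrow> bool" where
  "flat0 f \<longleftrightarrow> (\<exists>e>0. \<exists>F. smooth_on (ball 0 e) F \<and> (\<forall>w\<in>ball 0 e - {0}. F w = f w) \<and>
     (\<forall>vs\<in>lists {1, \<i>}. pderivs vs F 0 = 0))"

definition mat_holomorphic_on :: "(complex \<Rightarrow> 'n::finite cmat) \<Rightarrow> complex set \<Rightarrow> bool" where
  "mat_holomorphic_on F S \<longleftrightarrow> (\<forall>i j. (\<lambda>w. F w $ i $ j) holomorphic_on S)"

text \<open>\<open>f\<close> extends holomorphically over 0 with value \<open>L\<close> there.\<close>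

definition hol_extends :: "(complex \<Rightarrow> 'n::finite cmat) \<Rightarrow> 'n cmat \<Rightarrow> bool" where
  "hol_extends f L \<longleftrightarrow> (\<exists>e>0. \<exists>F. mat_holomorphic_on F (ball 0 e) \<and>
     (\<forall>w\<in>ball 0 e - {0}. F w = f w) \<and> F 0 = L)"

text \<open>The Wirtinger derivatives \<open>\<partial>/\<partial>w\<close> and \<open>\<partial>/\<partial>w\<close>-bar.\<close>

definition wirt :: "(complex \<Rightarrow> 'n::finite cmat) \<Rightarrow> complex \<Rightarrow> 'n cmat" where
  "wirt f w = cscale (1/2)
     (frechet_derivative f (at w) 1 - cscale \<i> (frechet_derivative f (at w) \<i>))"

definition wirtbar :: "(complex \<Rightarrow> 'n::finite cmat) \<Rightarrow> complex \<Rightarrow> 'n cmat" where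
  "wirtbar f w = cscale (1/2)
     (frechet_derivative f (at w) 1 + cscale \<i> (frechet_derivative f (at w) \<i>))"


section \<open>Compact Riemann surfaces\<close>

text \<open>A chart is a coordinate together with its domain; its values off the domain are irrelevant.\<close>

type_synonym 'x chart = "'x set \<times> ('x \<Rightarrow> complex)"

definition chart_inv :: "'x chart \<Rightarrow> complex \<Rightarrow> 'x" where
  "chart_inv c = inv_into (fst c) (snd c)"

definition is_chart :: "'x::topological_space chart \<Rightarrow> bool" where
  "is_chart c \<longleftrightarrow> open (fst c) \<and> open (snd c ` fst c) \<and>
     homeomorphism (fst c) (snd c ` fst c) (snd c) (chart_inv c)"

definition compatible :: "'x chart \<Rightarrow> 'x chart \<Rightarrow> bool" where
  "compatible c c' \<longleftrightarrow>
     (snd c' \<circ> chart_inv c) holomorphic_on (snd c ` (fst c \<inter> fst c')) \<and>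
     (snd c \<circ> chart_inv c') holomorphic_on (snd c' ` (fst c \<inter> fst c'))"

text \<open>The surface is the whole type \<open>'x\<close>, with a maximal holomorphic atlas.\<close>

definition compact_riemann_surface :: "'x::t2_space chart set \<Rightarrow> bool" where
  "compact_riemann_surface At \<longleftrightarrow>
     compact (UNIV :: 'x set) \<and> connected (UNIV :: 'x set) \<and>
     (\<forall>c\<in>At. is_chart c) \<and> (\<Union>c\<in>At. fst c) = UNIV \<and>
     (\<forall>c\<in>At. \<forall>c'\<in>At. compatible c c') \<and>
     (\<forall>c. is_chart c \<and> (\<forall>c'\<in>At. compatible c c') \<longrightarrow> c \<in> At)"

definition surf_smooth_on ::
  "'x chart set \<Rightarrow> 'x set \<Rightarrow> ('x \<Rightarrow> 'b::real_normed_vector) \<Rightarrow> bool" where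
  "surf_smooth_on At W f \<longleftrightarrow> (\<forall>c\<in>At. smooth_on (snd c ` (fst c \<inter> W)) (f \<circ> chart_inv c))"

definition surf_mat_hol_on ::
  "'x chart set \<Rightarrow> 'x set \<Rightarrow> ('x \<Rightarrow> 'n::finite cmat) \<Rightarrow> bool" where
  "surf_mat_hol_on At W f \<longleftrightarrow>
     (\<forall>c\<in>At. mat_holomorphic_on (f \<circ> chart_inv c) (snd c ` (fst c \<inter> W)))"

text \<open>\<open>jac c c' x\<close> is \<open>dz\<^sub>c / dz\<^sub>c\<^sub>'\<close> at \<open>x\<close>.\<close>

definition jac :: "'x chart \<Rightarrow> 'x chart \<Rightarrow> 'x \<Rightarrow> complex" where
  "jac c c' x = deriv (snd c \<circ> chart_inv c') (snd c' x)"

definition partition_of_unity ::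
  "'x::topological_space chart set \<Rightarrow> nat \<Rightarrow> (nat \<Rightarrow> 'x chart) \<Rightarrow> (nat \<Rightarrow> 'x \<Rightarrow> real) \<Rightarrow> bool" where
  "partition_of_unity At n c \<rho> \<longleftrightarrow>
     (\<forall>i<n. c i \<in> At \<and> surf_smooth_on At UNIV (\<rho> i) \<and> (\<forall>x. 0 \<le> \<rho> i x) \<and>
        closure {x. \<rho> i x \<noteq> 0} \<subseteq> fst (c i)) \<and>
     (\<forall>x. (\<Sum>i<n. \<rho> i x) = 1)"

text \<open>
  A complex 2-form is given by its coefficient \<open>\<Theta> c x\<close> of \<open>dz \<and> d\<close>\<open>z\<close>-bar in each chart \<open>c\<close>; the
  factor comes from \<open>dz \<and> d\<close>\<open>z\<close>-bar \<open>= -2\<i> dx \<and> dy\<close>. The choice of the finite partition of unity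
  does not matter.
\<close>

definition surf_integral ::
  "'x::topological_space chart set \<Rightarrow> ('x chart \<Rightarrow> 'x \<Rightarrow> complex) \<Rightarrow> complex" where
  "surf_integral At \<Theta> =
     (let (n, c, \<rho>) = (SOME (n, c, \<rho>). partition_of_unity At n c \<rho>)
      in \<Sum>i<n. - 2 * \<i> * (LINT w : snd (c i) ` fst (c i) | lborel.
            of_real (\<rho> i (chart_inv (c i) w)) * \<Theta> (c i) (chart_inv (c i) w)))"


section \<open>Divisor and irregular type\<close>

text \<open>
  The divisor is \<open>\<Sum>j=1..npts. ordr j * pt j\<close>, \<open>crd j\<close> is the fixed coordinate at \<open>pt j\<close>, and
  \<open>irr j i\<close> is the coefficient of \<open>z\<^sup>i dz\<close> in the irregular type at \<open>pt j\<close>.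
\<close>

record ('x, 'n::finite) irr_setting =
  grp :: "'n cmat set"
  tor :: "'n cmat set"
  atlas :: "'x chart set"
  npts :: nat
  pt :: "nat \<Rightarrow> 'x"
  ordr :: "nat \<Rightarrow> nat"
  crd :: "nat \<Rightarrow> 'x chart"
  irr :: "nat \<Rightarrow> int \<Rightarrow> 'n cmat"

abbreviation lieG :: "('x, 'n::finite) irr_setting \<Rightarrow> 'n cmat set" where
  "lieG S \<equiv> lie_alg (grp S)"

abbreviation lieT :: "('x, 'n::finite) irr_setting \<Rightarrow> 'n cmat set" where
  "lieT S \<equiv> lie_alg (tor S)"

definition Dred :: "('x, 'n::finite) irr_setting \<Rightarrow> 'x set" where
  "Dred S = pt S ` {1..npts S}"

definition irregular_setting :: "('x::t2_space, 'n::finite) irr_setting \<Rightarrow> bool" where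
  "irregular_setting S \<longleftrightarrow>
     semisimple_group (grp S) \<and> maximal_torus (grp S) (tor S) \<and>
     compact_riemann_surface (atlas S) \<and> inj_on (pt S) {1..npts S} \<and>
     (\<forall>j\<in>{1..npts S}. 1 \<le> ordr S j \<and> crd S j \<in> atlas S \<and>
        pt S j \<in> fst (crd S j) \<and> snd (crd S j) (pt S j) = 0 \<and>
        (\<forall>i\<in>{- int (ordr S j)..-2}. irr S j i \<in> lieT S))"

definition irr_fun :: "('x, 'n::finite) irr_setting \<Rightarrow> nat \<Rightarrow> complex \<Rightarrow> 'n cmat" where
  "irr_fun S j w = (\<Sum>i\<in>{- int (ordr S j)..-2}. cscale (w powi i) (irr S j i))"

text \<open>The formal Laurent series \<open>\<eta>\<^sub>j + \<Lambda>/z\<close>.\<close>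

definition normal_form_fls ::
  "('x, 'n::finite) irr_setting \<Rightarrow> nat \<Rightarrow> 'n cmat \<Rightarrow> complex fls^'n^'n" where
  "normal_form_fls S j \<Lambda> = (\<chi> p q.
     (\<Sum>i\<in>{- int (ordr S j)..-2}. fls_const (irr S j i $ p $ q) * fls_X_intpow i)
     + fls_const (\<Lambda> $ p $ q) * fls_X_intpow (-1))"


section \<open>Framed principal bundles with a meromorphic connection\<close>

text \<open>
  The total space of the bundle is the whole type \<open>'p\<close>, with a right action of the group.
  The holomorphic structure is given by the set \<open>hframes\<close> of all holomorphic local sections
  (i.e. local trivializations), each with its open domain. The framing is a point in each fibre
  over the reduced divisor. \<open>conn c \<sigma>\<close> is the coefficient of \<open>dz\<^sub>c\<close> in the connection form with respect to
  the holomorphic frame \<open>\<sigma>\<close>.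
\<close>

record ('x, 'p, 'n::finite) framed_conn =
  bproj :: "'p \<Rightarrow> 'x"
  bact :: "'p \<Rightarrow> 'n cmat \<Rightarrow> 'p"
  hframes :: "('x set \<times> ('x \<Rightarrow> 'p)) set"
  framing :: "nat \<Rightarrow> 'p"
  conn :: "'x chart \<Rightarrow> ('x \<Rightarrow> 'p) \<Rightarrow> 'x \<Rightarrow> 'n cmat"

definition local_section ::
  "('x::topological_space, 'p, 'n::finite) framed_conn \<Rightarrow> 'x set \<Rightarrow> ('x \<Rightarrow> 'p) \<Rightarrow> bool" where
  "local_section P U \<sigma> \<longleftrightarrow> open U \<and> (\<forall>x\<in>U. bproj P (\<sigma> x) = x)"

text \<open>The function \<open>g\<close> with \<open>\<tau> = \<sigma> g\<close>.\<close>

definition trans_fun ::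
  "('x, 'n::finite) irr_setting \<Rightarrow> ('x, 'p, 'n) framed_conn \<Rightarrow>
   ('x \<Rightarrow> 'p) \<Rightarrow> ('x \<Rightarrow> 'p) \<Rightarrow> 'x \<Rightarrow> 'n cmat" where
  "trans_fun S P \<sigma> \<tau> x = (THE g. g \<in> grp S \<and> \<tau> x = bact P (\<sigma> x) g)"

definition holomorphic_principal_bundle ::
  "('x::t2_space, 'n::finite) irr_setting \<Rightarrow> ('x, 'p, 'n) framed_conn \<Rightarrow> bool" where
  "holomorphic_principal_bundle S P \<longleftrightarrow>
     (\<forall>p. \<forall>g\<in>grp S. bproj P (bact P p g) = bproj P p) \<and>
     (\<forall>p. bact P p (mat 1) = p) \<and>
     (\<forall>p. \<forall>g\<in>grp S. \<forall>h\<in>grp S. bact P (bact P p g) h = bact P p (g ** h)) \<and>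
     (\<forall>p q. bproj P p = bproj P q \<longrightarrow> (\<exists>!g. g \<in> grp S \<and> q = bact P p g)) \<and>
     (\<forall>(U, \<sigma>)\<in>hframes P. local_section P U \<sigma>) \<and>
     (\<Union>(U, \<sigma>)\<in>hframes P. U) = UNIV \<and>
     (\<forall>(U, \<sigma>)\<in>hframes P. \<forall>(V, \<tau>)\<in>hframes P.
        surf_mat_hol_on (atlas S) (U \<inter> V) (trans_fun S P \<sigma> \<tau>)) \<and>
     (\<forall>V \<tau>. local_section P V \<tau> \<and>
        (\<forall>(U, \<sigma>)\<in>hframes P. surf_mat_hol_on (atlas S) (U \<inter> V) (trans_fun S P \<sigma> \<tau>))
        \<longrightarrow> (V, \<tau>) \<in> hframes P)"

definition continuous_section ::
  "('x::t2_space, 'n::finite) irr_setting \<Rightarrow> ('x, 'p, 'n) framed_conn \<Rightarrow> 'x set \<Rightarrow> ('x \<Rightarrow> 'p) \<Rightarrow> bool"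
  where
  "continuous_section S P V \<tau> \<longleftrightarrow> local_section P V \<tau> \<and>
     (\<forall>(U, \<sigma>)\<in>hframes P. continuous_on (U \<inter> V) (trans_fun S P \<sigma> \<tau>))"

definition smooth_section ::
  "('x::t2_space, 'n::finite) irr_setting \<Rightarrow> ('x, 'p, 'n) framed_conn \<Rightarrow> 'x set \<Rightarrow> ('x \<Rightarrow> 'p) \<Rightarrow> bool"
  where
  "smooth_section S P V \<tau> \<longleftrightarrow> local_section P V \<tau> \<and>
     (\<forall>(U, \<sigma>)\<in>hframes P. surf_smooth_on (atlas S) (U \<inter> V) (trans_fun S P \<sigma> \<tau>))"

text \<open>
  The clutching function of the bundle: compare a section over the complement of a point with
  one over a disc around it, along a positively oriented circle. Since the group is connected,
  based and free homotopy classes of loops agree.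
\<close>

definition topological_type ::
  "('x::t2_space, 'n::finite) irr_setting \<Rightarrow> ('x, 'p, 'n) framed_conn \<Rightarrow> (real \<Rightarrow> 'n cmat) set \<Rightarrow> bool"
  where
  "topological_type S P \<epsilon> \<longleftrightarrow>
     (\<exists>x0. \<exists>c\<in>atlas S. \<exists>r>0. \<exists>\<sigma> \<tau>. \<exists>\<gamma>\<in>\<epsilon>.
        x0 \<in> fst c \<and> snd c x0 = 0 \<and> cball 0 r \<subseteq> snd c ` fst c \<and>
        continuous_section S P (fst c) \<sigma> \<and> continuous_section S P (- {x0}) \<tau> \<and>
        homotopic_loops (grp S) (\<lambda>t. trans_fun S P \<sigma> \<tau> (chart_inv c (circlepath 0 r t))) \<gamma>)"

text \<open>
  Connection forms of a meromorphic connection with poles bounded by the divisor. A change of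
  frame \<open>\<tau> = \<sigma> g\<close> transforms the form \<open>A\<close> into \<open>g\<^sup>-\<^sup>1 A g + g\<^sup>-\<^sup>1 dg\<close>.
\<close>

definition meromorphic_connection ::
  "('x::t2_space, 'n::finite) irr_setting \<Rightarrow> ('x, 'p, 'n) framed_conn \<Rightarrow> bool" where
  "meromorphic_connection S P \<longleftrightarrow>
     (\<forall>c\<in>atlas S. \<forall>(U, \<sigma>)\<in>hframes P.
        (\<forall>x\<in>U \<inter> fst c - Dred S. conn P c \<sigma> x \<in> lieG S) \<and>
        mat_holomorphic_on (conn P c \<sigma> \<circ> chart_inv c) (snd c ` (U \<inter> fst c - Dred S)) \<and>
        (\<forall>c'\<in>atlas S. \<forall>x\<in>U \<inter> fst c \<inter> fst c' - Dred S.
           conn P c' \<sigma> x = cscale (jac c c' x) (conn P c \<sigma> x)) \<and>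
        (\<forall>(V, \<tau>)\<in>hframes P. \<forall>x\<in>U \<inter> V \<inter> fst c - Dred S.
           let g = trans_fun S P \<sigma> \<tau> in
           conn P c \<tau> x = matrix_inv (g x) ** conn P c \<sigma> x ** g x
             + matrix_inv (g x) ** wirt (g \<circ> chart_inv c) (snd c x))) \<and>
     (\<forall>j\<in>{1..npts S}. \<forall>(U, \<sigma>)\<in>hframes P. pt S j \<in> U \<longrightarrow>
        (\<exists>L. hol_extends
           (\<lambda>w. cscale (w ^ ordr S j) (conn P (crd S j) \<sigma> (chart_inv (crd S j) w))) L))"

definition generic_compatible_framing ::
  "('x::t2_space, 'n::finite) irr_setting \<Rightarrow> ('x, 'p, 'n) framed_conn \<Rightarrow> bool" where
  "generic_compatible_framing S P \<longleftrightarrow>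
     (\<forall>j\<in>{1..npts S}. bproj P (framing P j) = pt S j \<and>
        (\<forall>(U, \<sigma>)\<in>hframes P. pt S j \<in> U \<and> \<sigma> (pt S j) = framing P j \<longrightarrow>
           (\<exists>L\<in>t_reg (grp S) (tor S). hol_extends
              (\<lambda>w. cscale (w ^ ordr S j) (conn P (crd S j) \<sigma> (chart_inv (crd S j) w))) L)))"

text \<open>
  A formal gauge transformation \<open>g\<close> takes the Laurent expansion \<open>A\<close> of the connection form, in a
  frame extending the framing, to \<open>\<eta>\<^sub>j + \<Lambda>/z\<close>; the equation is that of a gauge transformation,
  multiplied by \<open>g\<close>.
\<close>

definition has_irregular_type ::
  "('x::t2_space, 'n::finite) irr_setting \<Rightarrow> ('x, 'p, 'n) framed_conn \<Rightarrow> bool" where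
  "has_irregular_type S P \<longleftrightarrow>
     (\<forall>j\<in>{1..npts S}. \<exists>(U, \<sigma>)\<in>hframes P. pt S j \<in> U \<and> \<sigma> (pt S j) = framing P j \<and>
        (\<exists>A :: complex fls^'n^'n. \<exists>M\<in>formal_gauge (grp S). \<exists>\<Lambda>\<in>lieT S.
           (\<forall>p q. (\<lambda>w. conn P (crd S j) \<sigma> (chart_inv (crd S j) w) $ p $ q)
              has_laurent_expansion (A $ p $ q)) \<and>
           (let g = (\<chi> p q. fps_to_fls (M $ p $ q)) :: complex fls^'n^'n;
                g' = (\<chi> p q. fls_deriv (g $ p $ q))
            in A ** g + g' = g ** normal_form_fls S j \<Lambda>)))"

text \<open>Representatives \<open>(P, s, \<nabla>)\<close> of points of the moduli space.\<close>

definition moduli_point ::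
  "('x::t2_space, 'n::finite) irr_setting \<Rightarrow> (real \<Rightarrow> 'n cmat) set \<Rightarrow> ('x, 'p, 'n) framed_conn \<Rightarrow> bool"
  where
  "moduli_point S \<epsilon> P \<longleftrightarrow> \<epsilon> \<in> pi1 (grp S) \<and> holomorphic_principal_bundle S P \<and>
     topological_type S P \<epsilon> \<and> meromorphic_connection S P \<and>
     generic_compatible_framing S P \<and> has_irregular_type S P"

text \<open>
  A smooth trivialization near \<open>pt j\<close>, extending the framing, in which the smooth connection
  underlying \<open>\<nabla>\<close> is represented by its normal form: its connection form, whose two lines give
  the \<open>dz\<close> and \<open>d\<close>\<open>z\<close>-bar coefficients, has Laurent expansion \<open>\<eta>\<^sub>j + \<Lambda> dz/z\<close>.
\<close>

definition normal_frame ::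
  "('x::t2_space, 'n::finite) irr_setting \<Rightarrow> ('x, 'p, 'n) framed_conn \<Rightarrow> nat \<Rightarrow> ('x \<Rightarrow> 'p) \<Rightarrow> bool"
  where
  "normal_frame S P j \<tau> \<longleftrightarrow>
     (\<exists>V. smooth_section S P V \<tau> \<and> pt S j \<in> V \<and> \<tau> (pt S j) = framing P j \<and>
       (\<exists>(U, \<sigma>)\<in>hframes P. pt S j \<in> U \<and>
          (let g = trans_fun S P \<sigma> \<tau> \<circ> chart_inv (crd S j);
               a = conn P (crd S j) \<sigma> \<circ> chart_inv (crd S j)
           in (\<exists>\<Lambda>\<in>lieT S. flat0 (\<lambda>w. matrix_inv (g w) ** a w ** g w + matrix_inv (g w) ** wirt g w
                  - irr_fun S j w - cscale (1 / w) \<Lambda>)) \<and>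
              flat0 (\<lambda>w. matrix_inv (g w) ** wirtbar g w))))"


section \<open>Forms with values in the adjoint bundle\<close>

text \<open>
  Sections of the adjoint bundle over \<open>W\<close> are equivariant functions on the part of the total
  space over \<open>W\<close>; their values elsewhere are irrelevant.
\<close>

definition ad_section ::
  "('x, 'n::finite) irr_setting \<Rightarrow> ('x, 'p, 'n) framed_conn \<Rightarrow> 'x set \<Rightarrow> ('p \<Rightarrow> 'n cmat) \<Rightarrow> bool" where
  "ad_section S P W \<mu> \<longleftrightarrow> (\<forall>p. bproj P p \<in> W \<longrightarrow> \<mu> p \<in> lieG S \<and>
     (\<forall>g\<in>grp S. \<mu> (bact P p g) = matrix_inv g ** \<mu> p ** g))"

definition ad_hol ::
  "('x, 'n::finite) irr_setting \<Rightarrow> ('x, 'p, 'n) framed_conn \<Rightarrow> 'x set \<Rightarrow> ('p \<Rightarrow> 'n cmat) \<Rightarrow> bool" where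
  "ad_hol S P W \<mu> \<longleftrightarrow> (\<forall>(U, \<sigma>)\<in>hframes P. surf_mat_hol_on (atlas S) (U \<inter> W) (\<mu> \<circ> \<sigma>))"

definition ad_smooth ::
  "('x, 'n::finite) irr_setting \<Rightarrow> ('x, 'p, 'n) framed_conn \<Rightarrow> 'x set \<Rightarrow> ('p \<Rightarrow> 'n cmat) \<Rightarrow> bool" where
  "ad_smooth S P W \<mu> \<longleftrightarrow> (\<forall>(U, \<sigma>)\<in>hframes P. surf_smooth_on (atlas S) (U \<inter> W) (\<mu> \<circ> \<sigma>))"

text \<open>
  \<open>\<phi> c p\<close> is the pair of coefficients of \<open>dz\<^sub>c\<close> and \<open>d\<close>\<open>z\<^sub>c\<close>-bar at the base point of \<open>p\<close>, each an equivariant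
  function of \<open>p\<close>.
\<close>

type_synonym ('x, 'p, 'n) ad_form = "'x chart \<Rightarrow> 'p \<Rightarrow> 'n cmat \<times> 'n cmat"

definition ad_oneform ::
  "('x, 'n::finite) irr_setting \<Rightarrow> ('x, 'p, 'n) framed_conn \<Rightarrow> 'x set \<Rightarrow> ('x, 'p, 'n) ad_form \<Rightarrow> bool"
  where
  "ad_oneform S P W \<phi> \<longleftrightarrow> (\<forall>c\<in>atlas S.
     ad_section S P (fst c \<inter> W) (\<lambda>p. fst (\<phi> c p)) \<and> ad_section S P (fst c \<inter> W) (\<lambda>p. snd (\<phi> c p)) \<and>
     (\<forall>c'\<in>atlas S. \<forall>p. bproj P p \<in> fst c \<inter> fst c' \<inter> W \<longrightarrow>
        \<phi> c' p = (cscale (jac c c' (bproj P p)) (fst (\<phi> c p)),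
                  cscale (cnj (jac c c' (bproj P p))) (snd (\<phi> c p)))))"

text \<open>
  One-forms on the complement of the divisor, normalized to be zero where they carry no
  information. Forms which are regular at the divisor are recorded in the same way.
\<close>

definition global_oneform ::
  "('x, 'n::finite) irr_setting \<Rightarrow> ('x, 'p, 'n) framed_conn \<Rightarrow> ('x, 'p, 'n) ad_form \<Rightarrow> bool" where
  "global_oneform S P \<phi> \<longleftrightarrow> ad_oneform S P (- Dred S) \<phi> \<and>
     (\<forall>c p. c \<notin> atlas S \<or> bproj P p \<notin> fst c - Dred S \<longrightarrow> \<phi> c p = (0, 0))"

definition form_smooth ::
  "('x, 'n::finite) irr_setting \<Rightarrow> ('x, 'p, 'n) framed_conn \<Rightarrow> 'x set \<Rightarrow> ('x, 'p, 'n) ad_form \<Rightarrow> bool"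
  where
  "form_smooth S P W \<phi> \<longleftrightarrow> (\<forall>c\<in>atlas S. \<forall>(U, \<sigma>)\<in>hframes P.
     smooth_on (snd c ` (fst c \<inter> U \<inter> W)) (\<lambda>w. \<phi> c (\<sigma> (chart_inv c w))))"

definition part10 :: "('x, 'p, 'n::finite) ad_form \<Rightarrow> ('x, 'p, 'n) ad_form" where
  "part10 \<phi> = (\<lambda>c p. (fst (\<phi> c p), 0))"

definition part01 :: "('x, 'p, 'n::finite) ad_form \<Rightarrow> ('x, 'p, 'n) ad_form" where
  "part01 \<phi> = (\<lambda>c p. (0, snd (\<phi> c p)))"

text \<open>The coefficient of \<open>dz\<^sub>c \<and> d\<close>\<open>z\<^sub>c\<close>-bar in \<open>\<kappa>(\<phi> \<and> \<psi>)\<close>; any point of the fibre gives the same value.\<close>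

definition killing_wedge ::
  "('x, 'n::finite) irr_setting \<Rightarrow> ('x, 'p, 'n) framed_conn \<Rightarrow>
   ('x, 'p, 'n) ad_form \<Rightarrow> ('x, 'p, 'n) ad_form \<Rightarrow> 'x chart \<Rightarrow> 'x \<Rightarrow> complex" where
  "killing_wedge S P \<phi> \<psi> c x = (let p = (SOME p. bproj P p = x) in
     killing (grp S) (fst (\<phi> c p)) (snd (\<psi> c p)) - killing (grp S) (snd (\<phi> c p)) (fst (\<psi> c p)))"

text \<open>A holomorphic frame whose value at the base point of \<open>p\<close> is \<open>p\<close>.\<close>

definition frame_through :: "('x, 'p, 'n::finite) framed_conn \<Rightarrow> 'p \<Rightarrow> 'x \<Rightarrow> 'p" where
  "frame_through P p = (SOME \<sigma>. \<exists>U. (U, \<sigma>) \<in> hframes P \<and> bproj P p \<in> U \<and> \<sigma> (bproj P p) = p)"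

text \<open>
  The covariant derivative \<open>\<nabla>\<mu> = (\<partial>\<mu> + [A, \<mu>]) + \<open>dbar\<close> \<mu>\<close> of a section; in a holomorphic frame
  the connection has no \<open>(0,1)\<close>-part.
\<close>

definition nabla ::
  "('x, 'n::finite) irr_setting \<Rightarrow> ('x, 'p, 'n) framed_conn \<Rightarrow> ('p \<Rightarrow> 'n cmat) \<Rightarrow> ('x, 'p, 'n) ad_form"
  where
  "nabla S P \<mu> c p =
     (let x = bproj P p; \<sigma> = frame_through P p; u = \<mu> \<circ> \<sigma> \<circ> chart_inv c; w = snd c x in
      if c \<in> atlas S \<and> x \<in> fst c - Dred S
      then (wirt u w + lie (conn P c \<sigma> x) (u w), wirtbar u w) else (0, 0))"

text \<open>
  For a one-form \<open>\<phi> = a dz + b d\<close>\<open>z\<close>-bar, the coefficients of \<open>dz \<and> d\<close>\<open>z\<close>-bar in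
  \<open>\<nabla>\<^sup>1\<^sup>,\<^sup>0\<phi>\<close> and \<open>\<nabla>\<^sup>0\<^sup>,\<^sup>1\<phi> = \<open>dbar\<close> \<phi>\<close>; they only involve \<open>b\<close> and \<open>a\<close> respectively.
\<close>

definition nabla10_form ::
  "('x, 'p, 'n::finite) framed_conn \<Rightarrow> ('x, 'p, 'n) ad_form \<Rightarrow> 'x chart \<Rightarrow> 'p \<Rightarrow> 'n cmat" where
  "nabla10_form P \<phi> c p =
     (let x = bproj P p; \<sigma> = frame_through P p; b = (\<lambda>w. snd (\<phi> c (\<sigma> (chart_inv c w)))); w = snd c x
      in wirt b w + lie (conn P c \<sigma> x) (b w))"

definition dbar_form ::
  "('x, 'p, 'n::finite) framed_conn \<Rightarrow> ('x, 'p, 'n) ad_form \<Rightarrow> 'x chart \<Rightarrow> 'p \<Rightarrow> 'n cmat" where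
  "dbar_form P \<phi> c p =
     (let x = bproj P p; \<sigma> = frame_through P p; a = (\<lambda>w. fst (\<phi> c (\<sigma> (chart_inv c w)))); w = snd c x
      in - wirtbar a w)"


section \<open>The Atiyah--Bott description\<close>

text \<open>
  Tangent vectors at \<open>\<nabla>\<close> to the space of singular connections with irregular type \<open>\<eta>\<close>; \<open>nf j\<close> is the
  trivialization near \<open>pt j\<close> in which the expansion \<open>L\<^sub>j\<close> is taken.
\<close>

definition tangent_conn ::
  "('x, 'n::finite) irr_setting \<Rightarrow> ('x, 'p, 'n) framed_conn \<Rightarrow> (nat \<Rightarrow> 'x \<Rightarrow> 'p) \<Rightarrow>
   ('x, 'p, 'n) ad_form set" where
  "tangent_conn S P nf = {\<phi>. global_oneform S P \<phi> \<and> form_smooth S P (- Dred S) \<phi> \<and>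
     (\<forall>j\<in>{1..npts S}.
        (\<forall>(U, \<sigma>)\<in>hframes P. pt S j \<in> U \<longrightarrow>
           (let f = (\<lambda>w. \<phi> (crd S j) (\<sigma> (chart_inv (crd S j) w))) in
            smooth_extends (\<lambda>w. cscale (w ^ ordr S j) (fst (f w))) \<and>
            smooth_extends (\<lambda>w. cscale (w ^ ordr S j) (snd (f w))))) \<and>
        (let f = (\<lambda>w. \<phi> (crd S j) (nf j (chart_inv (crd S j) w))) in
           (\<exists>\<Lambda>\<in>lieT S. flat0 (\<lambda>w. fst (f w) - cscale (1 / w) \<Lambda>)) \<and> flat0 (\<lambda>w. snd (f w))))}"

definition tangent_flat ::
  "('x, 'n::finite) irr_setting \<Rightarrow> ('x, 'p, 'n) framed_conn \<Rightarrow> (nat \<Rightarrow> 'x \<Rightarrow> 'p) \<Rightarrow>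
   ('x, 'p, 'n) ad_form set" where
  "tangent_flat S P nf = {\<phi>\<in>tangent_conn S P nf. \<forall>c\<in>atlas S. \<forall>p. bproj P p \<in> fst c - Dred S \<longrightarrow>
     nabla10_form P \<phi> c p + dbar_form P \<phi> c p = 0}"

definition lie_gauge1 ::
  "('x, 'n::finite) irr_setting \<Rightarrow> ('x, 'p, 'n) framed_conn \<Rightarrow> ('p \<Rightarrow> 'n cmat) set" where
  "lie_gauge1 S P = {\<mu>. ad_section S P UNIV \<mu> \<and> ad_smooth S P UNIV \<mu> \<and>
     (\<forall>j\<in>{1..npts S}. \<forall>(U, \<sigma>)\<in>hframes P. pt S j \<in> U \<longrightarrow>
        flat0 (\<mu> \<circ> \<sigma> \<circ> chart_inv (crd S j)))}"

definition AB_class ::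
  "('x, 'n::finite) irr_setting \<Rightarrow> ('x, 'p, 'n) framed_conn \<Rightarrow>
   ('x, 'p, 'n) ad_form \<Rightarrow> ('x, 'p, 'n) ad_form set" where
  "AB_class S P \<phi> = {\<lambda>c p. \<phi> c p + - nabla S P \<mu> c p | \<mu>. \<mu> \<in> lie_gauge1 S P}"

definition AB_tangent_space ::
  "('x, 'n::finite) irr_setting \<Rightarrow> ('x, 'p, 'n) framed_conn \<Rightarrow> (nat \<Rightarrow> 'x \<Rightarrow> 'p) \<Rightarrow>
   ('x, 'p, 'n) ad_form set set" where
  "AB_tangent_space S P nf = AB_class S P ` tangent_flat S P nf"

definition AB_form ::
  "('x::t2_space, 'n::finite) irr_setting \<Rightarrow> ('x, 'p, 'n) framed_conn \<Rightarrow>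
   ('x, 'p, 'n) ad_form \<Rightarrow> ('x, 'p, 'n) ad_form \<Rightarrow> complex" where
  "AB_form S P \<phi> \<psi> = surf_integral (atlas S) (killing_wedge S P \<phi> \<psi>)"

text \<open>The form on the quotient, evaluated on arbitrary representatives.\<close>

definition omega_AB ::
  "('x::t2_space, 'n::finite) irr_setting \<Rightarrow> ('x, 'p, 'n) framed_conn \<Rightarrow>
   ('x, 'p, 'n) ad_form set \<Rightarrow> ('x, 'p, 'n) ad_form set \<Rightarrow> complex" where
  "omega_AB S P a b = AB_form S P (SOME \<phi>. \<phi> \<in> a) (SOME \<psi>. \<psi> \<in> b)"


section \<open>The hypercohomology description\<close>

text \<open>Local sections over \<open>W\<close> of the subsheaf of \<open>ad P \<otimes> K(D\<^sub>r\<^sub>e\<^sub>d)\<close>.\<close>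

definition sheaf_adK ::
  "('x, 'n::finite) irr_setting \<Rightarrow> ('x, 'p, 'n) framed_conn \<Rightarrow> 'x set \<Rightarrow> ('x, 'p, 'n) ad_form set" where
  "sheaf_adK S P W = {\<nu>. ad_oneform S P (W - Dred S) \<nu> \<and>
     (\<forall>c\<in>atlas S. ad_hol S P (fst c \<inter> W - Dred S) (\<lambda>p. fst (\<nu> c p)) \<and>
        (\<forall>p. bproj P p \<in> fst c \<inter> W - Dred S \<longrightarrow> snd (\<nu> c p) = 0)) \<and>
     (\<forall>j\<in>{1..npts S}. pt S j \<in> W \<longrightarrow>
        (\<forall>(U, \<sigma>)\<in>hframes P. pt S j \<in> U \<and> \<sigma> (pt S j) = framing P j \<longrightarrow>
           (\<exists>L\<in>lieT S. hol_extends
              (\<lambda>w. cscale w (fst (\<nu> (crd S j) (\<sigma> (chart_inv (crd S j) w))))) L)))}"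

text \<open>Local sections of the subsheaf of \<open>ad P(- D\<^sub>r\<^sub>e\<^sub>d)\<close>: the preimage under \<open>-\<nabla>\<close>.\<close>

definition sheaf_ad ::
  "('x, 'n::finite) irr_setting \<Rightarrow> ('x, 'p, 'n) framed_conn \<Rightarrow> 'x set \<Rightarrow> ('p \<Rightarrow> 'n cmat) set" where
  "sheaf_ad S P W = {\<mu>. ad_section S P W \<mu> \<and> ad_hol S P W \<mu> \<and>
     (\<forall>p. bproj P p \<in> W \<inter> Dred S \<longrightarrow> \<mu> p = 0) \<and>
     (\<lambda>c p. - nabla S P \<mu> c p) \<in> sheaf_adK S P W}"

text \<open>
  Smooth sections of a locally free subsheaf \<open>E\<close> are sections of \<open>C\<^sup>\<infinity> \<otimes> E\<close> over the structure
  sheaf: locally finite sums of smooth functions times holomorphic sections of \<open>E\<close>.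
\<close>

definition smooth_ad ::
  "('x::t2_space, 'n::finite) irr_setting \<Rightarrow> ('x, 'p, 'n) framed_conn \<Rightarrow> ('p \<Rightarrow> 'n cmat) set" where
  "smooth_ad S P = {\<mu>. \<forall>x. \<exists>W n. \<exists>f :: nat \<Rightarrow> 'x \<Rightarrow> complex. \<exists>e. open W \<and> x \<in> W \<and>
     (\<forall>i<n. surf_smooth_on (atlas S) W (f i) \<and> e i \<in> sheaf_ad S P W) \<and>
     (\<forall>p. bproj P p \<in> W \<longrightarrow> \<mu> p = (\<Sum>i<(n::nat). cscale (f i (bproj P p)) (e i p)))}"

definition smooth_ad01 ::
  "('x::t2_space, 'n::finite) irr_setting \<Rightarrow> ('x, 'p, 'n) framed_conn \<Rightarrow> ('x, 'p, 'n) ad_form set" where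
  "smooth_ad01 S P = {\<tau>. global_oneform S P \<tau> \<and>
     (\<forall>x. \<exists>W. \<exists>c\<in>atlas S. \<exists>n. \<exists>f :: nat \<Rightarrow> 'x \<Rightarrow> complex. \<exists>e. open W \<and> x \<in> W \<and> W \<subseteq> fst c \<and>
        (\<forall>i<n. surf_smooth_on (atlas S) W (f i) \<and> e i \<in> sheaf_ad S P W) \<and>
        (\<forall>p. bproj P p \<in> W - Dred S \<longrightarrow>
           \<tau> c p = (0, \<Sum>i<(n::nat). cscale (f i (bproj P p)) (e i p))))}"

definition smooth_adK ::
  "('x::t2_space, 'n::finite) irr_setting \<Rightarrow> ('x, 'p, 'n) framed_conn \<Rightarrow> ('x, 'p, 'n) ad_form set" where
  "smooth_adK S P = {\<nu>. global_oneform S P \<nu> \<and>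
     (\<forall>x. \<exists>W. \<exists>c\<in>atlas S. \<exists>n. \<exists>f :: nat \<Rightarrow> 'x \<Rightarrow> complex. \<exists>e. open W \<and> x \<in> W \<and> W \<subseteq> fst c \<and>
        (\<forall>i<n. surf_smooth_on (atlas S) W (f i) \<and> e i \<in> sheaf_adK S P W) \<and>
        (\<forall>p. bproj P p \<in> W - Dred S \<longrightarrow>
           \<nu> c p = (\<Sum>i<(n::nat). cscale (f i (bproj P p)) (fst (e i c p)), 0)))}"

definition hypercocycles ::
  "('x::t2_space, 'n::finite) irr_setting \<Rightarrow> ('x, 'p, 'n) framed_conn \<Rightarrow>
   (('x, 'p, 'n) ad_form \<times> ('x, 'p, 'n) ad_form) set" where
  "hypercocycles S P = {(\<tau>, \<nu>). \<tau> \<in> smooth_ad01 S P \<and> \<nu> \<in> smooth_adK S P \<and>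
     (\<forall>c\<in>atlas S. \<forall>p. bproj P p \<in> fst c - Dred S \<longrightarrow> - nabla10_form P \<tau> c p = dbar_form P \<nu> c p)}"

text \<open>
  The coboundary of \<open>\<mu>\<close> is \<open>(-\<open>dbar\<close> \<mu>, -\<nabla>\<^sup>1\<^sup>,\<^sup>0\<mu>)\<close>: the sign of the first entry is forced by the cocycle
  condition, since \<open>\<nabla>\<^sup>1\<^sup>,\<^sup>0\<close> and \<open>dbar\<close> anticommute.
\<close>

definition hyper_class ::
  "('x::t2_space, 'n::finite) irr_setting \<Rightarrow> ('x, 'p, 'n) framed_conn \<Rightarrow>
   ('x, 'p, 'n) ad_form \<times> ('x, 'p, 'n) ad_form \<Rightarrow>
   (('x, 'p, 'n) ad_form \<times> ('x, 'p, 'n) ad_form) set" where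
  "hyper_class S P h =
     {(\<lambda>c p. fst h c p + - part01 (nabla S P \<mu>) c p,
       \<lambda>c p. snd h c p + - part10 (nabla S P \<mu>) c p) | \<mu>. \<mu> \<in> smooth_ad S P}"

definition H_tangent_space ::
  "('x::t2_space, 'n::finite) irr_setting \<Rightarrow> ('x, 'p, 'n) framed_conn \<Rightarrow>
   (('x, 'p, 'n) ad_form \<times> ('x, 'p, 'n) ad_form) set set" where
  "H_tangent_space S P = hyper_class S P ` hypercocycles S P"

definition H_form ::
  "('x::t2_space, 'n::finite) irr_setting \<Rightarrow> ('x, 'p, 'n) framed_conn \<Rightarrow>
   ('x, 'p, 'n) ad_form \<times> ('x, 'p, 'n) ad_form \<Rightarrow>
   ('x, 'p, 'n) ad_form \<times> ('x, 'p, 'n) ad_form \<Rightarrow> complex" where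
  "H_form S P = (\<lambda>(\<tau>1, \<nu>1) (\<tau>2, \<nu>2). surf_integral (atlas S)
     (\<lambda>c x. killing_wedge S P \<tau>1 \<nu>2 c x - killing_wedge S P \<tau>2 \<nu>1 c x))"

definition omega_H ::
  "('x::t2_space, 'n::finite) irr_setting \<Rightarrow> ('x, 'p, 'n) framed_conn \<Rightarrow>
   (('x, 'p, 'n) ad_form \<times> ('x, 'p, 'n) ad_form) set \<Rightarrow>
   (('x, 'p, 'n) ad_form \<times> ('x, 'p, 'n) ad_form) set \<Rightarrow> complex" where
  "omega_H S P A B = H_form S P (SOME h. h \<in> A) (SOME h. h \<in> B)"

text \<open>
  The correspondence between the two tangent spaces induced by
  \<open>\<phi> \<mapsto> (\<phi>\<^sup>0\<^sup>,\<^sup>1, \<phi>\<^sup>1\<^sup>,\<^sup>0)\<close>.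
\<close>

definition tangent_identified ::
  "('x, 'p, 'n::finite) ad_form set \<Rightarrow> (('x, 'p, 'n) ad_form \<times> ('x, 'p, 'n) ad_form) set \<Rightarrow> bool" where
  "tangent_identified a A \<longleftrightarrow> (\<exists>\<phi>\<in>a. (part01 \<phi>, part10 \<phi>) \<in> A)"

end

theory Submission
  imports Defs
begin

text \<open>
  A hypercocycle \<open>(\<tau>, \<nu>)\<close> amounts to a one-form \<open>h = \<nu> + \<tau>\<close> with \<open>\<nabla>h = 0\<close>. In these terms the
  integrands of the two symplectic forms agree: symmetry of the Killing form turns
  \<open>\<kappa>(\<tau>\<^sub>1, \<nu>\<^sub>2) - \<kappa>(\<tau>\<^sub>2, \<nu>\<^sub>1)\<close> into \<open>\<kappa>(h\<^sub>1 \<and> h\<^sub>2)\<close> (\<open>H_form_eq_AB_form\<close>).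

  The content is therefore independence of representatives. Both forms are evaluated at arbitrary
  members of the classes. A class of the Atiyah--Bott description and the hypercohomology class
  identified with it share a one-form \<open>\<phi>\<close>, so that every member of either class is \<open>h - \<nabla>\<mu>\<close> for one
  and the same \<open>h\<close>, where \<open>\<mu>\<close> is an infinitesimal gauge transformation which is flat at the marked
  points, a smooth section of the subsheaf of \<open>ad P(-D\<^sub>r\<^sub>e\<^sub>d)\<close>, or a combination of such sections. Since
  the pairing is additive and antisymmetric, it suffices that \<open>\<nabla>\<mu>\<close> pairs to zero with every form \<open>\<psi>\<close>
  such that \<open>\<nabla>\<psi> = 0\<close> (\<open>integral_exact\<close>).

  Invariance of the Killing form under the bracket with the connection form and \<open>\<nabla>\<psi> = 0\<close> give
  \<open>\<kappa>(\<nabla>\<mu> \<and> \<psi>) = d \<kappa>(\<mu>, \<psi>)\<close>, and Stokes' theorem concludes, except that \<open>\<kappa>(\<mu>, \<psi>)\<close> is singular at the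
  marked points. Theorem \<open>stokes\<close> covers one-forms with finitely many singularities whose
  coefficients and first partial derivatives are locally integrable: after localizing by a partition
  of unity one integrates along horizontal and vertical lines, almost all of which avoid the
  singular points, so no boundary terms arise.

  The integrability is controlled by the classes \<open>growth m\<close> of functions which are \<open>O(|w|\<^sup>m)\<close> with
  first derivatives \<open>O(|w|\<^sup>m\<^sup>-\<^sup>1)\<close>. In the coordinate at a marked point and the frame through the
  framing, \<open>\<mu>\<close> has growth 1, and the forms in question have a \<open>dz\<close>-part of growth -1 and a
  \<open>d\<close>\<open>z\<close>-bar-part of growth 1; products have growth at least 0, and derivatives \<open>O(1/|w|)\<close> are integrable
  in the plane. That \<open>\<nabla>\<mu>\<close> and hypercocycles have this growth is shown in
  \<open>gauge_section_lie_gauge1\<close>, \<open>gauge_section_smooth_ad\<close> and \<open>closed_form_hypercocycle\<close>: a flat section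
  compensates the poles of the connection of every order, and for sections \<open>e\<close> of the holomorphic
  subsheaf \<open>\<nabla>e\<close> has a logarithmic pole by definition.
\<close>

section \<open>Calculus of smooth functions\<close>

text \<open>
  The derivative in terms of its values on \<open>1\<close> and \<open>\<i>\<close>, which are the directions in which smoothness
  is defined.
\<close>

definition has_partials ::
  "complex set \<Rightarrow> (complex \<Rightarrow> 'b::real_normed_vector) \<Rightarrow> (complex \<Rightarrow> 'b) \<Rightarrow> (complex \<Rightarrow> 'b) \<Rightarrow> bool" where
  "has_partials S f f1 f2 \<longleftrightarrow>
     (\<forall>w\<in>S. (f has_derivative (\<lambda>v. Re v *\<^sub>R f1 w + Im v *\<^sub>R f2 w)) (at w))"

abbreviation pdiff :: "complex \<Rightarrow> (complex \<Rightarrow> 'b::real_normed_vector) \<Rightarrow> complex \<Rightarrow> 'b" where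
  "pdiff v f \<equiv> (\<lambda>w. frechet_derivative f (at w) v)"

lemma derivative_by_partials:
  assumes "(f has_derivative D) (at (w::complex))"
  shows "(f has_derivative (\<lambda>v. Re v *\<^sub>R D 1 + Im v *\<^sub>R D \<i>)) (at w)"
proof -
  interpret bounded_linear D using assms by (rule has_derivative_bounded_linear)
  have "D v = Re v *\<^sub>R D 1 + Im v *\<^sub>R D \<i>" for v
  proof -
    have "D v = D (Re v *\<^sub>R 1 + Im v *\<^sub>R \<i>)" by (rule arg_cong[of _ _ D]) (simp add: complex_eq_iff)
    then show ?thesis by (simp add: add scaleR)
  qed
  then show ?thesis using assms by (metis (no_types, lifting) ext)
qed

lemma has_partials_pdiff:
  assumes "open S" "f differentiable_on S"
  shows "has_partials S f (pdiff 1 f) (pdiff \<i> f)"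
  unfolding has_partials_def
proof
  fix w assume "w \<in> S"
  then have "f differentiable at w" using assms differentiable_on_eq_differentiable_at by blast
  then show "(f has_derivative (\<lambda>v. Re v *\<^sub>R pdiff 1 f w + Im v *\<^sub>R pdiff \<i> f w)) (at w)"
    using derivative_by_partials frechet_derivative_works by blast
qed

lemma has_partials_eq:
  assumes "has_partials S f f1 f2" "w \<in> S"
  shows "frechet_derivative f (at w) = (\<lambda>v. Re v *\<^sub>R f1 w + Im v *\<^sub>R f2 w)"
  using assms frechet_derivative_at[symmetric] unfolding has_partials_def by blast

lemma pdiff_cong:
  assumes "open S" "\<And>w. w \<in> S \<Longrightarrow> f w = g w" "w \<in> S"
  shows "frechet_derivative f (at w) = frechet_derivative g (at w)"
proof -
  have "(f has_derivative D) (at w) \<longleftrightarrow> (g has_derivative D) (at w)" for D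
    using assms has_derivative_transform_within_open[of f D w UNIV S g]
      has_derivative_transform_within_open[of g D w UNIV S f] by auto
  then show ?thesis unfolding frechet_derivative_def by simp
qed

text \<open>
  Smoothness is the weakest property that implies differentiability and passes to partial derivatives.
  The closure properties below are proved by exhibiting families that are stable under them.
\<close>

lemma smooth_on_coinduct:
  assumes "open S" "f \<in> F"
    and step: "\<And>g. g \<in> F \<Longrightarrow> \<exists>g1\<in>F. \<exists>g2\<in>F. has_partials S g g1 g2"
  shows "smooth_on S f"
proof -
  have *: "\<forall>g\<in>F. \<exists>h\<in>F. \<forall>w\<in>S. pderivs vs g w = h w" if "vs \<in> lists {1, \<i>}" for vs
    using that
  proof (induction vs)
    case Nil then show ?case by auto
  next
    case (Cons v vs)
    show ?case
    proof
      fix g assume "g \<in> F"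
      then obtain h where h: "h \<in> F" "\<forall>w\<in>S. pderivs vs g w = h w" using Cons.IH by blast
      obtain h1 h2 where hp: "h1 \<in> F" "h2 \<in> F" "has_partials S h h1 h2" using step h by blast
      have "pderivs (v # vs) g w = (if v = 1 then h1 w else h2 w)" if "w \<in> S" for w
        using pdiff_cong[OF assms(1), of "pderivs vs g" h w] h that has_partials_eq[OF hp(3) that] Cons.hyps
        by auto
      then show "\<exists>h\<in>F. \<forall>w\<in>S. pderivs (v # vs) g w = h w" using hp by (cases "v = 1") auto
    qed
  qed
  show ?thesis unfolding smooth_on_def
  proof
    fix vs assume "vs \<in> lists {1::complex, \<i>}"
    then obtain h where h: "h \<in> F" "\<forall>w\<in>S. pderivs vs f w = h w" using * assms(2) by blast
    obtain h1 h2 where "has_partials S h h1 h2" using step h by blast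
    then have "h differentiable_on S"
      unfolding has_partials_def differentiable_on_def
      using differentiable_at_withinI differentiableI by blast
    then show "pderivs vs f differentiable_on S"
      unfolding differentiable_on_def
      using h differentiable_transform_within[of h _ S 1 "pderivs vs f"] by auto
  qed
qed

lemma smooth_on_subset: "smooth_on S f \<Longrightarrow> T \<subseteq> S \<Longrightarrow> smooth_on T f"
  unfolding smooth_on_def using differentiable_on_subset by blast

lemma smooth_on_differentiable: "smooth_on S f \<Longrightarrow> f differentiable_on S"
  unfolding smooth_on_def by (metis lists.Nil pderivs.simps(1))

lemma smooth_on_continuous: "smooth_on S f \<Longrightarrow> continuous_on S f"
  using smooth_on_differentiable differentiable_imp_continuous_on by blast

lemma pderivs_append: "pderivs (vs @ [v]) f = pderivs vs (pdiff v f)"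
  by (induction vs) auto

lemma smooth_on_pdiff:
  assumes "smooth_on S f" "v \<in> {1, \<i>}"
  shows "smooth_on S (pdiff v f)"
  unfolding smooth_on_def
proof
  fix vs assume "vs \<in> lists {1::complex, \<i>}"
  then have "vs @ [v] \<in> lists {1, \<i>}" using assms(2) by auto
  then show "pderivs vs (pdiff v f) differentiable_on S"
    using assms(1) unfolding smooth_on_def by (metis pderivs_append)
qed

lemma smooth_on_partials:
  assumes "open S" "smooth_on S f"
  obtains f1 f2 where "smooth_on S f1" "smooth_on S f2" "has_partials S f f1 f2"
  using that[OF smooth_on_pdiff smooth_on_pdiff has_partials_pdiff] assms smooth_on_differentiable
  by auto

lemma has_partials_cong:
  assumes "open S" "\<And>w. w \<in> S \<Longrightarrow> f w = g w" "has_partials S f f1 f2"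
  shows "has_partials S g f1 f2"
  using assms has_derivative_transform_within_open[of f _ _ UNIV S g]
  unfolding has_partials_def by auto

lemma smooth_on_cong:
  assumes "open S" "\<And>w. w \<in> S \<Longrightarrow> f w = g w" "smooth_on S f"
  shows "smooth_on S g"
proof (rule smooth_on_coinduct[where F="{g. \<exists>f. smooth_on S f \<and> (\<forall>w\<in>S. f w = g w)}"])
  fix g :: "complex \<Rightarrow> 'a" assume "g \<in> {g. \<exists>f. smooth_on S f \<and> (\<forall>w\<in>S. f w = g w)}"
  then obtain f where f: "smooth_on S f" "\<forall>w\<in>S. f w = g w" by auto
  obtain f1 f2 where "smooth_on S f1" "smooth_on S f2" "has_partials S f f1 f2"
    using smooth_on_partials[OF assms(1) f(1)] by blast
  then show "\<exists>g1\<in>{g. \<exists>f. smooth_on S f \<and> (\<forall>w\<in>S. f w = g w)}.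
      \<exists>g2\<in>{g. \<exists>f. smooth_on S f \<and> (\<forall>w\<in>S. f w = g w)}. has_partials S g g1 g2"
    using has_partials_cong[OF assms(1)] f(2) by blast
qed (use assms in auto)

lemma smooth_on_local:
  assumes "open S" "\<And>x. x \<in> S \<Longrightarrow> \<exists>T. open T \<and> x \<in> T \<and> smooth_on T f"
  shows "smooth_on S f"
  unfolding smooth_on_def differentiable_on_def
proof (intro ballI)
  fix vs x assume vs: "vs \<in> lists {1::complex, \<i>}" and "x \<in> S"
  then obtain T where T: "open T" "x \<in> T" "smooth_on T f" using assms by blast
  then have "pderivs vs f differentiable at x"
    using vs unfolding smooth_on_def using differentiable_on_eq_differentiable_at by blast
  then show "pderivs vs f differentiable at x within S" by (rule differentiable_at_withinI)
qed

lemma smooth_on_linear: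
  assumes "open S" "bounded_linear L" "smooth_on S f"
  shows "smooth_on S (\<lambda>w. L (f w))"
proof (rule smooth_on_coinduct[where F="{\<lambda>w. L (f w) | f. smooth_on S f}"])
  interpret bounded_linear L by fact
  fix g assume "g \<in> {\<lambda>w. L (f w) | f. smooth_on S f}"
  then obtain f where f: "smooth_on S f" "g = (\<lambda>w. L (f w))" by auto
  obtain f1 f2 where p: "smooth_on S f1" "smooth_on S f2" "has_partials S f f1 f2"
    using smooth_on_partials[OF assms(1) f(1)] by blast
  have "has_partials S g (\<lambda>w. L (f1 w)) (\<lambda>w. L (f2 w))"
    unfolding has_partials_def
  proof
    fix w assume "w \<in> S"
    then have "(f has_derivative (\<lambda>v. Re v *\<^sub>R f1 w + Im v *\<^sub>R f2 w)) (at w)"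
      using p(3) unfolding has_partials_def by blast
    from has_derivative[OF this]
    show "(g has_derivative (\<lambda>v. Re v *\<^sub>R L (f1 w) + Im v *\<^sub>R L (f2 w))) (at w)"
      unfolding f(2) by (simp add: add scaleR)
  qed
  then show "\<exists>g1\<in>{\<lambda>w. L (f w) | f. smooth_on S f}.
     \<exists>g2\<in>{\<lambda>w. L (f w) | f. smooth_on S f}. has_partials S g g1 g2"
    using p by blast
qed (use assms in auto)

lemma has_partials_add:
  assumes "has_partials S f f1 f2" "has_partials S g g1 g2"
  shows "has_partials S (\<lambda>w. f w + g w) (\<lambda>w. f1 w + g1 w) (\<lambda>w. f2 w + g2 w)"
  unfolding has_partials_def
proof
  fix w assume "w \<in> S"
  then have "((\<lambda>w. f w + g w) has_derivative
     (\<lambda>v. (Re v *\<^sub>R f1 w + Im v *\<^sub>R f2 w) + (Re v *\<^sub>R g1 w + Im v *\<^sub>R g2 w))) (at w)"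
    using assms unfolding has_partials_def by (intro has_derivative_add) auto
  then show "((\<lambda>w. f w + g w) has_derivative
     (\<lambda>v. Re v *\<^sub>R (f1 w + g1 w) + Im v *\<^sub>R (f2 w + g2 w))) (at w)"
    by (rule has_derivative_eq_rhs) (auto simp: algebra_simps)
qed

lemma smooth_on_add:
  assumes "open S" "smooth_on S f" "smooth_on S g"
  shows "smooth_on S (\<lambda>w. f w + g w)"
proof (rule smooth_on_coinduct[where F="{\<lambda>w. f w + g w | f g. smooth_on S f \<and> smooth_on S g}"])
  let ?F = "{\<lambda>w. f w + g w | f g. smooth_on S f \<and> smooth_on S (g::complex \<Rightarrow> 'a)}"
  fix h assume "h \<in> ?F"
  then obtain f g where f: "smooth_on S f" "smooth_on S g" "h = (\<lambda>w. f w + g w)" by auto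
  obtain f1 f2 where p: "smooth_on S f1" "smooth_on S f2" "has_partials S f f1 f2"
    using smooth_on_partials[OF assms(1) f(1)] by blast
  obtain g1 g2 where q: "smooth_on S g1" "smooth_on S g2" "has_partials S g g1 g2"
    using smooth_on_partials[OF assms(1) f(2)] by blast
  show "\<exists>g1\<in>?F. \<exists>g2\<in>?F. has_partials S h g1 g2"
    using has_partials_add[OF p(3) q(3)] p q unfolding f(3) by blast
qed (use assms in auto)

lemma has_partials_const: "has_partials S (\<lambda>w. c) (\<lambda>w. 0) (\<lambda>w. 0)"
  unfolding has_partials_def by auto

lemma smooth_on_const:
  assumes "open S"
  shows "smooth_on S (\<lambda>w. c)"
proof (rule smooth_on_coinduct[where F="range (\<lambda>c w. c)"])
  fix g assume "g \<in> range (\<lambda>c w::complex. c::'a)"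
  then show "\<exists>g1\<in>range (\<lambda>c w. c). \<exists>g2\<in>range (\<lambda>c w. c). has_partials S g g1 g2"
    using has_partials_const[of S] by blast
qed (use assms in auto)

lemma smooth_on_sum:
  assumes "open S" "\<And>i. i \<in> I \<Longrightarrow> smooth_on S (f i)"
  shows "smooth_on S (\<lambda>w. \<Sum>i\<in>I. f i w)"
  using assms(2)
  by (induction I rule: infinite_finite_induct)
    (auto intro: smooth_on_add smooth_on_const assms(1))

lemma smooth_on_minus: "open S \<Longrightarrow> smooth_on S f \<Longrightarrow> smooth_on S (\<lambda>w. - f w)"
  by (rule smooth_on_linear[OF _ bounded_linear_minus[OF bounded_linear_ident]])

lemma smooth_on_diff:
  assumes "open S" "smooth_on S f" "smooth_on S g"
  shows "smooth_on S (\<lambda>w. f w - g w)"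
  using smooth_on_add[OF assms(1,2) smooth_on_minus[OF assms(1,3)]] by simp

text \<open>Products are not closed under differentiation, but finite sums of products are.\<close>

inductive_set products ::
  "('a::real_normed_vector \<Rightarrow> 'b::real_normed_vector \<Rightarrow> 'c::real_normed_vector) \<Rightarrow> complex set \<Rightarrow> (complex \<Rightarrow> 'c) set"
  for bl S where
  base: "smooth_on S f \<Longrightarrow> smooth_on S g \<Longrightarrow> (\<lambda>w. bl (f w) (g w)) \<in> products bl S"
| add: "f \<in> products bl S \<Longrightarrow> g \<in> products bl S \<Longrightarrow> (\<lambda>w. f w + g w) \<in> products bl S"

lemma has_partials_bilinear:
  assumes "bounded_bilinear bl" "has_partials S f f1 f2" "has_partials S g g1 g2"
  shows "has_partials S (\<lambda>w. bl (f w) (g w)) (\<lambda>w. bl (f w) (g1 w) + bl (f1 w) (g w))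
           (\<lambda>w. bl (f w) (g2 w) + bl (f2 w) (g w))"
  unfolding has_partials_def
proof
  interpret bounded_bilinear bl by fact
  fix w assume "w \<in> S"
  then have "((\<lambda>w. bl (f w) (g w)) has_derivative
     (\<lambda>v. bl (f w) (Re v *\<^sub>R g1 w + Im v *\<^sub>R g2 w) + bl (Re v *\<^sub>R f1 w + Im v *\<^sub>R f2 w) (g w))) (at w)"
    using assms unfolding has_partials_def by (intro FDERIV) auto
  then show "((\<lambda>w. bl (f w) (g w)) has_derivative
     (\<lambda>v. Re v *\<^sub>R (bl (f w) (g1 w) + bl (f1 w) (g w)) + Im v *\<^sub>R (bl (f w) (g2 w) + bl (f2 w) (g w)))) (at w)"
    by (rule has_derivative_eq_rhs) (auto simp: algebra_simps add_left add_right scaleR_left scaleR_right)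
qed

lemma smooth_on_bilinear:
  assumes "bounded_bilinear bl" "open S" "smooth_on S f" "smooth_on S g"
  shows "smooth_on S (\<lambda>w. bl (f w) (g w))"
proof (rule smooth_on_coinduct[where F="products bl S"])
  fix h assume "h \<in> products bl S"
  then show "\<exists>g1\<in>products bl S. \<exists>g2\<in>products bl S. has_partials S h g1 g2"
  proof induction
    case (base f g)
    obtain f1 f2 where p: "smooth_on S f1" "smooth_on S f2" "has_partials S f f1 f2"
      using smooth_on_partials[OF assms(2) base(1)] by blast
    obtain g1 g2 where q: "smooth_on S g1" "smooth_on S g2" "has_partials S g g1 g2"
      using smooth_on_partials[OF assms(2) base(2)] by blast
    show ?case
      using has_partials_bilinear[OF assms(1) p(3) q(3)]
        products.add[OF products.base[OF base(1) q(1)] products.base[OF p(1) base(2)]]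
        products.add[OF products.base[OF base(1) q(2)] products.base[OF p(2) base(2)]] by blast
  next
    case (add f g)
    obtain f1 f2 where f: "f1 \<in> products bl S" "f2 \<in> products bl S" "has_partials S f f1 f2" using add by blast
    obtain g1 g2 where g: "g1 \<in> products bl S" "g2 \<in> products bl S" "has_partials S g g1 g2" using add by blast
    show ?case
      using has_partials_add[OF f(3) g(3)] products.add[OF f(1) g(1)] products.add[OF f(2) g(2)] by blast
  qed
qed (use assms products.base in auto)

lemmas smooth_on_mult = smooth_on_bilinear[OF bounded_bilinear_mult]

text \<open>
  By the chain rule the partial derivatives of \<open>c \<cdot> (\<phi> \<circ> u)\<close> are again sums of such functions when \<open>\<Phi>\<close>
  contains the derivative of \<open>\<phi>\<close>.
\<close>

inductive_set compositions :: "(real \<Rightarrow> real) set \<Rightarrow> complex set \<Rightarrow> (complex \<Rightarrow> real) \<Rightarrow> (complex \<Rightarrow> real) set"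
  for \<Phi> S u where
  base: "\<phi> \<in> \<Phi> \<Longrightarrow> smooth_on S c \<Longrightarrow> (\<lambda>w. c w * \<phi> (u w)) \<in> compositions \<Phi> S u"
| add: "f \<in> compositions \<Phi> S u \<Longrightarrow> g \<in> compositions \<Phi> S u \<Longrightarrow> (\<lambda>w. f w + g w) \<in> compositions \<Phi> S u"

text \<open>
  Smoothness of an outer function enters through a family \<open>\<Phi>\<close> that is closed under differentiation:
  the multiples of powers of the inverse, and below the functions \<open>flat_exp p\<close>.
\<close>

lemma smooth_on_compose:
  fixes u :: "complex \<Rightarrow> real"
  assumes "open S" "smooth_on S u" "\<phi> \<in> \<Phi>"
    and \<Phi>: "\<And>\<phi>. \<phi> \<in> \<Phi> \<Longrightarrow> \<exists>\<phi>'\<in>\<Phi>. \<forall>w\<in>S. (\<phi> has_real_derivative \<phi>' (u w)) (at (u w))"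
  shows "smooth_on S (\<lambda>w. \<phi> (u w))"
proof -
  obtain u1 u2 where u: "smooth_on S u1" "smooth_on S u2" "has_partials S u u1 u2"
    using smooth_on_partials[OF assms(1,2)] by blast
  have "smooth_on S (\<lambda>w. 1 * \<phi> (u w))"
  proof (rule smooth_on_coinduct[where F="compositions \<Phi> S u"])
    fix h assume "h \<in> compositions \<Phi> S u"
    then show "\<exists>g1\<in>compositions \<Phi> S u. \<exists>g2\<in>compositions \<Phi> S u. has_partials S h g1 g2"
    proof induction
      case (base \<phi> c)
      obtain \<phi>' where \<phi>': "\<phi>' \<in> \<Phi>" "\<forall>w\<in>S. (\<phi> has_real_derivative \<phi>' (u w)) (at (u w))"
        using \<Phi> base by blast
      obtain c1 c2 where c: "smooth_on S c1" "smooth_on S c2" "has_partials S c c1 c2"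
        using smooth_on_partials[OF assms(1) base(2)] by blast
      have p: "has_partials S (\<lambda>w. c w * \<phi> (u w))
         (\<lambda>w. (c w * u1 w) * \<phi>' (u w) + c1 w * \<phi> (u w)) (\<lambda>w. (c w * u2 w) * \<phi>' (u w) + c2 w * \<phi> (u w))"
        unfolding has_partials_def
      proof
        fix w assume w: "w \<in> S"
        have "((\<lambda>w. \<phi> (u w)) has_derivative (\<lambda>v. \<phi>' (u w) * (Re v *\<^sub>R u1 w + Im v *\<^sub>R u2 w))) (at w)"
          using w \<phi>'(2) u(3) unfolding has_partials_def
          by (intro has_derivative_compose[of u _ w UNIV \<phi> "\<lambda>h. \<phi>' (u w) * h"])
            (simp_all add: has_field_derivative_def)
        moreover have "(c has_derivative (\<lambda>v. Re v *\<^sub>R c1 w + Im v *\<^sub>R c2 w)) (at w)"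
          using w c(3) unfolding has_partials_def by auto
        ultimately have "((\<lambda>w. c w * \<phi> (u w)) has_derivative
           (\<lambda>v. c w * (\<phi>' (u w) * (Re v *\<^sub>R u1 w + Im v *\<^sub>R u2 w)) + (Re v *\<^sub>R c1 w + Im v *\<^sub>R c2 w) * \<phi> (u w))) (at w)"
          by (intro has_derivative_mult)
        then show "((\<lambda>w. c w * \<phi> (u w)) has_derivative
           (\<lambda>v. Re v *\<^sub>R ((c w * u1 w) * \<phi>' (u w) + c1 w * \<phi> (u w))
              + Im v *\<^sub>R ((c w * u2 w) * \<phi>' (u w) + c2 w * \<phi> (u w)))) (at w)"
          by (rule has_derivative_eq_rhs) (auto simp: algebra_simps)
      qed
      have "(\<lambda>w. (c w * v w) * \<phi>' (u w) + d w * \<phi> (u w)) \<in> compositions \<Phi> S u"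
        if "smooth_on S v" "smooth_on S d" for v d
        using compositions.add[OF compositions.base[OF \<phi>'(1) smooth_on_mult[OF assms(1) base(2) that(1)], of u]
            compositions.base[OF base(1) that(2), of u]] .
      then show ?case using p u c by blast
    next
      case (add f g)
      obtain f1 f2 where f: "f1 \<in> compositions \<Phi> S u" "f2 \<in> compositions \<Phi> S u" "has_partials S f f1 f2" using add by blast
      obtain g1 g2 where g: "g1 \<in> compositions \<Phi> S u" "g2 \<in> compositions \<Phi> S u" "has_partials S g g1 g2" using add by blast
      show ?case
        using has_partials_add[OF f(3) g(3)] compositions.add[OF f(1) g(1)] compositions.add[OF f(2) g(2)] by blast
    qed
  next
    show "(\<lambda>w. 1 * \<phi> (u w)) \<in> compositions \<Phi> S u"
      by (rule compositions.base[OF assms(3) smooth_on_const[OF assms(1)]])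
  qed fact
  then show ?thesis by simp
qed

lemma smooth_on_inverse:
  fixes u :: "complex \<Rightarrow> real"
  assumes "open S" "smooth_on S u" "\<And>w. w \<in> S \<Longrightarrow> u w \<noteq> 0"
  shows "smooth_on S (\<lambda>w. inverse (u w))"
proof (rule smooth_on_compose[where \<Phi>="{\<lambda>t. c * inverse t ^ n | c n. True}", OF assms(1,2)])
  show "inverse \<in> {\<lambda>t. c * inverse t ^ n | (c::real) n. True}"
    by (rule CollectI, rule exI[of _ 1], rule exI[of _ 1]) auto
  fix \<phi> :: "real \<Rightarrow> real" assume "\<phi> \<in> {\<lambda>t. c * inverse t ^ n | c n. True}"
  then obtain c n where \<phi>: "\<phi> = (\<lambda>t. c * inverse t ^ n)" by auto
  have *: "(\<phi> has_real_derivative (- c * n) * inverse t ^ (Suc n)) (at t)" if "t \<noteq> 0" for t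
  proof -
    have "(inverse has_real_derivative - (inverse t * inverse t)) (at t)"
      using DERIV_inverse[OF that, of UNIV] by (simp add: power2_eq_square)
    from DERIV_cmult[OF DERIV_power[OF this], of c n]
    show ?thesis unfolding \<phi>
      by (rule DERIV_cong) (cases n; simp add: algebra_simps)
  qed
  have "(\<lambda>t. (- c * n) * inverse t ^ (Suc n)) \<in> {\<lambda>t. c * inverse t ^ n | c n. True}" by blast
  moreover have "\<forall>w\<in>S. (\<phi> has_real_derivative (- c * n) * inverse (u w) ^ (Suc n)) (at (u w))"
    using assms(3) * by blast
  ultimately show "\<exists>\<phi>'\<in>{\<lambda>t. c * inverse t ^ n | c n. True}.
      \<forall>w\<in>S. (\<phi> has_real_derivative \<phi>' (u w)) (at (u w))"
    by (rule bexI[rotated, where x="\<lambda>t. (- c * n) * inverse t ^ (Suc n)"])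
qed

lemma has_partials_holomorphic:
  assumes "open S" "f holomorphic_on S"
  shows "has_partials S f (deriv f) (\<lambda>w. \<i> * deriv f w)"
  unfolding has_partials_def
proof
  fix w assume "w \<in> S"
  then have "(f has_field_derivative deriv f w) (at w)" using assms holomorphic_derivI by blast
  then show "(f has_derivative (\<lambda>v. Re v *\<^sub>R deriv f w + Im v *\<^sub>R (\<i> * deriv f w))) (at w)"
    unfolding has_field_derivative_def
    by (rule has_derivative_eq_rhs) (auto simp: fun_eq_iff complex_eq_iff algebra_simps)
qed

lemma smooth_on_holomorphic:
  assumes "open S" "f holomorphic_on S"
  shows "smooth_on S f"
proof (rule smooth_on_coinduct[where F="{f. f holomorphic_on S}"])
  fix g assume "g \<in> {f. f holomorphic_on S}"
  then show "\<exists>g1\<in>{f. f holomorphic_on S}. \<exists>g2\<in>{f. f holomorphic_on S}. has_partials S g g1 g2"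
    using has_partials_holomorphic[OF assms(1), of g] holomorphic_deriv[of g S] assms(1)
      holomorphic_on_mult[OF holomorphic_on_const, of "deriv g" S \<i>] by blast
qed (use assms in auto)

section \<open>Symmetry of second derivatives\<close>

lemma has_partials_lines:
  assumes "has_partials S f f1 f2" "Complex s t \<in> S"
  shows "((\<lambda>s. f (Complex s t)) has_vector_derivative f1 (Complex s t)) (at s within X)"
    "((\<lambda>t. f (Complex s t)) has_vector_derivative f2 (Complex s t)) (at t within X)"
proof -
  have f: "(f has_derivative (\<lambda>v. Re v *\<^sub>R f1 (Complex s t) + Im v *\<^sub>R f2 (Complex s t))) (at (Complex s t))"
    using assms unfolding has_partials_def by blast
  have *: "((\<lambda>s. Complex s t) has_derivative (\<lambda>h. Complex h 0)) (at s within X)"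
    "((\<lambda>t. Complex s t) has_derivative (\<lambda>h. Complex 0 h)) (at t within X)"
    by (auto simp: Complex_eq intro!: derivative_eq_intros)
  show "((\<lambda>s. f (Complex s t)) has_vector_derivative f1 (Complex s t)) (at s within X)"
    "((\<lambda>t. f (Complex s t)) has_vector_derivative f2 (Complex s t)) (at t within X)"
    using has_derivative_compose[OF *(1) f] has_derivative_compose[OF *(2) f]
    by (auto simp: has_vector_derivative_def)
qed

text \<open>
  Two applications of the mean value theorem, first in the real and then in the imaginary direction.
\<close>

lemma second_difference:
  fixes f :: "complex \<Rightarrow> real"
  assumes p: "has_partials S f f1 f2" "has_partials S f1 f11 f12"
    and h: "h > 0" and sq: "\<And>s t. x \<le> s \<Longrightarrow> s \<le> x + h \<Longrightarrow> y \<le> t \<Longrightarrow> t \<le> y + h \<Longrightarrow> Complex s t \<in> S"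
  shows "\<exists>s t. x \<le> s \<and> s \<le> x + h \<and> y \<le> t \<and> t \<le> y + h \<and>
    f (Complex (x+h) (y+h)) - f (Complex x (y+h)) - f (Complex (x+h) y) + f (Complex x y) = h^2 * f12 (Complex s t)"
proof -
  let ?\<phi> = "\<lambda>s. f (Complex s (y+h)) - f (Complex s y)"
  have "(?\<phi> has_real_derivative (f1 (Complex s (y+h)) - f1 (Complex s y))) (at s)" if "x \<le> s" "s \<le> x+h" for s
    using has_partials_lines(1)[OF p(1) sq, of s "y+h"] has_partials_lines(1)[OF p(1) sq, of s y] that h
    by (intro derivative_eq_intros) (auto simp: has_real_derivative_iff_has_vector_derivative)
  then obtain s where s: "x < s" "s < x+h" "?\<phi> (x+h) - ?\<phi> x = h * (f1 (Complex s (y+h)) - f1 (Complex s y))"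
    using MVT2[of x "x+h" ?\<phi> "\<lambda>s. f1 (Complex s (y+h)) - f1 (Complex s y)"] h by auto
  have "((\<lambda>t. f1 (Complex s t)) has_real_derivative f12 (Complex s t)) (at t)" if "y \<le> t" "t \<le> y+h" for t
    using has_partials_lines(2)[OF p(2) sq, of s t] that s
    by (auto simp: has_real_derivative_iff_has_vector_derivative)
  then obtain t where t: "y < t" "t < y+h" "f1 (Complex s (y+h)) - f1 (Complex s y) = h * f12 (Complex s t)"
    using MVT2[of y "y+h" "\<lambda>t. f1 (Complex s t)" "\<lambda>t. f12 (Complex s t)"] h by auto
  show ?thesis using s t by (intro exI[of _ s] exI[of _ t]) (auto simp: power2_eq_square algebra_simps)
qed

text \<open>
  Reflection in the diagonal exchanges the two orders of differentiation in \<open>second_difference\<close>.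
\<close>

lemma has_partials_swap:
  assumes "has_partials S f f1 f2"
  shows "has_partials ((\<lambda>w. Complex (Im w) (Re w)) -` S) (\<lambda>w. f (Complex (Im w) (Re w)))
     (\<lambda>w. f2 (Complex (Im w) (Re w))) (\<lambda>w. f1 (Complex (Im w) (Re w)))"
  unfolding has_partials_def
proof
  fix w assume "w \<in> (\<lambda>w. Complex (Im w) (Re w)) -` S"
  then have f: "(f has_derivative (\<lambda>v. Re v *\<^sub>R f1 (Complex (Im w) (Re w)) + Im v *\<^sub>R f2 (Complex (Im w) (Re w)))) (at (Complex (Im w) (Re w)))"
    using assms unfolding has_partials_def by auto
  have "((\<lambda>w. Complex (Im w) (Re w)) has_derivative (\<lambda>v. Complex (Im v) (Re v))) (at w)"
    by (auto simp: Complex_eq intro!: derivative_eq_intros)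
  from has_derivative_compose[OF this f]
  show "((\<lambda>w. f (Complex (Im w) (Re w))) has_derivative
     (\<lambda>v. Re v *\<^sub>R f2 (Complex (Im w) (Re w)) + Im v *\<^sub>R f1 (Complex (Im w) (Re w)))) (at w)"
    by (rule has_derivative_eq_rhs) (auto simp: algebra_simps)
qed

text \<open>
  The second difference over a square does not depend on the order of the directions, so both mixed
  derivatives take a common value at points of arbitrarily small squares at \<open>w\<close>.
\<close>

lemma mixed_partials_real:
  fixes f :: "complex \<Rightarrow> real"
  assumes "open S" "has_partials S f f1 f2" "has_partials S f1 f11 f12" "has_partials S f2 f21 f22"
    "continuous_on S f12" "continuous_on S f21" "w \<in> S"
  shows "f12 w = f21 w"
proof (rule ccontr)
  assume neq: "f12 w \<noteq> f21 w"
  define \<epsilon> where "\<epsilon> = dist (f12 w) (f21 w) / 2"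
  have \<epsilon>: "\<epsilon> > 0" using neq by (simp add: \<epsilon>_def)
  have *: "\<exists>d>0. \<forall>z. dist z w < d \<longrightarrow> z \<in> S \<and> dist (g z) (g w) < \<epsilon>"
    if "continuous_on S g" for g :: "complex \<Rightarrow> real"
  proof -
    have "(g \<longlongrightarrow> g w) (at w)"
      using that assms(1,7) by (metis at_within_open continuous_on_def)
    then have "\<forall>\<^sub>F z in at w. dist (g z) (g w) < \<epsilon>" using \<epsilon> by (rule tendstoD)
    then have "\<forall>\<^sub>F z in nhds w. dist (g z) (g w) < \<epsilon>" using \<epsilon> unfolding eventually_nhds_conv_at by simp
    moreover have "\<forall>\<^sub>F z in nhds w. z \<in> S" using assms(1,7) by (rule eventually_nhds_in_open)
    ultimately have "\<forall>\<^sub>F z in nhds w. z \<in> S \<and> dist (g z) (g w) < \<epsilon>" by (intro eventually_conj)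
    then show ?thesis unfolding eventually_nhds_metric .
  qed
  obtain d1 where d1: "d1 > 0" "\<And>z. dist z w < d1 \<Longrightarrow> z \<in> S \<and> dist (f12 z) (f12 w) < \<epsilon>"
    using *[OF assms(5)] by blast
  obtain d2 where d2: "d2 > 0" "\<And>z. dist z w < d2 \<Longrightarrow> z \<in> S \<and> dist (f21 z) (f21 w) < \<epsilon>"
    using *[OF assms(6)] by blast
  note d = d1(1) d2(1) d1(2) d2(2)
  define h where "h = min d1 d2 / 4"
  have h: "h > 0" using d by (simp add: h_def)
  have near: "dist (Complex s t) w < min d1 d2" if "Re w \<le> s" "s \<le> Re w + h" "Im w \<le> t" "t \<le> Im w + h" for s t
  proof -
    have "dist (Complex s t) w \<le> \<bar>s - Re w\<bar> + \<bar>t - Im w\<bar>"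
      using cmod_le[of "Complex s t - w"] by (simp add: dist_norm)
    moreover have "2 * h < min d1 d2" using d unfolding h_def by (simp add: min_def)
    ultimately show ?thesis using that by linarith
  qed
  obtain s t where 1: "Re w \<le> s" "s \<le> Re w + h" "Im w \<le> t" "t \<le> Im w + h"
    "f (Complex (Re w+h) (Im w+h)) - f (Complex (Re w) (Im w+h)) - f (Complex (Re w+h) (Im w)) + f (Complex (Re w) (Im w)) = h^2 * f12 (Complex s t)"
    using second_difference[OF assms(2,3) h, of "Re w" "Im w"] near d(3) by (metis min_less_iff_conj)
  obtain t' s' where 2: "Im w \<le> t'" "t' \<le> Im w + h" "Re w \<le> s'" "s' \<le> Re w + h"
    "f (Complex (Re w+h) (Im w+h)) - f (Complex (Re w+h) (Im w)) - f (Complex (Re w) (Im w+h)) + f (Complex (Re w) (Im w)) = h^2 * f21 (Complex s' t')"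
    using second_difference[OF has_partials_swap[OF assms(2)] has_partials_swap[OF assms(4)] h, of "Im w" "Re w"] near d(4)
    by fastforce
  have "f12 (Complex s t) = f21 (Complex s' t')" proof -
    have "h^2 * f12 (Complex s t) = h^2 * f21 (Complex s' t')" using 1(5) 2(5) by linarith
    then show ?thesis using h by simp
  qed
  moreover have "dist (f12 (Complex s t)) (f12 w) < \<epsilon>" using near[of s t] 1 d(3) by auto
  moreover have "dist (f21 (Complex s' t')) (f21 w) < \<epsilon>" using near[of s' t'] 2 d(4) by auto
  ultimately have "dist (f12 w) (f21 w) < 2 * \<epsilon>" by (auto simp: dist_real_def)
  then show False by (simp add: \<epsilon>_def)
qed

lemma has_partials_inner:
  assumes "has_partials S f f1 f2"
  shows "has_partials S (\<lambda>w. f w \<bullet> b) (\<lambda>w. f1 w \<bullet> b) (\<lambda>w. f2 w \<bullet> b)"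
  unfolding has_partials_def
proof
  fix w assume "w \<in> S"
  then have "(f has_derivative (\<lambda>v. Re v *\<^sub>R f1 w + Im v *\<^sub>R f2 w)) (at w)"
    using assms unfolding has_partials_def by auto
  from has_derivative_inner_left[OF this, of b]
  show "((\<lambda>w. f w \<bullet> b) has_derivative (\<lambda>v. Re v *\<^sub>R (f1 w \<bullet> b) + Im v *\<^sub>R (f2 w \<bullet> b))) (at w)"
    by (rule has_derivative_eq_rhs) (auto simp: inner_add_left)
qed

lemma mixed_partials:
  fixes f :: "complex \<Rightarrow> 'b::euclidean_space"
  assumes "open S" "smooth_on S f" "w \<in> S"
  shows "pdiff \<i> (pdiff 1 f) w = pdiff 1 (pdiff \<i> f) w"
proof (rule euclidean_eqI)
  fix b :: 'b
  have s: "smooth_on S (pdiff v f)" "smooth_on S (pdiff u (pdiff v f))" if "u \<in> {1, \<i>}" "v \<in> {1, \<i>}" for u v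
    using smooth_on_pdiff assms that by blast+
  note hp = has_partials_inner[OF has_partials_pdiff[OF assms(1) smooth_on_differentiable], of _ b]
  show "pdiff \<i> (pdiff 1 f) w \<bullet> b = pdiff 1 (pdiff \<i> f) w \<bullet> b"
    by (rule mixed_partials_real[OF assms(1) hp[OF assms(2)] hp[OF s(1)] hp[OF s(1)] _ _ assms(3)])
      (auto intro!: continuous_on_inner continuous_on_const smooth_on_continuous[OF s(2)])
qed


section \<open>Smooth bump functions and partitions of unity\<close>

text \<open>
  The functions \<open>p(1/t) exp(-1/t)\<close>, extended by zero, are closed under differentiation; \<open>p = 1\<close> is the
  usual cutoff function.
\<close>

definition flat_exp :: "real poly \<Rightarrow> real \<Rightarrow> real" where
  "flat_exp p t = (if t > 0 then poly p (inverse t) * exp (- inverse t) else 0)"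

lemma poly_over_exp_tendsto_0: "((\<lambda>x. poly p x * exp (- x)) \<longlongrightarrow> (0::real)) at_top"
proof -
  have "((\<lambda>x. \<Sum>i\<le>degree p. coeff p i * (x ^ i / exp x)) \<longlongrightarrow> (\<Sum>i\<le>degree p. coeff p i * 0)) at_top"
    by (intro tendsto_sum tendsto_mult tendsto_const tendsto_power_div_exp_0)
  then show ?thesis
    by (simp add: poly_altdef exp_minus sum_distrib_right divide_inverse mult.assoc)
qed

lemma flat_exp_derivative:
  "(flat_exp p has_real_derivative flat_exp (monom 1 2 * (p - pderiv p)) t) (at t)"
proof -
  consider "t > 0" | "t < 0" | "t = 0" by linarith
  then show ?thesis
  proof cases
    case 1
    have d: "((\<lambda>t. poly p (inverse t) * exp (- inverse t)) has_real_derivative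
        flat_exp (monom 1 2 * (p - pderiv p)) t) (at t)"
      using 1 unfolding flat_exp_def
      by (auto intro!: derivative_eq_intros simp: poly_monom power2_eq_square algebra_simps)
    have ev: "\<forall>\<^sub>F s in nhds t. poly p (inverse s) * exp (- inverse s) = flat_exp p s"
      using eventually_nhds_in_open[of "{0<..}" t] 1 unfolding flat_exp_def
      by (auto elim: eventually_mono)
    show ?thesis by (rule iffD1[OF DERIV_cong_ev[OF refl ev refl] d])
  next
    case 2
    have d: "((\<lambda>t. 0) has_real_derivative flat_exp (monom 1 2 * (p - pderiv p)) t) (at t)"
      using 2 unfolding flat_exp_def by auto
    have ev: "\<forall>\<^sub>F s in nhds t. 0 = flat_exp p s"
      using eventually_nhds_in_open[of "{..<0}" t] 2 unfolding flat_exp_def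
      by (auto elim: eventually_mono)
    show ?thesis by (rule iffD1[OF DERIV_cong_ev[OF refl ev refl] d])
  next
    case 3
    have "((\<lambda>h. poly (pCons 0 p) (inverse h) * exp (- inverse h)) \<longlongrightarrow> 0) (at_right 0)"
      by (rule filterlim_compose[OF poly_over_exp_tendsto_0 filterlim_inverse_at_top_right])
    then have "((\<lambda>h. flat_exp p h / h) \<longlongrightarrow> 0) (at_right 0)"
      by (rule Lim_transform_eventually)
        (auto simp: flat_exp_def eventually_at_right_less field_simps intro!: eventually_mono[OF eventually_at_right_less])
    moreover have "((\<lambda>h. flat_exp p h / h) \<longlongrightarrow> 0) (at_left 0)"
      by (rule tendsto_eventually) (auto simp: flat_exp_def eventually_at_left_field intro!: exI[of _ "-1"])
    ultimately have "((\<lambda>h. flat_exp p h / h) \<longlongrightarrow> 0) (at 0)"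
      using filterlim_at_split by blast
    then show ?thesis using 3 unfolding DERIV_def by (simp add: flat_exp_def)
  qed
qed

lemma smooth_on_flat_exp:
  assumes "open S" "smooth_on S u"
  shows "smooth_on S (\<lambda>w. flat_exp 1 (u w))"
  by (rule smooth_on_compose[where \<Phi>="range flat_exp", OF assms]) (auto intro: flat_exp_derivative)

lemma flat_exp_nonneg: "flat_exp 1 t \<ge> 0"
  by (auto simp: flat_exp_def)

lemma flat_exp_eq_0_iff: "flat_exp 1 t = 0 \<longleftrightarrow> t \<le> 0"
  by (auto simp: flat_exp_def)

subsection \<open>Charts\<close>

lemma chart_inv_left: "is_chart c \<Longrightarrow> x \<in> fst c \<Longrightarrow> chart_inv c (snd c x) = x"
  and chart_inv_right: "w \<in> snd c ` fst c \<Longrightarrow> snd c (chart_inv c w) = w"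
  and chart_inv_mem: "w \<in> snd c ` fst c \<Longrightarrow> chart_inv c w \<in> fst c"
  by (auto simp: is_chart_def homeomorphism_def chart_inv_def f_inv_into_f inv_into_into)

lemma chart_image_eq:
  "is_chart c \<Longrightarrow> snd c ` (fst c \<inter> U) = snd c ` fst c \<inter> chart_inv c -` U"
  by (auto simp: chart_inv_left)

lemma chart_image_open:
  assumes "is_chart c" "open U"
  shows "open (snd c ` (fst c \<inter> U))"
proof -
  have "continuous_on (snd c ` fst c) (chart_inv c)" "open (snd c ` fst c)"
    using assms(1) unfolding is_chart_def homeomorphism_def by auto
  then show ?thesis
    unfolding chart_image_eq[OF assms(1)] using continuous_open_preimage[OF _ _ assms(2)] by blast
qed

lemma chart_continuous:
  assumes "is_chart c"
  shows "continuous_on (fst c) (snd c)" "continuous_on (snd c ` fst c) (chart_inv c)"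
    "open (fst c)" "open (snd c ` fst c)"
  using assms unfolding is_chart_def homeomorphism_def by auto

lemma atlas_chart: "compact_riemann_surface At \<Longrightarrow> c \<in> At \<Longrightarrow> is_chart c"
  unfolding compact_riemann_surface_def by blast

lemma transition_holomorphic:
  assumes "compact_riemann_surface At" "c \<in> At" "c' \<in> At"
  shows "(snd c' \<circ> chart_inv c) holomorphic_on (snd c ` (fst c \<inter> fst c'))"
  using assms unfolding compact_riemann_surface_def compatible_def by blast

subsection \<open>Bump functions in charts\<close>

definition chart_bump :: "'x chart \<Rightarrow> complex \<Rightarrow> real \<Rightarrow> 'x \<Rightarrow> real" where
  "chart_bump c z0 r y = (if y \<in> fst c then flat_exp 1 (r\<^sup>2 - ((Re (snd c y - z0))\<^sup>2 + (Im (snd c y - z0))\<^sup>2)) else 0)"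

lemma chart_bump_nonneg: "chart_bump c z0 r y \<ge> 0"
  unfolding chart_bump_def by (simp add: flat_exp_nonneg)

lemma chart_bump_nonzero_iff:
  assumes "r > 0"
  shows "chart_bump c z0 r y \<noteq> 0 \<longleftrightarrow> y \<in> fst c \<and> snd c y \<in> ball z0 r"
proof -
  have "(Re (snd c y - z0))\<^sup>2 + (Im (snd c y - z0))\<^sup>2 < r\<^sup>2 \<longleftrightarrow> dist z0 (snd c y) < r"
    using assms unfolding cmod_power2[symmetric] dist_norm norm_minus_commute[of z0]
    by (auto intro: power_strict_mono power_less_imp_less_base)
  then show ?thesis unfolding chart_bump_def by (auto simp: flat_exp_eq_0_iff)
qed

text \<open>
  The closed disc is mapped to a compact, hence closed subset of the surface, outside of which the
  bump function is zero; this settles the points that are not in the chart.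
\<close>

lemma chart_bump_smooth:
  assumes At: "compact_riemann_surface At" and c: "c \<in> At" and r: "r > 0" and K: "cball z0 r \<subseteq> snd c ` fst c"
  shows "surf_smooth_on At UNIV (chart_bump c z0 r)"
  unfolding surf_smooth_on_def
proof
  fix c' assume c': "c' \<in> At"
  note ch = atlas_chart[OF At c] and ch' = atlas_chart[OF At c']
  have clK: "closed (chart_inv c ` cball z0 r)"
    by (intro compact_imp_closed compact_continuous_image compact_cball
        continuous_on_subset[OF chart_continuous(2)[OF ch] K])
  show "smooth_on (snd c' ` (fst c' \<inter> UNIV)) (chart_bump c z0 r \<circ> chart_inv c')"
  proof (rule smooth_on_local)
    show "open (snd c' ` (fst c' \<inter> UNIV))" using chart_image_open[OF ch'] by blast
    fix w assume "w \<in> snd c' ` (fst c' \<inter> UNIV)"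
    then have w: "w \<in> snd c' ` fst c'" by auto
    show "\<exists>T. open T \<and> w \<in> T \<and> smooth_on T (chart_bump c z0 r \<circ> chart_inv c')"
    proof (cases "chart_inv c' w \<in> fst c")
      case True
      let ?T = "snd c' ` (fst c' \<inter> fst c)"
      have T: "open ?T" "w \<in> ?T"
        using chart_image_open[OF ch' chart_continuous(3)[OF ch]] True w chart_image_eq[OF ch'] by auto
      let ?h = "\<lambda>w. (snd c \<circ> chart_inv c') w - z0"
      have h: "smooth_on ?T ?h"
        by (intro smooth_on_holomorphic[OF T(1)] holomorphic_on_diff holomorphic_on_const
            transition_holomorphic[OF At c' c])
      have re: "smooth_on ?T (\<lambda>w. Re (?h w))" "smooth_on ?T (\<lambda>w. Im (?h w))"
        by (rule smooth_on_linear[OF T(1) bounded_linear_Re h], rule smooth_on_linear[OF T(1) bounded_linear_Im h])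
      have "smooth_on ?T (\<lambda>w. flat_exp 1 (r\<^sup>2 - ((Re (?h w))\<^sup>2 + (Im (?h w))\<^sup>2)))"
        unfolding power2_eq_square
        by (intro smooth_on_flat_exp smooth_on_diff smooth_on_add smooth_on_const smooth_on_mult T re)
      then have "smooth_on ?T (chart_bump c z0 r \<circ> chart_inv c')"
        by (rule smooth_on_cong[OF T(1), rotated]) (auto simp: chart_bump_def chart_inv_left[OF ch'])
      then show ?thesis using T by blast
    next
      case False
      let ?T = "snd c' ` (fst c' \<inter> - (chart_inv c ` cball z0 r))"
      have "chart_inv c ` cball z0 r \<subseteq> fst c" using K chart_inv_mem by blast
      then have T: "open ?T" "w \<in> ?T"
        using chart_image_open[OF ch' open_Compl[OF clK]] False w
        unfolding chart_image_eq[OF ch'] by auto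
      have "chart_bump c z0 r y = 0" if "y \<notin> chart_inv c ` cball z0 r" for y
      proof (rule ccontr)
        assume "chart_bump c z0 r y \<noteq> 0"
        then have "y \<in> fst c" "snd c y \<in> cball z0 r" unfolding chart_bump_nonzero_iff[OF r] by auto
        then show False using that chart_inv_left[OF ch] by (metis image_eqI)
      qed
      then have "smooth_on ?T (chart_bump c z0 r \<circ> chart_inv c')"
        by (intro smooth_on_cong[OF T(1) _ smooth_on_const[OF T(1), of 0]]) (auto simp: chart_inv_left[OF ch'])
      then show ?thesis using T by blast
    qed
  qed
qed

text \<open>
  Bump functions supported in the prescribed neighbourhoods are positive on open sets which cover the
  surface; finitely many suffice by compactness, and are divided by their sum.
\<close>

lemma partition_of_unity_exists:
  fixes At :: "'x::t2_space chart set"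
  assumes At: "compact_riemann_surface At"
    and c: "\<And>x. c x \<in> At" and N: "\<And>x. open (N x)" "\<And>x. x \<in> N x" "\<And>x. N x \<subseteq> fst (c x)"
  obtains n c' \<rho> where "partition_of_unity At n c' \<rho>"
    "\<And>i. i < n \<Longrightarrow> \<exists>x. c' i = c x \<and> closure {y. \<rho> i y \<noteq> 0} \<subseteq> N x"
proof -
  have ch: "is_chart (c x)" for x using atlas_chart[OF At c] .
  have "\<exists>r>0. cball (snd (c x) x) r \<subseteq> snd (c x) ` N x" for x
  proof -
    have "open (snd (c x) ` (fst (c x) \<inter> N x))" by (rule chart_image_open[OF ch N(1)])
    moreover have "fst (c x) \<inter> N x = N x" using N(3) by blast
    ultimately show ?thesis using N(2) open_contains_cball by (metis image_eqI)
  qed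
  then obtain r where r: "\<And>x. r x > 0" "\<And>x. cball (snd (c x) x) (r x) \<subseteq> snd (c x) ` N x" by metis
  define b where "b x = chart_bump (c x) (snd (c x) x) (r x)" for x
  define K where "K x = chart_inv (c x) ` cball (snd (c x) x) (r x)" for x
  have sub: "cball (snd (c x) x) (r x) \<subseteq> snd (c x) ` fst (c x)" for x using r(2) N(3) by blast
  have bs: "surf_smooth_on At UNIV (b x)" for x
    unfolding b_def by (rule chart_bump_smooth[OF At c r(1) sub])
  have K: "closed (K x)" for x unfolding K_def
    by (intro compact_imp_closed compact_continuous_image compact_cball
        continuous_on_subset[OF chart_continuous(2)[OF ch] sub])
  have KN: "K x \<subseteq> N x" for x
  proof
    fix y assume "y \<in> K x"
    then obtain w where w: "w \<in> cball (snd (c x) x) (r x)" "y = chart_inv (c x) w" unfolding K_def by blast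
    then obtain v where "v \<in> N x" "w = snd (c x) v" using r(2) by blast
    then show "y \<in> N x" using w chart_inv_left[OF ch[of x], of v] N(3)[of x] by auto
  qed
  have nz: "b x y \<noteq> 0 \<longleftrightarrow> y \<in> fst (c x) \<and> snd (c x) y \<in> ball (snd (c x) x) (r x)" for x y
    unfolding b_def by (rule chart_bump_nonzero_iff[OF r(1)])
  have bK: "{y. b x y \<noteq> 0} \<subseteq> K x" for x
  proof
    fix y assume "y \<in> {y. b x y \<noteq> 0}"
    then have y: "y \<in> fst (c x)" "snd (c x) y \<in> cball (snd (c x) x) (r x)" using nz by auto
    then show "y \<in> K x" unfolding K_def using chart_inv_left[OF ch y(1)] by (metis image_eqI)
  qed
  have op: "open {y. b x y \<noteq> 0}" for x
  proof -
    have "{y. b x y \<noteq> 0} = fst (c x) \<inter> snd (c x) -` ball (snd (c x) x) (r x)" using nz by auto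
    then show ?thesis using continuous_open_preimage[OF chart_continuous(1,3)[OF ch]] open_ball by metis
  qed
  have "x \<in> {y. b x y \<noteq> 0}" for x using nz[of x x] N(2,3) r(1) by auto
  then have "\<forall>C\<in>range (\<lambda>x. {y. b x y \<noteq> 0}). open C" "UNIV \<subseteq> \<Union> (range (\<lambda>x. {y. b x y \<noteq> 0}))"
    using op by blast+
  moreover have "compact (UNIV :: 'x set)" using At unfolding compact_riemann_surface_def by blast
  ultimately obtain \<C> where \<C>: "\<C> \<subseteq> range (\<lambda>x. {y. b x y \<noteq> 0})" "finite \<C>" "UNIV \<subseteq> \<Union>\<C>"
    using compactE by metis
  then obtain X where X: "finite X" "\<C> = (\<lambda>x. {y. b x y \<noteq> 0}) ` X" by (meson finite_subset_image)
  obtain e where e: "bij_betw e {0..<card X} X" using ex_bij_betw_nat_finite[OF X(1)] by blast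
  define s where "s y = (\<Sum>x\<in>X. b x y)" for y
  have bnn: "b x y \<ge> 0" for x y unfolding b_def by (rule chart_bump_nonneg)
  have s: "s y > 0" for y
  proof -
    obtain x where "x \<in> X" "b x y \<noteq> 0" using \<C>(3) X(2) by blast
    then show ?thesis unfolding s_def using bnn by (intro sum_pos2[OF X(1)]) (auto simp: less_le)
  qed
  define \<rho> where "\<rho> i y = b (e i) y * inverse (s y)" for i y
  have supp: "{y. \<rho> i y \<noteq> 0} = {y. b (e i) y \<noteq> 0}" for i
    unfolding \<rho>_def using s by (auto simp: less_imp_neq[symmetric])
  have cl: "closure {y. \<rho> i y \<noteq> 0} \<subseteq> N (e i)" for i
    unfolding supp using closure_minimal[OF bK K] KN by blast
  have cl': "closure {y. \<rho> i y \<noteq> 0} \<subseteq> fst (c (e i))" for i using cl N(3) by blast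
  have \<rho>nn: "0 \<le> \<rho> i y" for i y
    unfolding \<rho>_def using bnn s[of y] by (intro mult_nonneg_nonneg) (auto simp: less_imp_le)
  have "surf_smooth_on At UNIV (\<rho> i)" for i
    unfolding surf_smooth_on_def
  proof
    fix c' assume c': "c' \<in> At"
    let ?S = "snd c' ` (fst c' \<inter> UNIV)"
    have S: "open ?S" using chart_image_open[OF atlas_chart[OF At c']] by blast
    have bs': "smooth_on ?S (\<lambda>w. b x (chart_inv c' w))" for x
      using bs c' unfolding surf_smooth_on_def o_def by blast
    show "smooth_on ?S (\<rho> i \<circ> chart_inv c')"
      unfolding \<rho>_def s_def o_def
      using s unfolding s_def
      by (intro smooth_on_mult[OF S bs'] smooth_on_inverse[OF S] smooth_on_sum[OF S] bs') (metis less_irrefl)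
  qed
  moreover have "(\<Sum>i<card X. \<rho> i x) = 1" for x
  proof -
    have "(\<Sum>i<card X. \<rho> i x) = (\<Sum>i\<in>{0..<card X}. b (e i) x) * inverse (s x)"
      unfolding \<rho>_def sum_distrib_right atLeast0LessThan ..
    also have "(\<Sum>i\<in>{0..<card X}. b (e i) x) = s x"
      unfolding s_def by (rule sum.reindex_bij_betw[OF e])
    finally show ?thesis using s[of x] by simp
  qed
  ultimately have "partition_of_unity At (card X) (\<lambda>i. c (e i)) \<rho>"
    unfolding partition_of_unity_def using c cl' \<rho>nn by simp
  then show ?thesis using that cl by blast
qed

section \<open>Integration over the complex plane\<close>

lemma borel_measurable_complex_pair [measurable]:
  "(\<lambda>p. Complex (fst p) (snd p)) \<in> borel_measurable (borel \<Otimes>\<^sub>M borel)"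
proof -
  have "continuous_on UNIV (\<lambda>p. Complex (fst p) (snd p))"
    unfolding Complex_eq by (intro continuous_intros)
  then show ?thesis unfolding borel_prod by (rule borel_measurable_continuous_onI)
qed

lemma Basis_complex_le:
  assumes "\<And>b::complex. b \<in> Basis \<Longrightarrow> l \<bullet> b \<le> u \<bullet> b"
  shows "Re l \<le> Re u \<and> Im l \<le> Im u"
  using assms[of 1] assms[of \<i>] by (simp add: Basis_complex_def)

lemma lborel_complex_eq_pair:
  "(lborel :: complex measure) = distr (lborel \<Otimes>\<^sub>M lborel) borel (\<lambda>p. Complex (fst p) (snd p))"
proof (rule lborel_eqI)
  fix l u :: complex assume "\<And>b. b \<in> Basis \<Longrightarrow> l \<bullet> b \<le> u \<bullet> b"
  then have le: "Re l \<le> Re u" "Im l \<le> Im u" using Basis_complex_le by auto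
  have "(\<lambda>p. Complex (fst p) (snd p)) -` box l u \<inter> space (lborel \<Otimes>\<^sub>M lborel)
      = box (Re l) (Re u) \<times> box (Im l) (Im u)"
    by (auto simp: box_def Basis_complex_def space_pair_measure)
  then have "emeasure (distr (lborel \<Otimes>\<^sub>M lborel) borel (\<lambda>p. Complex (fst p) (snd p))) (box l u)
      = emeasure (lborel \<Otimes>\<^sub>M lborel) (box (Re l) (Re u) \<times> box (Im l) (Im u))"
    by (subst emeasure_distr) auto
  also have "\<dots> = ennreal (Re u - Re l) * ennreal (Im u - Im l)"
    by (subst lborel.emeasure_pair_measure_Times) (use le in \<open>auto simp: box_real\<close>)
  also have "\<dots> = ennreal (\<Prod>b\<in>Basis. (u - l) \<bullet> b)"
    using le by (simp add: Basis_complex_def ennreal_mult)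
  finally show "emeasure (distr (lborel \<Otimes>\<^sub>M lborel) borel (\<lambda>p. Complex (fst p) (snd p))) (box l u)
      = ennreal (\<Prod>b\<in>Basis. (u - l) \<bullet> b)" .
qed simp

lemma integrable_complex_pair:
  fixes f :: "complex \<Rightarrow> 'b::euclidean_space"
  assumes "integrable lborel f"
  shows "integrable (lborel \<Otimes>\<^sub>M lborel) (\<lambda>(x, y). f (Complex x y))"
    and "integral\<^sup>L (lborel \<Otimes>\<^sub>M lborel) (\<lambda>(x, y). f (Complex x y)) = integral\<^sup>L lborel f"
proof -
  have f: "f \<in> borel_measurable borel" using borel_measurable_integrable[OF assms] by simp
  have m: "(\<lambda>p. Complex (fst p) (snd p)) \<in> measurable (lborel \<Otimes>\<^sub>M lborel) borel" by measurable
  show "integrable (lborel \<Otimes>\<^sub>M lborel) (\<lambda>(x, y). f (Complex x y))"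
    using assms unfolding lborel_complex_eq_pair integrable_distr_eq[OF m f] by (simp add: split_def)
  show "integral\<^sup>L (lborel \<Otimes>\<^sub>M lborel) (\<lambda>(x, y). f (Complex x y)) = integral\<^sup>L lborel f"
    unfolding lborel_complex_eq_pair integral_distr[OF m f] by (simp add: split_def)
qed

lemma integral_derivative_compact_support:
  fixes g :: "real \<Rightarrow> 'b::euclidean_space"
  assumes g: "\<And>t. (g has_vector_derivative g' t) (at t)" and R: "\<And>t. \<bar>t\<bar> > R \<Longrightarrow> g t = 0"
  shows "integral\<^sup>L lborel g' = 0"
\<comment> \<open>A function that is not integrable has integral 0 by convention.\<close>
proof (cases "integrable lborel g'")
  case True
  define r where "r = \<bar>R\<bar> + 1"
  have g'0: "g' t = 0" if "\<bar>t\<bar> > R" for t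
  proof (rule vector_derivative_unique_at[OF g])
    have "open {t. \<bar>t\<bar> > R}" by (intro open_Collect_less continuous_intros)
    then show "(g has_vector_derivative 0) (at t)"
      using has_vector_derivative_transform_within_open[OF has_vector_derivative_const, of "{t. \<bar>t\<bar> > R}" t 0 g] that R
      by auto
  qed
  have "(g' has_integral (g r - g (- r))) {- r..r}"
    by (rule fundamental_theorem_of_calculus)
      (auto simp: r_def intro: has_vector_derivative_at_within g)
  moreover have "g r = 0" "g (- r) = 0" using R by (auto simp: r_def)
  ultimately have "(g' has_integral 0) {- r..r}" by simp
  then have "(g' has_integral 0) UNIV"
    by (rule has_integral_on_superset) (auto simp: r_def intro!: g'0)
  moreover have "(g' has_integral integral\<^sup>L lborel g') UNIV"
    using True by (rule has_integral_integral_lborel)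
  ultimately show ?thesis by (rule has_integral_unique[symmetric])
qed (rule not_integrable_integral_eq)

text \<open>
  The function may be singular at finitely many points. Almost every horizontal and vertical line
  avoids them, so that integrability of the derivative is enough.
\<close>

lemma integral_partials_compact_support:
  fixes u :: "complex \<Rightarrow> 'b::euclidean_space"
  assumes u: "has_partials (- F) u u1 u2" and F: "finite F" and R: "\<And>w. norm w > R \<Longrightarrow> u w = 0"
  shows "integrable lborel u1 \<Longrightarrow> integral\<^sup>L lborel u1 = 0"
    and "integrable lborel u2 \<Longrightarrow> integral\<^sup>L lborel u2 = 0"
proof -
  have big: "norm (Complex x y) > R" if "\<bar>x\<bar> > R \<or> \<bar>y\<bar> > R" for x y
    using that abs_Re_le_cmod[of "Complex x y"] abs_Im_le_cmod[of "Complex x y"] by auto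
  have AE: "AE y in lborel. y \<notin> f ` F" for f :: "complex \<Rightarrow> real"
    using F by (intro AE_not_in finite_imp_null_set_lborel) auto
  {
    assume i: "integrable lborel u1"
    have "(LINT x|lborel. u1 (Complex x y)) = 0" if "y \<notin> Im ` F" for y
    proof (rule integral_derivative_compact_support)
      fix t
      have "Complex t y \<in> - F" using that by force
      from has_partials_lines(1)[OF u this]
      show "((\<lambda>t. u (Complex t y)) has_vector_derivative u1 (Complex t y)) (at t)" .
    qed (use R big in auto)
    then have "(LINT y|lborel. LINT x|lborel. u1 (Complex x y)) = 0"
      using AE[of Im] by (intro integral_eq_zero_AE) (auto elim!: eventually_mono)
    then show "integral\<^sup>L lborel u1 = 0"
      using lborel_pair.integral_snd[OF integrable_complex_pair(1)[OF i]] integrable_complex_pair(2)[OF i]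
      by simp
  }
  {
    assume i: "integrable lborel u2"
    have "(LINT y|lborel. u2 (Complex x y)) = 0" if "x \<notin> Re ` F" for x
    proof (rule integral_derivative_compact_support)
      fix t
      have "Complex x t \<in> - F" using that by force
      from has_partials_lines(2)[OF u this]
      show "((\<lambda>t. u (Complex x t)) has_vector_derivative u2 (Complex x t)) (at t)" .
    qed (use R big in auto)
    then have "(LINT x|lborel. LINT y|lborel. u2 (Complex x y)) = 0"
      using AE[of Re] by (intro integral_eq_zero_AE) (auto elim!: eventually_mono)
    then show "integral\<^sup>L lborel u2 = 0"
      using lborel_pair.integral_fst[OF integrable_complex_pair(1)[OF i]] integrable_complex_pair(2)[OF i]
      by simp
  }
qed

lemma nn_integral_inverse_sqrt_finite:
  "(\<integral>\<^sup>+x. ennreal (indicator {-r..r} x * \<bar>x\<bar> powr (-1/2)) \<partial>lborel) < \<infinity>" if "r \<ge> 0" for r :: real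
proof -
  have 1: "(\<lambda>x. \<bar>x\<bar> powr (-1/2)) integrable_on {0..r}"
    using integrable_on_powr_from_0[of "-1/2" r] that
    by (auto intro: integrable_eq[where f="\<lambda>x. x powr (-1/2)"])
  then have 2: "(\<lambda>x. \<bar>x\<bar> powr (-1/2)) integrable_on {-r..0}"
    using Henstock_Kurzweil_Integration.integrable_reflect_real[of "\<lambda>x. \<bar>x\<bar> powr (-1/2)" r 0] by simp
  have "(\<lambda>x. \<bar>x\<bar> powr (-1/2)) integrable_on {-r..r}"
    using Henstock_Kurzweil_Integration.integrable_combine[OF _ _ 2 1] that by simp
  then have "(\<lambda>x. \<bar>x\<bar> powr (-1/2)) absolutely_integrable_on {-r..r}"
    by (rule nonnegative_absolutely_integrable_1) auto
  then have "integrable lborel (\<lambda>x. indicator {-r..r} x *\<^sub>R \<bar>x\<bar> powr (-1/2))"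
    unfolding set_integrable_def by (subst (asm) integrable_completion) auto
  then have "(\<integral>\<^sup>+x. ennreal (norm (indicator {-r..r} x *\<^sub>R \<bar>x\<bar> powr (-1/2))) \<partial>lborel) < \<infinity>"
    unfolding integrable_iff_bounded by blast
  then show ?thesis by (simp add: abs_mult)
qed

text \<open>
  A bound by a product replaces polar coordinates: \<open>|xy| \<le> x\<^sup>2 + y\<^sup>2\<close> gives
  \<open>1/|w| \<le> |x|\<^sup>-\<^sup>1\<^sup>/\<^sup>2 |y|\<^sup>-\<^sup>1\<^sup>/\<^sup>2\<close>, and both factors are integrable near zero.
\<close>

lemma inverse_norm_integrable:
  fixes r :: real
  assumes "r > 0"
  shows "set_integrable lborel (ball (0::complex) r) (\<lambda>w. inverse (norm w))"
proof -
  let ?h = "\<lambda>x. indicator {-r..r} x * \<bar>x\<bar> powr (-1/2) :: real"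
  have bd: "indicator (ball 0 r) (Complex x y) * inverse (norm (Complex x y)) \<le> ?h x * ?h y"
    if "x \<noteq> 0" "y \<noteq> 0" for x y
  proof (cases "Complex x y \<in> ball 0 r")
    case True
    have le: "\<bar>x\<bar> \<le> r" "\<bar>y\<bar> \<le> r"
      using abs_Re_le_cmod[of "Complex x y"] abs_Im_le_cmod[of "Complex x y"] True by auto
    have "\<bar>x\<bar> * \<bar>y\<bar> \<le> x\<^sup>2 + y\<^sup>2"
    proof -
      have "2 * (\<bar>x\<bar> * \<bar>y\<bar>) \<le> x\<^sup>2 + y\<^sup>2" using sum_squares_bound[of "\<bar>x\<bar>" "\<bar>y\<bar>"] by (simp add: mult.assoc)
      moreover have "0 \<le> \<bar>x\<bar> * \<bar>y\<bar>" by simp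
      ultimately show ?thesis by linarith
    qed
    then have "sqrt (\<bar>x\<bar> * \<bar>y\<bar>) \<le> norm (Complex x y)" by (simp add: cmod_def)
    then have "inverse (norm (Complex x y)) \<le> inverse (sqrt (\<bar>x\<bar> * \<bar>y\<bar>))"
      using that by (intro le_imp_inverse_le) auto
    also have "inverse (sqrt (\<bar>x\<bar> * \<bar>y\<bar>)) = \<bar>x\<bar> powr (-1/2) * \<bar>y\<bar> powr (-1/2)"
      using that by (simp add: powr_minus powr_half_sqrt real_sqrt_mult)
    finally show ?thesis using le True by (auto simp: indicator_def)
  qed (auto simp: indicator_def)
  have n: "(\<lambda>w::complex. inverse (norm w)) \<in> borel_measurable borel"
    by (intro borel_measurable_inverse borel_measurable_norm)
  have m: "(\<lambda>w::complex. indicator (ball 0 r) w *\<^sub>R inverse (norm w)) \<in> borel_measurable lborel"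
    using borel_measurable_scaleR[OF borel_measurable_indicator n, of "ball 0 r"] by simp
  have "(\<integral>\<^sup>+w. ennreal (norm (indicator (ball 0 r) w *\<^sub>R inverse (norm (w::complex)))) \<partial>lborel)
    = (\<integral>\<^sup>+w. ennreal (indicator (ball 0 r) w * inverse (norm (w::complex))) \<partial>lborel)"
    by (intro nn_integral_cong) (auto simp: indicator_def)
  also have "\<dots> = (\<integral>\<^sup>+p. ennreal (indicator (ball 0 r) (Complex (fst p) (snd p)) * inverse (norm (Complex (fst p) (snd p)))) \<partial>(lborel \<Otimes>\<^sub>M lborel))"
    unfolding lborel_complex_eq_pair using m by (subst nn_integral_distr) auto
  also have "\<dots> \<le> (\<integral>\<^sup>+p. ennreal (?h (fst p) * ?h (snd p)) \<partial>(lborel \<Otimes>\<^sub>M lborel))"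
  proof (rule nn_integral_mono_AE)
    have 0: "AE x::real in lborel. x \<noteq> 0" using AE_lborel_singleton[of 0] by simp
    have "AE p in lborel \<Otimes>\<^sub>M lborel. fst p \<noteq> (0::real) \<and> snd p \<noteq> (0::real)"
    proof (rule lborel_pair.AE_pair_measure)
      have "{p \<in> space (lborel \<Otimes>\<^sub>M lborel). fst p \<noteq> (0::real) \<and> snd p \<noteq> (0::real)} = (- {0}) \<times> (- {0})"
        by (auto simp: space_pair_measure)
      moreover have "\<dots> \<in> sets (lborel \<Otimes>\<^sub>M lborel)" by (intro pair_measureI) auto
      ultimately show "{p \<in> space (lborel \<Otimes>\<^sub>M lborel). fst p \<noteq> (0::real) \<and> snd p \<noteq> (0::real)}
          \<in> sets (lborel \<Otimes>\<^sub>M lborel)" by simp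
    qed (use 0 in \<open>auto elim!: eventually_mono\<close>)
    then show "AE p in lborel \<Otimes>\<^sub>M lborel. ennreal (indicator (ball 0 r) (Complex (fst p) (snd p)) * inverse (norm (Complex (fst p) (snd p))))
        \<le> ennreal (?h (fst p) * ?h (snd p))"
      by eventually_elim (intro ennreal_leI bd; simp)
  qed
  also have "\<dots> = (\<integral>\<^sup>+x. \<integral>\<^sup>+y. ennreal (?h x) * ennreal (?h y) \<partial>lborel \<partial>lborel)"
    by (subst lborel.nn_integral_fst[symmetric]) (auto simp: ennreal_mult)
  also have "\<dots> = (\<integral>\<^sup>+x. ennreal (?h x) \<partial>lborel) * (\<integral>\<^sup>+y. ennreal (?h y) \<partial>lborel)"
    by (simp add: nn_integral_cmult nn_integral_multc)
  also have "\<dots> < \<infinity>"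
    using nn_integral_inverse_sqrt_finite[of r] assms by (simp add: ennreal_mult_less_top)
  finally show ?thesis unfolding set_integrable_def integrable_iff_bounded using m by blast
qed

subsection \<open>Holomorphic changes of variables\<close>

text \<open>
  Identifying the plane with \<open>real^2\<close> turns the derivative of a holomorphic map into a matrix, whose
  determinant can be computed.
\<close>

definition complex_of_vec :: "real^2 \<Rightarrow> complex" where
  "complex_of_vec v = Complex (v $ 1) (v $ 2)"

definition vec_of_complex :: "complex \<Rightarrow> real^2" where
  "vec_of_complex w = vector [Re w, Im w]"

lemma complex_of_vec_inverse [simp]: "complex_of_vec (vec_of_complex w) = w"
  "vec_of_complex (complex_of_vec v) = v"
  by (auto simp: complex_of_vec_def vec_of_complex_def vec_eq_iff forall_2)

lemma bounded_linear_vec_of_complex: "bounded_linear vec_of_complex"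
  by (intro linear_conv_bounded_linear[THEN iffD1] linearI)
    (auto simp: vec_of_complex_def vec_eq_iff forall_2)

lemma bounded_linear_complex_of_vec: "bounded_linear complex_of_vec"
  by (intro linear_conv_bounded_linear[THEN iffD1] linearI)
    (auto simp: complex_of_vec_def complex_eq_iff)

lemma Basis_vec2: "(Basis :: (real^2) set) = {axis 1 1, axis 2 1}"
  by (auto simp: Basis_vec_def UNIV_2)

lemma lborel_complex_eq_vec: "(lborel :: complex measure) = distr lborel borel complex_of_vec"
proof (rule lborel_eqI)
  fix l u :: complex assume "\<And>b. b \<in> Basis \<Longrightarrow> l \<bullet> b \<le> u \<bullet> b"
  then have le: "Re l \<le> Re u" "Im l \<le> Im u" using Basis_complex_le by auto
  have m: "complex_of_vec \<in> borel_measurable borel"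
    by (intro borel_measurable_continuous_onI linear_continuous_on bounded_linear_complex_of_vec)
  have ax: "axis 1 1 \<noteq> (axis 2 1 :: real^2)" by (auto simp: axis_eq_axis)
  have "complex_of_vec -` box l u = box (vec_of_complex l) (vec_of_complex u)"
    by (auto simp: box_def Basis_complex_def Basis_vec2 complex_of_vec_def vec_of_complex_def inner_axis)
  then have "emeasure (distr lborel borel complex_of_vec) (box l u)
     = emeasure lborel (box (vec_of_complex l) (vec_of_complex u))"
    using m by (subst emeasure_distr) auto
  also have "\<dots> = ennreal (\<Prod>b\<in>Basis. (vec_of_complex u - vec_of_complex l) \<bullet> b)"
    by (rule emeasure_lborel_box) (use le in \<open>auto simp: Basis_vec2 inner_axis vec_of_complex_def\<close>)
  also have "\<dots> = ennreal (\<Prod>b\<in>Basis. (u - l) \<bullet> b)"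
    using ax by (simp add: Basis_complex_def Basis_vec2 inner_axis vec_of_complex_def)
  finally show "emeasure (distr lborel borel complex_of_vec) (box l u) = ennreal (\<Prod>b\<in>Basis. (u - l) \<bullet> b)" .
qed simp

lemma measurable_complex_of_vec [measurable]: "complex_of_vec \<in> borel_measurable borel"
  by (intro borel_measurable_continuous_onI linear_continuous_on bounded_linear_complex_of_vec)

lemma measurable_vec_of_complex [measurable]: "vec_of_complex \<in> borel_measurable borel"
  by (intro borel_measurable_continuous_onI linear_continuous_on bounded_linear_vec_of_complex)

lemma absolutely_integrable_vec_iff:
  fixes f :: "complex \<Rightarrow> complex"
  assumes m: "(\<lambda>w. indicator A w *\<^sub>R f w) \<in> borel_measurable borel"
  shows "(\<lambda>v. vec_of_complex (f (complex_of_vec v))) absolutely_integrable_on (vec_of_complex ` A)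
     \<longleftrightarrow> set_integrable lborel A f"
    and "set_integrable lborel A f \<Longrightarrow>
       complex_of_vec (integral (vec_of_complex ` A) (\<lambda>v. vec_of_complex (f (complex_of_vec v))))
         = set_lebesgue_integral lborel A f"
proof -
  have ind: "indicator (vec_of_complex ` A) v = (indicator A (complex_of_vec v) :: real)" for v
    by (auto simp: indicator_def image_iff) (metis complex_of_vec_inverse(2))
  let ?g = "\<lambda>v. vec_of_complex (indicator A (complex_of_vec v) *\<^sub>R f (complex_of_vec v))"
  have geq: "indicator (vec_of_complex ` A) v *\<^sub>R vec_of_complex (f (complex_of_vec v)) = ?g v" for v
    unfolding ind using linear_cmul[OF bounded_linear.linear[OF bounded_linear_vec_of_complex]] by metis
  have m2: "(\<lambda>v. indicator A (complex_of_vec v) *\<^sub>R f (complex_of_vec v)) \<in> borel_measurable borel"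
    using measurable_compose[OF measurable_complex_of_vec m] .
  have m3: "?g \<in> borel_measurable lborel"
    using measurable_compose[OF m2 measurable_vec_of_complex] by simp
  have i: "integrable lborel ?g \<longleftrightarrow> set_integrable lborel A f"
  proof -
    have "set_integrable lborel A f \<longleftrightarrow> integrable lborel (\<lambda>v. indicator A (complex_of_vec v) *\<^sub>R f (complex_of_vec v))"
      unfolding set_integrable_def lborel_complex_eq_vec using m
      by (subst integrable_distr_eq) auto
    also have "\<dots> \<longleftrightarrow> integrable lborel ?g"
      using integrable_bounded_linear[OF bounded_linear_vec_of_complex, of lborel "\<lambda>v. indicator A (complex_of_vec v) *\<^sub>R f (complex_of_vec v)"]
        integrable_bounded_linear[OF bounded_linear_complex_of_vec, of lborel ?g] by auto
    finally show ?thesis by simp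
  qed
  show iff: "(\<lambda>v. vec_of_complex (f (complex_of_vec v))) absolutely_integrable_on (vec_of_complex ` A)
     \<longleftrightarrow> set_integrable lborel A f"
    unfolding set_integrable_def geq i[unfolded set_integrable_def, symmetric] using integrable_completion[OF m3] .
  assume s: "set_integrable lborel A f"
  have "integral (vec_of_complex ` A) (\<lambda>v. vec_of_complex (f (complex_of_vec v)))
     = set_lebesgue_integral lebesgue (vec_of_complex ` A) (\<lambda>v. vec_of_complex (f (complex_of_vec v)))"
    using set_lebesgue_integral_eq_integral(2) iff s by metis
  also have "\<dots> = integral\<^sup>L lborel ?g"
    unfolding set_lebesgue_integral_def geq by (rule integral_completion[OF m3])
  finally have "complex_of_vec (integral (vec_of_complex ` A) (\<lambda>v. vec_of_complex (f (complex_of_vec v))))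
     = integral\<^sup>L lborel (\<lambda>v. complex_of_vec (?g v))"
    using i s integral_bounded_linear[OF bounded_linear_complex_of_vec, of lborel ?g] by simp
  also have "\<dots> = set_lebesgue_integral lborel A f"
    unfolding set_lebesgue_integral_def lborel_complex_eq_vec using m by (subst integral_distr) auto
  finally show "complex_of_vec (integral (vec_of_complex ` A) (\<lambda>v. vec_of_complex (f (complex_of_vec v))))
         = set_lebesgue_integral lborel A f" .
qed

text \<open>
  By the Cauchy--Riemann equations the real Jacobian determinant of \<open>T\<close> is \<open>|T'|\<^sup>2\<close>.
\<close>

lemma holomorphic_change_of_variables:
  fixes f T :: "complex \<Rightarrow> complex"
  assumes S: "open S" and T: "T holomorphic_on S" and inj: "inj_on T S"
    and f: "set_integrable lborel (T ` S) f"
  shows "set_integrable lborel S (\<lambda>w. (cmod (deriv T w))\<^sup>2 * f (T w))"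
    and "set_lebesgue_integral lborel S (\<lambda>w. (cmod (deriv T w))\<^sup>2 * f (T w)) = set_lebesgue_integral lborel (T ` S) f"
proof -
  let ?g = "\<lambda>v. vec_of_complex (T (complex_of_vec v))"
  let ?g' = "\<lambda>v h. vec_of_complex (deriv T (complex_of_vec v) * complex_of_vec h)"
  let ?F = "\<lambda>v. vec_of_complex (f (complex_of_vec v))"
  let ?k = "\<lambda>w. complex_of_real ((cmod (deriv T w))\<^sup>2) * f (T w)"
  have vS: "open (vec_of_complex ` S)"
  proof -
    have "vec_of_complex ` S = complex_of_vec -` S" by (auto simp: image_iff) (metis complex_of_vec_inverse(2))
    then show ?thesis using S
      by (metis continuous_open_vimage bounded_linear_complex_of_vec linear_continuous_at)
  qed
  have mf: "(\<lambda>w. indicator (T ` S) w *\<^sub>R f w) \<in> borel_measurable borel"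
    using f borel_measurable_integrable unfolding set_integrable_def by fastforce
  \<comment> \<open>Nothing is known about \<open>T\<close> outside \<open>S\<close>, so it is cut off before composing.\<close>
  have mk: "(\<lambda>w. indicator S w *\<^sub>R ?k w) \<in> borel_measurable borel"
  proof -
    have 1: "(\<lambda>w. indicator S w *\<^sub>R T w) \<in> borel_measurable borel"
      using S T by (intro borel_measurable_continuous_on_indicator holomorphic_on_imp_continuous_on) auto
    have 2: "(\<lambda>w. indicator S w *\<^sub>R deriv T w) \<in> borel_measurable borel"
      using S T by (intro borel_measurable_continuous_on_indicator holomorphic_on_imp_continuous_on holomorphic_deriv) auto
    have "(\<lambda>w. indicator S w *\<^sub>R ?k w) = (\<lambda>w. indicator S w *\<^sub>R (complex_of_real ((cmod (indicator S w *\<^sub>R deriv T w))\<^sup>2) * (indicator (T ` S) (indicator S w *\<^sub>R T w) *\<^sub>R f (indicator S w *\<^sub>R T w))))"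
      by (auto simp: indicator_def fun_eq_iff)
    moreover have "\<dots> \<in> borel_measurable borel"
    proof (rule borel_measurable_scaleR[OF borel_measurable_indicator borel_measurable_times])
      show "(\<lambda>w. complex_of_real ((cmod (indicator S w *\<^sub>R deriv T w))\<^sup>2)) \<in> borel_measurable borel"
        by (rule borel_measurable_continuous_on[where f="\<lambda>z. complex_of_real ((cmod z)\<^sup>2)", OF _ 2])
          (intro continuous_intros)
    qed (use S measurable_compose[OF 1 mf] in auto)
    ultimately show ?thesis by simp
  qed
  have der: "(?g has_derivative ?g' v) (at v within vec_of_complex ` S)" if "v \<in> vec_of_complex ` S" for v
  proof -
    have "complex_of_vec v \<in> S" using that by auto
    then have "(T has_derivative (\<lambda>h. deriv T (complex_of_vec v) * h)) (at (complex_of_vec v))"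
      using holomorphic_derivI[OF T S] unfolding has_field_derivative_def by blast
    from bounded_linear.has_derivative[OF bounded_linear_vec_of_complex
        has_derivative_compose[OF bounded_linear_imp_has_derivative[OF bounded_linear_complex_of_vec] this]]
    show ?thesis by (rule has_derivative_at_withinI)
  qed
  have inj': "inj_on ?g (vec_of_complex ` S)"
    using inj unfolding inj_on_def by (auto) (metis complex_of_vec_inverse(1))
  have img: "?g ` (vec_of_complex ` S) = vec_of_complex ` T ` S" by (auto simp: image_image)
  have det: "\<bar>det (matrix (?g' v))\<bar> = (cmod (deriv T (complex_of_vec v)))\<^sup>2" for v
    unfolding det_2 cmod_power2
    by (simp add: matrix_def vec_of_complex_def complex_of_vec_def axis_def power2_eq_square)
  have Feq: "\<bar>det (matrix (?g' v))\<bar> *\<^sub>R ?F (?g v) = vec_of_complex (?k (complex_of_vec v))" for v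
    unfolding det
    using linear_cmul[OF bounded_linear.linear[OF bounded_linear_vec_of_complex]]
    by (metis complex_of_vec_inverse(1) scaleR_conv_of_real)
  have F: "?F absolutely_integrable_on (?g ` (vec_of_complex ` S))"
    unfolding img using absolutely_integrable_vec_iff(1)[OF mf] f by blast
  have sets: "vec_of_complex ` S \<in> sets lebesgue" using vS by auto
  have "(\<lambda>v. vec_of_complex (?k (complex_of_vec v))) absolutely_integrable_on (vec_of_complex ` S)
      \<and> integral (vec_of_complex ` S) (\<lambda>v. vec_of_complex (?k (complex_of_vec v))) = integral (?g ` (vec_of_complex ` S)) ?F"
    using has_absolute_integral_change_of_variables[OF sets der inj', of ?F] F unfolding Feq by blast
  then show "set_integrable lborel S ?k" "set_lebesgue_integral lborel S ?k = set_lebesgue_integral lborel (T ` S) f"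
    using absolutely_integrable_vec_iff[OF mk] absolutely_integrable_vec_iff(2)[OF mf f] unfolding img by auto
qed

section \<open>Integrals of two-forms on a compact Riemann surface\<close>

text \<open>
  The coefficients of \<open>dz \<and> d\<close>\<open>z\<close>-bar in all charts, whence the factor \<open>|jac|\<^sup>2\<close>. Integrability in one chart
  around each point is enough, since it passes to every other chart by a change of variables.
\<close>

definition two_form :: "'x::topological_space chart set \<Rightarrow> ('x chart \<Rightarrow> 'x \<Rightarrow> complex) \<Rightarrow> bool" where
  "two_form At \<Theta> \<longleftrightarrow>
     (\<forall>c\<in>At. \<forall>c'\<in>At. \<forall>x\<in>fst c \<inter> fst c'. \<Theta> c' x = of_real ((cmod (jac c c' x))\<^sup>2) * \<Theta> c x) \<and>
     (\<forall>x. \<exists>c\<in>At. \<exists>N. open N \<and> x \<in> N \<and> N \<subseteq> fst c \<and> set_integrable lborel (snd c ` N) (\<Theta> c \<circ> chart_inv c))"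

lemma set_integral_eq_if_zero_outside:
  assumes "\<And>w. w \<in> A - B \<Longrightarrow> f w = 0" "\<And>w. w \<in> B - A \<Longrightarrow> f w = 0"
  shows "set_integrable M A f \<longleftrightarrow> set_integrable M B f"
    "set_lebesgue_integral M A f = set_lebesgue_integral M B f"
proof -
  have "(\<lambda>w. indicator A w *\<^sub>R f w) = (\<lambda>w. indicator B w *\<^sub>R f w)"
    using assms by (auto simp: fun_eq_iff indicator_def)
  then show "set_integrable M A f \<longleftrightarrow> set_integrable M B f"
    "set_lebesgue_integral M A f = set_lebesgue_integral M B f"
    unfolding set_integrable_def set_lebesgue_integral_def by simp_all
qed

lemma set_integral_support:
  assumes "B \<subseteq> A" "\<And>w. w \<in> A - B \<Longrightarrow> f w = 0"
  shows "set_integrable M A f \<longleftrightarrow> set_integrable M B f"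
    "set_lebesgue_integral M A f = set_lebesgue_integral M B f"
  by (rule set_integral_eq_if_zero_outside[of A B f]; use assms in blast)+

lemma transition_deriv:
  fixes c' :: "'x::topological_space chart"
  assumes "w \<in> snd c' ` fst c'"
  shows "deriv (snd c \<circ> chart_inv c') w = jac c c' (chart_inv c' w)"
  using chart_inv_right[OF assms] unfolding jac_def by simp

lemma two_form_change_chart:
  fixes At :: "'x::t2_space chart set" and \<Theta> :: "'x chart \<Rightarrow> 'x \<Rightarrow> complex"
  assumes At: "compact_riemann_surface At" and c: "c \<in> At" "c' \<in> At"
    and U: "open U" "U \<subseteq> fst c \<inter> fst c'"
    and tr: "\<And>x. x \<in> U \<Longrightarrow> \<Theta> c' x = of_real ((cmod (jac c c' x))\<^sup>2) * \<Theta> c x"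
    and i: "set_integrable lborel (snd c ` U) (\<lambda>w. \<Theta> c (chart_inv c w))"
  shows "set_integrable lborel (snd c' ` U) (\<lambda>w. \<Theta> c' (chart_inv c' w))"
    and "(LINT w : snd c' ` U | lborel. \<Theta> c' (chart_inv c' w)) = (LINT w : snd c ` U | lborel. \<Theta> c (chart_inv c w))"
proof -
  note ch = atlas_chart[OF At c(1)] and ch' = atlas_chart[OF At c(2)]
  let ?T = "snd c \<circ> chart_inv c'" and ?S = "snd c' ` U"
  have U': "fst c' \<inter> U = U" using U by blast
  have S: "open ?S" using chart_image_open[OF ch' U(1)] unfolding U' .
  have T: "?T holomorphic_on ?S"
    by (rule holomorphic_on_subset[OF transition_holomorphic[OF At c(2,1)]]) (use U in blast)
  have inj: "inj_on ?T ?S"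
  proof (rule inj_onI)
    fix v w assume "v \<in> ?S" "w \<in> ?S" and eq: "?T v = ?T w"
    then obtain x y where xy: "x \<in> U" "v = snd c' x" "y \<in> U" "w = snd c' y" by blast
    then have "chart_inv c' v = x" "chart_inv c' w = y" using chart_inv_left[OF ch'] U by auto
    then have "snd c x = snd c y" using eq by simp
    then have "x = y" using chart_inv_left[OF ch] xy U by (metis Int_iff subsetD)
    then show "v = w" using xy by simp
  qed
  have img: "?T ` ?S = snd c ` U"
    using chart_inv_left[OF ch'] U by (force simp: image_iff)
  have eq: "of_real ((cmod (deriv ?T w))\<^sup>2) * \<Theta> c (chart_inv c (?T w)) = \<Theta> c' (chart_inv c' w)" if w: "w \<in> ?S" for w
  proof -
    obtain x where x: "x \<in> U" "w = snd c' x" using w by blast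
    then have *: "chart_inv c' w = x" "w \<in> snd c' ` fst c'" using chart_inv_left[OF ch'] U by auto
    then have "chart_inv c (?T w) = x" using chart_inv_left[OF ch] x U by auto
    then show ?thesis using tr[OF x(1)] transition_deriv[OF *(2), of c] * by simp
  qed
  note cv = holomorphic_change_of_variables[OF S T inj, of "\<lambda>w. \<Theta> c (chart_inv c w)", unfolded img, OF i]
  show "set_integrable lborel ?S (\<lambda>w. \<Theta> c' (chart_inv c' w))"
    using cv(1) eq by (subst set_integrable_cong[OF refl refl]) auto
  have "(LINT w : ?S | lborel. \<Theta> c' (chart_inv c' w)) = (LINT w : ?S | lborel. of_real ((cmod (deriv ?T w))\<^sup>2) * \<Theta> c (chart_inv c (?T w)))"
    using eq S by (intro set_lebesgue_integral_cong) auto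
  then show "(LINT w : ?S | lborel. \<Theta> c' (chart_inv c' w)) = (LINT w : snd c ` U | lborel. \<Theta> c (chart_inv c w))"
    using cv(2) by simp
qed

lemma set_integrable_scaleR_bounded:
  fixes f :: "complex \<Rightarrow> complex" and g :: "complex \<Rightarrow> real"
  assumes A: "A \<in> sets borel" and g: "continuous_on A g" "\<And>w. w \<in> A \<Longrightarrow> \<bar>g w\<bar> \<le> B"
    and f: "set_integrable lborel A f"
  shows "set_integrable lborel A (\<lambda>w. g w *\<^sub>R f w)"
proof -
  have "integrable lborel (\<lambda>w. (indicator A w *\<^sub>R g w) *\<^sub>R (indicator A w *\<^sub>R f w))"
  proof (rule Bochner_Integration.integrable_bound)
    show "integrable lborel (\<lambda>w. B *\<^sub>R (indicator A w *\<^sub>R f w))"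
      using f unfolding set_integrable_def by (rule integrable_scaleR_right)
    have "(\<lambda>w. indicator A w *\<^sub>R g w) \<in> borel_measurable lborel"
      using borel_measurable_continuous_on_indicator[OF A g(1)] by simp
    then show "(\<lambda>w. (indicator A w *\<^sub>R g w) *\<^sub>R (indicator A w *\<^sub>R f w)) \<in> borel_measurable lborel"
      by (rule borel_measurable_scaleR[OF _ borel_measurable_integrable[OF f[unfolded set_integrable_def]]])
    show "AE w in lborel. norm ((indicator A w *\<^sub>R g w) *\<^sub>R (indicator A w *\<^sub>R f w)) \<le> norm (B *\<^sub>R (indicator A w *\<^sub>R f w))"
      using g(2) by (intro AE_I2) (fastforce simp: indicator_def intro: mult_right_mono)
  qed
  moreover have "(\<lambda>w. (indicator A w *\<^sub>R g w) *\<^sub>R (indicator A w *\<^sub>R f w)) = (\<lambda>w. indicator A w *\<^sub>R (g w *\<^sub>R f w))"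
    by (auto simp: indicator_def fun_eq_iff)
  ultimately show ?thesis unfolding set_integrable_def by simp
qed

lemma set_integrable_scaleR_compact:
  fixes f :: "complex \<Rightarrow> complex" and g :: "complex \<Rightarrow> real"
  assumes "compact A" "continuous_on A g" "set_integrable lborel A f"
  shows "set_integrable lborel A (\<lambda>w. g w *\<^sub>R f w)"
proof -
  have "bounded (g ` A)" using assms compact_continuous_image compact_imp_bounded by blast
  then obtain B where "\<forall>w\<in>A. \<bar>g w\<bar> \<le> B" unfolding bounded_iff by auto
  then show ?thesis using assms
    by (intro set_integrable_scaleR_bounded[of _ _ B]) (auto simp: compact_imp_closed borel_closed)
qed

lemma partition_of_unity_props:
  assumes At: "compact_riemann_surface At" and pou: "partition_of_unity At n c \<rho>" and i: "i < n"
  shows "c i \<in> At" "0 \<le> \<rho> i x" "\<rho> i x \<le> 1" "closure {x. \<rho> i x \<noteq> 0} \<subseteq> fst (c i)"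
    "surf_smooth_on At UNIV (\<rho> i)"
    "c' \<in> At \<Longrightarrow> continuous_on (snd c' ` fst c') (\<lambda>w. \<rho> i (chart_inv c' w))"
proof -
  show *: "c i \<in> At" "0 \<le> \<rho> i x" "closure {x. \<rho> i x \<noteq> 0} \<subseteq> fst (c i)" "surf_smooth_on At UNIV (\<rho> i)"
    using pou i unfolding partition_of_unity_def by auto
  have "\<rho> i x \<le> (\<Sum>i<n. \<rho> i x)"
    using pou i unfolding partition_of_unity_def by (intro member_le_sum) auto
  then show "\<rho> i x \<le> 1" using pou unfolding partition_of_unity_def by simp
  show "continuous_on (snd c' ` fst c') (\<lambda>w. \<rho> i (chart_inv c' w))" if "c' \<in> At"
    using *(4) that smooth_on_continuous unfolding surf_smooth_on_def o_def by fastforce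
qed

text \<open>
  The support of \<open>\<rho> i\<close> is compact, hence covered by finitely many sets on which the form is integrable.
\<close>

lemma two_form_integrable:
  fixes At :: "'x::t2_space chart set"
  assumes At: "compact_riemann_surface At" and pou: "partition_of_unity At n c \<rho>" and i: "i < n"
    and \<Theta>: "two_form At \<Theta>"
  shows "set_integrable lborel (snd (c i) ` fst (c i))
    (\<lambda>w. \<rho> i (chart_inv (c i) w) *\<^sub>R \<Theta> (c i) (chart_inv (c i) w))"
proof -
  note p = partition_of_unity_props[OF At pou i]
  note ch = atlas_chart[OF At p(1)]
  have cov: "\<exists>N. open N \<and> x \<in> N \<and> N \<subseteq> fst (c i) \<and> set_integrable lborel (snd (c i) ` N) (\<lambda>w. \<Theta> (c i) (chart_inv (c i) w))"
    if x: "x \<in> fst (c i)" for x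
  proof -
    obtain d N where d: "d \<in> At" "open N" "x \<in> N" "N \<subseteq> fst d" "set_integrable lborel (snd d ` N) (\<Theta> d \<circ> chart_inv d)"
      using \<Theta> unfolding two_form_def by blast
    let ?U = "N \<inter> fst (c i)"
    have U: "open ?U" using d chart_continuous(3)[OF ch] by auto
    have "open (snd d ` ?U)"
      using chart_image_open[OF atlas_chart[OF At d(1)] U] d(4) by (simp add: inf.absorb2 le_infI1)
    then have "set_integrable lborel (snd d ` ?U) (\<lambda>w. \<Theta> d (chart_inv d w))"
      using set_integrable_subset[OF d(5), of "snd d ` ?U"] by (auto simp: o_def)
    moreover have "\<Theta> (c i) x = of_real ((cmod (jac d (c i) x))\<^sup>2) * \<Theta> d x" if "x \<in> ?U" for x
      using \<Theta> d(1,4) p(1) that unfolding two_form_def by blast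
    ultimately have "set_integrable lborel (snd (c i) ` ?U) (\<lambda>w. \<Theta> (c i) (chart_inv (c i) w))"
      using two_form_change_chart(1)[OF At d(1) p(1) U, of \<Theta>] d(4) by blast
    then show ?thesis using U x d(3) by blast
  qed
  let ?K = "closure {x. \<rho> i x \<noteq> 0}"
  have "compact (UNIV :: 'x set)" using At unfolding compact_riemann_surface_def by blast
  then have K: "compact ?K" using compact_Int_closed[of UNIV ?K] by auto
  obtain N where N: "\<And>x. x \<in> ?K \<Longrightarrow> open (N x) \<and> x \<in> N x \<and> N x \<subseteq> fst (c i)
     \<and> set_integrable lborel (snd (c i) ` N x) (\<lambda>w. \<Theta> (c i) (chart_inv (c i) w))"
    using cov p(4) by (metis subsetD)
  obtain X where X: "X \<subseteq> ?K" "finite X" "?K \<subseteq> (\<Union>x\<in>X. N x)"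
    using compactE_image[OF K, of ?K N] N by blast
  let ?V = "\<Union>x\<in>X. snd (c i) ` N x"
  have sets: "open (snd (c i) ` N x)" if "x \<in> X" for x
    using chart_image_open[OF ch, of "N x"] N[of x] X(1) that by (auto simp: inf.absorb2)
  have V: "open ?V" using sets by blast
  have VS: "?V \<subseteq> snd (c i) ` fst (c i)" using N X(1) by blast
  have "set_integrable lborel ?V (\<lambda>w. \<Theta> (c i) (chart_inv (c i) w))"
    using N X(1) sets by (intro set_integrable_UN X(2)) auto
  then have "set_integrable lborel ?V (\<lambda>w. \<rho> i (chart_inv (c i) w) *\<^sub>R \<Theta> (c i) (chart_inv (c i) w))"
    using V p(2,3) continuous_on_subset[OF p(6)[OF p(1)] VS]
    by (intro set_integrable_scaleR_bounded[of _ _ 1]) auto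
  moreover have "\<rho> i (chart_inv (c i) w) = 0" if "w \<in> snd (c i) ` fst (c i) - ?V" for w
  proof (rule ccontr)
    assume "\<rho> i (chart_inv (c i) w) \<noteq> 0"
    then have "chart_inv (c i) w \<in> ?K" by (intro subsetD[OF closure_subset]) simp
    then obtain x where "x \<in> X" "chart_inv (c i) w \<in> N x" using X(3) by blast
    moreover have "snd (c i) (chart_inv (c i) w) = w" using chart_inv_right that by blast
    ultimately show False using that by (metis DiffD2 UN_I image_eqI)
  qed
  ultimately show ?thesis by (subst set_integral_support(1)[OF VS]) auto
qed

text \<open>
  The integral is defined by an arbitrary choice of a partition of unity. As partitions of unity exist,
  the chosen triple is one.
\<close>

lemma surf_integral_partition:
  fixes At :: "'x::t2_space chart set"
  assumes At: "compact_riemann_surface At"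
  obtains n c \<rho> where "partition_of_unity At n c \<rho>"
    "\<And>\<Theta>. surf_integral At \<Theta> = (\<Sum>i<n. - 2 * \<i> * (LINT w : snd (c i) ` fst (c i) | lborel.
        \<rho> i (chart_inv (c i) w) *\<^sub>R \<Theta> (c i) (chart_inv (c i) w)))"
proof -
  have "\<forall>x. \<exists>c\<in>At. x \<in> fst c" using At unfolding compact_riemann_surface_def by blast
  then obtain ch where ch: "\<And>x. ch x \<in> At" "\<And>x. x \<in> fst (ch x)" by metis
  obtain n0 c0 \<rho>0 where "partition_of_unity At n0 c0 \<rho>0"
    by (rule partition_of_unity_exists[OF At, of ch "\<lambda>x. fst (ch x)"])
      (use ch chart_continuous(3)[OF atlas_chart[OF At]] in auto)
  then have ex: "\<exists>t. (\<lambda>(n, c, \<rho>). partition_of_unity At n c \<rho>) t" by auto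
  obtain n c \<rho> where t: "(SOME (n, c, \<rho>). partition_of_unity At n c \<rho>) = (n, c, \<rho>)" by (metis prod_cases3)
  have "partition_of_unity At n c \<rho>" using someI_ex[OF ex] unfolding t by simp
  moreover have "surf_integral At \<Theta> = (\<Sum>i<n. - 2 * \<i> * (LINT w : snd (c i) ` fst (c i) | lborel.
        \<rho> i (chart_inv (c i) w) *\<^sub>R \<Theta> (c i) (chart_inv (c i) w)))" for \<Theta>
    unfolding surf_integral_def t by (simp add: scaleR_conv_of_real)
  ultimately show ?thesis using that by blast
qed

lemma surf_integral_cong:
  fixes At :: "'x::t2_space chart set"
  assumes At: "compact_riemann_surface At" and eq: "\<And>c x. c \<in> At \<Longrightarrow> x \<in> fst c \<Longrightarrow> \<Theta> c x = \<Theta>' c x"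
  shows "surf_integral At \<Theta> = surf_integral At \<Theta>'"
proof -
  obtain n c \<rho> where p: "partition_of_unity At n c \<rho>"
    "\<And>\<Theta>. surf_integral At \<Theta> = (\<Sum>i<n. - 2 * \<i> * (LINT w : snd (c i) ` fst (c i) | lborel.
        \<rho> i (chart_inv (c i) w) *\<^sub>R \<Theta> (c i) (chart_inv (c i) w)))"
    using surf_integral_partition[OF At] by blast
  show ?thesis unfolding p(2)
  proof (rule sum.cong[OF refl])
    fix i assume "i \<in> {..<n}"
    then have c: "c i \<in> At" using partition_of_unity_props[OF At p(1)] by blast
    have "open (snd (c i) ` fst (c i))" using chart_continuous(4)[OF atlas_chart[OF At c]] .
    then show "- 2 * \<i> * (LINT w : snd (c i) ` fst (c i) | lborel. \<rho> i (chart_inv (c i) w) *\<^sub>R \<Theta> (c i) (chart_inv (c i) w))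
      = - 2 * \<i> * (LINT w : snd (c i) ` fst (c i) | lborel. \<rho> i (chart_inv (c i) w) *\<^sub>R \<Theta>' (c i) (chart_inv (c i) w))"
      using eq[OF c chart_inv_mem]
      by (intro arg_cong2[where f="(*)"] refl set_lebesgue_integral_cong) auto
  qed
qed

lemma two_form_add:
  fixes At :: "'x::t2_space chart set"
  assumes At: "compact_riemann_surface At" and 1: "two_form At \<Theta>1" and 2: "two_form At \<Theta>2"
  shows "two_form At (\<lambda>c x. \<Theta>1 c x + \<Theta>2 c x)"
  unfolding two_form_def
proof (intro conjI ballI allI)
  fix c c' x assume x: "c \<in> At" "c' \<in> At" "x \<in> fst c \<inter> fst c'"
  have "\<Theta>1 c' x = of_real ((cmod (jac c c' x))\<^sup>2) * \<Theta>1 c x"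
    using 1 x unfolding two_form_def by blast
  moreover have "\<Theta>2 c' x = of_real ((cmod (jac c c' x))\<^sup>2) * \<Theta>2 c x"
    using 2 x unfolding two_form_def by blast
  ultimately show "\<Theta>1 c' x + \<Theta>2 c' x = of_real ((cmod (jac c c' x))\<^sup>2) * (\<Theta>1 c x + \<Theta>2 c x)"
    by (simp only: distrib_left)
next
  fix x
  obtain c N where c: "c \<in> At" "open N" "x \<in> N" "N \<subseteq> fst c" "set_integrable lborel (snd c ` N) (\<lambda>w. \<Theta>1 c (chart_inv c w))"
    using 1 unfolding two_form_def o_def by blast
  obtain d M where d: "d \<in> At" "open M" "x \<in> M" "M \<subseteq> fst d" "set_integrable lborel (snd d ` M) (\<lambda>w. \<Theta>2 d (chart_inv d w))"
    using 2 unfolding two_form_def o_def by blast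
  let ?U = "N \<inter> M"
  have U: "open ?U" "?U \<subseteq> fst d \<inter> fst c" "?U \<subseteq> fst c" "?U \<subseteq> fst d" using c d by auto
  have "open (snd c ` ?U)" "open (snd d ` ?U)"
    using chart_image_open[OF atlas_chart[OF At c(1)] U(1)] chart_image_open[OF atlas_chart[OF At d(1)] U(1)] U(3,4)
    by (auto simp: inf.absorb2)
  then have i: "set_integrable lborel (snd c ` ?U) (\<lambda>w. \<Theta>1 c (chart_inv c w))"
     "set_integrable lborel (snd d ` ?U) (\<lambda>w. \<Theta>2 d (chart_inv d w))"
    using set_integrable_subset[OF c(5), of "snd c ` ?U"] set_integrable_subset[OF d(5), of "snd d ` ?U"] by auto
  have "\<Theta>2 c x = of_real ((cmod (jac d c x))\<^sup>2) * \<Theta>2 d x" if "x \<in> ?U" for x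
    using 2 c(1) d(1) U(2) that unfolding two_form_def by blast
  from two_form_change_chart(1)[OF At d(1) c(1) U(1,2) this i(2)] i(1)
  have "set_integrable lborel (snd c ` ?U) (\<lambda>w. \<Theta>1 c (chart_inv c w) + \<Theta>2 c (chart_inv c w))"
    by (intro set_integral_add(1))
  then show "\<exists>c\<in>At. \<exists>N. open N \<and> x \<in> N \<and> N \<subseteq> fst c \<and>
      set_integrable lborel (snd c ` N) ((\<lambda>x. \<Theta>1 c x + \<Theta>2 c x) \<circ> chart_inv c)"
    using c(1,3) d(3) U by (intro bexI[of _ c] exI[of _ ?U]) (auto simp: o_def)
qed

lemma surf_integral_add:
  fixes At :: "'x::t2_space chart set"
  assumes At: "compact_riemann_surface At" and 1: "two_form At \<Theta>1" and 2: "two_form At \<Theta>2"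
  shows "surf_integral At (\<lambda>c x. \<Theta>1 c x + \<Theta>2 c x) = surf_integral At \<Theta>1 + surf_integral At \<Theta>2"
proof -
  obtain n c \<rho> where p: "partition_of_unity At n c \<rho>"
    "\<And>\<Theta>. surf_integral At \<Theta> = (\<Sum>i<n. - 2 * \<i> * (LINT w : snd (c i) ` fst (c i) | lborel.
        \<rho> i (chart_inv (c i) w) *\<^sub>R \<Theta> (c i) (chart_inv (c i) w)))"
    using surf_integral_partition[OF At] by blast
  have "(LINT w : snd (c i) ` fst (c i) | lborel. \<rho> i (chart_inv (c i) w) *\<^sub>R (\<Theta>1 (c i) (chart_inv (c i) w) + \<Theta>2 (c i) (chart_inv (c i) w)))
     = (LINT w : snd (c i) ` fst (c i) | lborel. \<rho> i (chart_inv (c i) w) *\<^sub>R \<Theta>1 (c i) (chart_inv (c i) w))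
     + (LINT w : snd (c i) ` fst (c i) | lborel. \<rho> i (chart_inv (c i) w) *\<^sub>R \<Theta>2 (c i) (chart_inv (c i) w))" if "i < n" for i
    unfolding scaleR_add_right
    by (rule set_integral_add(2)[OF two_form_integrable[OF At p(1) that 1] two_form_integrable[OF At p(1) that 2]])
  then show ?thesis unfolding p(2) by (simp add: sum.distrib[symmetric] distrib_left del: sum.distrib)
qed

text \<open>
  The contribution of each function of the partition of unity is supported in the overlap with \<open>c\<close>
  and may be computed in \<open>c\<close>, where the functions add up to 1.
\<close>

lemma surf_integral_single_chart:
  fixes At :: "'x::t2_space chart set"
  assumes At: "compact_riemann_surface At" and \<Theta>: "two_form At \<Theta>" and c: "c \<in> At" and K: "K \<subseteq> fst c"
    and zero: "\<And>d x. d \<in> At \<Longrightarrow> x \<in> fst d - K \<Longrightarrow> \<Theta> d x = 0"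
  shows "surf_integral At \<Theta> = - 2 * \<i> * (LINT w : snd c ` fst c | lborel. \<Theta> c (chart_inv c w))"
proof -
  obtain n d \<rho> where p: "partition_of_unity At n d \<rho>"
    "\<And>\<Theta>. surf_integral At \<Theta> = (\<Sum>i<n. - 2 * \<i> * (LINT w : snd (d i) ` fst (d i) | lborel.
        \<rho> i (chart_inv (d i) w) *\<^sub>R \<Theta> (d i) (chart_inv (d i) w)))"
    using surf_integral_partition[OF At] by blast
  note ch = atlas_chart[OF At c]
  have *: "set_integrable lborel (snd c ` fst c) (\<lambda>w. \<rho> i (chart_inv c w) *\<^sub>R \<Theta> c (chart_inv c w)) \<and>
     (LINT w : snd (d i) ` fst (d i) | lborel. \<rho> i (chart_inv (d i) w) *\<^sub>R \<Theta> (d i) (chart_inv (d i) w))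
      = (LINT w : snd c ` fst c | lborel. \<rho> i (chart_inv c w) *\<^sub>R \<Theta> c (chart_inv c w))" if i: "i < n" for i
  proof -
    note q = partition_of_unity_props[OF At p(1) i]
    note di = atlas_chart[OF At q(1)]
    let ?U = "fst (d i) \<inter> fst c"
    let ?\<Xi> = "\<lambda>c x. \<rho> i x *\<^sub>R \<Theta> c x"
    have U: "open ?U" using chart_continuous(3)[OF di] chart_continuous(3)[OF ch] by blast
    have z1: "?\<Xi> (d i) (chart_inv (d i) w) = 0" if "w \<in> snd (d i) ` fst (d i) - snd (d i) ` ?U" for w
    proof -
      have "chart_inv (d i) w \<in> fst (d i)" "snd (d i) (chart_inv (d i) w) = w"
        using that chart_inv_mem chart_inv_right by blast+
      moreover have "chart_inv (d i) w \<notin> fst c"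
      proof
        assume "chart_inv (d i) w \<in> fst c"
        then have "snd (d i) (chart_inv (d i) w) \<in> snd (d i) ` ?U" using calculation(1) by blast
        then show False using that calculation(2) by simp
      qed
      ultimately have "chart_inv (d i) w \<in> fst (d i) - K" using K by blast
      then show ?thesis using zero[OF q(1)] by simp
    qed
    have z2: "?\<Xi> c (chart_inv c w) = 0" if "w \<in> snd c ` fst c - snd c ` ?U" for w
    proof -
      have "chart_inv c w \<in> fst c" "snd c (chart_inv c w) = w"
        using that chart_inv_mem chart_inv_right by blast+
      moreover have "chart_inv c w \<notin> fst (d i)"
      proof
        assume "chart_inv c w \<in> fst (d i)"
        then have "snd c (chart_inv c w) \<in> snd c ` ?U" using calculation(1) by blast
        then show False using that calculation(2) by simp
      qed
      moreover have "{x. \<rho> i x \<noteq> 0} \<subseteq> fst (d i)" by (rule order_trans[OF closure_subset q(4)])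
      ultimately show ?thesis by auto
    qed
    have "snd (d i) ` ?U \<subseteq> snd (d i) ` fst (d i)" by blast
    note sup1 = set_integral_support[OF this z1, where M=lborel]
    have e1: "set_integrable lborel (snd (d i) ` ?U) (\<lambda>w. ?\<Xi> (d i) (chart_inv (d i) w))"
      by (rule iffD1[OF sup1(1) two_form_integrable[OF At p(1) i \<Theta>]])
    have e1': "(LINT w : snd (d i) ` fst (d i) | lborel. ?\<Xi> (d i) (chart_inv (d i) w)) = (LINT w : snd (d i) ` ?U | lborel. ?\<Xi> (d i) (chart_inv (d i) w))"
      by (rule sup1(2))
    have "?\<Xi> c x = of_real ((cmod (jac (d i) c x))\<^sup>2) * ?\<Xi> (d i) x" if "x \<in> ?U" for x
    proof -
      have "\<Theta> c x = of_real ((cmod (jac (d i) c x))\<^sup>2) * \<Theta> (d i) x"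
        using \<Theta> q(1) c that unfolding two_form_def by blast
      then show ?thesis by (simp only: scaleR_conv_of_real mult.left_commute)
    qed
    note cv = two_form_change_chart[OF At q(1) c U order_refl, of ?\<Xi>, OF this e1]
    have "snd c ` ?U \<subseteq> snd c ` fst c" by blast
    note sup = set_integral_support[OF this z2, where M=lborel]
    show ?thesis
      by (rule conjI[OF iffD2[OF sup(1) cv(1)] trans[OF e1' trans[OF cv(2)[symmetric] sup(2)[symmetric]]]])
  qed
  have "(\<Sum>i<n. LINT w : snd (d i) ` fst (d i) | lborel. \<rho> i (chart_inv (d i) w) *\<^sub>R \<Theta> (d i) (chart_inv (d i) w))
    = (\<Sum>i<n. LINT w : snd c ` fst c | lborel. \<rho> i (chart_inv c w) *\<^sub>R \<Theta> c (chart_inv c w))"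
    using * by (intro sum.cong) auto
  also have "\<dots> = (LINT w | lborel. (\<Sum>i<n. indicator (snd c ` fst c) w *\<^sub>R (\<rho> i (chart_inv c w) *\<^sub>R \<Theta> c (chart_inv c w))))"
    unfolding set_lebesgue_integral_def
    using * by (intro Bochner_Integration.integral_sum[symmetric]) (auto simp: set_integrable_def)
  also have "\<dots> = (LINT w : snd c ` fst c | lborel. \<Theta> c (chart_inv c w))"
    unfolding set_lebesgue_integral_def scaleR_sum_right[symmetric] scaleR_sum_left[symmetric]
    using p(1) unfolding partition_of_unity_def by simp
  finally show ?thesis by (simp only: p(2) sum_distrib_left[symmetric])
qed

section \<open>The Lie algebra of a linear algebraic group\<close>

text \<open>
  The first and second differential of a polynomial function at \<open>M\<close> in the directions \<open>U\<close> and \<open>V\<close>,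
  computed formally so that their dependence on \<open>M\<close> and on the directions is visible.
\<close>

primrec pd1 :: "'n::finite cmat \<Rightarrow> 'n cmat \<Rightarrow> 'n pexp \<Rightarrow> complex" where
  "pd1 M V (PConst c) = 0"
| "pd1 M V (PEntry i j) = V $ i $ j"
| "pd1 M V (PAdd f g) = pd1 M V f + pd1 M V g"
| "pd1 M V (PMul f g) = peval id M f * pd1 M V g + pd1 M V f * peval id M g"

primrec pd2 :: "'n::finite cmat \<Rightarrow> 'n cmat \<Rightarrow> 'n cmat \<Rightarrow> 'n pexp \<Rightarrow> complex" where
  "pd2 M U V (PConst c) = 0"
| "pd2 M U V (PEntry i j) = 0"
| "pd2 M U V (PAdd f g) = pd2 M U V f + pd2 M U V g"
| "pd2 M U V (PMul f g) = peval id M f * pd2 M U V g + pd1 M U f * pd1 M V g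
     + pd1 M V f * pd1 M U g + pd2 M U V f * peval id M g"

lemma pd2_commute: "pd2 M U V f = pd2 M V U f"
  by (induction f) (auto simp: algebra_simps)

lemma pd1_add: "pd1 M (V + W) f = pd1 M V f + pd1 M W f"
  by (induction f) (auto simp: algebra_simps)

lemma pd1_cscale: "pd1 M (cscale c V) f = c * pd1 M V f"
  by (induction f) (auto simp: algebra_simps cscale_def)

lemma peval_has_derivative:
  fixes M :: "complex \<Rightarrow> 'n::finite cmat" and V :: "'n cmat"
  assumes "\<And>i j. ((\<lambda>t. M t $ i $ j) has_field_derivative (V $ i $ j)) (at x)"
  shows "((\<lambda>t. peval id (M t) f) has_field_derivative pd1 (M x) V f) (at x)"
  using assms by (induction f) (auto intro!: derivative_eq_intros simp: algebra_simps)

lemma pd1_has_derivative: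
  fixes M V :: "complex \<Rightarrow> 'n::finite cmat" and M' V' :: "'n cmat"
  assumes "\<And>i j. ((\<lambda>t. M t $ i $ j) has_field_derivative (M' $ i $ j)) (at x)"
    and "\<And>i j. ((\<lambda>t. V t $ i $ j) has_field_derivative (V' $ i $ j)) (at x)"
  shows "((\<lambda>t. pd1 (M t) (V t) f) has_field_derivative pd2 (M x) M' (V x) f + pd1 (M x) V' f) (at x)"
proof (induction f)
  case (PMul f g)
  note p = peval_has_derivative[OF assms(1)]
  show ?case using assms
    by (auto intro!: derivative_eq_intros PMul p simp: algebra_simps)
qed (use assms in \<open>auto intro!: derivative_eq_intros\<close>)

lemma line_has_derivative:
  fixes M V :: "'n::finite cmat"
  shows
  "((\<lambda>t. (M + cscale t V) $ i $ j) has_field_derivative (V $ i $ j)) (at x)"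
  by (auto intro!: derivative_eq_intros simp: cscale_def)

lemma pd1_eqI:
  assumes "\<And>t. peval id (M + cscale t V) q = F t" "(F has_field_derivative d) (at 0)"
  shows "pd1 M V q = d"
proof -
  have "((\<lambda>t. peval id (M + cscale t V) q) has_field_derivative pd1 (M + cscale 0 V) V q) (at 0)"
    by (rule peval_has_derivative[OF line_has_derivative])
  then have "(F has_field_derivative pd1 M V q) (at 0)"
    using assms(1) by (simp add: cscale_def zero_vec_def[symmetric])
  then show ?thesis using assms(2) DERIV_unique by blast
qed

lemma lie_alg_iff: "X \<in> lie_alg G \<longleftrightarrow> (\<forall>f\<in>vanishing_ideal G. pd1 (mat 1) X f = 0)"
proof -
  have "deriv (\<lambda>t. peval id (mat 1 + cscale t X) f) 0 = pd1 (mat 1) X f" for f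
    using peval_has_derivative[OF line_has_derivative, of "mat 1" X f 0]
    by (intro DERIV_imp_deriv) (simp add: cscale_def zero_vec_def[symmetric])
  then show ?thesis unfolding lie_alg_def by simp
qed

lemma lie_alg_subspace: "cmat.subspace (lie_alg G)"
proof (rule cmat.subspaceI)
  have "cscale 0 X = 0" for X :: "'a cmat" by (simp add: cscale_def vec_eq_iff)
  then have "pd1 (mat 1) 0 f = 0" for f :: "'a pexp"
    using pd1_cscale[where M="mat 1" and c=0 and V=0 and f=f] by simp
  then show "0 \<in> lie_alg G" unfolding lie_alg_iff by blast
qed (auto simp: lie_alg_iff pd1_add pd1_cscale)

lemma pexp_sum_exists:
  assumes "finite A" "\<And>a. a \<in> A \<Longrightarrow> \<exists>q. \<forall>M. peval id M q = F a M"
  shows "\<exists>q. \<forall>M. peval id M q = (\<Sum>a\<in>A. F a M)"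
  using assms
proof (induction A)
  case empty then show ?case by (intro exI[of _ "PConst 0"]) auto
next
  case (insert a A)
  then obtain q1 q2 where "\<forall>M. peval id M q1 = F a M" "\<forall>M. peval id M q2 = (\<Sum>a\<in>A. F a M)" by blast
  then have "\<forall>M. peval id M (PAdd q1 q2) = (\<Sum>a\<in>insert a A. F a M)"
    unfolding peval.simps sum.insert[OF insert(1,2)] by simp
  then show ?case by blast
qed

lemma pexp_entry_exists: "\<exists>q. \<forall>M. peval id M q = (g ** M ** h) $ i $ j"
proof -
  have "\<exists>q. \<forall>M. peval id M q = (\<Sum>l\<in>UNIV. g $ i $ l * M $ l $ k) * h $ k $ j" for k
  proof -
    have "\<exists>q. \<forall>M. peval id M q = (\<Sum>l\<in>UNIV. g $ i $ l * M $ l $ k)"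
      by (rule pexp_sum_exists) (auto intro: exI[of _ "PMul (PConst (g $ i $ l)) (PEntry l k)" for l])
    then obtain q where "\<forall>M. peval id M q = (\<Sum>l\<in>UNIV. g $ i $ l * M $ l $ k)" by blast
    then show ?thesis by (intro exI[of _ "PMul q (PConst (h $ k $ j))"]) auto
  qed
  then have "\<exists>q. \<forall>M. peval id M q = (\<Sum>k\<in>UNIV. (\<Sum>l\<in>UNIV. g $ i $ l * M $ l $ k) * h $ k $ j)"
    by (intro pexp_sum_exists) auto
  then show ?thesis by (simp add: matrix_matrix_mult_def)
qed

lemma pexp_translate_exists: "\<exists>q. \<forall>M. peval id M q = peval id (g ** M ** h) f"
proof (induction f)
  case (PConst c) then show ?case by (intro exI[of _ "PConst c"]) auto
next
  case (PEntry i j)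
  show ?case unfolding peval.simps by (rule pexp_entry_exists)
next
  case (PAdd f1 f2)
  then obtain q1 q2 where "\<forall>M. peval id M q1 = peval id (g ** M ** h) f1" "\<forall>M. peval id M q2 = peval id (g ** M ** h) f2" by blast
  then show ?case by (intro exI[of _ "PAdd q1 q2"] allI) (simp only: peval.simps pd1.simps)
next
  case (PMul f1 f2)
  then obtain q1 q2 where "\<forall>M. peval id M q1 = peval id (g ** M ** h) f1" "\<forall>M. peval id M q2 = peval id (g ** M ** h) f2" by blast
  then show ?case by (intro exI[of _ "PMul q1 q2"] allI) (simp only: peval.simps pd1.simps)
qed

text \<open>
  The derivative along the left invariant vector field of \<open>X\<close> is a polynomial again, and so may lie in
  the vanishing ideal.
\<close>

lemma pexp_derivative_exists: "\<exists>q. \<forall>M. peval id M q = pd1 M (M ** X) f"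
proof (induction f)
  case (PConst c) then show ?case by (intro exI[of _ "PConst 0"]) auto
next
  case (PEntry i j)
  show ?case using pexp_entry_exists[of "mat 1" X i j] unfolding pd1.simps matrix_mul_lid .
next
  case (PAdd f1 f2)
  then obtain q1 q2 where "\<forall>M. peval id M q1 = pd1 M (M ** X) f1" "\<forall>M. peval id M q2 = pd1 M (M ** X) f2" by blast
  then show ?case by (intro exI[of _ "PAdd q1 q2"] allI) (simp only: peval.simps pd1.simps)
next
  case (PMul f1 f2)
  then obtain q1 q2 where "\<forall>M. peval id M q1 = pd1 M (M ** X) f1" "\<forall>M. peval id M q2 = pd1 M (M ** X) f2" by blast
  then show ?case by (intro exI[of _ "PAdd (PMul f1 q2) (PMul q1 f2)"] allI) (simp only: peval.simps pd1.simps)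
qed

lemma matrix_add_rdistrib: "(A + B) ** C = A ** C + B ** (C :: 'n::finite cmat)"
  by (simp add: matrix_matrix_mult_def vec_eq_iff distrib_right sum.distrib)

lemma matrix_cscale: "A ** cscale t X = cscale t (A ** X)" "cscale t X ** A = cscale t (X ** A)"
  by (auto simp: matrix_matrix_mult_def cscale_def vec_eq_iff sum_distrib_left algebra_simps)

lemma pd1_translate:
  fixes g h M V :: "'n::finite cmat"
  assumes q: "\<And>M. peval id M q = peval id (g ** M ** h) f"
  shows "pd1 M V q = pd1 (g ** M ** h) (g ** V ** h) f"
proof (rule pd1_eqI)
  show "peval id (M + cscale t V) q = peval id (g ** M ** h + cscale t (g ** V ** h)) f" for t
    unfolding q by (simp add: matrix_add_ldistrib matrix_add_rdistrib matrix_cscale)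
  show "((\<lambda>t. peval id (g ** M ** h + cscale t (g ** V ** h)) f) has_field_derivative
      pd1 (g ** M ** h) (g ** V ** h) f) (at 0)"
    using peval_has_derivative[OF line_has_derivative, of "g ** M ** h" "g ** V ** h" f 0]
    by (simp add: cscale_def zero_vec_def[symmetric])
qed

lemma matrix_inv_inverse:
  "invertible A \<Longrightarrow> A ** matrix_inv A = mat 1 \<and> matrix_inv A ** A = mat 1"
  unfolding matrix_inv_def invertible_def by (rule someI_ex)

lemma algebraic_group_inverse:
  assumes "linear_algebraic_group G" "g \<in> G"
  shows "matrix_inv g ** g = mat 1" "g ** matrix_inv g = mat 1" "matrix_inv g \<in> G" "matrix_inv (matrix_inv g) = g"
proof -
  have inv: "invertible g" if "g \<in> G" for g using assms(1) that unfolding linear_algebraic_group_def by auto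
  show 1: "matrix_inv g ** g = mat 1" "g ** matrix_inv g = mat 1" "matrix_inv g \<in> G"
    using matrix_inv_inverse[OF inv[OF assms(2)]] assms unfolding linear_algebraic_group_def by auto
  have "matrix_inv (matrix_inv g) = (g ** matrix_inv g) ** matrix_inv (matrix_inv g)" using 1 by simp
  also have "\<dots> = g" using matrix_inv_inverse[OF inv[OF 1(3)]] by (simp add: matrix_mul_assoc[symmetric])
  finally show "matrix_inv (matrix_inv g) = g" .
qed

text \<open>
  Conjugation maps the group to itself, hence preserves its vanishing ideal.
\<close>

lemma lie_alg_Ad:
  assumes G: "linear_algebraic_group G" and g: "g \<in> G" and X: "X \<in> lie_alg G"
  shows "matrix_inv g ** X ** g \<in> lie_alg G"
  unfolding lie_alg_iff
proof
  fix f assume f: "f \<in> vanishing_ideal G"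
  obtain q where q: "\<And>M. peval id M q = peval id (matrix_inv g ** M ** g) f"
    using pexp_translate_exists by blast
  have "q \<in> vanishing_ideal G"
    using f q G algebraic_group_inverse(3)[OF G g] g unfolding vanishing_ideal_def linear_algebraic_group_def by auto
  then have "pd1 (mat 1) X q = 0" using X unfolding lie_alg_iff by blast
  then show "pd1 (mat 1) (matrix_inv g ** X ** g) f = 0"
    using pd1_translate[OF q, of "mat 1" X] algebraic_group_inverse(1)[OF G g] by simp
qed

text \<open>
  The derivative of \<open>f\<close> along the left invariant field of \<open>X\<close> vanishes on the group again, hence can
  be differentiated along \<open>Y\<close>; the second derivatives cancel in the commutator.
\<close>

lemma lie_alg_lie:
  assumes G: "linear_algebraic_group G" and X: "X \<in> lie_alg G" and Y: "Y \<in> lie_alg G"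
  shows "lie X Y \<in> lie_alg G"
proof -
  have *: "pd2 (mat 1) V U f + pd1 (mat 1) (V ** U) f = 0"
    if U: "U \<in> lie_alg G" and V: "V \<in> lie_alg G" and f: "f \<in> vanishing_ideal G" for U V f
  proof -
    obtain q where q: "\<And>M. peval id M q = pd1 M (M ** U) f" using pexp_derivative_exists by blast
    have "pd1 h (h ** U) f = 0" if h: "h \<in> G" for h
    proof -
      obtain r where r: "\<And>M. peval id M r = peval id (h ** M ** mat 1) f" using pexp_translate_exists by blast
      have "r \<in> vanishing_ideal G"
        using f r G h unfolding vanishing_ideal_def linear_algebraic_group_def by auto
      then have "pd1 (mat 1) U r = 0" using U unfolding lie_alg_iff by blast
      then show ?thesis using pd1_translate[OF r, of "mat 1" U] by simp
    qed
    then have "q \<in> vanishing_ideal G" using q unfolding vanishing_ideal_def by auto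
    then have "pd1 (mat 1) V q = 0" using V unfolding lie_alg_iff by blast
    moreover have "pd1 (mat 1) V q = pd2 (mat 1) V U f + pd1 (mat 1) (V ** U) f"
    proof (rule pd1_eqI[OF q])
      have e: "(mat 1 + cscale t V) ** U = U + cscale t (V ** U)" for t
        by (simp add: matrix_add_rdistrib matrix_cscale)
      show "((\<lambda>t. pd1 (mat 1 + cscale t V) ((mat 1 + cscale t V) ** U) f) has_field_derivative
          pd2 (mat 1) V U f + pd1 (mat 1) (V ** U) f) (at 0)"
        using pd1_has_derivative[OF line_has_derivative line_has_derivative, of "mat 1" V U "V ** U" f 0]
        unfolding e by (simp add: cscale_def zero_vec_def[symmetric])
    qed
    ultimately show ?thesis by simp
  qed
  show ?thesis unfolding lie_alg_iff
  proof
    fix f assume f: "f \<in> vanishing_ideal G"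
    have "pd1 (mat 1) (X ** Y) f = pd1 (mat 1) (lie X Y) f + pd1 (mat 1) (Y ** X) f"
      unfolding pd1_add[symmetric] lie_def by simp
    then show "pd1 (mat 1) (lie X Y) f = 0"
      using *[OF X Y f] *[OF Y X f] pd2_commute[of "mat 1" X Y f] by algebra
  qed
qed

section \<open>The Killing form\<close>

text \<open>
  The basis used by the trace in the definition of the Killing form.
\<close>

definition lie_basis :: "'n::finite cmat set \<Rightarrow> 'n cmat set" where
  "lie_basis G = (SOME B. cmat.independent B \<and> cmat.span B = lie_alg G)"

lemma lie_basis: "cmat.independent (lie_basis G)" "cmat.span (lie_basis G) = lie_alg G"
proof -
  obtain B where B: "B \<subseteq> lie_alg G" "cmat.independent B" "lie_alg G \<subseteq> cmat.span B"
    using cmat.maximal_independent_subset[of "lie_alg G"] by blast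
  have "cmat.span B = lie_alg G"
    using B cmat.span_minimal[OF B(1) lie_alg_subspace] by blast
  then have "\<exists>B. cmat.independent B \<and> cmat.span B = lie_alg G" using B by blast
  from someI_ex[OF this] show "cmat.independent (lie_basis G)" "cmat.span (lie_basis G) = lie_alg G"
    unfolding lie_basis_def by auto
qed

definition matrix_unit :: "'n::finite \<Rightarrow> 'n \<Rightarrow> 'n cmat" where
  "matrix_unit i j = (\<chi> k l. if k = i \<and> l = j then 1 else 0)"

lemma matrix_sum_units:
  fixes X :: "'n::finite cmat"
  shows "X = (\<Sum>p\<in>UNIV. cscale (X $ fst p $ snd p) (matrix_unit (fst p) (snd p)))"
proof -
    have "X $ fst p $ snd p * (if k = fst p \<and> l = snd p then 1 else 0) = (if p = (k, l) then X $ k $ l else 0)" for k l p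
      by (cases p) auto
    then have "(\<Sum>p\<in>UNIV. cscale (X $ fst p $ snd p) (matrix_unit (fst p) (snd p))) $ k $ l
      = (\<Sum>p\<in>UNIV. if p = (k, l) then X $ k $ l else 0)" for k l
      by (simp only: sum_component cscale_def matrix_unit_def vec_lambda_beta)
    then show ?thesis by (auto simp: vec_eq_iff)
qed

lemma finite_independent:
  assumes "cmat.independent (B :: 'n::finite cmat set)"
  shows "finite B"
proof -
  let ?E = "(\<lambda>(i, j). matrix_unit i j :: 'n cmat) ` UNIV"
  have "X \<in> cmat.span ?E" for X
  proof -
    have "X = (\<Sum>p\<in>UNIV. cscale (X $ fst p $ snd p) (matrix_unit (fst p) (snd p)))"
      by (rule matrix_sum_units)
    also have "\<dots> \<in> cmat.span ?E"
      by (intro cmat.span_sum cmat.span_scale cmat.span_base) auto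
    finally show ?thesis .
  qed
  then show ?thesis using cmat.independent_span_bound[of ?E B] assms by auto
qed

definition lie_trace :: "'n::finite cmat set \<Rightarrow> ('n cmat \<Rightarrow> 'n cmat) \<Rightarrow> complex" where
  "lie_trace G T = (\<Sum>b\<in>lie_basis G. cmat.representation (lie_basis G) (T b) b)"

lemma killing_eq_trace: "killing G X Y = lie_trace G (\<lambda>b. lie X (lie Y b))"
  unfolding killing_def lie_trace_def lie_basis_def Let_def ..

text \<open>
  Brackets and conjugations are linear on all matrices, which is simpler to state than linearity on
  the Lie algebra.
\<close>

definition lie_endo :: "'n::finite cmat set \<Rightarrow> ('n cmat \<Rightarrow> 'n cmat) \<Rightarrow> bool" where
  "lie_endo G T \<longleftrightarrow> (\<forall>X\<in>lie_alg G. T X \<in> lie_alg G) \<and> (\<forall>X Y. T (X + Y) = T X + T Y) \<and>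
     (\<forall>c X. T (cscale c X) = cscale c (T X))"

lemma lie_endo_representation:
  assumes T: "lie_endo G T" and v: "v \<in> lie_alg G"
  shows "cmat.representation (lie_basis G) (T v) b
    = (\<Sum>b'\<in>lie_basis G. cmat.representation (lie_basis G) v b' * cmat.representation (lie_basis G) (T b') b)"
proof -
  let ?B = "lie_basis G"
  note B = lie_basis[of G] and fin = finite_independent[OF lie_basis(1)[of G]]
  have v': "v = (\<Sum>b'\<in>?B. cscale (cmat.representation ?B v b') b')"
    using cmat.sum_representation_eq[OF B(1) _ fin order_refl, of v] v B(2) by simp
  have T0: "T 0 = 0"
  proof -
    have "T (cscale 0 0) = cscale 0 (T 0)" using T unfolding lie_endo_def by blast
    then show ?thesis by (simp only: cmat.scale_zero_left)
  qed
  have Tsum: "T (\<Sum>b'\<in>A. cscale (f b') b') = (\<Sum>b'\<in>A. cscale (f b') (T b'))" if "finite A" for A f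
    using that T T0 unfolding lie_endo_def by (induction A) auto
  have b: "T b' \<in> cmat.span ?B" if "b' \<in> ?B" for b'
    using T that B(2) cmat.span_base unfolding lie_endo_def by blast
  have "cmat.representation ?B (T v) b = cmat.representation ?B (\<Sum>b'\<in>?B. cscale (cmat.representation ?B v b') (T b')) b"
    using arg_cong[OF v', of T] unfolding Tsum[OF fin] by simp
  also have "\<dots> = (\<Sum>b'\<in>?B. cmat.representation ?B (cscale (cmat.representation ?B v b') (T b')) b)"
    using b by (subst cmat.representation_sum[OF B(1)]) (auto intro: cmat.span_scale)
  also have "\<dots> = (\<Sum>b'\<in>?B. cmat.representation ?B v b' * cmat.representation ?B (T b') b)"
    using b by (intro sum.cong refl) (simp add: cmat.representation_scale[OF B(1)])
  finally show ?thesis .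
qed

lemma lie_basis_in: "b \<in> lie_basis G \<Longrightarrow> b \<in> lie_alg G"
  using lie_basis(2)[of G] cmat.span_base by blast

text \<open>
  In terms of the matrices of \<open>T\<close> and \<open>U\<close> both traces are the same double sum.
\<close>

lemma lie_trace_commute:
  assumes T: "lie_endo G T" and U: "lie_endo G U"
  shows "lie_trace G (\<lambda>b. T (U b)) = lie_trace G (\<lambda>b. U (T b))"
proof -
  let ?B = "lie_basis G" and ?r = "cmat.representation (lie_basis G)"
  have in': "U b \<in> lie_alg G" "T b \<in> lie_alg G" if "b \<in> ?B" for b
    using that T U lie_basis_in unfolding lie_endo_def by blast+
  have "lie_trace G (\<lambda>b. T (U b)) = (\<Sum>b\<in>?B. \<Sum>b'\<in>?B. ?r (U b) b' * ?r (T b') b)"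
    unfolding lie_trace_def using lie_endo_representation[OF T in'(1)] by simp
  also have "\<dots> = (\<Sum>b'\<in>?B. \<Sum>b\<in>?B. ?r (T b') b * ?r (U b) b')"
    by (subst sum.swap) (simp add: mult.commute)
  also have "\<dots> = lie_trace G (\<lambda>b. U (T b))"
    unfolding lie_trace_def using lie_endo_representation[OF U in'(2)] by simp
  finally show ?thesis .
qed

lemma lie_trace_diff:
  assumes T: "lie_endo G T" and U: "lie_endo G U"
  shows "lie_trace G (\<lambda>b. T b - U b) = lie_trace G T - lie_trace G U"
  unfolding lie_trace_def sum_subtractf[symmetric]
proof (rule sum.cong[OF refl])
  fix b assume "b \<in> lie_basis G"
  then have "T b \<in> cmat.span (lie_basis G)" "U b \<in> cmat.span (lie_basis G)"
    using T U lie_basis_in unfolding lie_endo_def lie_basis(2) by blast+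
  then show "cmat.representation (lie_basis G) (T b - U b) b
      = cmat.representation (lie_basis G) (T b) b - cmat.representation (lie_basis G) (U b) b"
    by (simp add: cmat.representation_diff[OF lie_basis(1)])
qed

lemma lie_add: "lie X (Y + Z) = lie X Y + lie X Z" "lie (X + Y) Z = lie X Z + lie Y Z"
  by (simp_all add: lie_def matrix_add_ldistrib matrix_add_rdistrib)

lemma lie_cscale: "lie X (cscale c Y) = cscale c (lie X Y)" "lie (cscale c X) Y = cscale c (lie X Y)"
  by (simp_all add: lie_def matrix_cscale cmat.scale_right_diff_distrib)

lemma lie_endo_lie:
  "linear_algebraic_group G \<Longrightarrow> X \<in> lie_alg G \<Longrightarrow> lie_endo G (lie X)"
  unfolding lie_endo_def using lie_alg_lie by (auto simp: lie_add lie_cscale)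

lemma lie_endo_comp: "lie_endo G T \<Longrightarrow> lie_endo G U \<Longrightarrow> lie_endo G (\<lambda>b. T (U b))"
  unfolding lie_endo_def by auto

lemma killing_commute:
  assumes "linear_algebraic_group G" "X \<in> lie_alg G" "Y \<in> lie_alg G"
  shows "killing G X Y = killing G Y X"
  unfolding killing_eq_trace by (intro lie_trace_commute lie_endo_lie assms)

lemma matrix_diff_ldistrib: "A ** (B - C) = A ** B - A ** (C :: 'n::finite cmat)"
  and matrix_diff_rdistrib: "(B - C) ** A = B ** A - C ** (A :: 'n::finite cmat)"
  by (simp_all add: matrix_matrix_mult_def vec_eq_iff right_diff_distrib left_diff_distrib sum_subtractf)

lemma lie_jacobi: "lie (lie A X) Z = lie A (lie X Z) - lie X (lie A Z)"
  by (simp add: lie_def matrix_diff_ldistrib matrix_diff_rdistrib matrix_mul_assoc)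

lemma lie_endo_lie3:
  "linear_algebraic_group G \<Longrightarrow> X \<in> lie_alg G \<Longrightarrow> Y \<in> lie_alg G \<Longrightarrow> Z \<in> lie_alg G \<Longrightarrow>
    lie_endo G (\<lambda>b. lie X (lie Y (lie Z b)))"
  unfolding lie_endo_def by (auto simp: lie_add lie_cscale intro!: lie_alg_lie)

text \<open>
  By the Jacobi identity both sides are differences of traces of threefold brackets. One trace occurs
  on both sides, the other two agree by cyclicity.
\<close>

lemma killing_invariant:
  assumes G: "linear_algebraic_group G" and A: "A \<in> lie_alg G" and X: "X \<in> lie_alg G" and Y: "Y \<in> lie_alg G"
  shows "killing G (lie A X) Y = - killing G X (lie A Y)"
proof -
  note e = lie_endo_lie[OF G A] lie_endo_lie[OF G X] lie_endo_lie[OF G Y]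
  have lin: "lie X (B - C) = lie X B - lie X C" for X B C :: "'a cmat"
    by (simp add: lie_def matrix_diff_ldistrib matrix_diff_rdistrib)
  have "killing G (lie A X) Y = lie_trace G (\<lambda>b. lie A (lie X (lie Y b))) - lie_trace G (\<lambda>b. lie X (lie A (lie Y b)))"
    unfolding killing_eq_trace lie_jacobi
    by (rule lie_trace_diff[OF lie_endo_lie3[OF G A X Y] lie_endo_lie3[OF G X A Y]])
  moreover have "killing G X (lie A Y) = lie_trace G (\<lambda>b. lie X (lie A (lie Y b))) - lie_trace G (\<lambda>b. lie X (lie Y (lie A b)))"
    unfolding killing_eq_trace lie_jacobi lin
    by (rule lie_trace_diff[OF lie_endo_lie3[OF G X A Y] lie_endo_lie3[OF G X Y A]])
  moreover have "lie_trace G (\<lambda>b. lie A (lie X (lie Y b))) = lie_trace G (\<lambda>b. lie X (lie Y (lie A b)))"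
    by (rule lie_trace_commute[OF e(1) lie_endo_comp[OF e(2,3)]])
  ultimately show ?thesis by simp
qed

lemma lie_Ad:
  assumes "linear_algebraic_group G" "g \<in> G"
  shows "lie (matrix_inv g ** A ** g) (matrix_inv g ** B ** g) = matrix_inv g ** lie A B ** g"
proof -
  have "matrix_inv g ** A ** g ** (matrix_inv g ** B ** g) = matrix_inv g ** (A ** B) ** g" for A B
  proof -
    have "matrix_inv g ** A ** g ** (matrix_inv g ** B ** g) = matrix_inv g ** A ** (g ** matrix_inv g) ** B ** g"
      by (simp only: matrix_mul_assoc)
    then show ?thesis unfolding algebraic_group_inverse(2)[OF assms] by (simp add: matrix_mul_assoc)
  qed
  then show ?thesis unfolding lie_def by (simp add: matrix_diff_ldistrib matrix_diff_rdistrib)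
qed

text \<open>
  Conjugation by \<open>g\<close> is an automorphism of the Lie algebra, and conjugate endomorphisms have the same
  trace.
\<close>

lemma killing_Ad:
  assumes G: "linear_algebraic_group G" and g: "g \<in> G" and X: "X \<in> lie_alg G" and Y: "Y \<in> lie_alg G"
  shows "killing G (matrix_inv g ** X ** g) (matrix_inv g ** Y ** g) = killing G X Y"
proof -
  let ?c = "\<lambda>Z. matrix_inv g ** Z ** g" and ?d = "\<lambda>Z. g ** Z ** matrix_inv g"
  note inv = algebraic_group_inverse[OF G g]
  have c: "lie_endo G ?c"
    unfolding lie_endo_def using lie_alg_Ad[OF G g]
    by (auto simp: matrix_add_ldistrib matrix_add_rdistrib matrix_cscale)
  have d: "lie_endo G ?d"
    unfolding lie_endo_def using lie_alg_Ad[OF G inv(3)] inv(4)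
    by (auto simp: matrix_add_ldistrib matrix_add_rdistrib matrix_cscale)
  have dc: "?d (?c Z) = Z" "?c (?d Z) = Z" for Z
  proof -
    have "?d (?c Z) = (g ** matrix_inv g) ** Z ** (g ** matrix_inv g)" "?c (?d Z) = (matrix_inv g ** g) ** Z ** (matrix_inv g ** g)"
      by (simp_all only: matrix_mul_assoc)
    then show "?d (?c Z) = Z" "?c (?d Z) = Z" unfolding inv by simp_all
  qed
  have "lie (?c A) (?c B) = ?c (lie A B)" for A B by (rule lie_Ad[OF G g])
  then have "lie (?c X) (lie (?c Y) b) = ?c (lie X (lie Y (?d b)))" for b
    using dc(2)[of b] by metis
  then have "killing G (?c X) (?c Y) = lie_trace G (\<lambda>b. ?c (lie X (lie Y (?d b))))"
    unfolding killing_eq_trace by simp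
  also have "\<dots> = lie_trace G (\<lambda>b. lie X (lie Y (?d (?c b))))"
    by (rule lie_trace_commute[OF c, of "\<lambda>b. lie X (lie Y (?d b))"])
      (intro lie_endo_comp[OF lie_endo_lie[OF G X] lie_endo_comp[OF lie_endo_lie[OF G Y] d]])
  finally show ?thesis unfolding dc(1) killing_eq_trace .
qed

text \<open>
  The Killing form is only meaningful on the Lie algebra; extending the basis to all matrices gives
  a bilinear form on matrices, which can be differentiated.
\<close>

definition kill :: "'n::finite cmat set \<Rightarrow> 'n cmat \<Rightarrow> 'n cmat \<Rightarrow> complex" where
  "kill G X Y = (\<Sum>b\<in>lie_basis G. cmat.representation (cmat.extend_basis (lie_basis G)) (lie X (lie Y b)) b)"

lemma kill_eq_killing:
  assumes "linear_algebraic_group G" "X \<in> lie_alg G" "Y \<in> lie_alg G"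
  shows "kill G X Y = killing G X Y"
  unfolding kill_def killing_eq_trace lie_trace_def
proof (rule sum.cong[OF refl])
  fix b assume "b \<in> lie_basis G"
  then have "lie X (lie Y b) \<in> cmat.span (lie_basis G)"
    unfolding lie_basis(2) by (intro lie_alg_lie assms lie_basis_in)
  then show "cmat.representation (cmat.extend_basis (lie_basis G)) (lie X (lie Y b)) b
     = cmat.representation (lie_basis G) (lie X (lie Y b)) b"
    by (subst cmat.representation_extend[OF cmat.independent_extend_basis[OF lie_basis(1)] _ cmat.extend_basis_superset[OF lie_basis(1)]]) auto
qed

lemma extended_representation:
  fixes G :: "'n::finite cmat set"
  defines "r \<equiv> cmat.representation (cmat.extend_basis (lie_basis G))"
  shows "r (X + Y) b = r X b + r Y b" "r (cscale c X) b = c * r X b"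
  unfolding r_def
  using cmat.representation_add[OF cmat.independent_extend_basis[OF lie_basis(1)[of G]]]
    cmat.representation_scale[OF cmat.independent_extend_basis[OF lie_basis(1)[of G]]]
  by (simp_all add: cmat.span_extend_basis[OF lie_basis(1)[of G]])

lemma kill_add: "kill G (X + Y) Z = kill G X Z + kill G Y Z" "kill G X (Y + Z) = kill G X Y + kill G X Z"
  unfolding kill_def lie_add extended_representation by (simp_all add: sum.distrib)

lemma kill_cscale: "kill G (cscale c X) Y = c * kill G X Y" "kill G X (cscale c Y) = c * kill G X Y"
  unfolding kill_def lie_cscale extended_representation by (simp_all add: sum_distrib_left)

lemma scaleR_eq_cscale: "r *\<^sub>R X = cscale (of_real r) (X :: 'n::finite cmat)"
  by (simp add: cscale_def vec_eq_iff scaleR_conv_of_real[where 'a=complex])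

lemma bounded_bilinear_kill: "bounded_bilinear (kill G)"
  unfolding bilinear_conv_bounded_bilinear[symmetric] bilinear_def
  by (intro conjI allI linearI) (simp_all add: kill_add kill_cscale scaleR_eq_cscale scaleR_conv_of_real)

lemma bounded_bilinear_lie: "bounded_bilinear (lie :: 'n::finite cmat \<Rightarrow> 'n cmat \<Rightarrow> 'n cmat)"
  unfolding bilinear_conv_bounded_bilinear[symmetric] bilinear_def
  by (intro conjI allI linearI) (simp_all add: lie_add lie_cscale scaleR_eq_cscale)

lemma bounded_bilinear_matmul: "bounded_bilinear ((**) :: 'n::finite cmat \<Rightarrow> 'n cmat \<Rightarrow> 'n cmat)"
  unfolding bilinear_conv_bounded_bilinear[symmetric] bilinear_def
  by (intro conjI allI linearI)
    (simp_all add: matrix_add_ldistrib matrix_add_rdistrib matrix_cscale scaleR_eq_cscale)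

lemma bounded_bilinear_cscale: "bounded_bilinear (cscale :: complex \<Rightarrow> 'n::finite cmat \<Rightarrow> 'n cmat)"
  unfolding bilinear_conv_bounded_bilinear[symmetric] bilinear_def
  by (intro conjI allI linearI)
    (simp_all add: cmat.scale_left_distrib cmat.scale_right_distrib scaleR_eq_cscale cmat.scale_left_commute scaleR_conv_of_real)

section \<open>Stokes' theorem for one-forms with isolated singularities\<close>

text \<open>
  The Wirtinger derivatives of scalar functions; \<open>wirt\<close> and \<open>wirtbar\<close> are their matrix-valued versions.
\<close>

definition wd :: "(complex \<Rightarrow> complex) \<Rightarrow> complex \<Rightarrow> complex" where
  "wd f w = (pdiff 1 f w - \<i> * pdiff \<i> f w) / 2"

definition wdbar :: "(complex \<Rightarrow> complex) \<Rightarrow> complex \<Rightarrow> complex" where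
  "wdbar f w = (pdiff 1 f w + \<i> * pdiff \<i> f w) / 2"

lemma has_derivative_wirtinger:
  assumes "f differentiable (at w)"
  shows "(f has_derivative (\<lambda>h. wd f w * h + wdbar f w * cnj h)) (at w)"
proof -
  have "(f has_derivative (\<lambda>v. Re v *\<^sub>R pdiff 1 f w + Im v *\<^sub>R pdiff \<i> f w)) (at w)"
    using derivative_by_partials assms frechet_derivative_works by blast
  then show ?thesis
  proof (rule has_derivative_eq_rhs)
    show "(\<lambda>v. Re v *\<^sub>R pdiff 1 f w + Im v *\<^sub>R pdiff \<i> f w) = (\<lambda>h. wd f w * h + wdbar f w * cnj h)"
      by (rule ext) (simp add: wd_def wdbar_def complex_eq_iff field_simps)
  qed
qed

lemma wirtinger_unique:
  assumes "(f has_derivative (\<lambda>h. p * h + q * cnj h)) (at w)"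
  shows "wd f w = p" "wdbar f w = q"
proof -
  have "frechet_derivative f (at w) = (\<lambda>h. p * h + q * cnj h)" using frechet_derivative_at[OF assms] by simp
  then show "wd f w = p" "wdbar f w = q" by (simp_all add: wd_def wdbar_def complex_eq_iff algebra_simps)
qed

text \<open>
  The second derivative of \<open>T\<close> appears only in the derivatives that do not enter the exterior
  derivative of \<open>a dz + b d\<close>\<open>z\<close>-bar.
\<close>

lemma wirtinger_pullback:
  assumes S: "open S" "w \<in> S" and T: "T holomorphic_on S" and f: "f differentiable (at (T w))"
  shows "(\<And>v. v \<in> S \<Longrightarrow> g v = deriv T v * f (T v)) \<Longrightarrow> wdbar g w = of_real ((cmod (deriv T w))\<^sup>2) * wdbar f (T w)"
    and "(\<And>v. v \<in> S \<Longrightarrow> g v = cnj (deriv T v) * f (T v)) \<Longrightarrow> wd g w = of_real ((cmod (deriv T w))\<^sup>2) * wd f (T w)"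
proof -
  let ?T' = "deriv T w" and ?T'' = "deriv (deriv T) w"
  have T1: "(T has_derivative (\<lambda>h. ?T' * h)) (at w)"
    using holomorphic_derivI[OF T S] unfolding has_field_derivative_def .
  have T2: "(deriv T has_derivative (\<lambda>h. ?T'' * h)) (at w)"
    using holomorphic_derivI[OF holomorphic_deriv[OF T S(1)] S] unfolding has_field_derivative_def .
  have c: "((\<lambda>v. f (T v)) has_derivative (\<lambda>h. wd f (T w) * (?T' * h) + wdbar f (T w) * cnj (?T' * h))) (at w)"
    by (rule has_derivative_compose[OF T1 has_derivative_wirtinger[OF f]])
  have sq: "?T' * cnj ?T' = of_real ((cmod ?T')\<^sup>2)" by (rule complex_norm_square[symmetric])
  {
    assume g: "\<And>v. v \<in> S \<Longrightarrow> g v = deriv T v * f (T v)"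
    have "((\<lambda>v. deriv T v * f (T v)) has_derivative
       (\<lambda>h. ?T' * (wd f (T w) * (?T' * h) + wdbar f (T w) * cnj (?T' * h)) + ?T'' * h * f (T w))) (at w)"
      by (rule has_derivative_mult[OF T2 c])
    then have "(g has_derivative
       (\<lambda>h. ?T' * (wd f (T w) * (?T' * h) + wdbar f (T w) * cnj (?T' * h)) + ?T'' * h * f (T w))) (at w)"
      by (rule has_derivative_transform_within_open[OF _ S]) (simp add: g)
    then have "(g has_derivative
       (\<lambda>h. (?T' * ?T' * wd f (T w) + ?T'' * f (T w)) * h + (?T' * cnj ?T') * wdbar f (T w) * cnj h)) (at w)"
      by (rule has_derivative_eq_rhs) (auto simp: algebra_simps)
    from wirtinger_unique(2)[OF this] show "wdbar g w = of_real ((cmod ?T')\<^sup>2) * wdbar f (T w)"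
      unfolding sq .
  }
  {
    assume g: "\<And>v. v \<in> S \<Longrightarrow> g v = cnj (deriv T v) * f (T v)"
    have T3: "((\<lambda>v. cnj (deriv T v)) has_derivative (\<lambda>h. cnj (?T'' * h))) (at w)"
      by (rule bounded_linear.has_derivative[OF bounded_linear_cnj T2])
    have "((\<lambda>v. cnj (deriv T v) * f (T v)) has_derivative
       (\<lambda>h. cnj ?T' * (wd f (T w) * (?T' * h) + wdbar f (T w) * cnj (?T' * h)) + cnj (?T'' * h) * f (T w))) (at w)"
      by (rule has_derivative_mult[OF T3 c])
    then have "(g has_derivative
       (\<lambda>h. cnj ?T' * (wd f (T w) * (?T' * h) + wdbar f (T w) * cnj (?T' * h)) + cnj (?T'' * h) * f (T w))) (at w)"
      by (rule has_derivative_transform_within_open[OF _ S]) (simp add: g)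
    then have "(g has_derivative
       (\<lambda>h. (?T' * cnj ?T') * wd f (T w) * h + (cnj ?T' * cnj ?T' * wdbar f (T w) + cnj ?T'' * f (T w)) * cnj h)) (at w)"
      by (rule has_derivative_eq_rhs) (auto simp: algebra_simps)
    from wirtinger_unique(1)[OF this] show "wd g w = of_real ((cmod ?T')\<^sup>2) * wd f (T w)"
      unfolding sq .
  }
qed

text \<open>
  The form \<open>a dz + b d\<close>\<open>z\<close>-bar, smooth outside the finite set \<open>D\<close>; its values on \<open>D\<close> are meaningless.
\<close>

definition one_form ::
  "'x::topological_space chart set \<Rightarrow> 'x set \<Rightarrow> ('x chart \<Rightarrow> 'x \<Rightarrow> complex) \<Rightarrow> ('x chart \<Rightarrow> 'x \<Rightarrow> complex) \<Rightarrow> bool" where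
  "one_form At D a b \<longleftrightarrow> finite D \<and>
     (\<forall>c\<in>At. \<forall>c'\<in>At. \<forall>x\<in>fst c \<inter> fst c' - D.
        a c' x = jac c c' x * a c x \<and> b c' x = cnj (jac c c' x) * b c x) \<and>
     (\<forall>c\<in>At. smooth_on (snd c ` (fst c - D)) (\<lambda>w. a c (chart_inv c w)) \<and>
        smooth_on (snd c ` (fst c - D)) (\<lambda>w. b c (chart_inv c w)))"

text \<open>
  The condition at a singular point under which it does not contribute to Stokes' theorem.
\<close>

definition locally_integrable ::
  "'x::topological_space chart set \<Rightarrow> ('x chart \<Rightarrow> 'x \<Rightarrow> complex) \<Rightarrow> ('x chart \<Rightarrow> 'x \<Rightarrow> complex) \<Rightarrow> 'x \<Rightarrow> bool" where
  "locally_integrable At a b x \<longleftrightarrow> (\<exists>c\<in>At. \<exists>N. open N \<and> x \<in> N \<and> N \<subseteq> fst c \<and>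
     (\<forall>f\<in>{\<lambda>w. a c (chart_inv c w), \<lambda>w. b c (chart_inv c w)}. set_integrable lborel (snd c ` N) f \<and>
        (\<forall>v\<in>{1, \<i>}. set_integrable lborel (snd c ` N) (pdiff v f))))"

text \<open>The exterior derivative, set to zero at the singular points.\<close>

definition dform ::
  "'x set \<Rightarrow> ('x chart \<Rightarrow> 'x \<Rightarrow> complex) \<Rightarrow> ('x chart \<Rightarrow> 'x \<Rightarrow> complex) \<Rightarrow> 'x chart \<Rightarrow> 'x \<Rightarrow> complex" where
  "dform D a b c x = (if x \<in> D then 0 else
     wd (\<lambda>w. b c (chart_inv c w)) (snd c x) - wdbar (\<lambda>w. a c (chart_inv c w)) (snd c x))"

lemma chart_image_minus_finite:
  fixes D :: "'x::t2_space set"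
  assumes "is_chart c" "finite D" "open U" "U \<subseteq> fst c"
  shows "open (snd c ` (U - D))"
proof -
  have "open (U - D)" using assms finite_imp_closed by blast
  from chart_image_open[OF assms(1) this] assms(4) show ?thesis by (simp add: inf.absorb2 Diff_subset subset_trans[OF Diff_subset])
qed

lemma smooth_on_differentiable_at: "open S \<Longrightarrow> smooth_on S f \<Longrightarrow> w \<in> S \<Longrightarrow> f differentiable (at w)"
  using smooth_on_differentiable differentiable_on_eq_differentiable_at by blast

lemma dform_transform:
  fixes At :: "'x::t2_space chart set"
  assumes At: "compact_riemann_surface At" and ab: "one_form At D a b" and c: "c \<in> At" "c' \<in> At"
    and x: "x \<in> fst c \<inter> fst c'"
  shows "dform D a b c' x = of_real ((cmod (jac c c' x))\<^sup>2) * dform D a b c x"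
proof (cases "x \<in> D")
  case False
  note ch = atlas_chart[OF At c(1)] and ch' = atlas_chart[OF At c(2)]
  have D: "finite D" using ab unfolding one_form_def by blast
  let ?U = "fst c \<inter> fst c' - D"
  let ?S = "snd c' ` ?U" and ?T = "snd c \<circ> chart_inv c'" and ?w = "snd c' x"
  have S: "open ?S" "?w \<in> ?S"
    using chart_image_minus_finite[OF ch' D, of "fst c \<inter> fst c'"] chart_continuous(3)[OF ch] chart_continuous(3)[OF ch'] x False by auto
  have T: "?T holomorphic_on ?S"
    by (rule holomorphic_on_subset[OF transition_holomorphic[OF At c(2,1)]]) blast
  have Tw: "?T ?w = snd c x" using chart_inv_left[OF ch'] x by simp
  have inS: "chart_inv c' v \<in> ?U" "v \<in> snd c' ` fst c'" "chart_inv c (?T v) = chart_inv c' v" if "v \<in> ?S" for v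
    using that chart_inv_left[OF ch'] chart_inv_left[OF ch] by auto
  have o: "open (snd c ` (fst c - D))" by (rule chart_image_minus_finite[OF ch D chart_continuous(3)[OF ch] order_refl])
  have sm: "smooth_on (snd c ` (fst c - D)) (\<lambda>w. a c (chart_inv c w))" "smooth_on (snd c ` (fst c - D)) (\<lambda>w. b c (chart_inv c w))"
    using ab c unfolding one_form_def by blast+
  have d: "(\<lambda>w. a c (chart_inv c w)) differentiable (at (?T ?w))" "(\<lambda>w. b c (chart_inv c w)) differentiable (at (?T ?w))"
    unfolding Tw using smooth_on_differentiable_at[OF o] sm x False by auto
  have jac: "deriv ?T v = jac c c' (chart_inv c' v)" if "v \<in> ?S" for v
    by (rule transition_deriv[OF inS(2)[OF that]])
  have tr: "a c' y = jac c c' y * a c y \<and> b c' y = cnj (jac c c' y) * b c y" if "y \<in> ?U" for y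
    using ab c that unfolding one_form_def by blast
  have ga: "a c' (chart_inv c' v) = deriv ?T v * a c (chart_inv c (?T v))" if "v \<in> ?S" for v
    using tr[OF inS(1)[OF that]] jac[OF that] inS(3)[OF that] by simp
  have gb: "b c' (chart_inv c' v) = cnj (deriv ?T v) * b c (chart_inv c (?T v))" if "v \<in> ?S" for v
    using tr[OF inS(1)[OF that]] jac[OF that] inS(3)[OF that] by simp
  have dT: "deriv ?T ?w = jac c c' x" using jac[OF S(2)] chart_inv_left[OF ch'] x by simp
  have A: "wdbar (\<lambda>w. a c' (chart_inv c' w)) ?w = of_real ((cmod (jac c c' x))\<^sup>2) * wdbar (\<lambda>w. a c (chart_inv c w)) (snd c x)"
    using wirtinger_pullback(1)[OF S T d(1), of "\<lambda>w. a c' (chart_inv c' w)", OF ga] unfolding dT Tw .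
  have B: "wd (\<lambda>w. b c' (chart_inv c' w)) ?w = of_real ((cmod (jac c c' x))\<^sup>2) * wd (\<lambda>w. b c (chart_inv c w)) (snd c x)"
    using wirtinger_pullback(2)[OF S T d(2), of "\<lambda>w. b c' (chart_inv c' w)", OF gb] unfolding dT Tw .
  show ?thesis unfolding dform_def using False by (simp only: if_False A B right_diff_distrib)
qed (simp add: dform_def)

lemma surf_smooth_chart:
  "surf_smooth_on At UNIV \<rho> \<Longrightarrow> c \<in> At \<Longrightarrow> smooth_on (snd c ` fst c) (\<lambda>w. \<rho> (chart_inv c w))"
  unfolding surf_smooth_on_def o_def by fastforce

lemma one_form_scale:
  fixes At :: "'x::t2_space chart set"
  assumes At: "compact_riemann_surface At" and ab: "one_form At D a b" and \<rho>: "surf_smooth_on At UNIV (\<rho> :: 'x \<Rightarrow> real)"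
  shows "one_form At D (\<lambda>c x. \<rho> x *\<^sub>R a c x) (\<lambda>c x. \<rho> x *\<^sub>R b c x)"
proof -
  have D: "finite D" using ab unfolding one_form_def by blast
  have "smooth_on (snd c ` (fst c - D)) (\<lambda>w. \<rho> (chart_inv c w) *\<^sub>R f c (chart_inv c w))"
    if c: "c \<in> At" and f: "f \<in> {a, b}" for c f
  proof -
    note ch = atlas_chart[OF At c]
    have "smooth_on (snd c ` (fst c - D)) (\<lambda>w. \<rho> (chart_inv c w))"
      by (rule smooth_on_subset[OF surf_smooth_chart[OF \<rho> c]]) blast
    moreover have "smooth_on (snd c ` (fst c - D)) (\<lambda>w. f c (chart_inv c w))"
      using ab c f unfolding one_form_def by blast
    ultimately show ?thesis
      by (intro smooth_on_bilinear[OF bounded_bilinear_scaleR] chart_image_minus_finite[OF ch D chart_continuous(3)[OF ch] order_refl])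
  qed
  moreover have "\<rho> x *\<^sub>R a c' x = jac c c' x * (\<rho> x *\<^sub>R a c x) \<and> \<rho> x *\<^sub>R b c' x = cnj (jac c c' x) * (\<rho> x *\<^sub>R b c x)"
    if "c \<in> At" "c' \<in> At" "x \<in> fst c \<inter> fst c' - D" for c c' x
  proof -
    have "a c' x = jac c c' x * a c x" "b c' x = cnj (jac c c' x) * b c x"
      using ab that unfolding one_form_def by blast+
    then show ?thesis by (simp only: mult_scaleR_right)
  qed
  ultimately show ?thesis using D unfolding one_form_def by blast
qed

lemma chart_ball_nbhd:
  assumes ch: "is_chart c" and M: "open M" "x \<in> M" "M \<subseteq> fst c"
  obtains r N where "r > 0" "cball (snd c x) r \<subseteq> snd c ` M" "open N" "x \<in> N" "N \<subseteq> M"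
    "snd c ` N = ball (snd c x) r"
proof -
  have "open (snd c ` M)" using chart_image_open[OF ch M(1)] M(3) by (simp add: inf.absorb2)
  then obtain r where r: "r > 0" "cball (snd c x) r \<subseteq> snd c ` M" using M(2) open_contains_cball by (metis image_eqI)
  let ?N = "fst c \<inter> snd c -` ball (snd c x) r"
  have sub: "ball (snd c x) r \<subseteq> snd c ` M" using r(2) ball_subset_cball by blast
  have "open ?N" using continuous_open_preimage[OF chart_continuous(1,3)[OF ch] open_ball] .
  moreover have "x \<in> ?N" using M r by auto
  moreover have "?N \<subseteq> M"
  proof
    fix y assume y: "y \<in> ?N"
    then obtain m where m: "m \<in> M" "snd c y = snd c m" using sub by blast
    then have "y = m" using chart_inv_left[OF ch] y M(3) by (metis IntD1 subsetD)
    then show "y \<in> M" using m by simp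
  qed
  moreover have "snd c ` ?N = ball (snd c x) r" using sub M(3) by blast
  ultimately show ?thesis using that r by blast
qed

lemma locally_integrable_regular:
  fixes At :: "'x::t2_space chart set"
  assumes At: "compact_riemann_surface At" and ab: "one_form At D a b" and x: "x \<notin> D"
  shows "locally_integrable At a b x"
proof -
  have D: "finite D" using ab unfolding one_form_def by blast
  obtain c where c: "c \<in> At" "x \<in> fst c" using At unfolding compact_riemann_surface_def by blast
  note ch = atlas_chart[OF At c(1)]
  have M: "open (fst c - D)" using chart_continuous(3)[OF ch] D finite_imp_closed by blast
  obtain r N where N: "r > 0" "cball (snd c x) r \<subseteq> snd c ` (fst c - D)" "open N" "x \<in> N" "N \<subseteq> fst c - D"
    "snd c ` N = ball (snd c x) r"
    by (rule chart_ball_nbhd[OF ch M, of x]) (use c x in auto)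
  have cont: "set_integrable lborel (snd c ` N) f" if "smooth_on (snd c ` (fst c - D)) f" for f :: "complex \<Rightarrow> complex"
  proof -
    have "continuous_on (cball (snd c x) r) f" using smooth_on_continuous[OF that] continuous_on_subset N(2) by blast
    then have "set_integrable lborel (cball (snd c x) r) f"
      unfolding set_integrable_def by (intro borel_integrable_compact) auto
    then show ?thesis unfolding N(6) by (rule set_integrable_subset) (auto intro: ball_subset_cball)
  qed
  have "smooth_on (snd c ` (fst c - D)) f" if "f \<in> {\<lambda>w. a c (chart_inv c w), \<lambda>w. b c (chart_inv c w)}" for f
    using ab c that unfolding one_form_def by blast
  then show ?thesis unfolding locally_integrable_def
    using N c cont smooth_on_pdiff by (intro bexI[of _ c] exI[of _ N]) blast+
qed

lemma pdiff_scaleR: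
  fixes f :: "complex \<Rightarrow> complex" and r :: "complex \<Rightarrow> real"
  assumes "open S" "smooth_on S r" "smooth_on S f" "w \<in> S"
  shows "pdiff 1 (\<lambda>w. r w *\<^sub>R f w) w = r w *\<^sub>R pdiff 1 f w + pdiff 1 r w *\<^sub>R f w"
    "pdiff \<i> (\<lambda>w. r w *\<^sub>R f w) w = r w *\<^sub>R pdiff \<i> f w + pdiff \<i> r w *\<^sub>R f w"
  using has_partials_eq[OF has_partials_bilinear[OF bounded_bilinear_scaleR
      has_partials_pdiff[OF assms(1) smooth_on_differentiable[OF assms(2)]]
      has_partials_pdiff[OF assms(1) smooth_on_differentiable[OF assms(3)]]] assms(4)]
  by simp_all

text \<open>
  The derivative of \<open>\<rho> \<cdot> f\<close> is \<open>\<rho>\<close> times a derivative of \<open>f\<close> plus \<open>f\<close> times a derivative of \<open>\<rho>\<close>, where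
  \<open>\<rho>\<close> and its derivatives are bounded near \<open>x\<close>.
\<close>

lemma two_form_dform:
  fixes At :: "'x::t2_space chart set"
  assumes At: "compact_riemann_surface At" and ab: "one_form At D a b" and li: "\<And>x. locally_integrable At a b x"
    and \<rho>: "surf_smooth_on At UNIV (\<rho> :: 'x \<Rightarrow> real)"
  shows "two_form At (dform D (\<lambda>c x. \<rho> x *\<^sub>R a c x) (\<lambda>c x. \<rho> x *\<^sub>R b c x))"
  unfolding two_form_def
proof (intro conjI ballI allI)
  fix c c' x assume "c \<in> At" "c' \<in> At" "x \<in> fst c \<inter> fst c'"
  then show "dform D (\<lambda>c x. \<rho> x *\<^sub>R a c x) (\<lambda>c x. \<rho> x *\<^sub>R b c x) c' x
     = of_real ((cmod (jac c c' x))\<^sup>2) * dform D (\<lambda>c x. \<rho> x *\<^sub>R a c x) (\<lambda>c x. \<rho> x *\<^sub>R b c x) c x"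
    by (rule dform_transform[OF At one_form_scale[OF At ab \<rho>]])
next
  fix x
  have D: "finite D" using ab unfolding one_form_def by blast
  obtain c M where c: "c \<in> At" and M: "open M" "x \<in> M" "M \<subseteq> fst c" and
    i: "\<And>f. f \<in> {\<lambda>w. a c (chart_inv c w), \<lambda>w. b c (chart_inv c w)} \<Longrightarrow> set_integrable lborel (snd c ` M) f \<and>
        (\<forall>v\<in>{1, \<i>}. set_integrable lborel (snd c ` M) (pdiff v f))"
    using li[of x] unfolding locally_integrable_def by blast
  note ch = atlas_chart[OF At c]
  obtain r N where N: "r > 0" "cball (snd c x) r \<subseteq> snd c ` M" "open N" "x \<in> N" "N \<subseteq> M"
    "snd c ` N = ball (snd c x) r"
    by (rule chart_ball_nbhd[OF ch M])
  let ?r = "\<lambda>w. \<rho> (chart_inv c w)"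
  let ?D = "snd c ` (D \<inter> fst c)"
  let ?S = "snd c ` (fst c - D)"
  let ?G = "\<lambda>v f w. ?r w *\<^sub>R pdiff v f w + pdiff v ?r w *\<^sub>R f w"
  have Dsets: "?D \<in> sets borel" using D by (intro borel_closed finite_imp_closed) auto
  have cb: "cball (snd c x) r \<subseteq> snd c ` fst c" using N(2) M(3) by blast
  have rs: "smooth_on (snd c ` fst c) ?r" by (rule surf_smooth_chart[OF \<rho> c])
  have rc: "continuous_on (cball (snd c x) r) ?r" "\<And>v. v \<in> {1, \<i>} \<Longrightarrow> continuous_on (cball (snd c x) r) (pdiff v ?r)"
    using continuous_on_subset[OF smooth_on_continuous[OF rs] cb]
      continuous_on_subset[OF smooth_on_continuous[OF smooth_on_pdiff[OF rs]] cb] by auto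
  have G: "set_integrable lborel (ball (snd c x) r - ?D) (?G v f)"
    if "f \<in> {\<lambda>w. a c (chart_inv c w), \<lambda>w. b c (chart_inv c w)}" "v \<in> {1, \<i>}" for f v
  proof -
    have "set_integrable lborel (cball (snd c x) r) f" "set_integrable lborel (cball (snd c x) r) (pdiff v f)"
      using i[OF that(1)] that(2) N(2) by (auto intro: set_integrable_subset)
    then have "set_integrable lborel (cball (snd c x) r) (?G v f)"
      using rc(1) rc(2)[OF that(2)] by (intro set_integral_add(1) set_integrable_scaleR_compact) auto
    then show ?thesis
      by (rule set_integrable_subset) (use Dsets in \<open>auto intro: sets.Diff\<close>)
  qed
  have oS: "open ?S" by (rule chart_image_minus_finite[OF ch D chart_continuous(3)[OF ch] order_refl])
  have sm: "smooth_on ?S ?r" "smooth_on ?S (\<lambda>w. a c (chart_inv c w))" "smooth_on ?S (\<lambda>w. b c (chart_inv c w))"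
    using smooth_on_subset[OF rs, of ?S] ab c unfolding one_form_def by auto
  let ?H = "\<lambda>w. (?G 1 (\<lambda>w. b c (chart_inv c w)) w - \<i> * ?G \<i> (\<lambda>w. b c (chart_inv c w)) w) / 2
      - (?G 1 (\<lambda>w. a c (chart_inv c w)) w + \<i> * ?G \<i> (\<lambda>w. a c (chart_inv c w)) w) / 2"
  let ?\<Xi> = "\<lambda>w. dform D (\<lambda>c x. \<rho> x *\<^sub>R a c x) (\<lambda>c x. \<rho> x *\<^sub>R b c x) c (chart_inv c w)"
  have eq: "?\<Xi> w = ?H w" if w: "w \<in> ball (snd c x) r - ?D" for w
  proof -
    have w': "w \<in> snd c ` fst c" using w cb by auto
    then have y: "chart_inv c w \<in> fst c" "snd c (chart_inv c w) = w" using chart_inv_mem chart_inv_right by blast+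
    then have "chart_inv c w \<notin> D" using w by force
    then have "w \<in> ?S" using y by force
    note p = pdiff_scaleR[OF oS sm(1) sm(2) this] pdiff_scaleR[OF oS sm(1) sm(3) this]
    show ?thesis using \<open>chart_inv c w \<notin> D\<close> unfolding dform_def wd_def wdbar_def y(2) p by simp
  qed
  have "set_integrable lborel (ball (snd c x) r - ?D) ?H"
    by (intro set_integral_diff(1) set_integral_add(1) set_integrable_divide set_integrable_mult_right G) auto
  then have "set_integrable lborel (ball (snd c x) r - ?D) ?\<Xi>"
    using eq by (subst set_integrable_cong[OF refl refl]) auto
  moreover have "?\<Xi> w = 0" if "w \<in> ?D" for w
    using that chart_inv_left[OF ch] unfolding dform_def by auto
  ultimately have "set_integrable lborel (snd c ` N) ?\<Xi>"
    unfolding N(6) using set_integral_eq_if_zero_outside(1)[of "ball (snd c x) r" "ball (snd c x) r - ?D" ?\<Xi> lborel] by blast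
  then show "\<exists>c\<in>At. \<exists>N. open N \<and> x \<in> N \<and> N \<subseteq> fst c \<and> set_integrable lborel (snd c ` N)
      (dform D (\<lambda>c x. \<rho> x *\<^sub>R a c x) (\<lambda>c x. \<rho> x *\<^sub>R b c x) c \<circ> chart_inv c)"
    using c N(3,4,5) M(3) by (intro bexI[of _ c] exI[of _ N]) (auto simp: o_def)
qed

text \<open>
  The cutoff allows to extend the coefficients by zero to the whole plane, where partial derivatives
  of functions with bounded support integrate to zero.
\<close>

lemma integral_dform_in_chart:
  fixes At :: "'x::t2_space chart set"
  assumes At: "compact_riemann_surface At" and ab: "one_form At D a b" and \<rho>: "surf_smooth_on At UNIV (\<rho> :: 'x \<Rightarrow> real)"
    and c: "c \<in> At" and K: "compact K" "{x. \<rho> x \<noteq> 0} \<subseteq> K" "K \<subseteq> N" "N \<subseteq> fst c"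
    and i: "\<And>f. f \<in> {\<lambda>w. a c (chart_inv c w), \<lambda>w. b c (chart_inv c w)} \<Longrightarrow> set_integrable lborel (snd c ` N) f \<and>
        (\<forall>v\<in>{1, \<i>}. set_integrable lborel (snd c ` N) (pdiff v f))"
  shows "(LINT w : snd c ` fst c | lborel. dform D (\<lambda>c x. \<rho> x *\<^sub>R a c x) (\<lambda>c x. \<rho> x *\<^sub>R b c x) c (chart_inv c w)) = 0"
proof -
  note ch = atlas_chart[OF At c]
  have D: "finite D" using ab unfolding one_form_def by blast
  let ?I = "snd c ` fst c"
  let ?r = "\<lambda>w. \<rho> (chart_inv c w)"
  let ?D = "snd c ` (D \<inter> fst c)"
  let ?S = "snd c ` (fst c - D)"
  let ?K = "snd c ` K"
  \<comment> \<open>The partial derivatives of the extended coefficient \<open>?u f\<close>, set to zero at the singular points,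
    where \<open>pdiff\<close> has no meaning.\<close>
  let ?G = "\<lambda>v f w. if w \<in> ?K - ?D then ?r w *\<^sub>R pdiff v f w + pdiff v ?r w *\<^sub>R f w else 0"
  let ?u = "\<lambda>f w. if w \<in> ?I then ?r w *\<^sub>R f w else 0"
  have Dsets: "?D \<in> sets borel" using D by (intro borel_closed finite_imp_closed) auto
  have cK: "compact ?K"
    by (intro compact_continuous_image K continuous_on_subset[OF chart_continuous(1)[OF ch]]) (use K in blast)
  have KI: "?K \<subseteq> ?I" using K by blast
  have rs: "smooth_on ?I ?r" by (rule surf_smooth_chart[OF \<rho> c])
  have rc: "continuous_on ?K ?r" "\<And>v. v \<in> {1, \<i>} \<Longrightarrow> continuous_on ?K (pdiff v ?r)"
    using continuous_on_subset[OF smooth_on_continuous[OF rs] KI]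
      continuous_on_subset[OF smooth_on_continuous[OF smooth_on_pdiff[OF rs]] KI] by auto
  have oS: "open ?S" by (rule chart_image_minus_finite[OF ch D chart_continuous(3)[OF ch] order_refl])
  have oI: "open ?I" using chart_continuous(4)[OF ch] .
  have sm: "smooth_on ?S ?r" using smooth_on_subset[OF rs, of ?S] by auto
  have smf: "smooth_on ?S f" if "f \<in> {\<lambda>w. a c (chart_inv c w), \<lambda>w. b c (chart_inv c w)}" for f
    using ab c that unfolding one_form_def by blast
  have inS: "w \<in> ?S" if "w \<in> ?I" "w \<notin> ?D" for w using that by blast
  have r0: "?r w = 0" if "w \<in> ?I - ?K" for w
  proof (rule ccontr)
    assume "?r w \<noteq> 0"
    then have "chart_inv c w \<in> K" using K(2) by blast
    moreover have "snd c (chart_inv c w) = w" using chart_inv_right that by blast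
    ultimately show False using that by (metis DiffD2 image_eqI)
  qed
  have closedK: "closed ?K" using cK compact_imp_closed by blast
  have hp: "has_partials (- ?D) (?u f) (?G 1 f) (?G \<i> f)"
    if f: "f \<in> {\<lambda>w. a c (chart_inv c w), \<lambda>w. b c (chart_inv c w)}" for f
    unfolding has_partials_def
  proof
    fix w assume w: "w \<in> - ?D"
    show "(?u f has_derivative (\<lambda>v. Re v *\<^sub>R ?G 1 f w + Im v *\<^sub>R ?G \<i> f w)) (at w)"
    proof (cases "w \<in> ?K")
      case True
      then have wS: "w \<in> ?S" using inS w KI by blast
      have "((\<lambda>w. ?r w *\<^sub>R f w) has_derivative (\<lambda>v. Re v *\<^sub>R (?r w *\<^sub>R pdiff 1 f w + pdiff 1 ?r w *\<^sub>R f w)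
         + Im v *\<^sub>R (?r w *\<^sub>R pdiff \<i> f w + pdiff \<i> ?r w *\<^sub>R f w))) (at w)"
        using has_partials_bilinear[OF bounded_bilinear_scaleR
            has_partials_pdiff[OF oS smooth_on_differentiable[OF sm]]
            has_partials_pdiff[OF oS smooth_on_differentiable[OF smf[OF f]]]] wS
        unfolding has_partials_def by blast
      then have "(?u f has_derivative (\<lambda>v. Re v *\<^sub>R (?r w *\<^sub>R pdiff 1 f w + pdiff 1 ?r w *\<^sub>R f w)
         + Im v *\<^sub>R (?r w *\<^sub>R pdiff \<i> f w + pdiff \<i> ?r w *\<^sub>R f w))) (at w)"
        by (rule has_derivative_transform_within_open[OF _ oS wS]) auto
      then show ?thesis using True w by auto
    next
      case False
      have "(?u f has_derivative (\<lambda>v. 0)) (at w)"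
        by (rule has_derivative_transform_within_open[OF has_derivative_const[of 0], of "- ?K"])
          (use False closedK r0 in auto)
      then show ?thesis using False by auto
    qed
  qed
  have Gi: "integrable lborel (?G v f)"
    if f: "f \<in> {\<lambda>w. a c (chart_inv c w), \<lambda>w. b c (chart_inv c w)}" and v: "v \<in> {1, \<i>}" for f v
  proof -
    have "?K \<subseteq> snd c ` N" "?K \<in> sets lborel" using K closedK by auto
    then have "set_integrable lborel ?K f" "set_integrable lborel ?K (pdiff v f)"
      using i[OF f] v by (auto intro: set_integrable_subset)
    then have "set_integrable lborel ?K (\<lambda>w. ?r w *\<^sub>R pdiff v f w + pdiff v ?r w *\<^sub>R f w)"
      using rc(1) rc(2)[OF v] cK by (intro set_integral_add(1) set_integrable_scaleR_compact) auto
    then have "set_integrable lborel (?K - ?D) (\<lambda>w. ?r w *\<^sub>R pdiff v f w + pdiff v ?r w *\<^sub>R f w)"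
      by (rule set_integrable_subset) (use Dsets closedK in \<open>auto intro: sets.Diff\<close>)
    moreover have "(\<lambda>w. indicator (?K - ?D) w *\<^sub>R (?r w *\<^sub>R pdiff v f w + pdiff v ?r w *\<^sub>R f w)) = ?G v f"
      by (auto simp: fun_eq_iff indicator_def)
    ultimately show ?thesis unfolding set_integrable_def by simp
  qed
  obtain R where R: "\<And>w. w \<in> ?K \<Longrightarrow> norm w \<le> R" using compact_imp_bounded[OF cK] unfolding bounded_iff by blast
  have u0: "?u f w = 0" if "norm w > R" for f :: "complex \<Rightarrow> complex" and w
  proof -
    have "w \<notin> ?K" using R[of w] that by linarith
    then show ?thesis using r0[of w] by auto
  qed
  have finD: "finite ?D" using D by auto
  have I0: "integral\<^sup>L lborel (?G v f) = 0"
    if f: "f \<in> {\<lambda>w. a c (chart_inv c w), \<lambda>w. b c (chart_inv c w)}" and v: "v \<in> {1, \<i>}" for f v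
  proof -
    note ip = integral_partials_compact_support[where F="?D" and u="?u f" and ?u1.0="?G 1 f" and ?u2.0="?G \<i> f" and R=R, OF hp[OF f] finD]
    have z: "?u f w = 0" if "R < norm w" for w by (rule u0[OF that])
    show ?thesis
    proof (cases "v = 1")
      case True
      show ?thesis unfolding True
        by (rule ip(1)) (rule z, assumption, rule Gi[OF f insertI1])
    next
      case False
      then have v: "v = \<i>" using v by blast
      show ?thesis unfolding v
        by (rule ip(2)) (rule z, assumption, rule Gi[OF f insertI2[OF insertI1]])
    qed
  qed
  let ?fa = "\<lambda>w. a c (chart_inv c w)" and ?fb = "\<lambda>w. b c (chart_inv c w)"
  let ?H = "\<lambda>w. (?G 1 ?fb w - \<i> * ?G \<i> ?fb w) / 2 - (?G 1 ?fa w + \<i> * ?G \<i> ?fa w) / 2"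
  have eq: "dform D (\<lambda>c x. \<rho> x *\<^sub>R a c x) (\<lambda>c x. \<rho> x *\<^sub>R b c x) c (chart_inv c w) = ?H w" if w: "w \<in> ?I" for w
  proof (cases "w \<in> ?D")
    case True
    then show ?thesis using chart_inv_left[OF ch] unfolding dform_def by auto
  next
    case False
    have y: "chart_inv c w \<in> fst c" "snd c (chart_inv c w) = w" using w chart_inv_mem chart_inv_right by blast+
    then have nD: "chart_inv c w \<notin> D" using False by force
    have pd: "pdiff v (\<lambda>w. ?r w *\<^sub>R f w) w = ?G v f w"
      if f: "f \<in> {?fa, ?fb}" and v: "v \<in> {1, \<i>}" for f v
    proof -
      have "frechet_derivative (\<lambda>w. ?r w *\<^sub>R f w) (at w) = frechet_derivative (?u f) (at w)"
        by (rule pdiff_cong[OF oI _ w]) auto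
      then show ?thesis using has_partials_eq[OF hp[OF f], of w] False v by auto
    qed
    show ?thesis using nD unfolding dform_def wd_def wdbar_def y(2)
      using pd[of ?fa] pd[of ?fb] by simp
  qed
  have "(LINT w : ?I | lborel. dform D (\<lambda>c x. \<rho> x *\<^sub>R a c x) (\<lambda>c x. \<rho> x *\<^sub>R b c x) c (chart_inv c w)) = (LINT w : ?I | lborel. ?H w)"
    using eq oI by (intro set_lebesgue_integral_cong) auto
  also have "\<dots> = integral\<^sup>L lborel ?H"
    unfolding set_lebesgue_integral_def using KI by (intro Bochner_Integration.integral_cong) (auto simp: indicator_def)
  also have "\<dots> = (integral\<^sup>L lborel (?G 1 ?fb) - \<i> * integral\<^sup>L lborel (?G \<i> ?fb)) / 2
      - (integral\<^sup>L lborel (?G 1 ?fa) + \<i> * integral\<^sup>L lborel (?G \<i> ?fa)) / 2"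
    using Gi[of ?fa 1] Gi[of ?fa \<i>] Gi[of ?fb 1] Gi[of ?fb \<i>]
    by (simp only: Bochner_Integration.integral_diff Bochner_Integration.integral_add integral_divide_zero integral_mult_right_zero
        Bochner_Integration.integrable_diff Bochner_Integration.integrable_add integrable_divide_zero integrable_mult_right insertI1 insertI2)
  also have "\<dots> = 0" using I0[of ?fa 1] I0[of ?fa \<i>] I0[of ?fb 1] I0[of ?fb \<i>] by (simp only: insertI1 insertI2) simp
  finally show ?thesis .
qed

lemma two_form_zero: "compact_riemann_surface At \<Longrightarrow> two_form At (\<lambda>c x. 0)"
  unfolding two_form_def compact_riemann_surface_def
  by (auto simp: o_def set_integrable_def is_chart_def) (metis UNIV_I UN_E fst_conv order_refl prod.collapse)

lemma surf_integral_sum: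
  fixes At :: "'x::t2_space chart set"
  assumes At: "compact_riemann_surface At" and "finite I" "\<And>i. i \<in> I \<Longrightarrow> two_form At (\<Theta> i)"
  shows "two_form At (\<lambda>c x. \<Sum>i\<in>I. \<Theta> i c x) \<and>
    surf_integral At (\<lambda>c x. \<Sum>i\<in>I. \<Theta> i c x) = (\<Sum>i\<in>I. surf_integral At (\<Theta> i))"
  using assms(2,3)
proof (induction I)
  case empty
  show ?case using two_form_zero[OF At] surf_integral_add[OF At two_form_zero[OF At] two_form_zero[OF At]] by simp
next
  case (insert i I)
  then show ?case
    using two_form_add[OF At, of "\<Theta> i" "\<lambda>c x. \<Sum>i\<in>I. \<Theta> i c x"] surf_integral_add[OF At, of "\<Theta> i" "\<lambda>c x. \<Sum>i\<in>I. \<Theta> i c x"]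
    by simp
qed

lemma pdiff_sum:
  assumes "\<And>k. k \<in> I \<Longrightarrow> f k differentiable (at w)"
  shows "pdiff v (\<lambda>w. \<Sum>k\<in>I. f k w) w = (\<Sum>k\<in>I. pdiff v (f k) w)"
proof -
  have "((\<lambda>w. \<Sum>k\<in>I. f k w) has_derivative (\<lambda>h. \<Sum>k\<in>I. frechet_derivative (f k) (at w) h)) (at w)"
    using assms frechet_derivative_works by (intro has_derivative_sum) blast
  from frechet_derivative_at[OF this, symmetric] show ?thesis by simp
qed

text \<open>
  A partition of unity subordinate to sets on which the coefficients and their derivatives are
  integrable splits the form into pieces supported in single charts; the exterior derivatives of the
  pieces add up to that of the form.
\<close>

theorem stokes:
  fixes At :: "'x::t2_space chart set"
  assumes At: "compact_riemann_surface At" and ab: "one_form At D a b"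
    and sing: "\<And>x. x \<in> D \<Longrightarrow> locally_integrable At a b x"
  shows "two_form At (dform D a b)" "surf_integral At (dform D a b) = 0"
proof -
  have li: "locally_integrable At a b x" for x
    using sing locally_integrable_regular[OF At ab] by blast
  have D: "finite D" using ab unfolding one_form_def by blast
  obtain c N where c: "\<And>x. c x \<in> At" "\<And>x. open (N x)" "\<And>x. x \<in> N x" "\<And>x. N x \<subseteq> fst (c x)" and
    i: "\<And>x f. f \<in> {\<lambda>w. a (c x) (chart_inv (c x) w), \<lambda>w. b (c x) (chart_inv (c x) w)} \<Longrightarrow>
        set_integrable lborel (snd (c x) ` N x) f \<and>
        (\<forall>v\<in>{1, \<i>}. set_integrable lborel (snd (c x) ` N x) (pdiff v f))"
    using li unfolding locally_integrable_def by metis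
  have "\<exists>n c' \<rho>. partition_of_unity At n c' \<rho> \<and> (\<forall>i<n. \<exists>x. c' i = c x \<and> closure {y. \<rho> i y \<noteq> 0} \<subseteq> N x)"
    by (rule partition_of_unity_exists[OF At c]) blast
  then obtain n c' \<rho> where pou: "partition_of_unity At n c' \<rho>"
    and sub: "\<And>i. i < n \<Longrightarrow> \<exists>x. c' i = c x \<and> closure {y. \<rho> i y \<noteq> 0} \<subseteq> N x"
    by blast
  have \<rho>: "surf_smooth_on At UNIV (\<rho> k)" if "k < n" for k
    using partition_of_unity_props(5)[OF At pou that] .
  define \<Xi> where "\<Xi> k = dform D (\<lambda>c x. \<rho> k x *\<^sub>R a c x) (\<lambda>c x. \<rho> k x *\<^sub>R b c x)" for k
  have tf: "two_form At (\<Xi> k)" if "k < n" for k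
    unfolding \<Xi>_def by (rule two_form_dform[OF At ab li \<rho>[OF that]])
  have sum1: "(\<Sum>k<n. \<rho> k x) = 1" for x using pou unfolding partition_of_unity_def by blast
  have eq: "dform D a b d x = (\<Sum>k<n. \<Xi> k d x)" if d: "d \<in> At" "x \<in> fst d" for d x
  proof (cases "x \<in> D")
    case True then show ?thesis unfolding \<Xi>_def dform_def by simp
  next
    case False
    note ch = atlas_chart[OF At d(1)]
    have oS: "open (snd d ` (fst d - D))" by (rule chart_image_minus_finite[OF ch D chart_continuous(3)[OF ch] order_refl])
    have wS: "snd d x \<in> snd d ` (fst d - D)" using d False by blast
    have s: "smooth_on (snd d ` (fst d - D)) (\<lambda>w. \<rho> k (chart_inv d w) *\<^sub>R a d (chart_inv d w))"
      "smooth_on (snd d ` (fst d - D)) (\<lambda>w. \<rho> k (chart_inv d w) *\<^sub>R b d (chart_inv d w))" if "k < n" for k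
      using one_form_scale[OF At ab \<rho>[OF that]] d(1) unfolding one_form_def by blast+
    have pd: "pdiff v (\<lambda>w. f (chart_inv d w)) (snd d x) = (\<Sum>k<n. pdiff v (\<lambda>w. \<rho> k (chart_inv d w) *\<^sub>R f (chart_inv d w)) (snd d x))"
      if "\<And>k. k < n \<Longrightarrow> smooth_on (snd d ` (fst d - D)) (\<lambda>w. \<rho> k (chart_inv d w) *\<^sub>R f (chart_inv d w))" for v f
    proof -
      have "(\<lambda>w. f (chart_inv d w)) = (\<lambda>w. \<Sum>k<n. \<rho> k (chart_inv d w) *\<^sub>R f (chart_inv d w))"
        unfolding scaleR_sum_left[symmetric] sum1 by simp
      then show ?thesis
        using pdiff_sum[of "{..<n}" "\<lambda>k w. \<rho> k (chart_inv d w) *\<^sub>R f (chart_inv d w)" "snd d x" v]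
          smooth_on_differentiable_at[OF oS that wS] by simp
    qed
    show ?thesis using False unfolding \<Xi>_def dform_def wd_def wdbar_def
      using pd[of "a d"] pd[of "b d"] s
      by (simp add: sum_divide_distrib[symmetric] sum_subtractf sum.distrib sum_distrib_left)
  qed
  have "surf_smooth_on At UNIV (\<lambda>x. 1 :: real)"
    unfolding surf_smooth_on_def o_def
  proof
    fix c assume "c \<in> At"
    from smooth_on_const[OF chart_continuous(4)[OF atlas_chart[OF At this]]]
    show "smooth_on (snd c ` (fst c \<inter> UNIV)) (\<lambda>x. 1 :: real)" unfolding Int_UNIV_right .
  qed
  from two_form_dform[OF At ab li this] show "two_form At (dform D a b)" by simp
  have "surf_integral At (dform D a b) = surf_integral At (\<lambda>c x. \<Sum>k<n. \<Xi> k c x)"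
    by (rule surf_integral_cong[OF At eq])
  also have "\<dots> = (\<Sum>k<n. surf_integral At (\<Xi> k))"
    using surf_integral_sum[OF At, of "{..<n}" \<Xi>] tf by simp
  also have "\<dots> = (\<Sum>k<n. 0)"
  proof (rule sum.cong[OF refl])
    fix k assume "k \<in> {..<n}"
    then have k: "k < n" by simp
    obtain x where x: "c' k = c x" "closure {y. \<rho> k y \<noteq> 0} \<subseteq> N x" using sub[OF k] by blast
    let ?K = "closure {y. \<rho> k y \<noteq> 0}"
    have "compact (UNIV :: 'x set)" using At unfolding compact_riemann_surface_def by blast
    then have K: "compact ?K" using compact_Int_closed[of UNIV ?K] by auto
    have z: "\<Xi> k d y = 0" if "d \<in> At" "y \<in> fst d - ?K" for d y
    proof -
      note ch = atlas_chart[OF At that(1)]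
      let ?S = "snd d ` (fst d \<inter> - ?K)"
      have S: "open ?S" "snd d y \<in> ?S" using chart_image_open[OF ch, of "- ?K"] that by auto
      have "\<rho> k (chart_inv d w) = 0" if "w \<in> ?S" for w
        using that chart_inv_left[OF ch] closure_subset[of "{y. \<rho> k y \<noteq> 0}"] by auto
      then have "frechet_derivative (\<lambda>w. \<rho> k (chart_inv d w) *\<^sub>R f (chart_inv d w)) (at (snd d y)) = frechet_derivative (\<lambda>w. 0) (at (snd d y))" for f :: "'x \<Rightarrow> complex"
        by (intro pdiff_cong[OF S(1) _ S(2)]) auto
      then show ?thesis unfolding \<Xi>_def dform_def wd_def wdbar_def by simp
    qed
    have "surf_integral At (\<Xi> k) = - 2 * \<i> * (LINT w : snd (c x) ` fst (c x) | lborel. \<Xi> k (c x) (chart_inv (c x) w))"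
      by (rule surf_integral_single_chart[OF At tf[OF k] c(1) _ z, where K="?K"]) (use x c(4) in blast)
    also have "(LINT w : snd (c x) ` fst (c x) | lborel. \<Xi> k (c x) (chart_inv (c x) w)) = 0"
      unfolding \<Xi>_def
      by (rule integral_dform_in_chart[OF At ab \<rho>[OF k] c(1) K closure_subset x(2) c(4) i])
    finally show "surf_integral At (\<Xi> k) = 0" by simp
  qed
  finally show "surf_integral At (dform D a b) = 0" by simp
qed

section \<open>Wirtinger derivatives of matrix-valued functions\<close>

lemma smooth_on_matrix:
  fixes F :: "complex \<Rightarrow> 'n::finite cmat"
  assumes S: "open S" and F: "\<And>i j. smooth_on S (\<lambda>w. F w $ i $ j)"
  shows "smooth_on S F"
proof -
  have "smooth_on S (\<lambda>w. \<Sum>p\<in>UNIV. cscale (F w $ fst p $ snd p) (matrix_unit (fst p) (snd p)))"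
    by (intro smooth_on_sum[OF S] smooth_on_linear[OF S bounded_bilinear.bounded_linear_left[OF bounded_bilinear_cscale]] F)
  then show ?thesis using matrix_sum_units[of "F _"] by (simp flip: matrix_sum_units)
qed

lemma pdiff_entry:
  fixes F :: "complex \<Rightarrow> 'n::finite cmat"
  assumes "F differentiable (at w)"
  shows "pdiff v (\<lambda>w. F w $ i $ j) w = pdiff v F w $ i $ j"
proof -
  have "bounded_linear (\<lambda>X :: 'n cmat. X $ i $ j)"
    using bounded_linear_compose[OF bounded_linear_vec_nth bounded_linear_vec_nth] .
  from bounded_linear.has_derivative[OF this assms[unfolded frechet_derivative_works]]
  show ?thesis using frechet_derivative_at by metis
qed

lemma mat_holomorphic_smooth:
  assumes S: "open S" and F: "mat_holomorphic_on F S"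
  shows "smooth_on S F"
  using F unfolding mat_holomorphic_on_def by (intro smooth_on_matrix[OF S] smooth_on_holomorphic[OF S]) blast

lemma mat_holomorphic_wirtbar:
  assumes S: "open S" "w \<in> S" and F: "mat_holomorphic_on F S"
  shows "wirtbar F w = 0"
proof -
  have d: "F differentiable (at w)"
    using smooth_on_differentiable_at[OF S(1) mat_holomorphic_smooth[OF S(1) F] S(2)] .
  have "pdiff \<i> F w $ i $ j = \<i> * pdiff 1 F w $ i $ j" for i j
  proof -
    have "(\<lambda>w. F w $ i $ j) holomorphic_on S" using F unfolding mat_holomorphic_on_def by blast
    from has_partials_eq[OF has_partials_holomorphic[OF S(1) this] S(2)]
    show ?thesis unfolding pdiff_entry[OF d, symmetric] by simp
  qed
  then show ?thesis unfolding wirtbar_def by (simp add: vec_eq_iff cscale_def)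
qed

lemma pdiff_bilinear:
  assumes "bounded_bilinear bl" "f differentiable (at w)" "g differentiable (at w)"
  shows "pdiff v (\<lambda>w. bl (f w) (g w)) w = bl (f w) (pdiff v g w) + bl (pdiff v f w) (g w)"
  using frechet_derivative_at[OF bounded_bilinear.FDERIV[OF assms(1) assms(2,3)[unfolded frechet_derivative_works]]]
  by metis

lemma pdiff_add:
  assumes "f differentiable (at w)" "g differentiable (at w)"
  shows "pdiff v (\<lambda>w. f w + g w) w = pdiff v f w + pdiff v g w"
  using frechet_derivative_at[OF has_derivative_add[OF assms[unfolded frechet_derivative_works]]] by metis

lemma pdiff_linear:
  assumes "bounded_linear L" "f differentiable (at w)"
  shows "pdiff v (\<lambda>w. L (f w)) w = L (pdiff v f w)"
  using frechet_derivative_at[OF bounded_linear.has_derivative[OF assms(1) assms(2)[unfolded frechet_derivative_works]]] by metis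

lemma bounded_linear_cscale: "bounded_linear (cscale c :: 'n::finite cmat \<Rightarrow> 'n cmat)"
  by (rule bounded_bilinear.bounded_linear_right[OF bounded_bilinear_cscale])

lemma kill_diff: "kill G (X - Y) Z = kill G X Z - kill G Y Z" "kill G X (Y - Z) = kill G X Y - kill G X Z"
  using bounded_bilinear.diff_left[OF bounded_bilinear_kill] bounded_bilinear.diff_right[OF bounded_bilinear_kill] by blast+

lemma kill_minus: "kill G (- X) Z = - kill G X Z" "kill G X (- Y) = - kill G X Y"
  using bounded_bilinear.minus_left[OF bounded_bilinear_kill] bounded_bilinear.minus_right[OF bounded_bilinear_kill] by blast+

lemma kill_zero: "kill G 0 Z = 0" "kill G X 0 = 0"
  using bounded_bilinear.zero_left[OF bounded_bilinear_kill] bounded_bilinear.zero_right[OF bounded_bilinear_kill] by blast+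

lemma lie_diff: "lie (X - Y) Z = lie X Z - lie Y Z" "lie X (Y - Z) = lie X Y - lie X (Z :: 'n::finite cmat)"
  using bounded_bilinear.diff_left[OF bounded_bilinear_lie] bounded_bilinear.diff_right[OF bounded_bilinear_lie] by blast+

lemma wirtinger_kill:
  assumes "f differentiable (at w)" "g differentiable (at w)"
  shows "wd (\<lambda>w. kill G (f w) (g w)) w = kill G (wirt f w) (g w) + kill G (f w) (wirt g w)"
    "wdbar (\<lambda>w. kill G (f w) (g w)) w = kill G (wirtbar f w) (g w) + kill G (f w) (wirtbar g w)"
  unfolding wd_def wdbar_def wirt_def wirtbar_def pdiff_bilinear[OF bounded_bilinear_kill assms]
  by (simp_all add: kill_add kill_diff kill_cscale field_simps)

lemma wirtinger_lie:
  assumes "f differentiable (at w)" "g differentiable (at w)"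
  shows "wirt (\<lambda>w. lie (f w) (g w)) w = lie (wirt f w) (g w) + lie (f w) (wirt g w)"
    "wirtbar (\<lambda>w. lie (f w) (g w)) w = lie (wirtbar f w) (g w) + lie (f w) (wirtbar g w)"
  unfolding wirt_def wirtbar_def pdiff_bilinear[OF bounded_bilinear_lie assms] lie_add lie_diff lie_cscale
  by (simp_all add: vec_eq_iff cscale_def field_simps)

lemma wirtinger_matmul:
  assumes "f differentiable (at w)" "g differentiable (at w)"
  shows "wirt (\<lambda>w. f w ** g w) w = wirt f w ** g w + f w ** wirt g w"
    "wirtbar (\<lambda>w. f w ** g w) w = wirtbar f w ** g w + f w ** wirtbar g w"
  unfolding wirt_def wirtbar_def pdiff_bilinear[OF bounded_bilinear_matmul assms]
    matrix_add_ldistrib matrix_add_rdistrib matrix_diff_ldistrib matrix_diff_rdistrib matrix_cscale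
  by (simp_all add: vec_eq_iff cscale_def field_simps)

lemma wirtinger_cscale:
  assumes "f differentiable (at w)" "g differentiable (at w)"
  shows "wirt (\<lambda>w. cscale (f w) (g w)) w = cscale (wd f w) (g w) + cscale (f w) (wirt g w)"
    "wirtbar (\<lambda>w. cscale (f w) (g w)) w = cscale (wdbar f w) (g w) + cscale (f w) (wirtbar g w)"
  unfolding wirt_def wirtbar_def wd_def wdbar_def pdiff_bilinear[OF bounded_bilinear_cscale assms]
  by (simp_all add: vec_eq_iff cscale_def field_simps)

lemma wirtinger_sum:
  assumes "\<And>k. k \<in> I \<Longrightarrow> f k differentiable (at w)"
  shows "wirt (\<lambda>w. \<Sum>k\<in>I. f k w) w = (\<Sum>k\<in>I. wirt (f k) w)"
    "wirtbar (\<lambda>w. \<Sum>k\<in>I. f k w) w = (\<Sum>k\<in>I. wirtbar (f k) w)"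
proof -
  have "pdiff v (\<lambda>w. \<Sum>k\<in>I. f k w) w = (\<Sum>k\<in>I. pdiff v (f k) w)" for v by (rule pdiff_sum[OF assms])
  then show "wirt (\<lambda>w. \<Sum>k\<in>I. f k w) w = (\<Sum>k\<in>I. wirt (f k) w)"
    "wirtbar (\<lambda>w. \<Sum>k\<in>I. f k w) w = (\<Sum>k\<in>I. wirtbar (f k) w)"
    unfolding wirt_def wirtbar_def
    by (simp_all add: vec_eq_iff cscale_def sum_component sum_distrib_left sum_subtractf sum.distrib right_diff_distrib distrib_left)
qed

lemma wirtinger_cong:
  fixes f g :: "complex \<Rightarrow> 'n::finite cmat"
  assumes "open S" "\<And>w. w \<in> S \<Longrightarrow> f w = g w" "w \<in> S"
  shows "wirt f w = wirt g w" "wirtbar f w = wirtbar g w"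
proof -
  have e: "frechet_derivative f (at w) = frechet_derivative g (at w)"
    by (rule pdiff_cong[OF assms(1) _ assms(3)]) (rule assms(2))
  show "wirt f w = wirt g w" "wirtbar f w = wirtbar g w"
    by (simp_all only: wirt_def wirtbar_def e)
qed

lemma wirtinger_add:
  assumes "f differentiable (at w)" "g differentiable (at w)"
  shows "wirt (\<lambda>w. f w + g w) w = wirt f w + wirt g w"
    "wirtbar (\<lambda>w. f w + g w) w = wirtbar f w + wirtbar g w"
  unfolding wirt_def wirtbar_def pdiff_add[OF assms]
  by (simp_all add: vec_eq_iff cscale_def field_simps)

lemma wirtinger_scaleR:
  assumes "f differentiable (at w)"
  shows "wirt (\<lambda>w. r *\<^sub>R f w) w = r *\<^sub>R wirt f w" "wirtbar (\<lambda>w. r *\<^sub>R f w) w = r *\<^sub>R wirtbar f w"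
  unfolding wirt_def wirtbar_def pdiff_linear[OF bounded_linear_scaleR_right assms]
  by (simp_all add: vec_eq_iff cscale_def scaleR_conv_of_real field_simps)

lemma wirtinger_const: "wirt (\<lambda>w. c) w = 0" "wirtbar (\<lambda>w. c) w = 0"
  unfolding wirt_def wirtbar_def by (simp_all add: vec_eq_iff cscale_def)

lemma smooth_on_wirtinger:
  assumes "open S" "smooth_on S f"
  shows "smooth_on S (wirt f)" "smooth_on S (wirtbar f)"
proof -
  have p: "smooth_on S (pdiff 1 f)" "smooth_on S (pdiff \<i> f)" using smooth_on_pdiff[OF assms(2)] by auto
  show "smooth_on S (wirt f)" "smooth_on S (wirtbar f)"
    unfolding wirt_def[abs_def] wirtbar_def[abs_def]
    by (intro smooth_on_linear[OF assms(1) bounded_linear_cscale] smooth_on_add smooth_on_diff assms(1) p)+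
qed

lemma smooth_on_scalar_wirtinger:
  assumes "open S" "smooth_on S f"
  shows "smooth_on S (wd f)" "smooth_on S (wdbar f)"
proof -
  have p: "smooth_on S (pdiff 1 f)" "smooth_on S (pdiff \<i> f)" using smooth_on_pdiff[OF assms(2)] by auto
  have l: "bounded_linear (\<lambda>x :: complex. x / 2)" "bounded_linear (\<lambda>x :: complex. \<i> * x)"
    by (rule bounded_linear_divide, rule bounded_linear_mult_right)
  show "smooth_on S (wd f)" "smooth_on S (wdbar f)"
    unfolding wd_def[abs_def] wdbar_def[abs_def]
    by (intro smooth_on_linear[OF assms(1) l(1)] smooth_on_add smooth_on_diff smooth_on_linear[OF assms(1) l(2)] assms(1) p)+
qed

text \<open>
  Both sides are a quarter of the Laplacian.
\<close>

lemma wirtinger_commute: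
  fixes f :: "complex \<Rightarrow> 'n::finite cmat"
  assumes S: "open S" "w \<in> S" and f: "smooth_on S f"
  shows "wirt (wirtbar f) w = wirtbar (wirt f) w"
proof -
  have d: "pdiff v f differentiable (at w)" if "v \<in> {1, \<i>}" for v
    using smooth_on_differentiable_at[OF S(1) smooth_on_pdiff[OF f that] S(2)] .
  have di: "(\<lambda>w. cscale \<i> (pdiff \<i> f w)) differentiable (at w)"
    using smooth_on_differentiable_at[OF S(1) smooth_on_linear[OF S(1) bounded_linear_cscale smooth_on_pdiff[OF f]] S(2)] by blast
  have dm: "(\<lambda>w. - cscale \<i> (pdiff \<i> f w)) differentiable (at w)"
    using di by (rule differentiable_minus)
  have 1: "pdiff v (wirtbar f) w = cscale (1/2) (pdiff v (pdiff 1 f) w + cscale \<i> (pdiff v (pdiff \<i> f) w))" for v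
    unfolding wirtbar_def[abs_def]
    using pdiff_linear[OF bounded_linear_cscale differentiable_add[OF d[of 1] di], of "1/2" v]
      pdiff_add[OF d[of 1] di, of v] pdiff_linear[OF bounded_linear_cscale d[of \<i>], of \<i> v] by simp
  have 2: "pdiff v (wirt f) w = cscale (1/2) (pdiff v (pdiff 1 f) w - cscale \<i> (pdiff v (pdiff \<i> f) w))" for v
    unfolding wirt_def[abs_def]
    using pdiff_linear[OF bounded_linear_cscale differentiable_add[OF d[of 1] dm], of "1/2" v]
      pdiff_add[OF d[of 1] dm, of v] pdiff_linear[OF bounded_linear_cscale d[of \<i>], of \<i> v]
      pdiff_linear[OF bounded_linear_minus[OF bounded_linear_ident] di, of v] by simp
  show ?thesis
    unfolding wirt_def[of "wirtbar f"] wirtbar_def[of "wirt f"] 1 2 mixed_partials[OF S(1) f S(2)]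
    by (simp add: vec_eq_iff cscale_def field_simps)
qed

section \<open>Growth of a function and its first derivatives at a puncture\<close>

text \<open>
  The derivatives lose one power, as those of \<open>w\<^sup>m\<close> do. Being a condition on a punctured disc, it
  ignores the value at 0.
\<close>

definition growth :: "int \<Rightarrow> (complex \<Rightarrow> 'b::real_normed_vector) \<Rightarrow> bool" where
  "growth m f \<longleftrightarrow> (\<exists>e>0. \<exists>C. smooth_on (ball 0 e - {0}) f \<and> (\<forall>w\<in>ball 0 e - {0}.
     norm (f w) \<le> C * norm w powi m \<and> (\<forall>v\<in>{1, \<i>}. norm (pdiff v f w) \<le> C * norm w powi (m - 1))))"

lemma growthE:
  assumes "growth m f" "d > 0"
  obtains e C where "0 < e" "e \<le> d" "0 \<le> C" "smooth_on (ball 0 e - {0}) f"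
    "\<And>w. w \<in> ball 0 e - {0} \<Longrightarrow> norm (f w) \<le> C * norm w powi m"
    "\<And>w v. w \<in> ball 0 e - {0} \<Longrightarrow> v \<in> {1, \<i>} \<Longrightarrow> norm (pdiff v f w) \<le> C * norm w powi (m - 1)"
proof -
  obtain e C where e: "e > 0" "smooth_on (ball 0 e - {0}) f"
    "\<And>w. w \<in> ball 0 e - {0} \<Longrightarrow> norm (f w) \<le> C * norm w powi m"
    "\<And>w v. w \<in> ball 0 e - {0} \<Longrightarrow> v \<in> {1, \<i>} \<Longrightarrow> norm (pdiff v f w) \<le> C * norm w powi (m - 1)"
    using assms(1) unfolding growth_def by blast
  have le: "C * norm w powi k \<le> max C 0 * norm w powi k" for w :: complex and k
    by (intro mult_right_mono) (auto simp: zero_le_power_int)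
  have sub: "ball 0 (min e d) - {0} \<subseteq> ball 0 e - {0 :: complex}" by auto
  show ?thesis
  proof (rule that)
    show "smooth_on (ball 0 (min e d) - {0}) f" using smooth_on_subset[OF e(2) sub] .
    show "norm (f w) \<le> max C 0 * norm w powi m" if "w \<in> ball 0 (min e d) - {0}" for w
      using e(3)[of w] le[of w m] that sub by (meson order_trans subsetD)
    show "norm (pdiff v f w) \<le> max C 0 * norm w powi (m - 1)" if "w \<in> ball 0 (min e d) - {0}" "v \<in> {1, \<i>}" for w v
      using e(4)[of w v] le[of w "m - 1"] that sub by (meson order_trans subsetD)
  qed (use e(1) assms(2) in auto)
qed

lemma growthI:
  assumes "e > 0" "smooth_on (ball 0 e - {0}) f"
    "\<And>w. w \<in> ball 0 e - {0} \<Longrightarrow> norm (f w) \<le> C * norm w powi m"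
    "\<And>w v. w \<in> ball 0 e - {0} \<Longrightarrow> v \<in> {1, \<i>} \<Longrightarrow> norm (pdiff v f w) \<le> C * norm w powi (m - 1)"
  shows "growth m f"
  using assms unfolding growth_def by blast

lemma open_punctured_ball: "open (ball 0 e - {0 :: complex})"
  by (intro open_Diff) auto

lemma growth_cong:
  assumes f: "growth m f" and "d > 0" "\<And>w. w \<in> ball 0 d - {0} \<Longrightarrow> f w = g w"
  shows "growth m g"
proof -
  obtain e C where e: "0 < e" "e \<le> d" "0 \<le> C" "smooth_on (ball 0 e - {0}) f"
    "\<And>w. w \<in> ball 0 e - {0} \<Longrightarrow> norm (f w) \<le> C * norm w powi m"
    "\<And>w v. w \<in> ball 0 e - {0} \<Longrightarrow> v \<in> {1, \<i>} \<Longrightarrow> norm (pdiff v f w) \<le> C * norm w powi (m - 1)"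
    using growthE[OF assms(1,2)] by blast
  have eq: "f w = g w" if "w \<in> ball 0 e - {0}" for w using assms(3)[of w] e(2) that by auto
  show ?thesis
  proof (rule growthI[OF e(1)])
    show "smooth_on (ball 0 e - {0}) g" by (rule smooth_on_cong[OF open_punctured_ball eq e(4)])
    show "norm (g w) \<le> C * norm w powi m" if "w \<in> ball 0 e - {0}" for w
      using e(5)[OF that] eq[OF that] by simp
    show "norm (pdiff v g w) \<le> C * norm w powi (m - 1)" if "w \<in> ball 0 e - {0}" "v \<in> {1, \<i>}" for w v
      using e(6)[OF that] pdiff_cong[OF open_punctured_ball eq that(1)] by simp
  qed
qed

lemma growth_weaken:
  assumes "growth m f" "k \<le> m"
  shows "growth k f"
proof -
  obtain e C where e: "0 < e" "e \<le> 1" "0 \<le> C" "smooth_on (ball 0 e - {0}) f"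
    "\<And>w. w \<in> ball 0 e - {0} \<Longrightarrow> norm (f w) \<le> C * norm w powi m"
    "\<And>w v. w \<in> ball 0 e - {0} \<Longrightarrow> v \<in> {1, \<i>} \<Longrightarrow> norm (pdiff v f w) \<le> C * norm w powi (m - 1)"
    using growthE[OF assms(1) zero_less_one] by blast
  have "norm w powi n \<le> norm w powi n'" if "w \<in> ball 0 e - {0}" "n' \<le> n" for w :: complex and n n'
    using that e(2) by (intro power_int_decreasing) auto
  then have "C * norm w powi n \<le> C * norm w powi n'" if "w \<in> ball 0 e - {0}" "n' \<le> n" for w :: complex and n n'
    using that e(3) by (intro mult_left_mono) auto
  then show ?thesis using e(5,6) assms(2)
    by (intro growthI[OF e(1,4), of C]) (meson order_trans diff_right_mono)+
qed

lemma growth_add: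
  assumes "growth m f" "growth m g"
  shows "growth m (\<lambda>w. f w + g w)"
proof -
  obtain d C where d: "0 < d" "smooth_on (ball 0 d - {0}) f"
    "\<And>w. w \<in> ball 0 d - {0} \<Longrightarrow> norm (f w) \<le> C * norm w powi m"
    "\<And>w v. w \<in> ball 0 d - {0} \<Longrightarrow> v \<in> {1, \<i>} \<Longrightarrow> norm (pdiff v f w) \<le> C * norm w powi (m - 1)"
    using growthE[OF assms(1) zero_less_one] by metis
  obtain e B where e: "0 < e" "e \<le> d" "smooth_on (ball 0 e - {0}) g"
    "\<And>w. w \<in> ball 0 e - {0} \<Longrightarrow> norm (g w) \<le> B * norm w powi m"
    "\<And>w v. w \<in> ball 0 e - {0} \<Longrightarrow> v \<in> {1, \<i>} \<Longrightarrow> norm (pdiff v g w) \<le> B * norm w powi (m - 1)"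
    using growthE[OF assms(2) d(1)] by metis
  have sub: "ball 0 e - {0} \<subseteq> ball 0 d - {0 :: complex}" using e(2) by auto
  have s: "smooth_on (ball 0 e - {0}) f" using smooth_on_subset[OF d(2) sub] .
  show ?thesis
  proof (rule growthI[OF e(1), of _ "C + B"])
    show "smooth_on (ball 0 e - {0}) (\<lambda>w. f w + g w)" by (rule smooth_on_add[OF open_punctured_ball s e(3)])
    show "norm (f w + g w) \<le> (C + B) * norm w powi m" if "w \<in> ball 0 e - {0}" for w
      using d(3)[of w] e(4)[OF that] sub that norm_triangle_ineq[of "f w" "g w"] by (auto simp: distrib_right)
    show "norm (pdiff v (\<lambda>w. f w + g w) w) \<le> (C + B) * norm w powi (m - 1)" if "w \<in> ball 0 e - {0}" "v \<in> {1, \<i>}" for w v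
    proof -
      have "pdiff v (\<lambda>w. f w + g w) w = pdiff v f w + pdiff v g w"
        by (rule pdiff_add[OF smooth_on_differentiable_at[OF open_punctured_ball s that(1)] smooth_on_differentiable_at[OF open_punctured_ball e(3) that(1)]])
      then show ?thesis using d(4)[of w v] e(5)[OF that] sub that norm_triangle_ineq[of "pdiff v f w" "pdiff v g w"]
        by (auto simp: distrib_right)
    qed
  qed
qed

lemma growth_bilinear:
  assumes bl: "bounded_bilinear bl" and "growth m f" "growth n g"
  shows "growth (m + n) (\<lambda>w. bl (f w) (g w))"
proof -
  obtain d C where d: "0 < d" "0 \<le> C" "smooth_on (ball 0 d - {0}) f"
    "\<And>w. w \<in> ball 0 d - {0} \<Longrightarrow> norm (f w) \<le> C * norm w powi m"
    "\<And>w v. w \<in> ball 0 d - {0} \<Longrightarrow> v \<in> {1, \<i>} \<Longrightarrow> norm (pdiff v f w) \<le> C * norm w powi (m - 1)"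
    using growthE[OF assms(2) zero_less_one] by metis
  obtain e B where e: "0 < e" "e \<le> d" "0 \<le> B" "smooth_on (ball 0 e - {0}) g"
    "\<And>w. w \<in> ball 0 e - {0} \<Longrightarrow> norm (g w) \<le> B * norm w powi n"
    "\<And>w v. w \<in> ball 0 e - {0} \<Longrightarrow> v \<in> {1, \<i>} \<Longrightarrow> norm (pdiff v g w) \<le> B * norm w powi (n - 1)"
    using growthE[OF assms(3) d(1)] by metis
  obtain K where K: "K > 0" "\<And>a b. norm (bl a b) \<le> norm a * norm b * K"
    using bounded_bilinear.pos_bounded[OF bl] by blast
  have sub: "w \<in> ball 0 d - {0}" if "w \<in> ball 0 e - {0}" for w :: complex using e(2) that by auto
  have s: "smooth_on (ball 0 e - {0}) f" using smooth_on_subset[OF d(3)] sub by blast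
  have est: "norm (bl a b) \<le> K * C * B * norm w powi (p + q)"
    if "norm a \<le> C * norm w powi p" "norm b \<le> B * norm w powi q" "w \<noteq> 0" for a b and w :: complex and p q
  proof -
    have "norm (bl a b) \<le> (C * norm w powi p) * (B * norm w powi q) * K"
      using that K(1) d(2) e(3) by (intro order_trans[OF K(2)] mult_mono) (auto simp: zero_le_power_int)
    then show ?thesis using that(3) by (simp add: power_int_add mult_ac)
  qed
  show ?thesis
  proof (rule growthI[OF e(1), of _ "2 * (K * C * B)"])
    show "smooth_on (ball 0 e - {0}) (\<lambda>w. bl (f w) (g w))"
      by (rule smooth_on_bilinear[OF bl open_punctured_ball s e(4)])
    fix w :: complex assume w: "w \<in> ball 0 e - {0}"
    have pos: "0 \<le> K * C * B * norm w powi k" for k using K(1) d(2) e(3) by (auto simp: zero_le_power_int)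
    show "norm (bl (f w) (g w)) \<le> 2 * (K * C * B) * norm w powi (m + n)"
      using est[OF d(4)[OF sub[OF w]] e(5)[OF w]] w pos[of "m + n"] by auto
    fix v :: complex assume v: "v \<in> {1, \<i>}"
    have "pdiff v (\<lambda>w. bl (f w) (g w)) w = bl (f w) (pdiff v g w) + bl (pdiff v f w) (g w)"
      by (rule pdiff_bilinear[OF bl smooth_on_differentiable_at[OF open_punctured_ball s w] smooth_on_differentiable_at[OF open_punctured_ball e(4) w]])
    moreover have "norm (bl (f w) (pdiff v g w)) \<le> K * C * B * norm w powi (m + n - 1)"
      using est[OF d(4)[OF sub[OF w]] e(6)[OF w v]] w by (simp add: add_diff_eq)
    moreover have "norm (bl (pdiff v f w) (g w)) \<le> K * C * B * norm w powi (m + n - 1)"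
      using est[OF d(5)[OF sub[OF w] v] e(5)[OF w]] w by (simp add: algebra_simps)
    ultimately show "norm (pdiff v (\<lambda>w. bl (f w) (g w)) w) \<le> 2 * (K * C * B) * norm w powi (m + n - 1)"
      using norm_triangle_ineq[of "bl (f w) (pdiff v g w)" "bl (pdiff v f w) (g w)"] by simp
  qed
qed

lemma growth_linear:
  assumes L: "bounded_linear L" and f: "growth m f"
  shows "growth m (\<lambda>w. L (f w))"
proof -
  obtain e C where e: "0 < e" "0 \<le> C" "smooth_on (ball 0 e - {0}) f"
    "\<And>w. w \<in> ball 0 e - {0} \<Longrightarrow> norm (f w) \<le> C * norm w powi m"
    "\<And>w v. w \<in> ball 0 e - {0} \<Longrightarrow> v \<in> {1, \<i>} \<Longrightarrow> norm (pdiff v f w) \<le> C * norm w powi (m - 1)"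
    using growthE[OF f zero_less_one] by metis
  obtain K where K: "K > 0" "\<And>a. norm (L a) \<le> norm a * K"
    using bounded_linear.pos_bounded[OF L] by blast
  have est: "norm (L a) \<le> C * K * t" if "norm a \<le> C * t" for a t
    using order_trans[OF K(2) mult_right_mono[OF that]] K(1) by (simp add: mult_ac)
  show ?thesis
  proof (rule growthI[OF e(1), of _ "C * K"])
    show "smooth_on (ball 0 e - {0}) (\<lambda>w. L (f w))" by (rule smooth_on_linear[OF open_punctured_ball L e(3)])
    fix w :: complex assume w: "w \<in> ball 0 e - {0}"
    show "norm (L (f w)) \<le> C * K * norm w powi m" by (rule est[OF e(4)[OF w]])
    fix v :: complex assume v: "v \<in> {1, \<i>}"
    show "norm (pdiff v (\<lambda>w. L (f w)) w) \<le> C * K * norm w powi (m - 1)"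
      unfolding pdiff_linear[OF L smooth_on_differentiable_at[OF open_punctured_ball e(3) w]]
      by (rule est[OF e(5)[OF w v]])
  qed
qed

lemma growth_const_0: "growth m (\<lambda>w. 0)"
  by (rule growthI[of 1 _ 0]) (auto intro: smooth_on_const open_punctured_ball)

lemma growth_sum:
  assumes "\<And>i. i \<in> I \<Longrightarrow> growth m (f i)"
  shows "growth m (\<lambda>w. \<Sum>i\<in>I. f i w)"
  using assms by (induction I rule: infinite_finite_induct) (auto intro: growth_add growth_const_0)

lemma onorm_partials:
  "onorm (\<lambda>v. Re v *\<^sub>R p + Im v *\<^sub>R q) \<le> norm p + norm q"
proof (rule onorm_le)
  fix v :: complex
  have "norm (Re v *\<^sub>R p + Im v *\<^sub>R q) \<le> \<bar>Re v\<bar> * norm p + \<bar>Im v\<bar> * norm q"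
    using norm_triangle_ineq[of "Re v *\<^sub>R p" "Im v *\<^sub>R q"] by simp
  also have "\<dots> \<le> norm v * norm p + norm v * norm q"
    by (intro add_mono mult_right_mono abs_Re_le_cmod abs_Im_le_cmod) auto
  finally show "norm (Re v *\<^sub>R p + Im v *\<^sub>R q) \<le> (norm p + norm q) * norm v" by (simp add: algebra_simps)
qed

lemma mean_value_bound:
  fixes f :: "complex \<Rightarrow> 'b::real_normed_vector"
  assumes "open S" "smooth_on S f" "cball 0 r \<subseteq> S" "norm w \<le> r"
    and "\<And>z v. norm z \<le> norm w \<Longrightarrow> v \<in> {1, \<i>} \<Longrightarrow> norm (pdiff v f z) \<le> B"
  shows "norm (f w - f 0) \<le> 2 * B * norm w"
proof -
  have "norm (f w - f 0) \<le> 2 * B * norm (w - 0)"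
  proof (rule differentiable_bound[of "cball 0 (norm w)" f "\<lambda>z v. Re v *\<^sub>R pdiff 1 f z + Im v *\<^sub>R pdiff \<i> f z"])
    fix z assume z: "z \<in> cball (0::complex) (norm w)"
    then have "z \<in> S" using assms(3,4) by auto
    then have "(f has_derivative (\<lambda>v. Re v *\<^sub>R pdiff 1 f z + Im v *\<^sub>R pdiff \<i> f z)) (at z)"
      using has_partials_pdiff[OF assms(1) smooth_on_differentiable[OF assms(2)]] unfolding has_partials_def by blast
    then show "(f has_derivative (\<lambda>v. Re v *\<^sub>R pdiff 1 f z + Im v *\<^sub>R pdiff \<i> f z)) (at z within cball 0 (norm w))"
      by (rule has_derivative_at_withinI)
    show "onorm (\<lambda>v. Re v *\<^sub>R pdiff 1 f z + Im v *\<^sub>R pdiff \<i> f z) \<le> 2 * B"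
      using onorm_partials[of "pdiff 1 f z" "pdiff \<i> f z"] assms(5)[of z 1] assms(5)[of z \<i>] z by simp
  qed auto
  then show ?thesis by simp
qed

lemma smooth_bounded:
  fixes f :: "complex \<Rightarrow> 'b::real_normed_vector"
  assumes "smooth_on S f" "cball 0 r \<subseteq> S"
  obtains C where "\<And>w. norm w \<le> r \<Longrightarrow> norm (f w) \<le> C"
    "\<And>w v. norm w \<le> r \<Longrightarrow> v \<in> {1, \<i>} \<Longrightarrow> norm (pdiff v f w) \<le> C"
proof -
  have "\<exists>C. \<forall>w\<in>cball 0 r. norm (g w) \<le> C" if "smooth_on S g" for g :: "complex \<Rightarrow> 'b"
  proof -
    have "compact (g ` cball 0 r)"
      by (rule compact_continuous_image[OF continuous_on_subset[OF smooth_on_continuous[OF that] assms(2)] compact_cball])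
    from compact_imp_bounded[OF this] show ?thesis unfolding bounded_iff by blast
  qed
  then obtain C0 C1 C2 where "\<forall>w\<in>cball 0 r. norm (f w) \<le> C0" "\<forall>w\<in>cball 0 r. norm (pdiff 1 f w) \<le> C1"
    "\<forall>w\<in>cball 0 r. norm (pdiff \<i> f w) \<le> C2"
    using assms(1) smooth_on_pdiff[OF assms(1)] by (metis insertI1 insertI2)
  then show ?thesis
    by (intro that[of "max C0 (max C1 C2)"]) (auto simp: le_max_iff_disj)
qed

lemma growth_smooth:
  assumes "e > 0" "smooth_on (ball 0 e) f"
  shows "growth 0 f"
proof -
  define r where "r = min (e / 2) 1"
  have r: "0 < r" "r \<le> 1" "cball 0 r \<subseteq> ball (0 :: complex) e" using assms(1) by (auto simp: r_def)
  obtain C where C: "\<And>w. norm w \<le> r \<Longrightarrow> norm (f w) \<le> C" "\<And>w v. norm w \<le> r \<Longrightarrow> v \<in> {1, \<i>} \<Longrightarrow> norm (pdiff v f w) \<le> C"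
    using smooth_bounded[OF assms(2) r(3)] by blast
  have C0: "0 \<le> C" using order_trans[OF norm_ge_zero[of "f 0"] C(1)[of 0]] r(1) by simp
  show ?thesis
  proof (rule growthI[OF r(1), of _ C])
    show "smooth_on (ball 0 r - {0}) f" by (rule smooth_on_subset[OF assms(2)]) (use r(3) ball_subset_cball[of 0 r] in blast)
    fix w :: complex assume w: "w \<in> ball 0 r - {0}"
    show "norm (f w) \<le> C * norm w powi 0" using C(1)[of w] w by simp
    fix v :: complex assume v: "v \<in> {1, \<i>}"
    have "1 \<le> inverse (norm w)" using w r(2) by (intro one_le_inverse) auto
    then have "C \<le> C * inverse (norm w)" using C0 mult_left_mono by fastforce
    then show "norm (pdiff v f w) \<le> C * norm w powi (0 - 1)"
      using C(2)[of w v] w v by (simp add: power_int_minus)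
  qed
qed

text \<open>
  The first power of \<open>|w|\<close> comes from the mean value theorem.
\<close>

lemma growth_smooth_zero:
  assumes "e > 0" "smooth_on (ball 0 e) f" "f 0 = 0"
  shows "growth 1 f"
proof -
  define r where "r = e / 2"
  have r: "0 < r" "cball 0 r \<subseteq> ball (0 :: complex) e" using assms(1) by (auto simp: r_def)
  obtain C where C: "\<And>w. norm w \<le> r \<Longrightarrow> norm (f w) \<le> C" "\<And>w v. norm w \<le> r \<Longrightarrow> v \<in> {1, \<i>} \<Longrightarrow> norm (pdiff v f w) \<le> C"
    using smooth_bounded[OF assms(2) r(2)] by blast
  have C0: "0 \<le> C" using order_trans[OF norm_ge_zero[of "f 0"] C(1)[of 0]] r(1) by simp
  show ?thesis
  proof (rule growthI[OF r(1), of _ "2 * C"])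
    show "smooth_on (ball 0 r - {0}) f" by (rule smooth_on_subset[OF assms(2)]) (use r(2) ball_subset_cball[of 0 r] in blast)
    fix w :: complex assume w: "w \<in> ball 0 r - {0}"
    have "norm (f w - f 0) \<le> 2 * C * norm w"
      by (rule mean_value_bound[OF open_ball assms(2) r(2)]) (use w C(2) in auto)
    then show "norm (f w) \<le> 2 * C * norm w powi 1" using assms(3) by simp
    fix v :: complex assume v: "v \<in> {1, \<i>}"
    show "norm (pdiff v f w) \<le> 2 * C * norm w powi (1 - 1)"
      using C(2)[of w v] C0 w v by simp
  qed
qed

text \<open>
  Induction on \<open>n\<close>: the derivatives of \<open>F\<close> vanish to all orders as well, and the mean value theorem
  gains one power.
\<close>

lemma flat_bound:
  assumes "e > 0" "smooth_on (ball 0 e) F" "\<forall>vs\<in>lists {1, \<i>}. pderivs vs F 0 = 0"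
  shows "\<exists>C\<ge>0. \<forall>w. norm w \<le> e / 2 \<longrightarrow> norm (F w) \<le> C * norm w ^ n"
  using assms(2,3)
proof (induction n arbitrary: F)
  case 0
  have r: "cball 0 (e / 2) \<subseteq> ball (0 :: complex) e" using assms(1) by auto
  obtain C where C: "\<And>w. norm w \<le> e / 2 \<Longrightarrow> norm (F w) \<le> C" using smooth_bounded[OF 0(1) r] by metis
  moreover have "0 \<le> C" using order_trans[OF norm_ge_zero[of "F 0"] C[of 0]] assms(1) by simp
  ultimately show ?case by auto
next
  case (Suc n)
  have r: "cball 0 (e / 2) \<subseteq> ball (0 :: complex) e" using assms(1) by auto
  have "\<exists>C\<ge>0. \<forall>w. norm w \<le> e / 2 \<longrightarrow> norm (pdiff v F w) \<le> C * norm w ^ n" if v: "v \<in> {1, \<i>}" for v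
  proof (rule Suc.IH)
    show "smooth_on (ball 0 e) (pdiff v F)" by (rule smooth_on_pdiff[OF Suc.prems(1) v])
    show "\<forall>vs\<in>lists {1, \<i>}. pderivs vs (pdiff v F) 0 = 0"
    proof
      fix vs assume "vs \<in> lists {1, \<i>}"
      then have "vs @ [v] \<in> lists {1, \<i>}" using v by auto
      then show "pderivs vs (pdiff v F) 0 = 0" using Suc.prems(2) by (metis pderivs_append)
    qed
  qed
  then obtain C1 C2 where C: "0 \<le> C1" "\<And>w. norm w \<le> e / 2 \<Longrightarrow> norm (pdiff 1 F w) \<le> C1 * norm w ^ n"
    "0 \<le> C2" "\<And>w. norm w \<le> e / 2 \<Longrightarrow> norm (pdiff \<i> F w) \<le> C2 * norm w ^ n"
    by (metis insertI1 insertI2)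
  have F0: "F 0 = 0" using Suc.prems(2) by (metis lists.Nil pderivs.simps(1))
  show ?case
  proof (intro exI[of _ "2 * (C1 + C2)"] conjI allI impI)
    show "0 \<le> 2 * (C1 + C2)" using C by simp
    fix w :: complex assume w: "norm w \<le> e / 2"
    have "norm (F w - F 0) \<le> 2 * ((C1 + C2) * norm w ^ n) * norm w"
    proof (rule mean_value_bound[OF open_ball Suc.prems(1) r w])
      fix z v :: complex assume z: "norm z \<le> norm w" and v: "v \<in> {1, \<i>}"
      have p: "norm z ^ n \<le> norm w ^ n" using z by (intro power_mono) auto
      have "norm (pdiff v F z) \<le> (C1 + C2) * norm z ^ n"
        using v C(2)[of z] C(4)[of z] z w C(1,3) by (auto simp: distrib_right intro: add_increasing add_increasing2)
      also have "\<dots> \<le> (C1 + C2) * norm w ^ n" using C(1,3) p by (intro mult_left_mono) auto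
      finally show "norm (pdiff v F z) \<le> (C1 + C2) * norm w ^ n" .
    qed
    then show "norm (F w) \<le> 2 * (C1 + C2) * norm w ^ Suc n" using F0 by (simp add: algebra_simps)
  qed
qed

lemma flat0_pdiff:
  assumes "flat0 f" "v \<in> {1, \<i>}"
  shows "flat0 (pdiff v f)"
proof -
  obtain e F where e: "e > 0" "smooth_on (ball 0 e) F" "\<forall>w\<in>ball 0 e - {0}. F w = f w"
    "\<forall>vs\<in>lists {1, \<i>}. pderivs vs F 0 = 0"
    using assms(1) unfolding flat0_def by blast
  have "pdiff v F w = pdiff v f w" if "w \<in> ball 0 e - {0}" for w
    using pdiff_cong[OF open_punctured_ball _ that, of F f] e(3) by simp
  moreover have "pderivs vs (pdiff v F) 0 = 0" if "vs \<in> lists {1, \<i>}" for vs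
  proof -
    have "vs @ [v] \<in> lists {1, \<i>}" using that assms(2) by auto
    then show ?thesis using e(4) by (metis pderivs_append)
  qed
  ultimately show ?thesis
    unfolding flat0_def using e(1) smooth_on_pdiff[OF e(2) assms(2)] by blast
qed

lemma growth_flat:
  assumes "flat0 f"
  shows "growth m f"
proof -
  obtain e F where e: "e > 0" "smooth_on (ball 0 e) F" "\<forall>w\<in>ball 0 e - {0}. F w = f w"
    "\<forall>vs\<in>lists {1, \<i>}. pderivs vs F 0 = 0"
    using assms unfolding flat0_def by blast
  define n where "n = nat (max m 0)"
  define r where "r = min (e / 2) 1"
  have r: "0 < r" "r \<le> 1" "r \<le> e / 2" using e(1) by (auto simp: r_def)
  have dF: "\<forall>vs\<in>lists {1, \<i>}. pderivs vs (pdiff v F) 0 = 0" if "v \<in> {1, \<i>}" for v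
  proof
    fix vs assume "vs \<in> lists {1, \<i>}"
    then have "vs @ [v] \<in> lists {1, \<i>}" using that by auto
    then show "pderivs vs (pdiff v F) 0 = 0" using e(4) by (metis pderivs_append)
  qed
  obtain C0 where C0: "0 \<le> C0" "\<And>w. norm w \<le> e / 2 \<Longrightarrow> norm (F w) \<le> C0 * norm w ^ n"
    using flat_bound[OF e(1,2,4)] by blast
  obtain C1 where C1: "0 \<le> C1" "\<And>w. norm w \<le> e / 2 \<Longrightarrow> norm (pdiff 1 F w) \<le> C1 * norm w ^ n"
    using flat_bound[OF e(1) smooth_on_pdiff[OF e(2)] dF, of 1] by blast
  obtain C2 where C2: "0 \<le> C2" "\<And>w. norm w \<le> e / 2 \<Longrightarrow> norm (pdiff \<i> F w) \<le> C2 * norm w ^ n"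
    using flat_bound[OF e(1) smooth_on_pdiff[OF e(2)] dF, of \<i>] by blast
  let ?C = "C0 + C1 + C2"
  have pw: "norm w ^ n \<le> norm w powi k" if "w \<in> ball 0 r - {0}" "k \<le> m" for w :: complex and k
  proof -
    have "norm w powi int n \<le> norm w powi k"
      using that r(2) by (intro power_int_decreasing) (auto simp: n_def)
    then show ?thesis by simp
  qed
  have step: "x \<le> ?C * norm w powi k"
    if "x \<le> D * norm w ^ n" "D \<le> ?C" "w \<in> ball 0 r - {0}" "k \<le> m" for x D k and w :: complex
  proof -
    have "D * norm w ^ n \<le> ?C * norm w ^ n" using that(2) by (intro mult_right_mono) auto
    also have "\<dots> \<le> ?C * norm w powi k" using pw[OF that(3,4)] C0(1) C1(1) C2(1) by (intro mult_left_mono) auto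
    finally show ?thesis using that(1) by linarith
  qed
  have "growth m F"
  proof (rule growthI[OF r(1), of _ ?C])
    show "smooth_on (ball 0 r - {0}) F" by (rule smooth_on_subset[OF e(2)]) (use r(3) e(1) in auto)
    fix w :: complex assume w: "w \<in> ball 0 r - {0}"
    then have w2: "norm w \<le> e / 2" using r(3) by auto
    show "norm (F w) \<le> ?C * norm w powi m" using C0 C1 C2 by (intro step[OF C0(2)[OF w2] _ w]) auto
    fix v :: complex assume v: "v \<in> {1, \<i>}"
    show "norm (pdiff v F w) \<le> ?C * norm w powi (m - 1)"
    proof (cases "v = 1")
      case True
      show ?thesis unfolding True using C0 C1 C2 by (intro step[OF C1(2)[OF w2] _ w]) auto
    next
      case False
      then have vi: "v = \<i>" using v by blast
      show ?thesis unfolding vi using C0 C1 C2 by (intro step[OF C2(2)[OF w2] _ w]) auto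
    qed
  qed
  then show ?thesis by (rule growth_cong[OF _ e(1)]) (use e(3) in blast)
qed

lemma growth_flat_wirtinger:
  assumes "flat0 f"
  shows "growth m (wirt f)" "growth m (wirtbar f)"
proof -
  have p: "growth m (pdiff 1 f)" "growth m (pdiff \<i> f)" using growth_flat[OF flat0_pdiff[OF assms]] by auto
  have d: "growth m (\<lambda>w. - cscale \<i> (pdiff \<i> f w))"
    by (rule growth_linear[OF bounded_linear_minus[OF bounded_linear_ident] growth_linear[OF bounded_linear_cscale p(2)]])
  show "growth m (wirt f)"
    using growth_linear[OF bounded_linear_cscale[of "1/2"] growth_add[OF p(1) d]] unfolding wirt_def[abs_def] by simp
  show "growth m (wirtbar f)"
    using growth_linear[OF bounded_linear_cscale[of "1/2"] growth_add[OF p(1) growth_linear[OF bounded_linear_cscale[of \<i>] p(2)]]]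
    unfolding wirtbar_def[abs_def] .
qed

lemma growth_inverse_power: "growth (- int k) (\<lambda>w :: complex. inverse w ^ k)"
proof (rule growthI[of 1 _ "real k + 1"])
  let ?S = "ball 0 1 - {0 :: complex}"
  have hol: "(\<lambda>w :: complex. inverse w ^ k) holomorphic_on ?S" by (intro holomorphic_intros) auto
  show "smooth_on ?S (\<lambda>w. inverse w ^ k)" by (rule smooth_on_holomorphic[OF open_punctured_ball hol])
  fix w :: complex assume w: "w \<in> ?S"
  have pw: "norm w powi (- int k) = inverse (norm w) ^ k" "norm w powi (- int k - 1) = inverse (norm w) ^ Suc k"
    by (simp_all add: power_int_minus power_inverse power_int_def nat_add_distrib flip: power_inverse)
  show "norm (inverse w ^ k) \<le> (real k + 1) * norm w powi (- int k)"
    unfolding pw by (simp add: norm_power norm_inverse distrib_right)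
  fix v :: complex assume v: "v \<in> {1, \<i>}"
  have "(inverse has_field_derivative - (inverse w * inverse w)) (at w)"
    using DERIV_inverse[of w UNIV] w by (simp add: power2_eq_square)
  then have d: "deriv (\<lambda>w. inverse w ^ k) w = of_nat k * (- (inverse w * inverse w) * inverse w ^ (k - Suc 0))"
    by (intro DERIV_imp_deriv DERIV_power)
  have n: "norm (of_nat k * (- (inverse w * inverse w) * inverse w ^ (k - Suc 0)))
      = real k * (inverse (norm w) * inverse (norm w) * inverse (norm w) ^ (k - Suc 0))"
    by (simp only: norm_mult norm_minus_cancel norm_inverse norm_power norm_of_nat)
  have "norm (deriv (\<lambda>w. inverse w ^ k) w) \<le> (real k + 1) * inverse (norm w) ^ Suc k"
    unfolding d n by (cases k) (auto simp: algebra_simps)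
  moreover have "norm (pdiff v (\<lambda>w. inverse w ^ k) w) = norm (deriv (\<lambda>w. inverse w ^ k) w)"
    using has_partials_eq[OF has_partials_holomorphic[OF open_punctured_ball hol] w] v by (auto simp: norm_mult)
  ultimately show "norm (pdiff v (\<lambda>w. inverse w ^ k) w) \<le> (real k + 1) * norm w powi (- int k - 1)"
    unfolding pw by simp
qed simp

text \<open>
  The function and its derivatives are \<open>O(1/|w|)\<close>, which is integrable in the plane.
\<close>

lemma growth_integrable:
  fixes f :: "complex \<Rightarrow> complex"
  assumes "growth 0 f"
  obtains e where "e > 0" "set_integrable lborel (ball 0 e) f" "\<And>v. v \<in> {1, \<i>} \<Longrightarrow> set_integrable lborel (ball 0 e) (pdiff v f)"
proof -
  obtain e C where e: "0 < e" "e \<le> 1" "0 \<le> C" "smooth_on (ball 0 e - {0}) f"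
    "\<And>w. w \<in> ball 0 e - {0} \<Longrightarrow> norm (f w) \<le> C * norm w powi 0"
    "\<And>w v. w \<in> ball 0 e - {0} \<Longrightarrow> v \<in> {1, \<i>} \<Longrightarrow> norm (pdiff v f w) \<le> C * norm w powi (0 - 1)"
    using growthE[OF assms zero_less_one] by blast
  have int: "set_integrable lborel (ball 0 e) g"
    if g: "smooth_on (ball 0 e - {0}) g" and b: "\<And>w. w \<in> ball 0 e - {0} \<Longrightarrow> norm (g w) \<le> C * inverse (norm w)"
    for g :: "complex \<Rightarrow> complex"
  proof -
    let ?A = "ball 0 e - {0 :: complex}"
    have "integrable lborel (\<lambda>w. indicator ?A w *\<^sub>R g w)"
    proof (rule Bochner_Integration.integrable_bound)
      show "integrable lborel (\<lambda>w :: complex. C * (indicator (ball 0 e) w *\<^sub>R inverse (norm w)))"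
        using inverse_norm_integrable[OF e(1)] unfolding set_integrable_def by (rule integrable_mult_right)
      show "(\<lambda>w. indicator ?A w *\<^sub>R g w) \<in> borel_measurable lborel"
        using borel_measurable_continuous_on_indicator[OF _ smooth_on_continuous[OF g]] by simp
      show "AE w in lborel. norm (indicator ?A w *\<^sub>R g w) \<le> norm (C * (indicator (ball 0 e) w *\<^sub>R inverse (norm w)))"
        using b e(3) by (intro AE_I2) (auto simp: indicator_def)
    qed
    then have "set_integrable lborel ?A g" unfolding set_integrable_def .
    then show ?thesis
      by (subst set_integrable_discrete_difference[where X="{0}"]) auto
  qed
  show ?thesis
  proof (rule that[OF e(1)])
    show "set_integrable lborel (ball 0 e) f"
    proof (rule int[OF e(4)])
      fix w :: complex assume w: "w \<in> ball 0 e - {0}"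
      have "1 \<le> inverse (norm w)" using w e(2) by (intro one_le_inverse) auto
      then have "C \<le> C * inverse (norm w)" using e(3) mult_left_mono by fastforce
      then show "norm (f w) \<le> C * inverse (norm w)" using e(5)[OF w] by simp
    qed
    show "set_integrable lborel (ball 0 e) (pdiff v f)" if v: "v \<in> {1, \<i>}" for v
      using e(6) v by (intro int smooth_on_pdiff[OF e(4) v]) (auto simp: power_int_minus)
  qed
qed

section \<open>Frames of the bundle and covariant derivatives\<close>

lemma matrix_inv_mat_1: "matrix_inv (mat 1 :: 'n::finite cmat) = mat 1"
  using matrix_inv_inverse[of "mat 1 :: 'n cmat"] by (metis invertible_def matrix_mul_lid)

lemma bounded_linear_conj:
  fixes A B :: "'n::finite cmat"
  shows "bounded_linear (\<lambda>X. A ** X ** B)"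
  by (rule bounded_linear_compose[OF bounded_bilinear.bounded_linear_left[OF bounded_bilinear_matmul]
        bounded_bilinear.bounded_linear_right[OF bounded_bilinear_matmul]])

lemma wirtinger_conj:
  fixes A B :: "'n::finite cmat"
  assumes "f differentiable (at w)"
  shows "wirt (\<lambda>w. A ** f w ** B) w = A ** wirt f w ** B" "wirtbar (\<lambda>w. A ** f w ** B) w = A ** wirtbar f w ** B"
  unfolding wirt_def wirtbar_def pdiff_linear[OF bounded_linear_conj assms]
  by (simp_all add: matrix_add_ldistrib matrix_add_rdistrib matrix_diff_ldistrib matrix_diff_rdistrib matrix_cscale)

lemma wirtinger_compose:
  fixes f :: "complex \<Rightarrow> 'n::finite cmat"
  assumes f: "f differentiable (at (T w))" and T: "(T has_field_derivative T') (at w)"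
  shows "wirt (\<lambda>v. f (T v)) w = cscale T' (wirt f (T w))" "wirtbar (\<lambda>v. f (T v)) w = cscale (cnj T') (wirtbar f (T w))"
proof -
  have 1: "(f has_derivative (\<lambda>v. Re v *\<^sub>R pdiff 1 f (T w) + Im v *\<^sub>R pdiff \<i> f (T w))) (at (T w))"
    using derivative_by_partials f frechet_derivative_works by blast
  have "((\<lambda>v. f (T v)) has_derivative (\<lambda>h. Re (T' * h) *\<^sub>R pdiff 1 f (T w) + Im (T' * h) *\<^sub>R pdiff \<i> f (T w))) (at w)"
    by (rule has_derivative_compose[OF T[unfolded has_field_derivative_def] 1])
  from frechet_derivative_at[OF this, symmetric]
  have p: "pdiff h (\<lambda>v. f (T v)) w = Re (T' * h) *\<^sub>R pdiff 1 f (T w) + Im (T' * h) *\<^sub>R pdiff \<i> f (T w)" for h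
    by simp
  show "wirt (\<lambda>v. f (T v)) w = cscale T' (wirt f (T w))" "wirtbar (\<lambda>v. f (T v)) w = cscale (cnj T') (wirtbar f (T w))"
    unfolding wirt_def wirtbar_def p
    by (simp_all add: vec_eq_iff cscale_def complex_eq_iff field_simps)
qed

text \<open>
  The Lie algebra is cut out by linear equations, which may be differentiated.
\<close>

lemma lie_alg_derivative:
  assumes T: "open T" and u: "smooth_on T u" and uG: "\<And>w. w \<in> T \<Longrightarrow> u w \<in> lie_alg G" and w: "w \<in> T"
  shows "wirt u w \<in> lie_alg G" "wirtbar u w \<in> lie_alg G"
proof -
  have p: "pdiff v u w \<in> lie_alg G" for v
    unfolding lie_alg_iff
  proof
    fix f assume f: "f \<in> vanishing_ideal G"
    have L: "bounded_linear (\<lambda>X. pd1 (mat 1) X f)"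
      by (intro linear_conv_bounded_linear[THEN iffD1] linearI) (simp_all add: pd1_add pd1_cscale scaleR_eq_cscale scaleR_conv_of_real)
    have "pdiff v (\<lambda>w. pd1 (mat 1) (u w) f) w = pd1 (mat 1) (pdiff v u w) f"
      by (rule pdiff_linear[OF L smooth_on_differentiable_at[OF T u w]])
    moreover have "pdiff v (\<lambda>w. pd1 (mat 1) (u w) f) w = pdiff v (\<lambda>w. 0) w"
      using pdiff_cong[OF T _ w, of "\<lambda>w. pd1 (mat 1) (u w) f" "\<lambda>w. 0"] uG f unfolding lie_alg_iff by simp
    ultimately show "pd1 (mat 1) (pdiff v u w) f = 0" by simp
  qed
  note sub = lie_alg_subspace[of G]
  show "wirt u w \<in> lie_alg G" "wirtbar u w \<in> lie_alg G"
    unfolding wirt_def wirtbar_def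
    by (intro cmat.subspace_scale[OF sub] cmat.subspace_diff[OF sub] cmat.subspace_add[OF sub] p)+
qed

locale moduli_context =
  fixes S :: "('x::t2_space, 'n::finite) irr_setting" and P :: "('x, 'p, 'n) framed_conn"
  assumes setting: "irregular_setting S" and principal: "holomorphic_principal_bundle S P"
    and mero: "meromorphic_connection S P" and framed: "generic_compatible_framing S P"
begin

lemma group: "linear_algebraic_group (grp S)"
  using setting unfolding irregular_setting_def semisimple_group_def by blast

lemma surface: "compact_riemann_surface (atlas S)"
  using setting unfolding irregular_setting_def by blast

lemma finite_D: "finite (Dred S)"
  unfolding Dred_def by simp

lemma marked:
  assumes "j \<in> {1..npts S}"
  shows "crd S j \<in> atlas S" "pt S j \<in> fst (crd S j)" "snd (crd S j) (pt S j) = 0" "pt S j \<in> Dred S"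
  using setting assms unfolding irregular_setting_def Dred_def by auto

lemma marked_cases:
  assumes "x \<in> Dred S"
  obtains j where "j \<in> {1..npts S}" "x = pt S j"
  using assms unfolding Dred_def by blast

lemmas chart = atlas_chart[OF surface]

lemma chart_cover: "\<exists>c\<in>atlas S. x \<in> fst c"
  using surface unfolding compact_riemann_surface_def by blast

lemma one_in_group: "mat 1 \<in> grp S"
  and group_mult: "g \<in> grp S \<Longrightarrow> h \<in> grp S \<Longrightarrow> g ** h \<in> grp S"
  using group unfolding linear_algebraic_group_def by blast+

lemmas group_inverse = algebraic_group_inverse[OF group]

lemmas principal_axioms = principal[unfolded holomorphic_principal_bundle_def]

lemma act_proj: "g \<in> grp S \<Longrightarrow> bproj P (bact P p g) = bproj P p"
  using principal_axioms[THEN conjunct1] by blast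

lemma act_one: "bact P p (mat 1) = p"
  using principal_axioms[THEN conjunct2, THEN conjunct1] by blast

lemma act_assoc: "g \<in> grp S \<Longrightarrow> h \<in> grp S \<Longrightarrow> bact P (bact P p g) h = bact P p (g ** h)"
  using principal_axioms[THEN conjunct2, THEN conjunct2, THEN conjunct1] by blast

lemma act_ex1: "bproj P p = bproj P q \<Longrightarrow> \<exists>!g. g \<in> grp S \<and> q = bact P p g"
  using principal_axioms[THEN conjunct2, THEN conjunct2, THEN conjunct2, THEN conjunct1] by blast

lemmas frame_axioms = principal_axioms[THEN conjunct2, THEN conjunct2, THEN conjunct2, THEN conjunct2]

lemma frame_section: "(U, \<sigma>) \<in> hframes P \<Longrightarrow> local_section P U \<sigma>"
  using frame_axioms[THEN conjunct1] by blast

lemma frame_cover: obtains U \<sigma> where "(U, \<sigma>) \<in> hframes P" "x \<in> U"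
proof -
  have "x \<in> (\<Union>(U, \<sigma>)\<in>hframes P. U)" using frame_axioms[THEN conjunct2, THEN conjunct1] by simp
  then show ?thesis using that by auto
qed

lemma frame_transition:
  "(U, \<sigma>) \<in> hframes P \<Longrightarrow> (V, \<tau>) \<in> hframes P \<Longrightarrow> surf_mat_hol_on (atlas S) (U \<inter> V) (trans_fun S P \<sigma> \<tau>)"
  using frame_axioms[THEN conjunct2, THEN conjunct2, THEN conjunct1] by blast

lemma frame_maximal:
  "local_section P V \<tau> \<Longrightarrow> (\<And>U \<sigma>. (U, \<sigma>) \<in> hframes P \<Longrightarrow> surf_mat_hol_on (atlas S) (U \<inter> V) (trans_fun S P \<sigma> \<tau>))
    \<Longrightarrow> (V, \<tau>) \<in> hframes P"
  using frame_axioms[THEN conjunct2, THEN conjunct2, THEN conjunct2] by blast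

lemma frame_open: "(U, \<sigma>) \<in> hframes P \<Longrightarrow> open U"
  and frame_proj: "(U, \<sigma>) \<in> hframes P \<Longrightarrow> x \<in> U \<Longrightarrow> bproj P (\<sigma> x) = x"
  using frame_section unfolding local_section_def by blast+

lemma act_cancel: "g \<in> grp S \<Longrightarrow> h \<in> grp S \<Longrightarrow> bact P p g = bact P p h \<Longrightarrow> g = h"
  using act_ex1[of p "bact P p g"] act_proj by metis

lemma trans_fun:
  assumes "bproj P (\<sigma> x) = bproj P (\<tau> x)"
  shows "trans_fun S P \<sigma> \<tau> x \<in> grp S" "\<tau> x = bact P (\<sigma> x) (trans_fun S P \<sigma> \<tau> x)"
  using theI'[OF act_ex1[OF assms]] unfolding trans_fun_def by blast+

lemma trans_fun_unique:
  assumes "g \<in> grp S" "\<tau> x = bact P (\<sigma> x) g"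
  shows "trans_fun S P \<sigma> \<tau> x = g"
proof -
  have "bproj P (\<sigma> x) = bproj P (\<tau> x)" using assms act_proj by simp
  from trans_fun[of \<sigma> x \<tau>, OF this] show ?thesis using act_cancel assms by metis
qed

lemma in_chart:
  assumes "c \<in> atlas S" "w \<in> snd c ` (fst c \<inter> A)"
  shows "chart_inv c w \<in> fst c" "chart_inv c w \<in> A" "snd c (chart_inv c w) = w"
  using assms chart_inv_left[OF chart[OF assms(1)]] by auto

text \<open>
  The family of holomorphic frames is maximal, and the transition function to the translated frame is
  that to \<open>\<sigma>\<close> followed by a constant.
\<close>

lemma frame_translate:
  assumes \<sigma>: "(U, \<sigma>) \<in> hframes P" and g: "g \<in> grp S"
  shows "(U, \<lambda>y. bact P (\<sigma> y) g) \<in> hframes P"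
proof (rule frame_maximal)
  show "local_section P U (\<lambda>y. bact P (\<sigma> y) g)"
    using frame_section[OF \<sigma>] act_proj[OF g] unfolding local_section_def by simp
  fix V \<tau> assume \<tau>: "(V, \<tau>) \<in> hframes P"
  have eq: "trans_fun S P \<tau> (\<lambda>y. bact P (\<sigma> y) g) y = trans_fun S P \<tau> \<sigma> y ** g" if "y \<in> V \<inter> U" for y
  proof -
    have "bproj P (\<tau> y) = bproj P (\<sigma> y)" using frame_proj[OF \<sigma>] frame_proj[OF \<tau>] that by auto
    note t = trans_fun[of \<tau> y \<sigma>, OF this]
    show ?thesis
    proof (rule trans_fun_unique)
      show "trans_fun S P \<tau> \<sigma> y ** g \<in> grp S" by (rule group_mult[OF t(1) g])
      show "bact P (\<sigma> y) g = bact P (\<tau> y) (trans_fun S P \<tau> \<sigma> y ** g)"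
        using act_assoc[OF t(1) g, of "\<tau> y"] t(2) by simp
    qed
  qed
  show "surf_mat_hol_on (atlas S) (V \<inter> U) (trans_fun S P \<tau> (\<lambda>y. bact P (\<sigma> y) g))"
    unfolding surf_mat_hol_on_def mat_holomorphic_on_def
  proof (intro ballI allI)
    fix c i j assume c: "c \<in> atlas S"
    let ?T = "snd c ` (fst c \<inter> (V \<inter> U))"
    have "(\<lambda>w. (trans_fun S P \<tau> \<sigma> \<circ> chart_inv c) w $ i $ k) holomorphic_on ?T" for k
      using frame_transition[OF \<tau> \<sigma>] c unfolding surf_mat_hol_on_def mat_holomorphic_on_def by blast
    then have "(\<lambda>w. \<Sum>k\<in>UNIV. (trans_fun S P \<tau> \<sigma> \<circ> chart_inv c) w $ i $ k * g $ k $ j) holomorphic_on ?T"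
      by (intro holomorphic_intros)
    then show "(\<lambda>w. (trans_fun S P \<tau> (\<lambda>y. bact P (\<sigma> y) g) \<circ> chart_inv c) w $ i $ j) holomorphic_on ?T"
    proof (rule holomorphic_transform)
      fix w assume "w \<in> ?T"
      then have "chart_inv c w \<in> V \<inter> U" by (rule in_chart(2)[OF c])
      from eq[OF this]
      show "(\<Sum>k\<in>UNIV. (trans_fun S P \<tau> \<sigma> \<circ> chart_inv c) w $ i $ k * g $ k $ j)
          = (trans_fun S P \<tau> (\<lambda>y. bact P (\<sigma> y) g) \<circ> chart_inv c) w $ i $ j"
        by (simp add: matrix_matrix_mult_def)
    qed
  qed
qed

text \<open>
  Through every point passes a translate of any frame defined at its base point.
\<close>

lemma frame_through:
  obtains U where "(U, frame_through P p) \<in> hframes P" "bproj P p \<in> U" "frame_through P p (bproj P p) = p"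
proof -
  obtain U \<sigma> where \<sigma>: "(U, \<sigma>) \<in> hframes P" "bproj P p \<in> U" by (rule frame_cover)
  have "bproj P (\<sigma> (bproj P p)) = bproj P p" by (rule frame_proj[OF \<sigma>])
  then obtain g where g: "g \<in> grp S" "p = bact P (\<sigma> (bproj P p)) g" using act_ex1 by blast
  have "\<exists>\<sigma>. \<exists>U. (U, \<sigma>) \<in> hframes P \<and> bproj P p \<in> U \<and> \<sigma> (bproj P p) = p"
    using frame_translate[OF \<sigma>(1) g(1)] \<sigma>(2) g(2) by (intro exI[of _ "\<lambda>y. bact P (\<sigma> y) g"] exI[of _ U]) auto
  from someI_ex[OF this] show ?thesis using that unfolding frame_through_def by blast
qed

lemma fibre_point: "bproj P (SOME p. bproj P p = x) = x"
proof -
  obtain U \<sigma> where "(U, \<sigma>) \<in> hframes P" "x \<in> U" by (rule frame_cover)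
  then have "bproj P (\<sigma> x) = x" by (rule frame_proj)
  then show ?thesis by (rule someI)
qed

lemma ad_section_in: "ad_section S P W \<mu> \<Longrightarrow> bproj P p \<in> W \<Longrightarrow> \<mu> p \<in> lieG S"
  and ad_section_act: "ad_section S P W \<mu> \<Longrightarrow> bproj P p \<in> W \<Longrightarrow> g \<in> grp S \<Longrightarrow> \<mu> (bact P p g) = matrix_inv g ** \<mu> p ** g"
  unfolding ad_section_def by blast+

text \<open>
  Two points of a fibre differ by a group element, under which the Killing form is invariant.
\<close>

lemma kill_fibre:
  assumes "ad_section S P W \<mu>" "ad_section S P W \<nu>" "bproj P p \<in> W" "bproj P q = bproj P p"
  shows "kill (grp S) (\<mu> q) (\<nu> q) = kill (grp S) (\<mu> p) (\<nu> p)"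
proof -
  obtain g where g: "g \<in> grp S" "q = bact P p g" using act_ex1 assms(4) by metis
  have "kill (grp S) (\<mu> q) (\<nu> q) = killing (grp S) (\<mu> q) (\<nu> q)"
    using assms ad_section_in by (intro kill_eq_killing[OF group]) metis+
  also have "\<dots> = killing (grp S) (\<mu> p) (\<nu> p)"
    unfolding g(2) ad_section_act[OF assms(1,3) g(1)] ad_section_act[OF assms(2,3) g(1)]
    by (rule killing_Ad[OF group g(1) ad_section_in[OF assms(1,3)] ad_section_in[OF assms(2,3)]])
  also have "\<dots> = kill (grp S) (\<mu> p) (\<nu> p)"
    by (rule kill_eq_killing[OF group ad_section_in[OF assms(1,3)] ad_section_in[OF assms(2,3)], symmetric])
  finally show ?thesis .
qed

lemma open_minus_D: "open U \<Longrightarrow> open (U - Dred S)"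
  using finite_D finite_imp_closed by blast

lemma chart_open: "c \<in> atlas S \<Longrightarrow> open A \<Longrightarrow> open (snd c ` (fst c \<inter> A))"
  using chart_image_open[OF chart] .

lemmas mero_axioms = mero[unfolded meromorphic_connection_def]

lemma conn_axioms:
  assumes "c \<in> atlas S" "(U, \<sigma>) \<in> hframes P"
  shows "\<forall>x\<in>U \<inter> fst c - Dred S. conn P c \<sigma> x \<in> lieG S"
    "mat_holomorphic_on (conn P c \<sigma> \<circ> chart_inv c) (snd c ` (U \<inter> fst c - Dred S))"
    "\<forall>c'\<in>atlas S. \<forall>x\<in>U \<inter> fst c \<inter> fst c' - Dred S. conn P c' \<sigma> x = cscale (jac c c' x) (conn P c \<sigma> x)"
    "\<forall>(V, \<tau>)\<in>hframes P. \<forall>x\<in>U \<inter> V \<inter> fst c - Dred S.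
           let g = trans_fun S P \<sigma> \<tau> in
           conn P c \<tau> x = matrix_inv (g x) ** conn P c \<sigma> x ** g x
             + matrix_inv (g x) ** wirt (g \<circ> chart_inv c) (snd c x)"
  using bspec[OF bspec[OF mero_axioms[THEN conjunct1] assms(1)] assms(2), unfolded prod.case] by simp_all

lemma conn_in:
  assumes "c \<in> atlas S" "(U, \<sigma>) \<in> hframes P" "x \<in> fst c" "x \<in> U - Dred S"
  shows "conn P c \<sigma> x \<in> lieG S"
  using conn_axioms(1)[OF assms(1,2)] assms(3,4) by blast

lemma conn_hol:
  assumes "c \<in> atlas S" "(U, \<sigma>) \<in> hframes P"
  shows "mat_holomorphic_on (\<lambda>w. conn P c \<sigma> (chart_inv c w)) (snd c ` (fst c \<inter> (U - Dred S)))"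
proof -
  have "fst c \<inter> (U - Dred S) = U \<inter> fst c - Dred S" by blast
  then show ?thesis using conn_axioms(2)[OF assms] unfolding o_def by simp
qed

lemma conn_chart:
  assumes "c \<in> atlas S" "c' \<in> atlas S" "(U, \<sigma>) \<in> hframes P" "x \<in> fst c \<inter> fst c'" "x \<in> U - Dred S"
  shows "conn P c' \<sigma> x = cscale (jac c c' x) (conn P c \<sigma> x)"
  using conn_axioms(3)[OF assms(1,3)] assms(2,4,5) by blast

lemma conn_frame:
  assumes "c \<in> atlas S" "(U, \<sigma>) \<in> hframes P" "(V, \<tau>) \<in> hframes P" "x \<in> fst c" "x \<in> U \<inter> V - Dred S"
  defines "g \<equiv> trans_fun S P \<sigma> \<tau>"
  shows "conn P c \<tau> x = matrix_inv (g x) ** conn P c \<sigma> x ** g x + matrix_inv (g x) ** wirt (g \<circ> chart_inv c) (snd c x)"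
proof -
  have "x \<in> U \<inter> V \<inter> fst c - Dred S" using assms(4,5) by blast
  from bspec[OF bspec[OF conn_axioms(4)[OF assms(1,2)] assms(3), unfolded prod.case] this]
  show ?thesis unfolding g_def Let_def .
qed

text \<open>
  The value of the covariant derivative at a point of the bundle is defined by some frame through
  this point. Another frame with the same value there differs by a holomorphic function \<open>g\<close> with
  value 1, whose derivative cancels between the derivative of the section and the connection form.
\<close>

lemma nabla_frame:
  assumes c: "c \<in> atlas S" and \<sigma>: "(U, \<sigma>) \<in> hframes P" and W: "open W"
    and \<mu>: "ad_section S P W \<mu>" and sm: "ad_smooth S P W \<mu>"
    and x: "x \<in> fst c" "x \<in> U" "x \<in> W" "x \<notin> Dred S"
  defines "u \<equiv> \<lambda>w. \<mu> (\<sigma> (chart_inv c w))"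
  shows "nabla S P \<mu> c (\<sigma> x) = (wirt u (snd c x) + lie (conn P c \<sigma> x) (u (snd c x)), wirtbar u (snd c x))"
proof -
  define \<tau> where "\<tau> = frame_through P (\<sigma> x)"
  have px: "bproj P (\<sigma> x) = x" by (rule frame_proj[OF \<sigma> x(2)])
  obtain V where \<tau>: "(V, \<tau>) \<in> hframes P" "x \<in> V" "\<tau> x = \<sigma> x"
    using frame_through[of "\<sigma> x"] unfolding px \<tau>_def by metis
  let ?A = "U \<inter> V \<inter> W"
  let ?T = "snd c ` (fst c \<inter> ?A)" and ?w = "snd c x"
  define g where "g w = trans_fun S P \<sigma> \<tau> (chart_inv c w)" for w
  define h where "h w = trans_fun S P \<tau> \<sigma> (chart_inv c w)" for w
  define u' where "u' w = \<mu> (\<tau> (chart_inv c w))" for w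
  have "open ?A" by (intro open_Int frame_open[OF \<sigma>] frame_open[OF \<tau>(1)] W)
  then have T: "open ?T" "?w \<in> ?T" using chart_open[OF c] x \<tau>(2) by blast+
  have iw: "chart_inv c ?w = x" using chart_inv_left[OF chart[OF c] x(1)] .
  have gh: "mat_holomorphic_on g ?T" "mat_holomorphic_on h ?T"
  proof -
    have "mat_holomorphic_on f (snd c ` (fst c \<inter> (U \<inter> V))) \<Longrightarrow> mat_holomorphic_on f ?T" for f :: "complex \<Rightarrow> 'n cmat"
      unfolding mat_holomorphic_on_def by (blast intro: holomorphic_on_subset)
    moreover have "mat_holomorphic_on g (snd c ` (fst c \<inter> (U \<inter> V)))" "mat_holomorphic_on h (snd c ` (fst c \<inter> (V \<inter> U)))"
      using frame_transition[OF \<sigma> \<tau>(1)] frame_transition[OF \<tau>(1) \<sigma>] c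
      unfolding surf_mat_hol_on_def g_def[abs_def] h_def[abs_def] o_def by blast+
    ultimately show "mat_holomorphic_on g ?T" "mat_holomorphic_on h ?T" by (auto simp: Int_commute)
  qed
  have t: "g w \<in> grp S" "\<tau> (chart_inv c w) = bact P (\<sigma> (chart_inv c w)) (g w)"
    "h w \<in> grp S" "\<sigma> (chart_inv c w) = bact P (\<tau> (chart_inv c w)) (h w)" if w: "w \<in> ?T" for w
  proof -
    have "chart_inv c w \<in> ?A" by (rule in_chart(2)[OF c w])
    then have e: "bproj P (\<sigma> (chart_inv c w)) = bproj P (\<tau> (chart_inv c w))"
      using frame_proj[OF \<sigma>, of "chart_inv c w"] frame_proj[OF \<tau>(1), of "chart_inv c w"] by simp
    show "g w \<in> grp S" "\<tau> (chart_inv c w) = bact P (\<sigma> (chart_inv c w)) (g w)"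
      unfolding g_def by (rule trans_fun[of \<sigma> "chart_inv c w" \<tau>, OF e])+
    show "h w \<in> grp S" "\<sigma> (chart_inv c w) = bact P (\<tau> (chart_inv c w)) (h w)"
      unfolding h_def by (rule trans_fun[of \<tau> "chart_inv c w" \<sigma>, OF e[symmetric]])+
  qed
  have g_h: "g w ** h w = mat 1" if w: "w \<in> ?T" for w
  proof (rule act_cancel[OF group_mult[OF t(1,3)[OF w]] one_in_group])
    show "bact P (\<sigma> (chart_inv c w)) (g w ** h w) = bact P (\<sigma> (chart_inv c w)) (mat 1)"
      unfolding act_assoc[OF t(1,3)[OF w], of "\<sigma> (chart_inv c w)", symmetric] t(2)[OF w, symmetric]
        t(4)[OF w, symmetric] act_one ..
  qed
  have hinv: "matrix_inv (g w) = h w" if w: "w \<in> ?T" for w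
  proof -
    have "matrix_inv (g w) = matrix_inv (g w) ** (g w ** h w)" using g_h[OF w] by simp
    also have "\<dots> = h w" using group_inverse(1)[OF t(1)[OF w]] by (simp add: matrix_mul_assoc)
    finally show ?thesis .
  qed
  have g1: "g ?w = mat 1" "h ?w = mat 1"
    unfolding g_def h_def iw using trans_fun_unique[OF one_in_group] act_one \<tau>(3) by metis+
  have us: "smooth_on ?T u"
  proof (rule smooth_on_subset)
    show "smooth_on (snd c ` (fst c \<inter> (U \<inter> W))) u"
      using sm \<sigma> c unfolding ad_smooth_def surf_smooth_on_def u_def o_def by blast
  qed blast
  note gs = mat_holomorphic_smooth[OF T(1) gh(1)] and hs = mat_holomorphic_smooth[OF T(1) gh(2)]
  note d = smooth_on_differentiable_at[OF T(1) us T(2)] smooth_on_differentiable_at[OF T(1) gs T(2)]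
    smooth_on_differentiable_at[OF T(1) hs T(2)]
  have hu: "(\<lambda>w. h w ** u w) differentiable (at ?w)"
    by (rule smooth_on_differentiable_at[OF T(1) smooth_on_bilinear[OF bounded_bilinear_matmul T(1) hs us] T(2)])
  have ueq: "u' w = (h w ** u w) ** g w" if w: "w \<in> ?T" for w
  proof -
    have "bproj P (\<sigma> (chart_inv c w)) \<in> W" using in_chart(2)[OF c w] frame_proj[OF \<sigma>] by auto
    from ad_section_act[OF \<mu> this t(1)[OF w]] show ?thesis
      unfolding u'_def u_def t(2)[OF w, symmetric] hinv[OF w] .
  qed
  have dgh: "wirt g ?w + wirt h ?w = 0"
  proof -
    have "wirt (\<lambda>w. g w ** h w) ?w = wirt (\<lambda>w. mat 1) ?w" by (rule wirtinger_cong(1)[OF T(1) g_h T(2)])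
    then show ?thesis using wirtinger_matmul(1)[OF d(2,3)] g1 by (simp add: wirtinger_const)
  qed
  have w1: "wirt u' ?w = wirt u ?w + u ?w ** wirt g ?w - wirt g ?w ** u ?w"
  proof -
    have "wirt u' ?w = wirt (\<lambda>w. (h w ** u w) ** g w) ?w" by (rule wirtinger_cong(1)[OF T(1) ueq T(2)])
    also have "\<dots> = wirt h ?w ** u ?w + wirt u ?w + u ?w ** wirt g ?w"
      unfolding wirtinger_matmul(1)[OF hu d(2)] wirtinger_matmul(1)[OF d(3,1)] g1 by simp
    also have "wirt h ?w = - wirt g ?w" using dgh by (simp add: eq_neg_iff_add_eq_0 add.commute)
    finally show ?thesis
      using matrix_diff_rdistrib[of 0 "wirt g ?w" "u ?w"] by (simp add: matrix_matrix_mult_def[of 0] vec_eq_iff)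
  qed
  have w2: "wirtbar u' ?w = wirtbar u ?w"
  proof -
    have "wirtbar u' ?w = wirtbar (\<lambda>w. (h w ** u w) ** g w) ?w" by (rule wirtinger_cong(2)[OF T(1) ueq T(2)])
    also have "\<dots> = wirtbar u ?w"
      unfolding wirtinger_matmul(2)[OF hu d(2)] wirtinger_matmul(2)[OF d(3,1)] g1
        mat_holomorphic_wirtbar[OF T gh(1)] mat_holomorphic_wirtbar[OF T gh(2)] by simp
    finally show ?thesis .
  qed
  have cn: "conn P c \<tau> x = conn P c \<sigma> x + wirt g ?w"
  proof -
    have "x \<in> U \<inter> V - Dred S" using x \<tau>(2) by blast
    from conn_frame[OF c \<sigma> \<tau>(1) x(1) this] show ?thesis
      using g1(1) unfolding g_def[abs_def] iw o_def by (simp add: matrix_inv_mat_1)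
  qed
  have uw: "u' ?w = u ?w" unfolding u'_def u_def iw \<tau>(3) ..
  have "nabla S P \<mu> c (\<sigma> x) = (wirt u' ?w + lie (conn P c \<tau> x) (u' ?w), wirtbar u' ?w)"
    unfolding nabla_def Let_def px \<tau>_def[symmetric] u'_def[abs_def] using c x by (simp add: o_def)
  also have "\<dots> = (wirt u ?w + lie (conn P c \<sigma> x) (u ?w), wirtbar u ?w)"
    unfolding w1 w2 cn uw lie_add(2) lie_def[of "wirt g ?w"] by simp
  finally show ?thesis .
qed

lemma frame_values_smooth:
  "c \<in> atlas S \<Longrightarrow> (U, \<sigma>) \<in> hframes P \<Longrightarrow> ad_smooth S P W \<mu> \<Longrightarrow>
    smooth_on (snd c ` (fst c \<inter> (U \<inter> W))) (\<lambda>w. \<mu> (\<sigma> (chart_inv c w)))"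
  unfolding ad_smooth_def surf_smooth_on_def o_def by blast

text \<open>
  A constant group element conjugates the section and the connection form in the translated frame, hence
  also the covariant derivative.
\<close>

lemma nabla_values:
  assumes c: "c \<in> atlas S" and \<mu>: "ad_section S P UNIV \<mu>" and sm: "ad_smooth S P UNIV \<mu>"
  shows "ad_section S P (fst c \<inter> - Dred S) (\<lambda>p. fst (nabla S P \<mu> c p))"
    "ad_section S P (fst c \<inter> - Dred S) (\<lambda>p. snd (nabla S P \<mu> c p))"
proof -
  have "fst (nabla S P \<mu> c p) \<in> lieG S \<and> snd (nabla S P \<mu> c p) \<in> lieG S \<and>
     (\<forall>g\<in>grp S. fst (nabla S P \<mu> c (bact P p g)) = matrix_inv g ** fst (nabla S P \<mu> c p) ** g \<and>
        snd (nabla S P \<mu> c (bact P p g)) = matrix_inv g ** snd (nabla S P \<mu> c p) ** g)"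
    if p: "bproj P p \<in> fst c \<inter> - Dred S" for p
  proof -
    define x where "x = bproj P p"
    define \<sigma> where "\<sigma> = frame_through P p"
    obtain U where \<sigma>: "(U, \<sigma>) \<in> hframes P" "x \<in> U" "\<sigma> x = p" unfolding x_def \<sigma>_def by (rule frame_through)
    have x: "x \<in> fst c" "x \<notin> Dred S" using p unfolding x_def by auto
    let ?T = "snd c ` (fst c \<inter> U)" and ?w = "snd c x"
    define u where "u w = \<mu> (\<sigma> (chart_inv c w))" for w
    have T: "open ?T" "?w \<in> ?T" using chart_open[OF c frame_open[OF \<sigma>(1)]] x \<sigma>(2) by auto
    have us: "smooth_on ?T u" using frame_values_smooth[OF c \<sigma>(1) sm] unfolding u_def[abs_def] by simp
    have uG: "u w \<in> lieG S" for w unfolding u_def by (rule ad_section_in[OF \<mu>]) simp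
    have A: "conn P c \<sigma> x \<in> lieG S" using conn_in[OF c \<sigma>(1) x(1)] \<sigma>(2) x(2) by blast
    have n: "nabla S P \<mu> c p = (wirt u ?w + lie (conn P c \<sigma> x) (u ?w), wirtbar u ?w)"
      using nabla_frame[OF c \<sigma>(1) open_UNIV \<mu> sm x(1) \<sigma>(2) UNIV_I x(2)] unfolding \<sigma>(3) u_def[abs_def] .
    note sub = lie_alg_subspace[of "grp S"]
    have in': "fst (nabla S P \<mu> c p) \<in> lieG S" "snd (nabla S P \<mu> c p) \<in> lieG S"
      unfolding n fst_conv snd_conv
      by (intro cmat.subspace_add[OF sub] lie_alg_derivative[OF T(1) us uG T(2)] lie_alg_lie[OF group A uG])+
    have "fst (nabla S P \<mu> c (bact P p g)) = matrix_inv g ** fst (nabla S P \<mu> c p) ** g \<and>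
        snd (nabla S P \<mu> c (bact P p g)) = matrix_inv g ** snd (nabla S P \<mu> c p) ** g" if g: "g \<in> grp S" for g
    proof -
      let ?\<sigma> = "\<lambda>y. bact P (\<sigma> y) g"
      note \<sigma>' = frame_translate[OF \<sigma>(1) g]
      have ueq: "\<mu> (?\<sigma> (chart_inv c w)) = matrix_inv g ** u w ** g" for w
        unfolding u_def by (rule ad_section_act[OF \<mu> UNIV_I g])
      have gx: "trans_fun S P \<sigma> ?\<sigma> y = g" for y by (rule trans_fun_unique[OF g refl])
      have "x \<in> U \<inter> U - Dred S" using \<sigma>(2) x(2) by blast
      from conn_frame[OF c \<sigma>(1) \<sigma>' x(1) this]
      have A': "conn P c ?\<sigma> x = matrix_inv g ** conn P c \<sigma> x ** g"
        unfolding gx o_def wirtinger_const by simp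
      have d: "u differentiable (at ?w)" by (rule smooth_on_differentiable_at[OF T(1) us T(2)])
      have "nabla S P \<mu> c (bact P p g) = (wirt (\<lambda>w. matrix_inv g ** u w ** g) ?w + lie (conn P c ?\<sigma> x) (matrix_inv g ** u ?w ** g),
          wirtbar (\<lambda>w. matrix_inv g ** u w ** g) ?w)"
        using nabla_frame[OF c \<sigma>' open_UNIV \<mu> sm x(1) \<sigma>(2) UNIV_I x(2)] unfolding \<sigma>(3) ueq .
      then show ?thesis
        unfolding n A' lie_Ad[OF group g] wirtinger_conj[OF d]
        by (simp add: matrix_add_ldistrib matrix_add_rdistrib)
    qed
    then show ?thesis using in' by blast
  qed
  then show "ad_section S P (fst c \<inter> - Dred S) (\<lambda>p. fst (nabla S P \<mu> c p))"
    "ad_section S P (fst c \<inter> - Dred S) (\<lambda>p. snd (nabla S P \<mu> c p))"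
    unfolding ad_section_def by blast+
qed

lemma transition:
  assumes c: "c \<in> atlas S" "c' \<in> atlas S" and x: "x \<in> fst c" "x \<in> fst c'"
  shows "((\<lambda>w. snd c (chart_inv c' w)) has_field_derivative jac c c' x) (at (snd c' x))"
proof -
  have hol: "(snd c \<circ> chart_inv c') holomorphic_on (snd c' ` (fst c' \<inter> fst c))"
    by (rule transition_holomorphic[OF surface c(2,1)])
  have op: "open (snd c' ` (fst c' \<inter> fst c))" by (rule chart_open[OF c(2) chart_continuous(3)[OF chart[OF c(1)]]])
  have "snd c' x \<in> snd c' ` (fst c' \<inter> fst c)" using x by blast
  from holomorphic_derivI[OF hol op this] show ?thesis unfolding jac_def by (simp add: o_def)
qed

lemma nabla_chart:
  assumes c: "c \<in> atlas S" "c' \<in> atlas S" and \<mu>: "ad_section S P UNIV \<mu>" and sm: "ad_smooth S P UNIV \<mu>"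
    and p: "bproj P p \<in> fst c \<inter> fst c' - Dred S"
  shows "nabla S P \<mu> c' p = (cscale (jac c c' (bproj P p)) (fst (nabla S P \<mu> c p)),
      cscale (cnj (jac c c' (bproj P p))) (snd (nabla S P \<mu> c p)))"
proof -
  define x where "x = bproj P p"
  define \<sigma> where "\<sigma> = frame_through P p"
  obtain U where \<sigma>: "(U, \<sigma>) \<in> hframes P" "x \<in> U" "\<sigma> x = p" unfolding x_def \<sigma>_def by (rule frame_through)
  have x: "x \<in> fst c" "x \<in> fst c'" "x \<notin> Dred S" using p unfolding x_def by auto
  define u where "u w = \<mu> (\<sigma> (chart_inv c w))" for w
  define u' where "u' w = \<mu> (\<sigma> (chart_inv c' w))" for w
  let ?T = "\<lambda>w. snd c (chart_inv c' w)" and ?J = "jac c c' x"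
  have iw: "chart_inv c (snd c x) = x" "chart_inv c' (snd c' x) = x"
    using chart_inv_left[OF chart[OF c(1)] x(1)] chart_inv_left[OF chart[OF c(2)] x(2)] by auto
  have n: "nabla S P \<mu> c p = (wirt u (snd c x) + lie (conn P c \<sigma> x) (u (snd c x)), wirtbar u (snd c x))"
    using nabla_frame[OF c(1) \<sigma>(1) open_UNIV \<mu> sm x(1) \<sigma>(2) UNIV_I x(3)] unfolding \<sigma>(3) u_def[abs_def] .
  have n': "nabla S P \<mu> c' p = (wirt u' (snd c' x) + lie (conn P c' \<sigma> x) (u' (snd c' x)), wirtbar u' (snd c' x))"
    using nabla_frame[OF c(2) \<sigma>(1) open_UNIV \<mu> sm x(2) \<sigma>(2) UNIV_I x(3)] unfolding \<sigma>(3) u'_def[abs_def] .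
  let ?A = "snd c' ` (fst c' \<inter> fst c)"
  have A: "open ?A" "snd c' x \<in> ?A" using chart_open[OF c(2) chart_continuous(3)[OF chart[OF c(1)]]] x by auto
  have eq: "u' w = u (?T w)" if "w \<in> ?A" for w
    using in_chart(2)[OF c(2) that] chart_inv_left[OF chart[OF c(1)]] unfolding u_def u'_def by simp
  have Tx: "?T (snd c' x) = snd c x" using iw by simp
  have d: "u differentiable (at (?T (snd c' x)))"
    unfolding Tx
  proof (rule smooth_on_differentiable_at)
    show "open (snd c ` (fst c \<inter> U))" by (rule chart_open[OF c(1) frame_open[OF \<sigma>(1)]])
    show "smooth_on (snd c ` (fst c \<inter> U)) u" using frame_values_smooth[OF c(1) \<sigma>(1) sm] unfolding u_def[abs_def] by simp
  qed (use x \<sigma>(2) in blast)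
  note w = wirtinger_compose[OF d transition[OF c x(1,2)]]
  have "wirt u' (snd c' x) = cscale ?J (wirt u (snd c x))" "wirtbar u' (snd c' x) = cscale (cnj ?J) (wirtbar u (snd c x))"
    using wirtinger_cong[OF A(1) eq A(2)] w unfolding Tx by simp_all
  moreover have "u' (snd c' x) = u (snd c x)" unfolding u_def u'_def iw ..
  moreover have "conn P c' \<sigma> x = cscale ?J (conn P c \<sigma> x)" using conn_chart[OF c \<sigma>(1)] x \<sigma>(2) by blast
  ultimately show ?thesis
    unfolding n n' x_def[symmetric] by (simp add: lie_cscale cmat.scale_right_distrib)
qed

lemma global_oneform_nabla:
  assumes \<mu>: "ad_section S P UNIV \<mu>" and sm: "ad_smooth S P UNIV \<mu>"
  shows "global_oneform S P (nabla S P \<mu>)"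
proof -
  have "nabla S P \<mu> c p = (0, 0)" if "c \<notin> atlas S \<or> bproj P p \<notin> fst c - Dred S" for c p
    using that unfolding nabla_def Let_def by auto
  moreover have "nabla S P \<mu> c' p = (cscale (jac c c' (bproj P p)) (fst (nabla S P \<mu> c p)),
      cscale (cnj (jac c c' (bproj P p))) (snd (nabla S P \<mu> c p)))"
    if "c \<in> atlas S" "c' \<in> atlas S" "bproj P p \<in> fst c \<inter> fst c' \<inter> - Dred S" for c c' p
    using nabla_chart[OF that(1,2) \<mu> sm] that(3) by blast
  ultimately show ?thesis
    unfolding global_oneform_def ad_oneform_def using nabla_values[OF _ \<mu> sm] by blast
qed

definition form_regular :: "('x, 'p, 'n) ad_form \<Rightarrow> bool" where
  "form_regular \<phi> \<longleftrightarrow> (\<forall>c\<in>atlas S. \<forall>(U, \<sigma>)\<in>hframes P.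
     smooth_on (snd c ` (fst c \<inter> (U - Dred S))) (\<lambda>w. fst (\<phi> c (\<sigma> (chart_inv c w)))) \<and>
     smooth_on (snd c ` (fst c \<inter> (U - Dred S))) (\<lambda>w. snd (\<phi> c (\<sigma> (chart_inv c w)))))"

definition form_closed :: "('x, 'p, 'n) ad_form \<Rightarrow> bool" where
  "form_closed \<phi> \<longleftrightarrow> (\<forall>c\<in>atlas S. \<forall>p. bproj P p \<in> fst c - Dred S \<longrightarrow>
     nabla10_form P \<phi> c p + dbar_form P \<phi> c p = 0)"

lemma nabla_in_frame:
  assumes c: "c \<in> atlas S" and \<sigma>: "(U, \<sigma>) \<in> hframes P"
    and \<mu>: "ad_section S P UNIV \<mu>" and sm: "ad_smooth S P UNIV \<mu>"
  defines "u \<equiv> \<lambda>w. \<mu> (\<sigma> (chart_inv c w))"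
  assumes w: "w \<in> snd c ` (fst c \<inter> (U - Dred S))"
  shows "nabla S P \<mu> c (\<sigma> (chart_inv c w)) = (wirt u w + lie (conn P c \<sigma> (chart_inv c w)) (u w), wirtbar u w)"
proof -
  note i = in_chart[OF c w]
  show ?thesis
    using nabla_frame[OF c \<sigma> open_UNIV \<mu> sm i(1) _ UNIV_I, of ] i(2,3) unfolding u_def by simp
qed

lemma form_regular_nabla:
  assumes \<mu>: "ad_section S P UNIV \<mu>" and sm: "ad_smooth S P UNIV \<mu>"
  shows "form_regular (nabla S P \<mu>)"
  unfolding form_regular_def
proof (intro ballI, clarify, intro conjI)
  fix c U \<sigma> assume c: "c \<in> atlas S" and \<sigma>: "(U, \<sigma>) \<in> hframes P"
  let ?T = "snd c ` (fst c \<inter> (U - Dred S))"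
  have T: "open ?T" by (rule chart_open[OF c open_minus_D[OF frame_open[OF \<sigma>]]])
  define u where "u w = \<mu> (\<sigma> (chart_inv c w))" for w
  have us: "smooth_on ?T u"
    by (rule smooth_on_subset[of "snd c ` (fst c \<inter> (U \<inter> UNIV))"])
      (use frame_values_smooth[OF c \<sigma> sm] u_def[abs_def] in auto)
  have As: "smooth_on ?T (\<lambda>w. conn P c \<sigma> (chart_inv c w))" by (rule mat_holomorphic_smooth[OF T conn_hol[OF c \<sigma>]])
  note n = nabla_in_frame[OF c \<sigma> \<mu> sm, folded u_def]
  show "smooth_on ?T (\<lambda>w. fst (nabla S P \<mu> c (\<sigma> (chart_inv c w))))"
  proof (rule smooth_on_cong[OF T])
    show "smooth_on ?T (\<lambda>w. wirt u w + lie (conn P c \<sigma> (chart_inv c w)) (u w))"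
      by (intro smooth_on_add[OF T] smooth_on_wirtinger(1)[OF T us] smooth_on_bilinear[OF bounded_bilinear_lie T As us])
  qed (simp add: n)
  show "smooth_on ?T (\<lambda>w. snd (nabla S P \<mu> c (\<sigma> (chart_inv c w))))"
    by (rule smooth_on_cong[OF T _ smooth_on_wirtinger(2)[OF T us]]) (simp add: n)
qed

text \<open>The connection is flat: \<open>\<nabla>\<^sup>2 \<mu> = 0\<close> because second derivatives commute and the connection form is holomorphic.\<close>

lemma form_closed_nabla:
  assumes \<mu>: "ad_section S P UNIV \<mu>" and sm: "ad_smooth S P UNIV \<mu>"
  shows "form_closed (nabla S P \<mu>)"
  unfolding form_closed_def
proof (intro ballI allI impI)
  fix c p assume c: "c \<in> atlas S" and p: "bproj P p \<in> fst c - Dred S"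
  define x where "x = bproj P p"
  define \<sigma> where "\<sigma> = frame_through P p"
  obtain U where \<sigma>: "(U, \<sigma>) \<in> hframes P" "x \<in> U" "\<sigma> x = p" unfolding x_def \<sigma>_def by (rule frame_through)
  have x: "x \<in> fst c" "x \<notin> Dred S" using p unfolding x_def by auto
  let ?T = "snd c ` (fst c \<inter> (U - Dred S))" and ?w = "snd c x"
  have T: "open ?T" "?w \<in> ?T" using chart_open[OF c open_minus_D[OF frame_open[OF \<sigma>(1)]]] x \<sigma>(2) by auto
  define u where "u w = \<mu> (\<sigma> (chart_inv c w))" for w
  define A where "A w = conn P c \<sigma> (chart_inv c w)" for w
  have us: "smooth_on ?T u"
    by (rule smooth_on_subset[of "snd c ` (fst c \<inter> (U \<inter> UNIV))"])
      (use frame_values_smooth[OF c \<sigma>(1) sm] u_def[abs_def] in auto)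
  have Ah: "mat_holomorphic_on A ?T" using conn_hol[OF c \<sigma>(1)] unfolding A_def[abs_def] .
  note As = mat_holomorphic_smooth[OF T(1) Ah]
  note n = nabla_in_frame[OF c \<sigma>(1) \<mu> sm, folded u_def A_def]
  have Aw: "conn P c \<sigma> x = A ?w" unfolding A_def chart_inv_left[OF chart[OF c] x(1)] ..
  have du: "wirt u differentiable (at ?w)" "wirtbar u differentiable (at ?w)" "u differentiable (at ?w)" "A differentiable (at ?w)"
    "(\<lambda>w. lie (A w) (u w)) differentiable (at ?w)"
    by (rule smooth_on_differentiable_at[OF T(1) _ T(2)];
        intro smooth_on_wirtinger[OF T(1) us] us As smooth_on_bilinear[OF bounded_bilinear_lie T(1) As us])+
  have b: "wirt (\<lambda>w. snd (nabla S P \<mu> c (\<sigma> (chart_inv c w)))) ?w = wirt (wirtbar u) ?w"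
    by (rule wirtinger_cong(1)[OF T(1) _ T(2)]) (simp add: n)
  have a: "wirtbar (\<lambda>w. fst (nabla S P \<mu> c (\<sigma> (chart_inv c w)))) ?w = wirtbar (wirt u) ?w + lie (A ?w) (wirtbar u ?w)"
  proof -
    have "wirtbar (\<lambda>w. fst (nabla S P \<mu> c (\<sigma> (chart_inv c w)))) ?w = wirtbar (\<lambda>w. wirt u w + lie (A w) (u w)) ?w"
      by (rule wirtinger_cong(2)[OF T(1) _ T(2)]) (simp add: n)
    also have "\<dots> = wirtbar (wirt u) ?w + lie (A ?w) (wirtbar u ?w)"
      unfolding wirtinger_add(2)[OF du(1,5)] wirtinger_lie(2)[OF du(4,3)] mat_holomorphic_wirtbar[OF T Ah]
      using bounded_bilinear.zero_left[OF bounded_bilinear_lie] by simp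
    finally show ?thesis .
  qed
  have nw: "snd (nabla S P \<mu> c (\<sigma> (chart_inv c ?w))) = wirtbar u ?w" using n[OF T(2)] by simp
  show "nabla10_form P (nabla S P \<mu>) c p + dbar_form P (nabla S P \<mu>) c p = 0"
    unfolding nabla10_form_def dbar_form_def Let_def x_def[symmetric] \<sigma>_def[symmetric] a b nw Aw
      wirtinger_commute[OF T us] by simp
qed

end

section \<open>Closed forms with logarithmic growth and their pairing\<close>

lemma set_integrable_near_regular:
  fixes g :: "complex \<Rightarrow> complex"
  assumes ch: "is_chart c" and M: "open M" "x \<in> M" "M \<subseteq> fst c" and g: "smooth_on (snd c ` M) g"
  shows "\<exists>N. open N \<and> x \<in> N \<and> N \<subseteq> M \<and> set_integrable lborel (snd c ` N) g"
proof -
  obtain r N where N: "r > 0" "cball (snd c x) r \<subseteq> snd c ` M" "open N" "x \<in> N" "N \<subseteq> M"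
    "snd c ` N = ball (snd c x) r"
    by (rule chart_ball_nbhd[OF ch M])
  have "continuous_on (cball (snd c x) r) g" using smooth_on_continuous[OF g] continuous_on_subset N(2) by blast
  then have "set_integrable lborel (cball (snd c x) r) g"
    unfolding set_integrable_def by (intro borel_integrable_compact) auto
  then have "set_integrable lborel (snd c ` N) g"
    unfolding N(6) by (rule set_integrable_subset) (auto intro: ball_subset_cball)
  then show ?thesis using N by blast
qed

lemma set_integrable_near_puncture:
  fixes g :: "complex \<Rightarrow> complex"
  assumes ch: "is_chart c" and M: "open M" "x \<in> M" "M \<subseteq> fst c" and x: "snd c x = 0" and g: "growth 0 g"
  shows "\<exists>N. open N \<and> x \<in> N \<and> N \<subseteq> M \<and> set_integrable lborel (snd c ` N) g \<and>
    (\<forall>v\<in>{1, \<i>}. set_integrable lborel (snd c ` N) (pdiff v g))"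
proof -
  obtain e where e: "e > 0" "set_integrable lborel (ball 0 e) g" "\<And>v. v \<in> {1, \<i>} \<Longrightarrow> set_integrable lborel (ball 0 e) (pdiff v g)"
    by (rule growth_integrable[OF g]) blast
  let ?M = "M \<inter> (fst c \<inter> snd c -` ball 0 e)"
  have oM: "open ?M"
    using M(1) continuous_open_preimage[OF chart_continuous(1,3)[OF ch] open_ball] by blast
  obtain r N where N: "r > 0" "open N" "x \<in> N" "N \<subseteq> ?M" "snd c ` N = ball (snd c x) r"
    by (rule chart_ball_nbhd[OF ch oM]) (use M x e(1) in auto)
  have sub: "snd c ` N \<subseteq> ball 0 e" "snd c ` N \<in> sets lborel" using N(4) unfolding N(5)[symmetric] by blast (simp add: N(5))
  show ?thesis
  proof (intro exI[of _ N] conjI ballI)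
    show "set_integrable lborel (snd c ` N) g" by (rule set_integrable_subset[OF e(2) sub(2,1)])
    show "set_integrable lborel (snd c ` N) (pdiff v g)" if "v \<in> {1, \<i>}" for v
      by (rule set_integrable_subset[OF e(3)[OF that] sub(2,1)])
  qed (use N in auto)
qed

lemma wd_cong:
  assumes "open T" "\<And>w. w \<in> T \<Longrightarrow> f w = g w" "w \<in> T"
  shows "wd f w = wd g w" "wdbar f w = wdbar g w"
proof -
  have e: "frechet_derivative f (at w) = frechet_derivative g (at w)"
    by (rule pdiff_cong[OF assms(1) _ assms(3)]) (rule assms(2))
  show "wd f w = wd g w" "wdbar f w = wdbar g w"
    by (simp_all only: wd_def wdbar_def e)
qed

lemma surf_integral_zero: "compact_riemann_surface At \<Longrightarrow> surf_integral At (\<lambda>c x. 0) = 0"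
  using surf_integral_sum[of At "{}"] by simp

context moduli_context
begin

text \<open>
  The frame in which growth at a marked point is measured.
\<close>

abbreviation framing_frame :: "nat \<Rightarrow> 'x \<Rightarrow> 'p" where
  "framing_frame j \<equiv> frame_through P (framing P j)"

lemma framing_frame:
  assumes "j \<in> {1..npts S}"
  obtains U where "(U, framing_frame j) \<in> hframes P" "pt S j \<in> U" "framing_frame j (pt S j) = framing P j"
proof -
  have "bproj P (framing P j) = pt S j" using framed assms unfolding generic_compatible_framing_def by blast
  then show ?thesis using frame_through[of "framing P j"] that by metis
qed

text \<open>Marked points are isolated, so a punctured disc at a marked point lies off the divisor.\<close>

lemma marked_nbhd:
  assumes j: "j \<in> {1..npts S}" and W: "open W" "pt S j \<in> W"
  obtains N e where "open N" "pt S j \<in> N" "N \<subseteq> W" "N \<subseteq> fst (crd S j)" "N \<inter> Dred S = {pt S j}"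
    "e > 0" "ball 0 e \<subseteq> snd (crd S j) ` N"
    "\<And>w. w \<in> ball 0 e - {0} \<Longrightarrow> w \<in> snd (crd S j) ` (fst (crd S j) \<inter> (W - Dred S))"
proof -
  note m = marked[OF j]
  let ?c = "crd S j"
  let ?N = "(W \<inter> fst ?c) - (Dred S - {pt S j})"
  have "closed (Dred S - {pt S j})" using finite_D finite_imp_closed by blast
  then have N: "open ?N" using W(1) chart_continuous(3)[OF chart[OF m(1)]] by blast
  have "open (snd ?c ` (fst ?c \<inter> ?N))" by (rule chart_open[OF m(1) N])
  moreover have "fst ?c \<inter> ?N = ?N" by blast
  ultimately have "open (snd ?c ` ?N)" by simp
  moreover have "0 \<in> snd ?c ` ?N" using m W(2) by (metis (no_types, lifting) Diff_iff IntI image_eqI singletonI)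
  ultimately obtain e where e: "e > 0" "ball 0 e \<subseteq> snd ?c ` ?N" using open_contains_ball by metis
  have "w \<in> snd ?c ` (fst ?c \<inter> (W - Dred S))" if w: "w \<in> ball 0 e - {0}" for w
  proof -
    obtain y where y: "y \<in> ?N" "w = snd ?c y" using e(2) w by blast
    then have "y \<noteq> pt S j" using w m(3) by auto
    then show ?thesis using y by blast
  qed
  then show ?thesis using that[OF N _ _ _ _ e] m W(2) by blast
qed

text \<open>
  A simple pole is allowed in the \<open>dz\<close>-coefficient, whereas the \<open>d\<close>\<open>z\<close>-bar-coefficient vanishes to first
  order: the orders add up to 0 in a wedge product.
\<close>

definition form_log :: "('x, 'p, 'n) ad_form \<Rightarrow> bool" where
  "form_log \<phi> \<longleftrightarrow> (\<forall>j\<in>{1..npts S}.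
     growth (-1) (\<lambda>w. fst (\<phi> (crd S j) (framing_frame j (chart_inv (crd S j) w)))) \<and>
     growth 1 (\<lambda>w. snd (\<phi> (crd S j) (framing_frame j (chart_inv (crd S j) w)))))"

text \<open>
  The class of forms that contains the hypercocycles and all \<open>\<nabla>\<mu>\<close>, is stable under sums, and on which
  the pairing converges.
\<close>

definition closed_form :: "('x, 'p, 'n) ad_form \<Rightarrow> bool" where
  "closed_form \<phi> \<longleftrightarrow> global_oneform S P \<phi> \<and> form_regular \<phi> \<and> form_closed \<phi> \<and> form_log \<phi>"

lemma closed_formD:
  assumes "closed_form \<phi>"
  shows "global_oneform S P \<phi>" "form_regular \<phi>" "form_closed \<phi>" "form_log \<phi>"
  using assms unfolding closed_form_def by blast+

lemma global_oneform_sections: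
  assumes "global_oneform S P \<phi>" "c \<in> atlas S"
  shows "ad_section S P (fst c \<inter> - Dred S) (\<lambda>p. fst (\<phi> c p))" "ad_section S P (fst c \<inter> - Dred S) (\<lambda>p. snd (\<phi> c p))"
  using assms unfolding global_oneform_def ad_oneform_def by blast+

lemma global_oneform_chart:
  assumes "global_oneform S P \<phi>" "c \<in> atlas S" "c' \<in> atlas S" "bproj P p \<in> fst c" "bproj P p \<in> fst c'" "bproj P p \<notin> Dred S"
  shows "\<phi> c' p = (cscale (jac c c' (bproj P p)) (fst (\<phi> c p)), cscale (cnj (jac c c' (bproj P p))) (snd (\<phi> c p)))"
  using assms unfolding global_oneform_def ad_oneform_def by blast

lemma global_oneform_zero:
  assumes "global_oneform S P \<phi>" "c \<notin> atlas S \<or> bproj P p \<notin> fst c - Dred S"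
  shows "\<phi> c p = (0, 0)"
  using assms unfolding global_oneform_def by blast

lemma form_regularD:
  assumes "form_regular \<phi>" "c \<in> atlas S" "(U, \<sigma>) \<in> hframes P"
  shows "smooth_on (snd c ` (fst c \<inter> (U - Dred S))) (\<lambda>w. fst (\<phi> c (\<sigma> (chart_inv c w))))"
    "smooth_on (snd c ` (fst c \<inter> (U - Dred S))) (\<lambda>w. snd (\<phi> c (\<sigma> (chart_inv c w))))"
  using assms unfolding form_regular_def by blast+

lemma ad_section_add_scaleR:
  assumes "ad_section S P W \<mu>" "ad_section S P W \<nu>"
  shows "ad_section S P W (\<lambda>p. \<mu> p + r *\<^sub>R \<nu> p)"
proof -
  have conj: "A ** (X + r *\<^sub>R Y) ** B = A ** X ** B + r *\<^sub>R (A ** Y ** B)" for A B X Y :: "'n cmat"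
    using linear_add[OF bounded_linear.linear[OF bounded_linear_conj[of A B]], of X "r *\<^sub>R Y"]
      linear_cmul[OF bounded_linear.linear[OF bounded_linear_conj[of A B]], of r Y] by simp
  have "X + r *\<^sub>R Y \<in> lieG S" if "X \<in> lieG S" "Y \<in> lieG S" for X Y
    unfolding scaleR_eq_cscale
    by (intro cmat.subspace_add[OF lie_alg_subspace] cmat.subspace_scale[OF lie_alg_subspace] that)
  then show ?thesis using assms unfolding ad_section_def by (simp add: conj)
qed

text \<open>
  All conditions are linear; the scalar -1 gives differences.
\<close>

lemma closed_form_add_scaleR:
  assumes \<phi>: "closed_form \<phi>" and \<psi>: "closed_form \<psi>"
  shows "closed_form (\<lambda>c p. \<phi> c p + r *\<^sub>R \<psi> c p)"
proof -
  note f = closed_formD[OF \<phi>] and g = closed_formD[OF \<psi>]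
  have "global_oneform S P (\<lambda>c p. \<phi> c p + r *\<^sub>R \<psi> c p)"
    unfolding global_oneform_def ad_oneform_def
  proof (intro conjI ballI allI impI)
    fix c assume c: "c \<in> atlas S"
    show "ad_section S P (fst c \<inter> - Dred S) (\<lambda>p. fst (\<phi> c p + r *\<^sub>R \<psi> c p))"
      unfolding fst_add fst_scaleR by (rule ad_section_add_scaleR[OF global_oneform_sections(1)[OF f(1) c] global_oneform_sections(1)[OF g(1) c]])
    show "ad_section S P (fst c \<inter> - Dred S) (\<lambda>p. snd (\<phi> c p + r *\<^sub>R \<psi> c p))"
      unfolding snd_add snd_scaleR by (rule ad_section_add_scaleR[OF global_oneform_sections(2)[OF f(1) c] global_oneform_sections(2)[OF g(1) c]])
    fix c' p assume c': "c' \<in> atlas S" and p: "bproj P p \<in> fst c \<inter> fst c' \<inter> - Dred S"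
    show "\<phi> c' p + r *\<^sub>R \<psi> c' p = (cscale (jac c c' (bproj P p)) (fst (\<phi> c p + r *\<^sub>R \<psi> c p)),
        cscale (cnj (jac c c' (bproj P p))) (snd (\<phi> c p + r *\<^sub>R \<psi> c p)))"
      using global_oneform_chart[OF f(1) c c'] global_oneform_chart[OF g(1) c c'] p
      by (simp add: cmat.scale_right_distrib scaleR_eq_cscale mult.commute)
  next
    fix c p assume "c \<notin> atlas S \<or> bproj P p \<notin> fst c - Dred S"
    then show "\<phi> c p + r *\<^sub>R \<psi> c p = (0, 0)" using global_oneform_zero[OF f(1)] global_oneform_zero[OF g(1)] by simp
  qed
  moreover have "form_regular (\<lambda>c p. \<phi> c p + r *\<^sub>R \<psi> c p)"
    unfolding form_regular_def
  proof (intro ballI, clarify)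
    fix c U \<sigma> assume c: "c \<in> atlas S" and \<sigma>: "(U, \<sigma>) \<in> hframes P"
    note T = chart_open[OF c open_minus_D[OF frame_open[OF \<sigma>]]]
    show "smooth_on (snd c ` (fst c \<inter> (U - Dred S))) (\<lambda>w. fst (\<phi> c (\<sigma> (chart_inv c w)) + r *\<^sub>R \<psi> c (\<sigma> (chart_inv c w)))) \<and>
      smooth_on (snd c ` (fst c \<inter> (U - Dred S))) (\<lambda>w. snd (\<phi> c (\<sigma> (chart_inv c w)) + r *\<^sub>R \<psi> c (\<sigma> (chart_inv c w))))"
      unfolding fst_add snd_add fst_scaleR snd_scaleR
      by (intro conjI smooth_on_add[OF T] smooth_on_linear[OF T bounded_linear_scaleR_right] form_regularD[OF f(2) c \<sigma>] form_regularD[OF g(2) c \<sigma>])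
  qed
  moreover have "form_closed (\<lambda>c p. \<phi> c p + r *\<^sub>R \<psi> c p)"
    unfolding form_closed_def
  proof (intro ballI allI impI)
    fix c p assume c: "c \<in> atlas S" and p: "bproj P p \<in> fst c - Dred S"
    define x where "x = bproj P p"
    define \<sigma> where "\<sigma> = frame_through P p"
    obtain U where \<sigma>: "(U, \<sigma>) \<in> hframes P" "x \<in> U" "\<sigma> x = p" unfolding x_def \<sigma>_def by (rule frame_through)
    note T = chart_open[OF c open_minus_D[OF frame_open[OF \<sigma>(1)]]]
    have wT: "snd c x \<in> snd c ` (fst c \<inter> (U - Dred S))" using p \<sigma>(2) unfolding x_def by blast
    have d: "(\<lambda>w. fst (\<phi> c (\<sigma> (chart_inv c w)))) differentiable (at (snd c x))" "(\<lambda>w. snd (\<phi> c (\<sigma> (chart_inv c w)))) differentiable (at (snd c x))"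
      "(\<lambda>w. fst (\<psi> c (\<sigma> (chart_inv c w)))) differentiable (at (snd c x))" "(\<lambda>w. snd (\<psi> c (\<sigma> (chart_inv c w)))) differentiable (at (snd c x))"
      by (rule smooth_on_differentiable_at[OF T _ wT], rule form_regularD[OF f(2) c \<sigma>(1)] form_regularD[OF g(2) c \<sigma>(1)])+
    note scaled = smooth_on_differentiable_at[OF T smooth_on_linear[OF T bounded_linear_scaleR_right form_regularD(1)[OF g(2) c \<sigma>(1)]] wT]
      smooth_on_differentiable_at[OF T smooth_on_linear[OF T bounded_linear_scaleR_right form_regularD(2)[OF g(2) c \<sigma>(1)]] wT]
    have lie_scaleR: "lie X (r *\<^sub>R Y) = r *\<^sub>R lie X Y" for X Y :: "'n cmat"
      unfolding scaleR_eq_cscale lie_cscale ..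
    have vanish: "(X + r *\<^sub>R X' + (Y + r *\<^sub>R Y')) + - (Z + r *\<^sub>R Z') = 0" if "X + Y + - Z = 0" "X' + Y' + - Z' = 0" for X Y Z X' Y' Z' :: "'n cmat"
    proof -
      have "(X + r *\<^sub>R X' + (Y + r *\<^sub>R Y')) + - (Z + r *\<^sub>R Z') = (X + Y + - Z) + r *\<^sub>R (X' + Y' + - Z')"
        by (simp add: algebra_simps)
      then show ?thesis unfolding that by simp
    qed
    have "nabla10_form P \<phi> c p + dbar_form P \<phi> c p = 0" "nabla10_form P \<psi> c p + dbar_form P \<psi> c p = 0"
      using f(3) g(3) c p unfolding form_closed_def by blast+
    note zero = this[unfolded nabla10_form_def dbar_form_def Let_def x_def[symmetric] \<sigma>_def[symmetric]]
    show "nabla10_form P (\<lambda>c p. \<phi> c p + r *\<^sub>R \<psi> c p) c p + dbar_form P (\<lambda>c p. \<phi> c p + r *\<^sub>R \<psi> c p) c p = 0"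
      unfolding nabla10_form_def dbar_form_def Let_def x_def[symmetric] \<sigma>_def[symmetric] fst_add snd_add
        fst_scaleR snd_scaleR wirtinger_add(1)[OF d(2) scaled(2)] wirtinger_add(2)[OF d(1) scaled(1)]
        wirtinger_scaleR(1)[OF d(4)] wirtinger_scaleR(2)[OF d(3)] lie_add(1) lie_scaleR
      by (rule vanish[OF zero])
  qed
  moreover have "form_log (\<lambda>c p. \<phi> c p + r *\<^sub>R \<psi> c p)"
    unfolding form_log_def fst_add snd_add fst_scaleR snd_scaleR
    by (intro ballI conjI growth_add growth_linear[OF bounded_linear_scaleR_right]) (use f(4) g(4) in \<open>unfold form_log_def, blast+\<close>)
  ultimately show ?thesis unfolding closed_form_def by blast
qed

lemma closed_form_add:
  assumes "closed_form \<phi>" "closed_form \<psi>"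
  shows "closed_form (\<lambda>c p. \<phi> c p + \<psi> c p)"
  using closed_form_add_scaleR[OF assms, of 1] by (simp only: scaleR_one)

lemma killing_wedge_at:
  assumes \<phi>: "global_oneform S P \<phi>" and \<psi>: "global_oneform S P \<psi>" and c: "c \<in> atlas S" and p: "bproj P p = x" "x \<in> fst c" "x \<notin> Dred S"
  shows "killing_wedge S P \<phi> \<psi> c x = kill (grp S) (fst (\<phi> c p)) (snd (\<psi> c p)) - kill (grp S) (snd (\<phi> c p)) (fst (\<psi> c p))"
proof -
  define q where "q = (SOME p. bproj P p = x)"
  have q: "bproj P q = x" unfolding q_def by (rule fibre_point)
  let ?W = "fst c \<inter> - Dred S"
  have xW: "bproj P p \<in> ?W" "bproj P q \<in> ?W" using p q by auto
  note s = global_oneform_sections[OF \<phi> c] and t = global_oneform_sections[OF \<psi> c]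
  have "killing_wedge S P \<phi> \<psi> c x = killing (grp S) (fst (\<phi> c q)) (snd (\<psi> c q)) - killing (grp S) (snd (\<phi> c q)) (fst (\<psi> c q))"
    unfolding killing_wedge_def Let_def q_def ..
  also have "\<dots> = kill (grp S) (fst (\<phi> c q)) (snd (\<psi> c q)) - kill (grp S) (snd (\<phi> c q)) (fst (\<psi> c q))"
    using kill_eq_killing[OF group ad_section_in[OF s(1) xW(2)] ad_section_in[OF t(2) xW(2)]]
      kill_eq_killing[OF group ad_section_in[OF s(2) xW(2)] ad_section_in[OF t(1) xW(2)]] by simp
  also have "\<dots> = kill (grp S) (fst (\<phi> c p)) (snd (\<psi> c p)) - kill (grp S) (snd (\<phi> c p)) (fst (\<psi> c p))"
    using kill_fibre[OF s(1) t(2) xW(1), of q] kill_fibre[OF s(2) t(1) xW(1), of q] p(1) q by simp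
  finally show ?thesis .
qed

lemma killing_wedge_divisor:
  assumes \<phi>: "global_oneform S P \<phi>" and \<psi>: "global_oneform S P \<psi>" and x: "x \<in> Dred S"
  shows "killing_wedge S P \<phi> \<psi> c x = 0"
proof -
  have "0 \<in> lieG S" using cmat.subspace_0[OF lie_alg_subspace] .
  then have "killing (grp S) 0 0 = 0" using kill_eq_killing[OF group, of 0 0] kill_zero(1) by metis
  moreover have "\<phi> c (SOME p. bproj P p = x) = (0, 0)" "\<psi> c (SOME p. bproj P p = x) = (0, 0)"
    using global_oneform_zero[OF \<phi>] global_oneform_zero[OF \<psi>] fibre_point[of x] x by auto
  ultimately show ?thesis unfolding killing_wedge_def Let_def by simp
qed

text \<open>
  Away from the divisor the coefficient is smooth; at a marked point it has growth \<open>-1 + 1 = 0\<close>.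
\<close>

lemma two_form_killing_wedge:
  assumes \<phi>: "closed_form \<phi>" and \<psi>: "closed_form \<psi>"
  shows "two_form (atlas S) (killing_wedge S P \<phi> \<psi>)"
  unfolding two_form_def
proof (intro conjI ballI allI)
  note f = closed_formD[OF \<phi>] and g = closed_formD[OF \<psi>]
  {
    fix c c' x assume c: "c \<in> atlas S" "c' \<in> atlas S" and x: "x \<in> fst c \<inter> fst c'"
    show "killing_wedge S P \<phi> \<psi> c' x = of_real ((cmod (jac c c' x))\<^sup>2) * killing_wedge S P \<phi> \<psi> c x"
    proof (cases "x \<in> Dred S")
      case True
      then show ?thesis using killing_wedge_divisor[OF f(1) g(1) True] by simp
    next
      case False
      define p where "p = (SOME p. bproj P p = x)"
      have p: "bproj P p = x" unfolding p_def by (rule fibre_point)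
      let ?J = "jac c c' x"
      have e: "\<phi> c' p = (cscale ?J (fst (\<phi> c p)), cscale (cnj ?J) (snd (\<phi> c p)))"
        "\<psi> c' p = (cscale ?J (fst (\<psi> c p)), cscale (cnj ?J) (snd (\<psi> c p)))"
        using global_oneform_chart[OF f(1) c, of p] global_oneform_chart[OF g(1) c, of p] p x False by auto
      show ?thesis
        unfolding killing_wedge_at[OF f(1) g(1) c(1) p IntD1[OF x] False] killing_wedge_at[OF f(1) g(1) c(2) p IntD2[OF x] False]
          e complex_norm_square by (simp add: kill_cscale right_diff_distrib mult.left_commute)
    qed
  next
    fix x
    show "\<exists>c\<in>atlas S. \<exists>N. open N \<and> x \<in> N \<and> N \<subseteq> fst c \<and> set_integrable lborel (snd c ` N) (killing_wedge S P \<phi> \<psi> c \<circ> chart_inv c)"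
    proof (cases "x \<in> Dred S")
      case False
      obtain c where c: "c \<in> atlas S" "x \<in> fst c" using chart_cover by blast
      obtain U \<sigma> where \<sigma>: "(U, \<sigma>) \<in> hframes P" "x \<in> U" by (rule frame_cover)
      let ?M = "fst c \<inter> (U - Dred S)"
      let ?g = "\<lambda>w. kill (grp S) (fst (\<phi> c (\<sigma> (chart_inv c w)))) (snd (\<psi> c (\<sigma> (chart_inv c w))))
         - kill (grp S) (snd (\<phi> c (\<sigma> (chart_inv c w)))) (fst (\<psi> c (\<sigma> (chart_inv c w))))"
      have T: "open (snd c ` ?M)" by (rule chart_open[OF c(1) open_minus_D[OF frame_open[OF \<sigma>(1)]]])
      have sm: "smooth_on (snd c ` ?M) ?g"
        by (intro smooth_on_diff[OF T] smooth_on_bilinear[OF bounded_bilinear_kill T]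
            form_regularD[OF f(2) c(1) \<sigma>(1)] form_regularD[OF g(2) c(1) \<sigma>(1)])
      have M: "open ?M" "x \<in> ?M" "?M \<subseteq> fst c"
        using chart_continuous(3)[OF chart[OF c(1)]] open_minus_D[OF frame_open[OF \<sigma>(1)]] c \<sigma>(2) False by auto
      obtain N where N: "open N" "x \<in> N" "N \<subseteq> ?M" "set_integrable lborel (snd c ` N) ?g"
        using set_integrable_near_regular[OF chart[OF c(1)] M sm] by blast
      have "killing_wedge S P \<phi> \<psi> c (chart_inv c w) = ?g w" if w: "w \<in> snd c ` N" for w
      proof -
        have "w \<in> snd c ` ?M" using w N(3) by blast
        note i = in_chart[OF c(1) this]
        show ?thesis
          using killing_wedge_at[OF f(1) g(1) c(1) frame_proj[OF \<sigma>(1)] i(1)] i(2) by blast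
      qed
      then have "set_integrable lborel (snd c ` N) (killing_wedge S P \<phi> \<psi> c \<circ> chart_inv c)"
        using N(4) by (subst set_integrable_cong[OF refl refl]) auto
      then show ?thesis using c N M(3) by blast
    next
      case True
      then obtain j where j: "j \<in> {1..npts S}" "x = pt S j" by (rule marked_cases)
      note m = marked[OF j(1)]
      let ?c = "crd S j" and ?\<sigma> = "framing_frame j"
      obtain U where \<sigma>: "(U, ?\<sigma>) \<in> hframes P" "pt S j \<in> U" by (rule framing_frame[OF j(1)])
      obtain M e where M: "open M" "pt S j \<in> M" "M \<subseteq> U" "M \<subseteq> fst ?c" "M \<inter> Dred S = {pt S j}"
        by (rule marked_nbhd[OF j(1) frame_open[OF \<sigma>(1)] \<sigma>(2)])
      let ?g = "\<lambda>w. kill (grp S) (fst (\<phi> ?c (?\<sigma> (chart_inv ?c w)))) (snd (\<psi> ?c (?\<sigma> (chart_inv ?c w))))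
         - kill (grp S) (snd (\<phi> ?c (?\<sigma> (chart_inv ?c w)))) (fst (\<psi> ?c (?\<sigma> (chart_inv ?c w))))"
      have gr: "growth (-1) (\<lambda>w. fst (\<phi> ?c (?\<sigma> (chart_inv ?c w))))" "growth 1 (\<lambda>w. snd (\<phi> ?c (?\<sigma> (chart_inv ?c w))))"
        "growth (-1) (\<lambda>w. fst (\<psi> ?c (?\<sigma> (chart_inv ?c w))))" "growth 1 (\<lambda>w. snd (\<psi> ?c (?\<sigma> (chart_inv ?c w))))"
        using f(4) g(4) j(1) unfolding form_log_def by blast+
      have "growth 0 (\<lambda>w. kill (grp S) (fst (\<phi> ?c (?\<sigma> (chart_inv ?c w)))) (snd (\<psi> ?c (?\<sigma> (chart_inv ?c w))))
         + - kill (grp S) (snd (\<phi> ?c (?\<sigma> (chart_inv ?c w)))) (fst (\<psi> ?c (?\<sigma> (chart_inv ?c w)))))"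
        using growth_bilinear[OF bounded_bilinear_kill gr(1,4), of "grp S"] growth_bilinear[OF bounded_bilinear_kill gr(2,3), of "grp S"]
        by (intro growth_add growth_linear[OF bounded_linear_minus[OF bounded_linear_ident]]) simp_all
      then have "growth 0 ?g" by simp
      from set_integrable_near_puncture[OF chart[OF m(1)] M(1,2,4) m(3) this]
      obtain N where N: "open N" "pt S j \<in> N" "N \<subseteq> M" "set_integrable lborel (snd ?c ` N) ?g" by blast
      have "killing_wedge S P \<phi> \<psi> ?c (chart_inv ?c w) = ?g w" if w: "w \<in> snd ?c ` N" for w
      proof -
        have "w \<in> snd ?c ` (fst ?c \<inter> N)" using w N(3) M(4) by blast
        note i = in_chart[OF m(1) this]
        have pr: "bproj P (?\<sigma> (chart_inv ?c w)) = chart_inv ?c w"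
          using frame_proj[OF \<sigma>(1)] i(2) N(3) M(3) by blast
        show ?thesis
        proof (cases "chart_inv ?c w \<in> Dred S")
          case True
          then have "\<phi> ?c (?\<sigma> (chart_inv ?c w)) = (0, 0)" using global_oneform_zero[OF f(1)] pr by simp
          then show ?thesis using killing_wedge_divisor[OF f(1) g(1) True] by (simp add: kill_zero)
        next
          case False
          then show ?thesis by (rule killing_wedge_at[OF f(1) g(1) m(1) pr i(1)])
        qed
      qed
      then have "set_integrable lborel (snd ?c ` N) (killing_wedge S P \<phi> \<psi> ?c \<circ> chart_inv ?c)"
        using N(4) by (subst set_integrable_cong[OF refl refl]) auto
      then show ?thesis using m(1) N M(4) j(2) by blast
    qed
  }
qed

text \<open>
  A common class for the infinitesimal gauge transformations and for the sections whose coboundaries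
  are taken in hypercohomology.
\<close>

definition gauge_section :: "('p \<Rightarrow> 'n cmat) \<Rightarrow> bool" where
  "gauge_section \<mu> \<longleftrightarrow> ad_section S P UNIV \<mu> \<and> ad_smooth S P UNIV \<mu> \<and>
     (\<forall>j\<in>{1..npts S}. growth 1 (\<lambda>w. \<mu> (framing_frame j (chart_inv (crd S j) w)))) \<and> form_log (nabla S P \<mu>)"

lemma closed_form_nabla: "gauge_section \<mu> \<Longrightarrow> closed_form (nabla S P \<mu>)"
  unfolding gauge_section_def closed_form_def
  using global_oneform_nabla form_regular_nabla form_closed_nabla by blast

text \<open>
  Stokes' theorem for the one-form \<open>\<kappa>(\<mu>, \<psi>)\<close>: by invariance of the Killing form and closedness of
  \<open>\<psi>\<close> its derivative is \<open>\<kappa>(\<nabla>\<mu> \<and> \<psi>)\<close>.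
\<close>

lemma integral_exact:
  assumes \<mu>: "gauge_section \<mu>" and \<psi>: "closed_form \<psi>"
  shows "surf_integral (atlas S) (killing_wedge S P (nabla S P \<mu>) \<psi>) = 0"
proof -
  have sec: "ad_section S P UNIV \<mu>" and sm: "ad_smooth S P UNIV \<mu>"
    and gr: "\<And>j. j \<in> {1..npts S} \<Longrightarrow> growth 1 (\<lambda>w. \<mu> (framing_frame j (chart_inv (crd S j) w)))"
    using \<mu> unfolding gauge_section_def by blast+
  note g = closed_formD[OF \<psi>] and n = closed_formD[OF closed_form_nabla[OF \<mu>]]
  define q where "q x = (SOME p. bproj P p = x)" for x
  have q: "bproj P (q x) = x" for x unfolding q_def by (rule fibre_point)
  define a where "a c x = kill (grp S) (\<mu> (q x)) (fst (\<psi> c (q x)))" for c x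
  define b where "b c x = kill (grp S) (\<mu> (q x)) (snd (\<psi> c (q x)))" for c x
  have at: "a c x = kill (grp S) (\<mu> p) (fst (\<psi> c p))" "b c x = kill (grp S) (\<mu> p) (snd (\<psi> c p))"
    if c: "c \<in> atlas S" and p: "bproj P p = x" and x: "x \<in> fst c" for c p x
  proof -
    have "a c x = kill (grp S) (\<mu> p) (fst (\<psi> c p)) \<and> b c x = kill (grp S) (\<mu> p) (snd (\<psi> c p))"
    proof (cases "x \<in> Dred S")
      case True
      then have "\<psi> c p = (0, 0)" "\<psi> c (q x) = (0, 0)" using global_oneform_zero[OF g(1)] p q[of x] by auto
      then show ?thesis unfolding a_def b_def by (simp add: kill_zero)
    next
      case False
      have sW: "ad_section S P (fst c \<inter> - Dred S) \<mu>" using sec unfolding ad_section_def by blast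
      have xW: "bproj P p \<in> fst c \<inter> - Dred S" using p x False by auto
      have e: "bproj P (q x) = bproj P p" using p q by simp
      show ?thesis unfolding a_def b_def
        using kill_fibre[OF sW global_oneform_sections(1)[OF g(1) c] xW e]
          kill_fibre[OF sW global_oneform_sections(2)[OF g(1) c] xW e] by blast
    qed
    then show "a c x = kill (grp S) (\<mu> p) (fst (\<psi> c p))" "b c x = kill (grp S) (\<mu> p) (snd (\<psi> c p))" by blast+
  qed
  have in_frame: "a c (chart_inv c w) = kill (grp S) (\<mu> (\<sigma> (chart_inv c w))) (fst (\<psi> c (\<sigma> (chart_inv c w))))"
    "b c (chart_inv c w) = kill (grp S) (\<mu> (\<sigma> (chart_inv c w))) (snd (\<psi> c (\<sigma> (chart_inv c w))))"
    if c: "c \<in> atlas S" and \<sigma>: "(U, \<sigma>) \<in> hframes P" and w: "w \<in> snd c ` (fst c \<inter> U)" for c U \<sigma> w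
    using at[OF c frame_proj[OF \<sigma> in_chart(2)[OF c w]] in_chart(1)[OF c w]] by blast+
  have smooth: "smooth_on (snd c ` (fst c \<inter> (U - Dred S))) (\<lambda>w. a c (chart_inv c w))"
    "smooth_on (snd c ` (fst c \<inter> (U - Dred S))) (\<lambda>w. b c (chart_inv c w))"
    if c: "c \<in> atlas S" and \<sigma>: "(U, \<sigma>) \<in> hframes P" for c U \<sigma>
  proof -
    let ?T = "snd c ` (fst c \<inter> (U - Dred S))"
    have T: "open ?T" by (rule chart_open[OF c open_minus_D[OF frame_open[OF \<sigma>]]])
    have u: "smooth_on ?T (\<lambda>w. \<mu> (\<sigma> (chart_inv c w)))"
      by (rule smooth_on_subset[OF frame_values_smooth[OF c \<sigma> sm]]) blast
    have k: "smooth_on ?T (\<lambda>w. kill (grp S) (\<mu> (\<sigma> (chart_inv c w))) (fst (\<psi> c (\<sigma> (chart_inv c w)))))"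
      "smooth_on ?T (\<lambda>w. kill (grp S) (\<mu> (\<sigma> (chart_inv c w))) (snd (\<psi> c (\<sigma> (chart_inv c w)))))"
      by (intro smooth_on_bilinear[OF bounded_bilinear_kill T u] form_regularD[OF g(2) c \<sigma>])+
    have TU: "w \<in> snd c ` (fst c \<inter> U)" if "w \<in> ?T" for w using that by blast
    show "smooth_on ?T (\<lambda>w. a c (chart_inv c w))"
      by (rule smooth_on_cong[OF T _ k(1)]) (rule in_frame(1)[OF c \<sigma> TU, symmetric])
    show "smooth_on ?T (\<lambda>w. b c (chart_inv c w))"
      by (rule smooth_on_cong[OF T _ k(2)]) (rule in_frame(2)[OF c \<sigma> TU, symmetric])
  qed
  have one: "one_form (atlas S) (Dred S) a b"
    unfolding one_form_def
  proof (intro conjI ballI)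
    show "finite (Dred S)" by (rule finite_D)
  next
    fix c c' x assume c: "c \<in> atlas S" "c' \<in> atlas S" and x: "x \<in> fst c \<inter> fst c' - Dred S"
    have e: "\<psi> c' (q x) = (cscale (jac c c' x) (fst (\<psi> c (q x))), cscale (cnj (jac c c' x)) (snd (\<psi> c (q x))))"
      using global_oneform_chart[OF g(1) c, of "q x"] x unfolding q by blast
    show "a c' x = jac c c' x * a c x" "b c' x = cnj (jac c c' x) * b c x"
      unfolding a_def b_def e by (simp_all add: kill_cscale)
  next
    fix c assume c: "c \<in> atlas S"
    have o: "open (snd c ` (fst c - Dred S))"
      by (rule chart_image_minus_finite[OF chart[OF c] finite_D chart_continuous(3)[OF chart[OF c]] order_refl])
    have loc: "\<exists>T. open T \<and> w \<in> T \<and> smooth_on T (\<lambda>w. a c (chart_inv c w)) \<and> smooth_on T (\<lambda>w. b c (chart_inv c w))"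
      if w: "w \<in> snd c ` (fst c - Dred S)" for w
    proof -
      obtain x where x: "x \<in> fst c" "x \<notin> Dred S" "w = snd c x" using w by blast
      obtain U \<sigma> where \<sigma>: "(U, \<sigma>) \<in> hframes P" "x \<in> U" by (rule frame_cover)
      have "w \<in> snd c ` (fst c \<inter> (U - Dred S))" using x \<sigma>(2) by blast
      then show ?thesis using smooth[OF c \<sigma>(1)] chart_open[OF c open_minus_D[OF frame_open[OF \<sigma>(1)]]] by blast
    qed
    show "smooth_on (snd c ` (fst c - Dred S)) (\<lambda>w. a c (chart_inv c w))"
      by (rule smooth_on_local[OF o]) (use loc in blast)
    show "smooth_on (snd c ` (fst c - Dred S)) (\<lambda>w. b c (chart_inv c w))"
      by (rule smooth_on_local[OF o]) (use loc in blast)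
  qed
  have loc: "locally_integrable (atlas S) a b x" if x: "x \<in> Dred S" for x
  proof -
    obtain j where j: "j \<in> {1..npts S}" "x = pt S j" using x by (rule marked_cases)
    note m = marked[OF j(1)]
    let ?c = "crd S j" and ?\<sigma> = "framing_frame j"
    obtain U where \<sigma>: "(U, ?\<sigma>) \<in> hframes P" "pt S j \<in> U" by (rule framing_frame[OF j(1)])
    let ?ga = "\<lambda>w. kill (grp S) (\<mu> (?\<sigma> (chart_inv ?c w))) (fst (\<psi> ?c (?\<sigma> (chart_inv ?c w))))"
    let ?gb = "\<lambda>w. kill (grp S) (\<mu> (?\<sigma> (chart_inv ?c w))) (snd (\<psi> ?c (?\<sigma> (chart_inv ?c w))))"
    have l: "growth (-1) (\<lambda>w. fst (\<psi> ?c (?\<sigma> (chart_inv ?c w))))" "growth 1 (\<lambda>w. snd (\<psi> ?c (?\<sigma> (chart_inv ?c w))))"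
      using g(4) j(1) unfolding form_log_def by blast+
    have ga: "growth 0 ?ga" using growth_bilinear[OF bounded_bilinear_kill gr[OF j(1)] l(1), of "grp S"] by simp
    have gb: "growth 0 ?gb"
      by (rule growth_weaken[OF growth_bilinear[OF bounded_bilinear_kill gr[OF j(1)] l(2)]]) simp
    have M: "open (fst ?c \<inter> U)" "pt S j \<in> fst ?c \<inter> U" "fst ?c \<inter> U \<subseteq> fst ?c"
      using frame_open[OF \<sigma>(1)] chart_continuous(3)[OF chart[OF m(1)]] m(2) \<sigma>(2) by auto
    obtain N1 where N1: "open N1" "pt S j \<in> N1" "N1 \<subseteq> fst ?c \<inter> U" "set_integrable lborel (snd ?c ` N1) ?ga"
      "\<forall>v\<in>{1, \<i>}. set_integrable lborel (snd ?c ` N1) (pdiff v ?ga)"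
      using set_integrable_near_puncture[OF chart[OF m(1)] M m(3) ga] by blast
    have N1': "N1 \<subseteq> fst ?c" using N1(3) by blast
    obtain N2 where N2: "open N2" "pt S j \<in> N2" "N2 \<subseteq> N1" "set_integrable lborel (snd ?c ` N2) ?gb"
      "\<forall>v\<in>{1, \<i>}. set_integrable lborel (snd ?c ` N2) (pdiff v ?gb)"
      using set_integrable_near_puncture[OF chart[OF m(1)] N1(1,2) N1' m(3) gb] by blast
    have sub: "fst ?c \<inter> N2 = N2" using N2(3) N1' by blast
    have op: "open (snd ?c ` N2)" using chart_open[OF m(1) N2(1)] unfolding sub .
    have i1: "set_integrable lborel (snd ?c ` N2) ?ga" "\<forall>v\<in>{1, \<i>}. set_integrable lborel (snd ?c ` N2) (pdiff v ?ga)"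
      using N1(4,5) N2(3) op by (auto intro!: set_integrable_subset[of lborel "snd ?c ` N1"])
    have wU: "w \<in> snd ?c ` (fst ?c \<inter> U)" if "w \<in> snd ?c ` N2" for w using that N2(3) N1(3) by blast
    have ea: "?ga w = a ?c (chart_inv ?c w)" and eb: "?gb w = b ?c (chart_inv ?c w)" if "w \<in> snd ?c ` N2" for w
      using in_frame[OF m(1) \<sigma>(1) wU[OF that]] by simp_all
    have tr: "set_integrable lborel (snd ?c ` N2) f \<and> (\<forall>v\<in>{1, \<i>}. set_integrable lborel (snd ?c ` N2) (pdiff v f))"
      if h: "set_integrable lborel (snd ?c ` N2) h" "\<forall>v\<in>{1, \<i>}. set_integrable lborel (snd ?c ` N2) (pdiff v h)"
        and eq: "\<And>w. w \<in> snd ?c ` N2 \<Longrightarrow> h w = f w" for f h :: "complex \<Rightarrow> complex"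
    proof -
      have p: "pdiff v h w = pdiff v f w" if "w \<in> snd ?c ` N2" for v w
        using pdiff_cong[OF op eq that] by simp
      have "set_integrable lborel (snd ?c ` N2) (pdiff v f)" if "v \<in> {1, \<i>}" for v
        by (rule iffD1[OF set_integrable_cong[OF refl refl p] bspec[OF h(2) that]])
      then show ?thesis using iffD1[OF set_integrable_cong[OF refl refl eq] h(1)] by blast
    qed
    show ?thesis
      unfolding locally_integrable_def
      using tr[OF i1 ea] tr[OF N2(4,5) eb] m(1) N2(1,2) sub j(2)
      by (intro bexI[of _ ?c] exI[of _ N2]) (simp_all, blast)
  qed
  have "dform (Dred S) a b c x = killing_wedge S P (nabla S P \<mu>) \<psi> c x" if c: "c \<in> atlas S" and x: "x \<in> fst c" for c x
  proof (cases "x \<in> Dred S")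
    case True
    then show ?thesis using killing_wedge_divisor[OF n(1) g(1) True] unfolding dform_def by simp
  next
    case False
    define p where "p = q x"
    have p: "bproj P p = x" unfolding p_def by (rule q)
    define \<sigma> where "\<sigma> = frame_through P p"
    obtain U where \<sigma>: "(U, \<sigma>) \<in> hframes P" "x \<in> U" "\<sigma> x = p" using frame_through[of p] unfolding p \<sigma>_def by metis
    let ?T = "snd c ` (fst c \<inter> (U - Dred S))" and ?w = "snd c x"
    have T: "open ?T" "?w \<in> ?T" using chart_open[OF c open_minus_D[OF frame_open[OF \<sigma>(1)]]] x \<sigma>(2) False by auto
    have iw: "chart_inv c ?w = x" by (rule chart_inv_left[OF chart[OF c] x])
    define u where "u w = \<mu> (\<sigma> (chart_inv c w))" for w
    define A where "A w = fst (\<psi> c (\<sigma> (chart_inv c w)))" for w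
    define B where "B w = snd (\<psi> c (\<sigma> (chart_inv c w)))" for w
    define C where "C = conn P c \<sigma> x"
    have us: "smooth_on ?T u" unfolding u_def[abs_def]
      by (rule smooth_on_subset[OF frame_values_smooth[OF c \<sigma>(1) sm]]) blast
    note d = smooth_on_differentiable_at[OF T(1) us T(2)]
      smooth_on_differentiable_at[OF T(1) form_regularD(1)[OF g(2) c \<sigma>(1)] T(2), folded A_def]
      smooth_on_differentiable_at[OF T(1) form_regularD(2)[OF g(2) c \<sigma>(1)] T(2), folded B_def]
    have TU: "w \<in> snd c ` (fst c \<inter> U)" if "w \<in> ?T" for w using that by blast
    have eqs: "a c (chart_inv c w) = kill (grp S) (u w) (A w)" "b c (chart_inv c w) = kill (grp S) (u w) (B w)" if "w \<in> ?T" for w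
      unfolding u_def A_def B_def by (rule in_frame[OF c \<sigma>(1) TU[OF that]])+
    have "dform (Dred S) a b c x = wd (\<lambda>w. kill (grp S) (u w) (B w)) ?w - wdbar (\<lambda>w. kill (grp S) (u w) (A w)) ?w"
      unfolding dform_def using False wd_cong(1)[OF T(1) eqs(2) T(2)] wd_cong(2)[OF T(1) eqs(1) T(2)] by simp
    also have "\<dots> = kill (grp S) (wirt u ?w) (B ?w) - kill (grp S) (wirtbar u ?w) (A ?w) + kill (grp S) (u ?w) (wirt B ?w - wirtbar A ?w)"
      unfolding wirtinger_kill(1)[OF d(1,3)] wirtinger_kill(2)[OF d(1,2)] kill_diff by (simp add: algebra_simps)
    also have "wirt B ?w - wirtbar A ?w = - lie C (B ?w)"
    proof -
      have "nabla10_form P \<psi> c p + dbar_form P \<psi> c p = 0" using g(3) c p x False unfolding form_closed_def by blast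
      then have "wirt B ?w + lie C (B ?w) - wirtbar A ?w = 0"
        unfolding nabla10_form_def dbar_form_def Let_def p \<sigma>_def[symmetric] C_def A_def[abs_def] B_def[abs_def] by simp
      then show ?thesis by (simp add: algebra_simps eq_neg_iff_add_eq_0)
    qed
    also have "kill (grp S) (u ?w) (- lie C (B ?w)) = kill (grp S) (lie C (u ?w)) (B ?w)"
    proof -
      have in': "C \<in> lieG S" "u ?w \<in> lieG S" "B ?w \<in> lieG S"
        using conn_in[OF c \<sigma>(1) x] \<sigma>(2) False ad_section_in[OF sec UNIV_I] ad_section_in[OF global_oneform_sections(2)[OF g(1) c], of p] p x
        unfolding C_def u_def B_def iw \<sigma>(3) by auto
      have "lie C (B ?w) \<in> lieG S" "lie C (u ?w) \<in> lieG S" using lie_alg_lie[OF group] in' by blast+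
      then have "kill (grp S) (lie C (u ?w)) (B ?w) = - kill (grp S) (u ?w) (lie C (B ?w))"
        using killing_invariant[OF group in'] kill_eq_killing[OF group] in' by simp
      then show ?thesis by (simp add: kill_minus)
    qed
    also have "kill (grp S) (wirt u ?w) (B ?w) - kill (grp S) (wirtbar u ?w) (A ?w) + kill (grp S) (lie C (u ?w)) (B ?w)
      = killing_wedge S P (nabla S P \<mu>) \<psi> c x"
    proof -
      have "nabla S P \<mu> c p = (wirt u ?w + lie C (u ?w), wirtbar u ?w)"
        using nabla_frame[OF c \<sigma>(1) open_UNIV sec sm x \<sigma>(2) UNIV_I False] unfolding \<sigma>(3) u_def[abs_def] C_def .
      moreover have "\<psi> c p = (A ?w, B ?w)" unfolding A_def B_def iw \<sigma>(3) by simp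
      ultimately show ?thesis
        using killing_wedge_at[OF n(1) g(1) c p x False] by (simp add: kill_add)
    qed
    finally show ?thesis .
  qed
  then have "surf_integral (atlas S) (killing_wedge S P (nabla S P \<mu>) \<psi>) = surf_integral (atlas S) (dform (Dred S) a b)"
    by (intro surf_integral_cong[OF surface]) simp
  also have "\<dots> = 0" by (rule stokes(2)[OF surface one loc])
  finally show ?thesis .
qed

lemma pairing_add:
  assumes \<phi>: "closed_form \<phi>" and \<theta>: "closed_form \<theta>" and \<psi>: "closed_form \<psi>"
  shows "AB_form S P (\<lambda>c p. \<phi> c p + \<theta> c p) \<psi> = AB_form S P \<phi> \<psi> + AB_form S P \<theta> \<psi>"
proof -
  note f = closed_formD(1)[OF \<phi>] and h = closed_formD(1)[OF \<theta>] and g = closed_formD(1)[OF \<psi>]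
    and fh = closed_formD(1)[OF closed_form_add[OF \<phi> \<theta>]]
  have "killing_wedge S P (\<lambda>c p. \<phi> c p + \<theta> c p) \<psi> c x = killing_wedge S P \<phi> \<psi> c x + killing_wedge S P \<theta> \<psi> c x"
    if c: "c \<in> atlas S" and x: "x \<in> fst c" for c x
  proof (cases "x \<in> Dred S")
    case True
    then show ?thesis using killing_wedge_divisor[OF f g] killing_wedge_divisor[OF h g] killing_wedge_divisor[OF fh g] by simp
  next
    case False
    note p = fibre_point[of x]
    show ?thesis
      using killing_wedge_at[OF f g c p x False] killing_wedge_at[OF h g c p x False] killing_wedge_at[OF fh g c p x False]
      by (simp add: kill_add)
  qed
  then show ?thesis
    unfolding AB_form_def surf_integral_add[OF surface two_form_killing_wedge[OF \<phi> \<psi>] two_form_killing_wedge[OF \<theta> \<psi>], symmetric]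
    by (rule surf_integral_cong[OF surface])
qed

lemma kill_commute: "X \<in> lieG S \<Longrightarrow> Y \<in> lieG S \<Longrightarrow> kill (grp S) X Y = kill (grp S) Y X"
  using killing_commute[OF group] kill_eq_killing[OF group] by simp

lemma pairing_antisymmetric:
  assumes \<phi>: "closed_form \<phi>" and \<psi>: "closed_form \<psi>"
  shows "AB_form S P \<phi> \<psi> = - AB_form S P \<psi> \<phi>"
proof -
  note f = closed_formD(1)[OF \<phi>] and g = closed_formD(1)[OF \<psi>]
  have "killing_wedge S P \<phi> \<psi> c x + killing_wedge S P \<psi> \<phi> c x = 0" if c: "c \<in> atlas S" and x: "x \<in> fst c" for c x
  proof (cases "x \<in> Dred S")
    case True
    then show ?thesis using killing_wedge_divisor[OF f g] killing_wedge_divisor[OF g f] by simp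
  next
    case False
    note p = fibre_point[of x]
    have xW: "bproj P (SOME p. bproj P p = x) \<in> fst c \<inter> - Dred S" using p x False by simp
    show ?thesis
      using killing_wedge_at[OF f g c p x False] killing_wedge_at[OF g f c p x False]
        kill_commute[OF ad_section_in[OF global_oneform_sections(1)[OF f c] xW] ad_section_in[OF global_oneform_sections(2)[OF g c] xW]]
        kill_commute[OF ad_section_in[OF global_oneform_sections(2)[OF f c] xW] ad_section_in[OF global_oneform_sections(1)[OF g c] xW]]
      by simp
  qed
  then have "surf_integral (atlas S) (\<lambda>c x. killing_wedge S P \<phi> \<psi> c x + killing_wedge S P \<psi> \<phi> c x) = surf_integral (atlas S) (\<lambda>c x. 0)"
    by (intro surf_integral_cong[OF surface])
  then have "AB_form S P \<phi> \<psi> + AB_form S P \<psi> \<phi> = 0"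
    unfolding AB_form_def surf_integral_zero[OF surface]
      surf_integral_add[OF surface two_form_killing_wedge[OF \<phi> \<psi>] two_form_killing_wedge[OF \<psi> \<phi>]] .
  then show ?thesis by (simp add: eq_neg_iff_add_eq_0)
qed

lemma closed_form_shift:
  assumes "closed_form \<phi>" "gauge_section \<mu>"
  shows "closed_form (\<lambda>c p. \<phi> c p + - nabla S P \<mu> c p)"
  using closed_form_add_scaleR[OF assms(1) closed_form_nabla[OF assms(2)], of "-1"] by (simp only: scaleR_minus1_left)

lemma pairing_shift_left:
  assumes \<phi>: "closed_form \<phi>" and \<psi>: "closed_form \<psi>" and \<mu>: "gauge_section \<mu>"
  shows "AB_form S P (\<lambda>c p. \<phi> c p + - nabla S P \<mu> c p) \<psi> = AB_form S P \<phi> \<psi>"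
proof -
  have "AB_form S P (\<lambda>c p. (\<phi> c p + - nabla S P \<mu> c p) + nabla S P \<mu> c p) \<psi>
      = AB_form S P (\<lambda>c p. \<phi> c p + - nabla S P \<mu> c p) \<psi> + AB_form S P (nabla S P \<mu>) \<psi>"
    by (rule pairing_add[OF closed_form_shift[OF \<phi> \<mu>] closed_form_nabla[OF \<mu>] \<psi>])
  moreover have "AB_form S P (nabla S P \<mu>) \<psi> = 0"
    unfolding AB_form_def by (rule integral_exact[OF \<mu> \<psi>])
  ultimately show ?thesis by simp
qed

end

section \<open>Gauge transformations and hypercocycles have logarithmic growth\<close>

lemma growth_pole:
  assumes "hol_extends (\<lambda>w. cscale (w ^ k) (X w)) L"
  shows "growth (- int k) X"
proof -
  obtain e F where e: "e > 0" "mat_holomorphic_on F (ball 0 e)" "\<And>w. w \<in> ball 0 e - {0} \<Longrightarrow> F w = cscale (w ^ k) (X w)"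
    using assms unfolding hol_extends_def by blast
  have "growth (- int k + 0) (\<lambda>w. cscale (inverse w ^ k) (F w))"
    by (rule growth_bilinear[OF bounded_bilinear_cscale growth_inverse_power
          growth_smooth[OF e(1) mat_holomorphic_smooth[OF open_ball e(2)]]])
  then have g: "growth (- int k) (\<lambda>w. cscale (inverse w ^ k) (F w))" by simp
  show ?thesis
  proof (rule growth_cong[OF g e(1)])
    fix w :: complex assume w: "w \<in> ball 0 e - {0}"
    then have "inverse w ^ k * w ^ k = 1" by (simp add: power_mult_distrib[symmetric])
    then show "cscale (inverse w ^ k) (F w) = X w" unfolding e(3)[OF w] cmat.scale_scale by simp
  qed
qed

context moduli_context
begin

lemma frame_values_hol:
  "c \<in> atlas S \<Longrightarrow> (U, \<sigma>) \<in> hframes P \<Longrightarrow> ad_hol S P W e \<Longrightarrow>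
    mat_holomorphic_on (\<lambda>w. e (\<sigma> (chart_inv c w))) (snd c ` (fst c \<inter> (U \<inter> W)))"
  unfolding ad_hol_def surf_mat_hol_on_def o_def by blast

lemma ad_smooth_hol:
  assumes W: "open W" and e: "ad_hol S P W e"
  shows "ad_smooth S P W e"
  unfolding ad_smooth_def surf_smooth_on_def o_def
proof (intro ballI, clarify)
  fix U \<sigma> c assume \<sigma>: "(U, \<sigma>) \<in> hframes P" and c: "c \<in> atlas S"
  show "smooth_on (snd c ` (fst c \<inter> (U \<inter> W))) (\<lambda>w. e (\<sigma> (chart_inv c w)))"
    by (rule mat_holomorphic_smooth[OF chart_open[OF c open_Int[OF frame_open[OF \<sigma>] W]] frame_values_hol[OF c \<sigma> e]])
qed

lemma surf_smooth_values:
  "c \<in> atlas S \<Longrightarrow> surf_smooth_on (atlas S) W f \<Longrightarrow> smooth_on (snd c ` (fst c \<inter> W)) (\<lambda>w. f (chart_inv c w))"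
  unfolding surf_smooth_on_def o_def by blast

lemma ball_in_frame:
  assumes j: "j \<in> {1..npts S}" and W: "open W" "pt S j \<in> W" "W \<subseteq> U"
  obtains e where "e > 0" "ball 0 e \<subseteq> snd (crd S j) ` (fst (crd S j) \<inter> W)"
    "ball 0 e - {0} \<subseteq> snd (crd S j) ` (fst (crd S j) \<inter> (W - Dred S))"
proof -
  obtain N e where N: "N \<subseteq> W" "N \<subseteq> fst (crd S j)" "e > 0" "ball 0 e \<subseteq> snd (crd S j) ` N"
    "\<And>w. w \<in> ball 0 e - {0} \<Longrightarrow> w \<in> snd (crd S j) ` (fst (crd S j) \<inter> (W - Dred S))"
    by (rule marked_nbhd[OF j W(1,2)]) blast
  have "ball 0 e \<subseteq> snd (crd S j) ` (fst (crd S j) \<inter> W)" using N(1,2,4) by blast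
  then show ?thesis using that N(3,5) by blast
qed

text \<open>
  A section with vanishing Taylor series at the marked point has every growth, so its bracket with the
  connection form is bounded whatever the order of the pole.
\<close>

lemma gauge_section_lie_gauge1:
  assumes \<mu>: "\<mu> \<in> lie_gauge1 S P"
  shows "gauge_section \<mu>"
proof -
  have sec: "ad_section S P UNIV \<mu>" and sm: "ad_smooth S P UNIV \<mu>"
    using \<mu> unfolding lie_gauge1_def by blast+
  have g: "growth 1 (\<lambda>w. \<mu> (framing_frame j (chart_inv (crd S j) w))) \<and>
     growth (-1) (\<lambda>w. fst (nabla S P \<mu> (crd S j) (framing_frame j (chart_inv (crd S j) w)))) \<and>
     growth 1 (\<lambda>w. snd (nabla S P \<mu> (crd S j) (framing_frame j (chart_inv (crd S j) w))))"
    if j: "j \<in> {1..npts S}" for j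
  proof -
    let ?c = "crd S j" and ?\<sigma> = "framing_frame j"
    note m = marked[OF j]
    obtain U where \<sigma>: "(U, ?\<sigma>) \<in> hframes P" "pt S j \<in> U" by (rule framing_frame[OF j])
    define u where "u w = \<mu> (?\<sigma> (chart_inv ?c w))" for w
    define A where "A w = conn P ?c ?\<sigma> (chart_inv ?c w)" for w
    have "flat0 (\<mu> \<circ> ?\<sigma> \<circ> chart_inv ?c)"
      using \<mu> j \<sigma> unfolding lie_gauge1_def by blast
    then have flat: "flat0 u" unfolding u_def[abs_def] o_def .
    have "\<forall>(U, \<sigma>)\<in>hframes P. pt S j \<in> U \<longrightarrow>
        (\<exists>L. hol_extends (\<lambda>w. cscale (w ^ ordr S j) (conn P (crd S j) \<sigma> (chart_inv (crd S j) w))) L)"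
      using mero_axioms[THEN conjunct2] j by blast
    then obtain L where "hol_extends (\<lambda>w. cscale (w ^ ordr S j) (A w)) L"
      using \<sigma> unfolding A_def[abs_def] by blast
    then have A: "growth (- int (ordr S j)) A" by (rule growth_pole)
    obtain e where e: "e > 0" "ball 0 e - {0} \<subseteq> snd ?c ` (fst ?c \<inter> (U - Dred S))"
      by (rule ball_in_frame[OF j frame_open[OF \<sigma>(1)] \<sigma>(2) order_refl])
    note n = nabla_in_frame[OF m(1) \<sigma>(1) sec sm, folded u_def A_def]
    have "growth (-1) (\<lambda>w. lie (A w) (u w))"
      by (rule growth_weaken[OF growth_bilinear[OF bounded_bilinear_lie A growth_flat[OF flat, of "int (ordr S j)"]]]) simp
    then have 1: "growth (-1) (\<lambda>w. wirt u w + lie (A w) (u w))"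
      by (rule growth_add[OF growth_flat_wirtinger(1)[OF flat]])
    have "growth (-1) (\<lambda>w. fst (nabla S P \<mu> ?c (?\<sigma> (chart_inv ?c w))))"
      by (rule growth_cong[OF 1 e(1)]) (use n e(2) in auto)
    moreover have "growth 1 (\<lambda>w. snd (nabla S P \<mu> ?c (?\<sigma> (chart_inv ?c w))))"
      by (rule growth_cong[OF growth_flat_wirtinger(2)[OF flat] e(1)]) (use n e(2) in auto)
    ultimately show ?thesis using growth_flat[OF flat, of 1] unfolding u_def[abs_def] by blast
  qed
  then show ?thesis using sec sm unfolding gauge_section_def form_log_def by blast
qed

lemma sheaf_adK_growth:
  assumes e: "e \<in> sheaf_adK S P W" and j: "j \<in> {1..npts S}" "pt S j \<in> W"
  shows "growth (-1) (\<lambda>w. fst (e (crd S j) (framing_frame j (chart_inv (crd S j) w))))"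
proof -
  obtain U where \<sigma>: "(U, framing_frame j) \<in> hframes P" "pt S j \<in> U" "framing_frame j (pt S j) = framing P j"
    by (rule framing_frame[OF j(1)])
  have "\<forall>(U, \<sigma>)\<in>hframes P. pt S j \<in> U \<and> \<sigma> (pt S j) = framing P j \<longrightarrow>
           (\<exists>L\<in>lieT S. hol_extends (\<lambda>w. cscale w (fst (e (crd S j) (\<sigma> (chart_inv (crd S j) w))))) L)"
    using e j unfolding sheaf_adK_def by blast
  then obtain L where "hol_extends (\<lambda>w. cscale (w ^ 1) (fst (e (crd S j) (framing_frame j (chart_inv (crd S j) w))))) L"
    using \<sigma> by fastforce
  from growth_pole[OF this] show ?thesis by simp
qed

lemma sheaf_adD:
  assumes "e \<in> sheaf_ad S P W"
  shows "ad_section S P W e" "ad_hol S P W e" "\<And>p. bproj P p \<in> W \<inter> Dred S \<Longrightarrow> e p = 0"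
    "(\<lambda>c p. - nabla S P e c p) \<in> sheaf_adK S P W"
  using assms unfolding sheaf_ad_def by blast+

text \<open>
  Sections of the subsheaf vanish at the marked points.
\<close>

lemma growth_holomorphic_zero:
  assumes e: "e \<in> sheaf_ad S P W" and W: "open W" and j: "j \<in> {1..npts S}" "pt S j \<in> W"
  shows "growth 1 (\<lambda>w. e (framing_frame j (chart_inv (crd S j) w)))"
proof -
  note m = marked[OF j(1)]
  obtain U where \<sigma>: "(U, framing_frame j) \<in> hframes P" "pt S j \<in> U" "framing_frame j (pt S j) = framing P j"
    by (rule framing_frame[OF j(1)])
  obtain d where d: "d > 0" "ball 0 d \<subseteq> snd (crd S j) ` (fst (crd S j) \<inter> (U \<inter> W))"
    by (rule ball_in_frame[OF j(1), of "U \<inter> W" UNIV]) (use frame_open[OF \<sigma>(1)] W \<sigma>(2) j(2) in auto)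
  note hol = frame_values_hol[OF m(1) \<sigma>(1) sheaf_adD(2)[OF e]]
  have o: "open (snd (crd S j) ` (fst (crd S j) \<inter> (U \<inter> W)))"
    by (rule chart_open[OF m(1) open_Int[OF frame_open[OF \<sigma>(1)] W]])
  have i0: "chart_inv (crd S j) 0 = pt S j" using chart_inv_left[OF chart[OF m(1)] m(2)] unfolding m(3) .
  have "bproj P (framing_frame j (pt S j)) \<in> W \<inter> Dred S" using frame_proj[OF \<sigma>(1,2)] j(2) m(4) by simp
  then have "e (framing_frame j (chart_inv (crd S j) 0)) = 0" unfolding i0 by (rule sheaf_adD(3)[OF e])
  then show ?thesis
    by (intro growth_smooth_zero[OF d(1) smooth_on_subset[OF mat_holomorphic_smooth[OF o hol] d(2)]])
qed

lemma growth_surf_smooth: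
  assumes f: "surf_smooth_on (atlas S) W f" and W: "open W" and j: "j \<in> {1..npts S}" "pt S j \<in> W"
  obtains e where "e > 0" "smooth_on (ball 0 e) (\<lambda>w. f (chart_inv (crd S j) w))"
proof -
  obtain e where e: "e > 0" "ball 0 e \<subseteq> snd (crd S j) ` (fst (crd S j) \<inter> W)"
    by (rule ball_in_frame[OF j(1) W j(2) order_refl])
  show ?thesis using that[OF e(1) smooth_on_subset[OF surf_smooth_values[OF marked(1)[OF j(1)] f] e(2)]] .
qed

lemma smooth_ad_representation:
  assumes "\<mu> \<in> smooth_ad S P"
  obtains W n f e where "open W" "x \<in> W" "\<And>i. i < (n :: nat) \<Longrightarrow> surf_smooth_on (atlas S) W (f i)"
    "\<And>i. i < n \<Longrightarrow> e i \<in> sheaf_ad S P W"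
    "\<And>p. bproj P p \<in> W \<Longrightarrow> \<mu> p = (\<Sum>i<n. cscale (f i (bproj P p)) (e i p))"
  using assms unfolding smooth_ad_def by blast

text \<open>
  Locally \<open>\<mu>\<close> is a sum of terms \<open>f e\<close> with \<open>f\<close> smooth and \<open>e\<close> in the holomorphic subsheaf, and
  \<open>\<nabla>(f e) = df \<cdot> e + f \<nabla>e\<close>. Here \<open>e\<close> has growth 1, and \<open>\<nabla>e\<close> has no \<open>(0,1)\<close>-part and growth -1, because
  \<open>\<nabla>e\<close> belongs to the sheaf of logarithmic forms.
\<close>

lemma gauge_section_smooth_ad:
  assumes \<mu>: "\<mu> \<in> smooth_ad S P"
  shows "gauge_section \<mu>"
proof -
  have sec: "ad_section S P UNIV \<mu>"
    unfolding ad_section_def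
  proof (intro allI impI)
    fix p
    obtain W n f e where W: "open W" "bproj P p \<in> W" "\<And>i. i < (n :: nat) \<Longrightarrow> surf_smooth_on (atlas S) W (f i)"
      "\<And>i. i < n \<Longrightarrow> e i \<in> sheaf_ad S P W"
      "\<And>p. bproj P p \<in> W \<Longrightarrow> \<mu> p = (\<Sum>i<n. cscale (f i (bproj P p)) (e i p))"
      by (rule smooth_ad_representation[OF \<mu>, where x="bproj P p"]) blast
    note s = sheaf_adD(1)[OF W(4)]
    show "\<mu> p \<in> lieG S \<and> (\<forall>g\<in>grp S. \<mu> (bact P p g) = matrix_inv g ** \<mu> p ** g)"
    proof (intro conjI ballI)
      show "\<mu> p \<in> lieG S"
        unfolding W(5)[OF W(2)]
        by (intro cmat.subspace_sum[OF lie_alg_subspace] cmat.subspace_scale[OF lie_alg_subspace] ad_section_in[OF s W(2)]) simp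
      fix g assume g: "g \<in> grp S"
      have pg: "bproj P (bact P p g) = bproj P p" by (rule act_proj[OF g])
      have "\<mu> (bact P p g) = (\<Sum>i<n. cscale (f i (bproj P p)) (e i (bact P p g)))"
        using W(5)[of "bact P p g"] W(2) unfolding pg by simp
      also have "\<dots> = (\<Sum>i<n. matrix_inv g ** cscale (f i (bproj P p)) (e i p) ** g)"
        using ad_section_act[OF s W(2) g] by (intro sum.cong) (simp_all add: matrix_cscale)
      also have "\<dots> = matrix_inv g ** \<mu> p ** g"
        unfolding W(5)[OF W(2)] by (rule linear_sum[OF bounded_linear.linear[OF bounded_linear_conj], symmetric])
      finally show "\<mu> (bact P p g) = matrix_inv g ** \<mu> p ** g" .
    qed
  qed
  have sm: "ad_smooth S P UNIV \<mu>"
    unfolding ad_smooth_def surf_smooth_on_def o_def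
  proof (intro ballI, clarify)
    fix U \<sigma> c assume \<sigma>: "(U, \<sigma>) \<in> hframes P" and c: "c \<in> atlas S"
    show "smooth_on (snd c ` (fst c \<inter> (U \<inter> UNIV))) (\<lambda>x. \<mu> (\<sigma> (chart_inv c x)))"
    proof (rule smooth_on_local)
      show "open (snd c ` (fst c \<inter> (U \<inter> UNIV)))" using chart_open[OF c frame_open[OF \<sigma>]] by simp
      fix w assume "w \<in> snd c ` (fst c \<inter> (U \<inter> UNIV))"
      then obtain x where x: "x \<in> fst c" "x \<in> U" "w = snd c x" by blast
      obtain W n f e where W: "open W" "x \<in> W"
        "\<And>i. i < (n :: nat) \<Longrightarrow> surf_smooth_on (atlas S) W (f i)" "\<And>i. i < n \<Longrightarrow> e i \<in> sheaf_ad S P W"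
        "\<And>p. bproj P p \<in> W \<Longrightarrow> \<mu> p = (\<Sum>i<n. cscale (f i (bproj P p)) (e i p))"
        by (rule smooth_ad_representation[OF \<mu>, where x="x"]) blast
      let ?T = "snd c ` (fst c \<inter> (U \<inter> W))"
      have T: "open ?T" by (rule chart_open[OF c open_Int[OF frame_open[OF \<sigma>] W(1)]])
      have "smooth_on ?T (\<lambda>w. f i (chart_inv c w))" if "i < n" for i
        by (rule smooth_on_subset[OF surf_smooth_values[OF c W(3)[OF that]]]) blast
      moreover have "smooth_on ?T (\<lambda>w. e i (\<sigma> (chart_inv c w)))" if "i < n" for i
        by (rule mat_holomorphic_smooth[OF T frame_values_hol[OF c \<sigma> sheaf_adD(2)[OF W(4)[OF that]]]])
      ultimately have s: "smooth_on ?T (\<lambda>w. \<Sum>i<n. cscale (f i (chart_inv c w)) (e i (\<sigma> (chart_inv c w))))"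
        by (intro smooth_on_sum[OF T] smooth_on_bilinear[OF bounded_bilinear_cscale T]) auto
      have v: "(\<Sum>i<n. cscale (f i (chart_inv c w)) (e i (\<sigma> (chart_inv c w)))) = \<mu> (\<sigma> (chart_inv c w))" if "w \<in> ?T" for w
        using W(5)[of "\<sigma> (chart_inv c w)"] frame_proj[OF \<sigma>, of "chart_inv c w"] in_chart(2)[OF c that] by simp
      have "smooth_on ?T (\<lambda>w. \<mu> (\<sigma> (chart_inv c w)))" by (rule smooth_on_cong[OF T v s])
      then show "\<exists>T. open T \<and> w \<in> T \<and> smooth_on T (\<lambda>x. \<mu> (\<sigma> (chart_inv c x)))" using T x W(2) by blast
    qed
  qed
  have g: "growth 1 (\<lambda>w. \<mu> (framing_frame j (chart_inv (crd S j) w))) \<and>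
     growth (-1) (\<lambda>w. fst (nabla S P \<mu> (crd S j) (framing_frame j (chart_inv (crd S j) w)))) \<and>
     growth 1 (\<lambda>w. snd (nabla S P \<mu> (crd S j) (framing_frame j (chart_inv (crd S j) w))))"
    if j: "j \<in> {1..npts S}" for j
  proof -
    let ?c = "crd S j" and ?\<sigma> = "framing_frame j"
    note m = marked[OF j]
    obtain U where \<sigma>: "(U, ?\<sigma>) \<in> hframes P" "pt S j \<in> U" by (rule framing_frame[OF j])
    obtain W n f e where W: "open W" "pt S j \<in> W"
      "\<And>i. i < (n :: nat) \<Longrightarrow> surf_smooth_on (atlas S) W (f i)" "\<And>i. i < n \<Longrightarrow> e i \<in> sheaf_ad S P W"
      "\<And>p. bproj P p \<in> W \<Longrightarrow> \<mu> p = (\<Sum>i<n. cscale (f i (bproj P p)) (e i p))"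
      by (rule smooth_ad_representation[OF \<mu>, where x="pt S j"]) blast
    let ?T = "snd ?c ` (fst ?c \<inter> (U \<inter> W))" and ?T' = "snd ?c ` (fst ?c \<inter> (U \<inter> W - Dred S))"
    have T: "open ?T" "open ?T'"
      using chart_open[OF m(1) open_Int[OF frame_open[OF \<sigma>(1)] W(1)]]
        chart_open[OF m(1) open_minus_D[OF open_Int[OF frame_open[OF \<sigma>(1)] W(1)]]] by auto
    obtain d where d: "d > 0" "ball 0 d \<subseteq> ?T" "ball 0 d - {0} \<subseteq> ?T'"
      by (rule ball_in_frame[OF j, of "U \<inter> W" UNIV]) (use frame_open[OF \<sigma>(1)] W(1,2) \<sigma>(2) in auto)
    define F where "F i w = f i (chart_inv ?c w)" for i w
    define E where "E i w = e i (?\<sigma> (chart_inv ?c w))" for i w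
    define A where "A w = conn P ?c ?\<sigma> (chart_inv ?c w)" for w
    define u where "u w = \<mu> (?\<sigma> (chart_inv ?c w))" for w
    define X where "X i w = wirt (E i) w + lie (A w) (E i w)" for i w
    have Fs: "smooth_on ?T (F i)" if "i < n" for i
      unfolding F_def[abs_def] by (rule smooth_on_subset[OF surf_smooth_values[OF m(1) W(3)[OF that]]]) blast
    have Eh: "mat_holomorphic_on (E i) ?T" if "i < n" for i
      unfolding E_def[abs_def] by (rule frame_values_hol[OF m(1) \<sigma>(1) sheaf_adD(2)[OF W(4)[OF that]]])
    note Es = mat_holomorphic_smooth[OF T(1) Eh]
    have Fg: "growth 0 (F i)" "growth 0 (wd (F i))" "growth 0 (wdbar (F i))" if "i < n" for i
      using growth_smooth[OF d(1) smooth_on_subset[OF Fs[OF that] d(2)]]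
        growth_smooth[OF d(1) smooth_on_subset[OF smooth_on_scalar_wirtinger(1)[OF T(1) Fs[OF that]] d(2)]]
        growth_smooth[OF d(1) smooth_on_subset[OF smooth_on_scalar_wirtinger(2)[OF T(1) Fs[OF that]] d(2)]] by blast+
    have Eg: "growth 1 (E i)" if "i < n" for i
      unfolding E_def[abs_def] by (rule growth_holomorphic_zero[OF W(4)[OF that] W(1) j W(2)])
    have u_eq: "u w = (\<Sum>i<n. cscale (F i w) (E i w))" if "w \<in> ?T" for w
    proof -
      have y: "chart_inv ?c w \<in> U" "chart_inv ?c w \<in> W" using in_chart(2)[OF m(1) that] by blast+
      show ?thesis unfolding u_def F_def E_def using W(5)[of "?\<sigma> (chart_inv ?c w)"] frame_proj[OF \<sigma>(1) y(1)] y(2) by simp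
    qed
    have Xe: "fst (nabla S P (e i) ?c (?\<sigma> (chart_inv ?c w))) = X i w" if i: "i < n" and w: "w \<in> ?T'" for i w
    proof -
      have y: "chart_inv ?c w \<in> U" "chart_inv ?c w \<in> W" "chart_inv ?c w \<notin> Dred S" using in_chart(2)[OF m(1) w] by blast+
      note a = sheaf_adD[OF W(4)[OF i]]
      from nabla_frame[OF m(1) \<sigma>(1) W(1) a(1) ad_smooth_hol[OF W(1) a(2)] in_chart(1)[OF m(1) w] y]
      show ?thesis unfolding X_def E_def[abs_def] A_def in_chart(3)[OF m(1) w] by simp
    qed
    have Xg: "growth (-1) (X i)" if i: "i < n" for i
    proof (rule growth_cong[OF _ d(1)])
      have "growth (-1) (\<lambda>w. fst (- nabla S P (e i) ?c (?\<sigma> (chart_inv ?c w))))"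
        by (rule sheaf_adK_growth[OF sheaf_adD(4)[OF W(4)[OF i]] j W(2)])
      from growth_linear[OF bounded_linear_minus[OF bounded_linear_ident] this]
      show "growth (-1) (\<lambda>w. fst (nabla S P (e i) ?c (?\<sigma> (chart_inv ?c w))))" by simp
    qed (use Xe[OF i] d(3) in blast)
    have n: "nabla S P \<mu> ?c (?\<sigma> (chart_inv ?c w)) =
        ((\<Sum>i<n. cscale (wd (F i) w) (E i w) + cscale (F i w) (X i w)), (\<Sum>i<n. cscale (wdbar (F i) w) (E i w)))"
      if w: "w \<in> ball 0 d - {0}" for w
    proof -
      have wT: "w \<in> ?T" "w \<in> ?T'" using w d(2,3) by blast+
      have wU: "w \<in> snd ?c ` (fst ?c \<inter> (U - Dred S))" using wT(2) by blast
      have dF: "F i differentiable (at w)" "E i differentiable (at w)"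
        "(\<lambda>w. cscale (F i w) (E i w)) differentiable (at w)" if "i < n" for i
        using smooth_on_differentiable_at[OF T(1) _ wT(1)] Fs[OF that] Es[OF that]
          smooth_on_bilinear[OF bounded_bilinear_cscale T(1) Fs[OF that] Es[OF that]] by blast+
      have w1: "wirt u w = (\<Sum>i<n. cscale (wd (F i) w) (E i w) + cscale (F i w) (wirt (E i) w))"
      proof -
        have "wirt u w = wirt (\<lambda>w. \<Sum>i<n. cscale (F i w) (E i w)) w" by (rule wirtinger_cong(1)[OF T(1) u_eq wT(1)])
        also have "\<dots> = (\<Sum>i<n. wirt (\<lambda>w. cscale (F i w) (E i w)) w)" by (rule wirtinger_sum(1)) (use dF in auto)
        also have "\<dots> = (\<Sum>i<n. cscale (wd (F i) w) (E i w) + cscale (F i w) (wirt (E i) w))"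
          using wirtinger_cscale(1)[OF dF(1,2)] by (intro sum.cong) auto
        finally show ?thesis .
      qed
      have w2: "wirtbar u w = (\<Sum>i<n. cscale (wdbar (F i) w) (E i w))"
      proof -
        have "wirtbar u w = wirtbar (\<lambda>w. \<Sum>i<n. cscale (F i w) (E i w)) w" by (rule wirtinger_cong(2)[OF T(1) u_eq wT(1)])
        also have "\<dots> = (\<Sum>i<n. wirtbar (\<lambda>w. cscale (F i w) (E i w)) w)" by (rule wirtinger_sum(2)) (use dF in auto)
        also have "\<dots> = (\<Sum>i<n. cscale (wdbar (F i) w) (E i w))"
          using wirtinger_cscale(2)[OF dF(1,2)] mat_holomorphic_wirtbar[OF T(1) wT(1) Eh] by (intro sum.cong) auto
        finally show ?thesis .
      qed
      have l: "lie (A w) (u w) = (\<Sum>i<n. cscale (F i w) (lie (A w) (E i w)))"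
        unfolding u_eq[OF wT(1)] bounded_bilinear.sum_right[OF bounded_bilinear_lie] lie_cscale ..
      show ?thesis
        using nabla_in_frame[OF m(1) \<sigma>(1) sec sm wU] unfolding u_def[symmetric, abs_def] A_def[symmetric] w1 w2 l X_def
        by (simp add: sum.distrib cmat.scale_right_distrib add.assoc)
    qed
    have s1: "growth (-1) (\<lambda>w. \<Sum>i<n. cscale (wd (F i) w) (E i w) + cscale (F i w) (X i w))"
    proof (intro growth_sum growth_add)
      fix i assume "i \<in> {..<n}"
      then have i: "i < n" by simp
      show "growth (-1) (\<lambda>w. cscale (wd (F i) w) (E i w))"
        by (rule growth_weaken[OF growth_bilinear[OF bounded_bilinear_cscale Fg(2)[OF i] Eg[OF i]]]) simp
      show "growth (-1) (\<lambda>w. cscale (F i w) (X i w))"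
        by (rule growth_weaken[OF growth_bilinear[OF bounded_bilinear_cscale Fg(1)[OF i] Xg[OF i]]]) simp
    qed
    have s2: "growth 1 (\<lambda>w. \<Sum>i<n. cscale (wdbar (F i) w) (E i w))"
    proof (intro growth_sum)
      fix i assume "i \<in> {..<n}"
      then have i: "i < n" by simp
      show "growth 1 (\<lambda>w. cscale (wdbar (F i) w) (E i w))"
        by (rule growth_weaken[OF growth_bilinear[OF bounded_bilinear_cscale Fg(3)[OF i] Eg[OF i]]]) simp
    qed
    have s3: "growth 1 (\<lambda>w. \<Sum>i<n. cscale (F i w) (E i w))"
    proof (intro growth_sum)
      fix i assume "i \<in> {..<n}"
      then have i: "i < n" by simp
      show "growth 1 (\<lambda>w. cscale (F i w) (E i w))"
        by (rule growth_weaken[OF growth_bilinear[OF bounded_bilinear_cscale Fg(1)[OF i] Eg[OF i]]]) simp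
    qed
    have "growth 1 u" by (rule growth_cong[OF s3 d(1)]) (use u_eq d(2) in auto)
    moreover have "growth (-1) (\<lambda>w. fst (nabla S P \<mu> ?c (?\<sigma> (chart_inv ?c w))))"
      by (rule growth_cong[OF s1 d(1)]) (simp add: n)
    moreover have "growth 1 (\<lambda>w. snd (nabla S P \<mu> ?c (?\<sigma> (chart_inv ?c w))))"
      by (rule growth_cong[OF s2 d(1)]) (simp add: n)
    ultimately show ?thesis unfolding u_def[abs_def] by blast
  qed
  then show ?thesis using sec sm unfolding gauge_section_def form_log_def by blast
qed

text \<open>
  The local representation is given in one chart and carried to the others by the transformation rule
  of one-forms; the same applies to \<open>(0,1)\<close>-forms below, with the conjugate factor.
\<close>

lemma smooth_adK_representation:
  assumes \<nu>: "\<nu> \<in> smooth_adK S P"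
  shows "\<exists>W. \<exists>n :: nat. \<exists>f :: nat \<Rightarrow> 'x \<Rightarrow> complex. \<exists>e. open W \<and> x \<in> W \<and>
     (\<forall>i<n. surf_smooth_on (atlas S) W (f i) \<and> e i \<in> sheaf_adK S P W) \<and>
     (\<forall>c\<in>atlas S. \<forall>p. bproj P p \<in> fst c \<and> bproj P p \<in> W - Dred S \<longrightarrow>
        \<nu> c p = (\<Sum>i<n. cscale (f i (bproj P p)) (fst (e i c p)), 0))"
proof -
  obtain W c0 n f e where W: "open W" "x \<in> W" "W \<subseteq> fst c0" "c0 \<in> atlas S"
    and fe: "\<forall>i<n. surf_smooth_on (atlas S) W (f i) \<and> e i \<in> sheaf_adK S P W"
    and rep: "\<And>p. bproj P p \<in> W - Dred S \<Longrightarrow> \<nu> c0 p = (\<Sum>i<(n::nat). cscale (f i (bproj P p)) (fst (e i c0 p)), 0)"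
    using \<nu> unfolding smooth_adK_def by blast
  have gl: "global_oneform S P \<nu>" using \<nu> unfolding smooth_adK_def by blast
  have "\<nu> c p = (\<Sum>i<n. cscale (f i (bproj P p)) (fst (e i c p)), 0)"
    if c: "c \<in> atlas S" and p: "bproj P p \<in> fst c" "bproj P p \<in> W - Dred S" for c p
  proof -
    let ?J = "jac c0 c (bproj P p)"
    have "bproj P p \<in> fst c0" "bproj P p \<notin> Dred S" using p W(3) by blast+
    from global_oneform_chart[OF gl W(4) c this(1) p(1) this(2)]
    have 1: "\<nu> c p = (cscale ?J (\<Sum>i<n. cscale (f i (bproj P p)) (fst (e i c0 p))), cscale (cnj ?J) 0)"
      unfolding rep[OF p(2)] by simp
    have 2: "fst (e i c p) = cscale ?J (fst (e i c0 p))" if "i < n" for i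
    proof -
      have "ad_oneform S P (W - Dred S) (e i)" using fe that unfolding sheaf_adK_def by blast
      then have "e i c p = (cscale ?J (fst (e i c0 p)), cscale (cnj ?J) (snd (e i c0 p)))"
        using W(3,4) c p unfolding ad_oneform_def by blast
      then show ?thesis by simp
    qed
    have "cscale ?J (\<Sum>i<n. cscale (f i (bproj P p)) (fst (e i c0 p))) = (\<Sum>i<n. cscale (f i (bproj P p)) (fst (e i c p)))"
      unfolding cmat.scale_sum_right using 2 by (intro sum.cong refl) (simp add: cmat.scale_left_commute)
    then show ?thesis using 1 by (simp only: cmat.scale_zero_right)
  qed
  then show ?thesis using W(1,2) fe by blast
qed

lemma smooth_ad01_representation:
  assumes \<tau>: "\<tau> \<in> smooth_ad01 S P"
  shows "\<exists>W. \<exists>c0\<in>atlas S. \<exists>n :: nat. \<exists>f :: nat \<Rightarrow> 'x \<Rightarrow> complex. \<exists>e. open W \<and> x \<in> W \<and> W \<subseteq> fst c0 \<and>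
     (\<forall>i<n. surf_smooth_on (atlas S) W (f i) \<and> e i \<in> sheaf_ad S P W) \<and>
     (\<forall>c\<in>atlas S. \<forall>p. bproj P p \<in> fst c \<and> bproj P p \<in> W - Dred S \<longrightarrow>
        \<tau> c p = (0, cscale (cnj (jac c0 c (bproj P p))) (\<Sum>i<n. cscale (f i (bproj P p)) (e i p))))"
proof -
  obtain W c0 n f e where W: "open W" "x \<in> W" "W \<subseteq> fst c0" "c0 \<in> atlas S"
    and fe: "\<forall>i<n. surf_smooth_on (atlas S) W (f i) \<and> e i \<in> sheaf_ad S P W"
    and rep: "\<And>p. bproj P p \<in> W - Dred S \<Longrightarrow> \<tau> c0 p = (0, \<Sum>i<(n::nat). cscale (f i (bproj P p)) (e i p))"
    using \<tau> unfolding smooth_ad01_def by blast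
  have gl: "global_oneform S P \<tau>" using \<tau> unfolding smooth_ad01_def by blast
  have "\<tau> c p = (0, cscale (cnj (jac c0 c (bproj P p))) (\<Sum>i<n. cscale (f i (bproj P p)) (e i p)))"
    if c: "c \<in> atlas S" and p: "bproj P p \<in> fst c" "bproj P p \<in> W - Dred S" for c p
  proof -
    have "bproj P p \<in> fst c0" "bproj P p \<notin> Dred S" using p W(3) by blast+
    from global_oneform_chart[OF gl W(4) c this(1) p(1) this(2)]
    show ?thesis unfolding rep[OF p(2)] fst_conv snd_conv cmat.scale_zero_right .
  qed
  then show ?thesis using W fe by blast
qed

lemma hypercocycle_types:
  assumes "(\<tau>, \<nu>) \<in> hypercocycles S P"
  shows "fst (\<tau> c p) = 0" "snd (\<nu> c p) = 0"
proof -
  have \<tau>: "\<tau> \<in> smooth_ad01 S P" and \<nu>: "\<nu> \<in> smooth_adK S P" using assms unfolding hypercocycles_def by blast+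
  have gl: "global_oneform S P \<tau>" "global_oneform S P \<nu>"
    using \<tau> \<nu> unfolding smooth_ad01_def smooth_adK_def by blast+
  have "fst (\<tau> c p) = 0 \<and> snd (\<nu> c p) = 0"
  proof (cases "c \<in> atlas S \<and> bproj P p \<in> fst c - Dred S")
    case True
    obtain z where "\<tau> c p = (0, z)" using smooth_ad01_representation[OF \<tau>, of "bproj P p"] True by blast
    moreover obtain z' where "\<nu> c p = (z', 0)" using smooth_adK_representation[OF \<nu>, of "bproj P p"] True by blast
    ultimately show ?thesis by simp
  next
    case False
    then show ?thesis using global_oneform_zero[OF gl(1), of c p] global_oneform_zero[OF gl(2), of c p] by auto
  qed
  then show "fst (\<tau> c p) = 0" "snd (\<nu> c p) = 0" by blast+
qed

lemma jac_smooth: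
  assumes c: "c \<in> atlas S" "c' \<in> atlas S"
  shows "smooth_on (snd c' ` (fst c' \<inter> fst c)) (\<lambda>w. cnj (jac c c' (chart_inv c' w)))"
proof -
  let ?T = "snd c' ` (fst c' \<inter> fst c)"
  have T: "open ?T" by (rule chart_open[OF c(2) chart_continuous(3)[OF chart[OF c(1)]]])
  have "deriv (snd c \<circ> chart_inv c') holomorphic_on ?T"
    by (rule holomorphic_deriv[OF transition_holomorphic[OF surface c(2,1)] T])
  from smooth_on_linear[OF T bounded_linear_cnj smooth_on_holomorphic[OF T this]]
  show ?thesis
  proof (rule smooth_on_cong[OF T, rotated])
    fix w assume "w \<in> ?T"
    then have "w \<in> snd c' ` fst c'" by blast
    from transition_deriv[OF this, of c]
    show "cnj (deriv (snd c \<circ> chart_inv c') w) = cnj (jac c c' (chart_inv c' w))" by simp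
  qed
qed

text \<open>
  The cocycle condition says that \<open>\<nabla>(\<nu> + \<tau>) = 0\<close>; regularity and growth are inherited from the
  holomorphic sections in a local representation.
\<close>

lemma closed_form_hypercocycle:
  assumes h: "(\<tau>, \<nu>) \<in> hypercocycles S P"
  shows "closed_form (\<lambda>c p. (fst (\<nu> c p), snd (\<tau> c p)))"
proof -
  have \<tau>: "\<tau> \<in> smooth_ad01 S P" and \<nu>: "\<nu> \<in> smooth_adK S P"
    and cocycle: "\<And>c p. c \<in> atlas S \<Longrightarrow> bproj P p \<in> fst c - Dred S \<Longrightarrow> - nabla10_form P \<tau> c p = dbar_form P \<nu> c p"
    using h unfolding hypercocycles_def by blast+
  have gl: "global_oneform S P \<tau>" "global_oneform S P \<nu>"
    using \<tau> \<nu> unfolding smooth_ad01_def smooth_adK_def by blast+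
  have "global_oneform S P (\<lambda>c p. (fst (\<nu> c p), snd (\<tau> c p)))"
    unfolding global_oneform_def ad_oneform_def fst_conv snd_conv
  proof (intro conjI ballI allI impI)
    fix c assume c: "c \<in> atlas S"
    show "ad_section S P (fst c \<inter> - Dred S) (\<lambda>p. fst (\<nu> c p))" by (rule global_oneform_sections(1)[OF gl(2) c])
    show "ad_section S P (fst c \<inter> - Dred S) (\<lambda>p. snd (\<tau> c p))" by (rule global_oneform_sections(2)[OF gl(1) c])
    fix c' p assume c': "c' \<in> atlas S" and p: "bproj P p \<in> fst c \<inter> fst c' \<inter> - Dred S"
    have p': "bproj P p \<in> fst c" "bproj P p \<in> fst c'" "bproj P p \<notin> Dred S" using p by blast+
    show "(fst (\<nu> c' p), snd (\<tau> c' p)) = (cscale (jac c c' (bproj P p)) (fst (\<nu> c p)), cscale (cnj (jac c c' (bproj P p))) (snd (\<tau> c p)))"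
      using global_oneform_chart[OF gl(1) c c' p'] global_oneform_chart[OF gl(2) c c' p'] by simp
  next
    fix c p assume "c \<notin> atlas S \<or> bproj P p \<notin> fst c - Dred S"
    then show "(fst (\<nu> c p), snd (\<tau> c p)) = (0, 0)" using global_oneform_zero[OF gl(1)] global_oneform_zero[OF gl(2)] by simp
  qed
  moreover have "form_regular (\<lambda>c p. (fst (\<nu> c p), snd (\<tau> c p)))"
    unfolding form_regular_def fst_conv snd_conv
  proof (intro ballI, clarify, intro conjI)
    fix c U \<sigma> assume c: "c \<in> atlas S" and \<sigma>: "(U, \<sigma>) \<in> hframes P"
    let ?S = "snd c ` (fst c \<inter> (U - Dred S))"
    have oS: "open ?S" by (rule chart_open[OF c open_minus_D[OF frame_open[OF \<sigma>]]])
    show "smooth_on ?S (\<lambda>w. fst (\<nu> c (\<sigma> (chart_inv c w))))"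
    proof (rule smooth_on_local[OF oS])
      fix w assume "w \<in> ?S"
      then obtain x where x: "x \<in> fst c" "x \<in> U" "x \<notin> Dred S" "w = snd c x" by blast
      obtain W n f e where W: "open W" "x \<in> W"
        and f: "\<And>i. i < (n::nat) \<Longrightarrow> surf_smooth_on (atlas S) W (f i)" and e: "\<And>i. i < n \<Longrightarrow> e i \<in> sheaf_adK S P W"
        and rep: "\<And>c p. c \<in> atlas S \<Longrightarrow> bproj P p \<in> fst c \<Longrightarrow> bproj P p \<in> W - Dred S \<Longrightarrow>
          \<nu> c p = (\<Sum>i<n. cscale (f i (bproj P p)) (fst (e i c p)), 0)"
        using smooth_adK_representation[OF \<nu>, of x] by blast
      let ?T = "snd c ` (fst c \<inter> (U \<inter> (fst c \<inter> W - Dred S)))"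
      have oW: "open (U \<inter> (fst c \<inter> W - Dred S))"
        by (intro open_Int frame_open[OF \<sigma>] open_minus_D W(1) chart_continuous(3)[OF chart[OF c]])
      have T: "open ?T" by (rule chart_open[OF c oW])
      have fs: "smooth_on ?T (\<lambda>w. f i (chart_inv c w))" if "i < n" for i
        by (rule smooth_on_subset[OF surf_smooth_values[OF c f[OF that]]]) blast
      have es: "smooth_on ?T (\<lambda>w. fst (e i c (\<sigma> (chart_inv c w))))" if "i < n" for i
      proof -
        have "ad_hol S P (fst c \<inter> W - Dred S) (\<lambda>p. fst (e i c p))" using e[OF that] c unfolding sheaf_adK_def by blast
        from mat_holomorphic_smooth[OF T frame_values_hol[OF c \<sigma> this]] show ?thesis .
      qed
      have s: "smooth_on ?T (\<lambda>w. \<Sum>i<n. cscale (f i (chart_inv c w)) (fst (e i c (\<sigma> (chart_inv c w)))))"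
        by (intro smooth_on_sum[OF T] smooth_on_bilinear[OF bounded_bilinear_cscale T] fs es) auto
      have "smooth_on ?T (\<lambda>w. fst (\<nu> c (\<sigma> (chart_inv c w))))"
      proof (rule smooth_on_cong[OF T _ s])
        fix w assume w: "w \<in> ?T"
        have y: "chart_inv c w \<in> U" "chart_inv c w \<in> W - Dred S" using in_chart(2)[OF c w] by blast+
        have pr: "bproj P (\<sigma> (chart_inv c w)) = chart_inv c w" by (rule frame_proj[OF \<sigma> y(1)])
        show "(\<Sum>i<n. cscale (f i (chart_inv c w)) (fst (e i c (\<sigma> (chart_inv c w))))) = fst (\<nu> c (\<sigma> (chart_inv c w)))"
          using rep[OF c, of "\<sigma> (chart_inv c w)"] in_chart(1)[OF c w] y(2) unfolding pr by simp
      qed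
      then show "\<exists>T. open T \<and> w \<in> T \<and> smooth_on T (\<lambda>w. fst (\<nu> c (\<sigma> (chart_inv c w))))" using T x W(2) by blast
    qed
    show "smooth_on ?S (\<lambda>w. snd (\<tau> c (\<sigma> (chart_inv c w))))"
    proof (rule smooth_on_local[OF oS])
      fix w assume "w \<in> ?S"
      then obtain x where x: "x \<in> fst c" "x \<in> U" "x \<notin> Dred S" "w = snd c x" by blast
      obtain W c0 n f e where W: "open W" "x \<in> W" "W \<subseteq> fst c0" "c0 \<in> atlas S"
        and f: "\<And>i. i < (n::nat) \<Longrightarrow> surf_smooth_on (atlas S) W (f i)" and e: "\<And>i. i < n \<Longrightarrow> e i \<in> sheaf_ad S P W"
        and rep: "\<And>c p. c \<in> atlas S \<Longrightarrow> bproj P p \<in> fst c \<Longrightarrow> bproj P p \<in> W - Dred S \<Longrightarrow>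
          \<tau> c p = (0, cscale (cnj (jac c0 c (bproj P p))) (\<Sum>i<n. cscale (f i (bproj P p)) (e i p)))"
        using smooth_ad01_representation[OF \<tau>, of x] by blast
      let ?T = "snd c ` (fst c \<inter> (U \<inter> W - Dred S))"
      have T: "open ?T" by (rule chart_open[OF c open_minus_D[OF open_Int[OF frame_open[OF \<sigma>] W(1)]]])
      have js: "smooth_on ?T (\<lambda>w. cnj (jac c0 c (chart_inv c w)))"
        by (rule smooth_on_subset[OF jac_smooth[OF W(4) c]]) (use W(3) in blast)
      have fs: "smooth_on ?T (\<lambda>w. f i (chart_inv c w))" if "i < n" for i
        by (rule smooth_on_subset[OF surf_smooth_values[OF c f[OF that]]]) blast
      have es: "smooth_on ?T (\<lambda>w. e i (\<sigma> (chart_inv c w)))" if "i < n" for i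
        by (rule smooth_on_subset[OF frame_values_smooth[OF c \<sigma> ad_smooth_hol[OF W(1) sheaf_adD(2)[OF e[OF that]]]]]) blast
      have s: "smooth_on ?T (\<lambda>w. cscale (cnj (jac c0 c (chart_inv c w))) (\<Sum>i<n. cscale (f i (chart_inv c w)) (e i (\<sigma> (chart_inv c w)))))"
        by (intro smooth_on_bilinear[OF bounded_bilinear_cscale T] js smooth_on_sum[OF T] fs es) auto
      have "smooth_on ?T (\<lambda>w. snd (\<tau> c (\<sigma> (chart_inv c w))))"
      proof (rule smooth_on_cong[OF T _ s])
        fix w assume w: "w \<in> ?T"
        have y: "chart_inv c w \<in> U" "chart_inv c w \<in> W - Dred S" using in_chart(2)[OF c w] by blast+
        have pr: "bproj P (\<sigma> (chart_inv c w)) = chart_inv c w" by (rule frame_proj[OF \<sigma> y(1)])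
        show "cscale (cnj (jac c0 c (chart_inv c w))) (\<Sum>i<n. cscale (f i (chart_inv c w)) (e i (\<sigma> (chart_inv c w)))) = snd (\<tau> c (\<sigma> (chart_inv c w)))"
          using rep[OF c, of "\<sigma> (chart_inv c w)"] in_chart(1)[OF c w] y(2) unfolding pr by simp
      qed
      then show "\<exists>T. open T \<and> w \<in> T \<and> smooth_on T (\<lambda>w. snd (\<tau> c (\<sigma> (chart_inv c w))))" using T x W(2) by blast
    qed
  qed
  moreover have "form_closed (\<lambda>c p. (fst (\<nu> c p), snd (\<tau> c p)))"
    unfolding form_closed_def
  proof (intro ballI allI impI)
    fix c p assume c: "c \<in> atlas S" and p: "bproj P p \<in> fst c - Dred S"
    have "nabla10_form P (\<lambda>c p. (fst (\<nu> c p), snd (\<tau> c p))) c p = nabla10_form P \<tau> c p"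
      "dbar_form P (\<lambda>c p. (fst (\<nu> c p), snd (\<tau> c p))) c p = dbar_form P \<nu> c p"
      unfolding nabla10_form_def dbar_form_def by simp_all
    then show "nabla10_form P (\<lambda>c p. (fst (\<nu> c p), snd (\<tau> c p))) c p + dbar_form P (\<lambda>c p. (fst (\<nu> c p), snd (\<tau> c p))) c p = 0"
      using cocycle[OF c p] by (metis add.right_inverse)
  qed
  moreover have "form_log (\<lambda>c p. (fst (\<nu> c p), snd (\<tau> c p)))"
    unfolding form_log_def fst_conv snd_conv
  proof (intro ballI conjI)
    fix j assume j: "j \<in> {1..npts S}"
    let ?c = "crd S j" and ?\<sigma> = "framing_frame j"
    note m = marked[OF j]
    obtain U where \<sigma>: "(U, ?\<sigma>) \<in> hframes P" "pt S j \<in> U" by (rule framing_frame[OF j])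
    show "growth (-1) (\<lambda>w. fst (\<nu> ?c (?\<sigma> (chart_inv ?c w))))"
    proof -
      obtain W n f e where W: "open W" "pt S j \<in> W"
        and f: "\<And>i. i < (n::nat) \<Longrightarrow> surf_smooth_on (atlas S) W (f i)" and e: "\<And>i. i < n \<Longrightarrow> e i \<in> sheaf_adK S P W"
        and rep: "\<And>c p. c \<in> atlas S \<Longrightarrow> bproj P p \<in> fst c \<Longrightarrow> bproj P p \<in> W - Dred S \<Longrightarrow>
          \<nu> c p = (\<Sum>i<n. cscale (f i (bproj P p)) (fst (e i c p)), 0)"
        using smooth_adK_representation[OF \<nu>, of "pt S j"] by blast
      obtain d where d: "d > 0" "ball 0 d - {0} \<subseteq> snd ?c ` (fst ?c \<inter> (U \<inter> W - Dred S))"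
        by (rule ball_in_frame[OF j, of "U \<inter> W" UNIV]) (use frame_open[OF \<sigma>(1)] W \<sigma>(2) in auto)
      have fg: "growth 0 (\<lambda>w. f i (chart_inv ?c w))" if "i < n" for i
        using growth_surf_smooth[OF f[OF that] W(1) j W(2)] growth_smooth by metis
      have "growth (0 + (-1)) (\<lambda>w. cscale (f i (chart_inv ?c w)) (fst (e i ?c (?\<sigma> (chart_inv ?c w)))))" if "i < n" for i
        by (rule growth_bilinear[OF bounded_bilinear_cscale fg[OF that] sheaf_adK_growth[OF e[OF that] j W(2)]])
      then have "growth (-1) (\<lambda>w. \<Sum>i<n. cscale (f i (chart_inv ?c w)) (fst (e i ?c (?\<sigma> (chart_inv ?c w)))))"
        by (intro growth_sum) simp
      then show ?thesis
      proof (rule growth_cong[OF _ d(1)])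
        fix w :: complex assume "w \<in> ball 0 d - {0}"
        then have w: "w \<in> snd ?c ` (fst ?c \<inter> (U \<inter> W - Dred S))" using d(2) by blast
        have y: "chart_inv ?c w \<in> U" "chart_inv ?c w \<in> W - Dred S" using in_chart(2)[OF m(1) w] by blast+
        have pr: "bproj P (?\<sigma> (chart_inv ?c w)) = chart_inv ?c w" by (rule frame_proj[OF \<sigma>(1) y(1)])
        show "(\<Sum>i<n. cscale (f i (chart_inv ?c w)) (fst (e i ?c (?\<sigma> (chart_inv ?c w))))) = fst (\<nu> ?c (?\<sigma> (chart_inv ?c w)))"
          using rep[OF m(1), of "?\<sigma> (chart_inv ?c w)"] in_chart(1)[OF m(1) w] y(2) unfolding pr by simp
      qed
    qed
    show "growth 1 (\<lambda>w. snd (\<tau> ?c (?\<sigma> (chart_inv ?c w))))"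
    proof -
      obtain W c0 n f e where W: "open W" "pt S j \<in> W" "W \<subseteq> fst c0" "c0 \<in> atlas S"
        and f: "\<And>i. i < (n::nat) \<Longrightarrow> surf_smooth_on (atlas S) W (f i)" and e: "\<And>i. i < n \<Longrightarrow> e i \<in> sheaf_ad S P W"
        and rep: "\<And>c p. c \<in> atlas S \<Longrightarrow> bproj P p \<in> fst c \<Longrightarrow> bproj P p \<in> W - Dred S \<Longrightarrow>
          \<tau> c p = (0, cscale (cnj (jac c0 c (bproj P p))) (\<Sum>i<n. cscale (f i (bproj P p)) (e i p)))"
        using smooth_ad01_representation[OF \<tau>, of "pt S j"] by blast
      obtain d where d: "d > 0" "ball 0 d \<subseteq> snd ?c ` (fst ?c \<inter> (U \<inter> W))" "ball 0 d - {0} \<subseteq> snd ?c ` (fst ?c \<inter> (U \<inter> W - Dred S))"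
        by (rule ball_in_frame[OF j, of "U \<inter> W" UNIV]) (use frame_open[OF \<sigma>(1)] W \<sigma>(2) in auto)
      have fg: "growth 0 (\<lambda>w. f i (chart_inv ?c w))" if "i < n" for i
        using growth_surf_smooth[OF f[OF that] W(1) j W(2)] growth_smooth by metis
      have jg: "growth 0 (\<lambda>w. cnj (jac c0 ?c (chart_inv ?c w)))"
        by (rule growth_smooth[OF d(1) smooth_on_subset[OF jac_smooth[OF W(4) m(1)]]]) (use d(2) W(3) in blast)
      have "growth (0 + 1) (\<lambda>w. cscale (f i (chart_inv ?c w)) (e i (?\<sigma> (chart_inv ?c w))))" if "i < n" for i
        by (rule growth_bilinear[OF bounded_bilinear_cscale fg[OF that] growth_holomorphic_zero[OF e[OF that] W(1) j W(2)]])
      then have "growth 1 (\<lambda>w. \<Sum>i<n. cscale (f i (chart_inv ?c w)) (e i (?\<sigma> (chart_inv ?c w))))"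
        by (intro growth_sum) simp
      from growth_bilinear[OF bounded_bilinear_cscale jg this]
      have "growth 1 (\<lambda>w. cscale (cnj (jac c0 ?c (chart_inv ?c w))) (\<Sum>i<n. cscale (f i (chart_inv ?c w)) (e i (?\<sigma> (chart_inv ?c w)))))"
        by simp
      then show ?thesis
      proof (rule growth_cong[OF _ d(1)])
        fix w :: complex assume "w \<in> ball 0 d - {0}"
        then have w: "w \<in> snd ?c ` (fst ?c \<inter> (U \<inter> W - Dred S))" using d(3) by blast
        have y: "chart_inv ?c w \<in> U" "chart_inv ?c w \<in> W - Dred S" using in_chart(2)[OF m(1) w] by blast+
        have pr: "bproj P (?\<sigma> (chart_inv ?c w)) = chart_inv ?c w" by (rule frame_proj[OF \<sigma>(1) y(1)])
        show "cscale (cnj (jac c0 ?c (chart_inv ?c w))) (\<Sum>i<n. cscale (f i (chart_inv ?c w)) (e i (?\<sigma> (chart_inv ?c w)))) = snd (\<tau> ?c (?\<sigma> (chart_inv ?c w)))"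
          using rep[OF m(1), of "?\<sigma> (chart_inv ?c w)"] in_chart(1)[OF m(1) w] y(2) unfolding pr by simp
      qed
    qed
  qed
  ultimately show ?thesis unfolding closed_form_def by blast
qed

section \<open>Comparison of the two pairings\<close>

text \<open>
  For forms of pure type the two integrands agree pointwise by symmetry of the Killing form.
\<close>

lemma H_form_eq_AB_form:
  assumes \<phi>: "closed_form (\<lambda>c p. (fst (\<nu>1 c p), snd (\<tau>1 c p)))" and \<psi>: "closed_form (\<lambda>c p. (fst (\<nu>2 c p), snd (\<tau>2 c p)))"
    and zero: "\<And>c p. fst (\<tau>1 c p) = 0" "\<And>c p. fst (\<tau>2 c p) = 0"
  shows "H_form S P (\<tau>1, \<nu>1) (\<tau>2, \<nu>2)
    = AB_form S P (\<lambda>c p. (fst (\<nu>1 c p), snd (\<tau>1 c p))) (\<lambda>c p. (fst (\<nu>2 c p), snd (\<tau>2 c p)))"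
  unfolding H_form_def AB_form_def prod.case
proof (rule surf_integral_cong[OF surface])
  fix c x assume c: "c \<in> atlas S" and x: "x \<in> fst c"
  define p where "p = (SOME p. bproj P p = x)"
  have p: "bproj P p = x" unfolding p_def by (rule fibre_point)
  note f = closed_formD(1)[OF \<phi>] and g = closed_formD(1)[OF \<psi>]
  have in': "fst (\<nu>1 c p) \<in> lieG S" "snd (\<tau>1 c p) \<in> lieG S" "fst (\<nu>2 c p) \<in> lieG S" "snd (\<tau>2 c p) \<in> lieG S"
  proof -
    have "(fst (\<phi> c p) \<in> lieG S \<and> snd (\<phi> c p) \<in> lieG S)" if gl: "global_oneform S P \<phi>" for \<phi>
    proof (cases "x \<in> Dred S")
      case True
      then show ?thesis using global_oneform_zero[OF gl, of c p] p cmat.subspace_0[OF lie_alg_subspace] by auto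
    next
      case False
      then have "bproj P p \<in> fst c \<inter> - Dred S" using p x by simp
      then show ?thesis using ad_section_in[OF global_oneform_sections(1)[OF gl c]] ad_section_in[OF global_oneform_sections(2)[OF gl c]] by blast
    qed
    from this[OF f] this[OF g]
    show "fst (\<nu>1 c p) \<in> lieG S" "snd (\<tau>1 c p) \<in> lieG S" "fst (\<nu>2 c p) \<in> lieG S" "snd (\<tau>2 c p) \<in> lieG S" by simp_all
  qed
  have k0: "killing (grp S) 0 Z = 0" for Z
  proof -
    have "lie 0 (lie Z b) = 0" for b :: "'n cmat" by (rule bounded_bilinear.zero_left[OF bounded_bilinear_lie])
    then show ?thesis unfolding killing_eq_trace lie_trace_def
      by (simp add: cmat.representation_zero)
  qed
  show "killing_wedge S P \<tau>1 \<nu>2 c x - killing_wedge S P \<tau>2 \<nu>1 c x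
    = killing_wedge S P (\<lambda>c p. (fst (\<nu>1 c p), snd (\<tau>1 c p))) (\<lambda>c p. (fst (\<nu>2 c p), snd (\<tau>2 c p))) c x"
    unfolding killing_wedge_def Let_def p_def[symmetric] zero k0
    using killing_commute[OF group in'(4,1)] by simp
qed

text \<open>
  The one-form common to \<open>a\<close> and \<open>A\<close> ties the representatives chosen in both classes to a single closed
  form, and likewise for \<open>b\<close> and \<open>B\<close>. Representatives may be changed in the first argument, hence by
  antisymmetry also in the second.
\<close>

lemma omega_agree:
  assumes a: "a \<in> AB_tangent_space S P nf" and b: "b \<in> AB_tangent_space S P nf"
    and A: "A \<in> H_tangent_space S P" and B: "B \<in> H_tangent_space S P"
    and aA: "tangent_identified a A" and bB: "tangent_identified b B"
  shows "omega_AB S P a b = omega_H S P A B"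
proof -
  \<comment> \<open>The representatives \<open>m\<close> and \<open>(\<tau>, \<nu>)\<close> both pair like the hypercocycle \<open>h\<close> that defines the class \<open>A\<close>.\<close>
  have representatives: "\<exists>h m \<tau> \<nu>. closed_form h \<and> (SOME \<phi>. \<phi> \<in> a) = m \<and> (SOME k. k \<in> A) = (\<tau>, \<nu>) \<and>
      (\<forall>c p. fst (\<tau> c p) = 0) \<and> closed_form m \<and> closed_form (\<lambda>c p. (fst (\<nu> c p), snd (\<tau> c p))) \<and>
      (\<forall>\<psi>. closed_form \<psi> \<longrightarrow> AB_form S P m \<psi> = AB_form S P h \<psi> \<and>
         AB_form S P (\<lambda>c p. (fst (\<nu> c p), snd (\<tau> c p))) \<psi> = AB_form S P h \<psi>)"
    if a: "a \<in> AB_tangent_space S P nf" and A: "A \<in> H_tangent_space S P" and aA: "tangent_identified a A" for a A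
  proof -
    obtain \<phi>0 where \<phi>0: "a = AB_class S P \<phi>0" using a unfolding AB_tangent_space_def by blast
    obtain \<tau>0 \<nu>0 where h0: "(\<tau>0, \<nu>0) \<in> hypercocycles S P" "A = hyper_class S P (\<tau>0, \<nu>0)"
      using A unfolding H_tangent_space_def by (metis (no_types, lifting) imageE prod.collapse)
    obtain \<phi> where \<phi>: "\<phi> \<in> a" "(part01 \<phi>, part10 \<phi>) \<in> A" using aA unfolding tangent_identified_def by blast
    define h where "h = (\<lambda>c p. (fst (\<nu>0 c p), snd (\<tau>0 c p)))"
    have h: "closed_form h" unfolding h_def by (rule closed_form_hypercocycle[OF h0(1)])
    note types = hypercocycle_types[OF h0(1)]
    obtain \<mu>2 where \<mu>2: "\<mu>2 \<in> lie_gauge1 S P" "\<phi> = (\<lambda>c p. \<phi>0 c p + - nabla S P \<mu>2 c p)"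
      using \<phi>(1) unfolding \<phi>0 AB_class_def by blast
    obtain m2 where m2: "m2 \<in> smooth_ad S P"
      "part01 \<phi> = (\<lambda>c p. \<tau>0 c p + - part01 (nabla S P m2) c p)" "part10 \<phi> = (\<lambda>c p. \<nu>0 c p + - part10 (nabla S P m2) c p)"
      using \<phi>(2) unfolding h0(2) hyper_class_def by auto
    have \<phi>_eq: "\<phi> = (\<lambda>c p. h c p + - nabla S P m2 c p)"
    proof (intro ext prod_eqI)
      fix c p
      show "fst (\<phi> c p) = fst (h c p + - nabla S P m2 c p)"
        using fun_cong[OF fun_cong[OF m2(3), of c], of p] unfolding part10_def h_def by (simp add: prod_eq_iff)
      show "snd (\<phi> c p) = snd (h c p + - nabla S P m2 c p)"
        using fun_cong[OF fun_cong[OF m2(2), of c], of p] unfolding part01_def h_def by (simp add: prod_eq_iff)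
    qed
    note gm2 = gauge_section_smooth_ad[OF m2(1)] and g\<mu>2 = gauge_section_lie_gauge1[OF \<mu>2(1)]
    have \<phi>c: "closed_form \<phi>" unfolding \<phi>_eq by (rule closed_form_shift[OF h gm2])
    have \<phi>0_eq: "\<phi>0 = (\<lambda>c p. \<phi> c p + nabla S P \<mu>2 c p)" unfolding \<mu>2(2) by simp
    have \<phi>0c: "closed_form \<phi>0" unfolding \<phi>0_eq by (rule closed_form_add[OF \<phi>c closed_form_nabla[OF g\<mu>2]])
    have \<phi>0p: "AB_form S P \<phi>0 \<psi> = AB_form S P h \<psi>" if \<psi>: "closed_form \<psi>" for \<psi>
    proof -
      have "AB_form S P \<phi>0 \<psi> = AB_form S P \<phi> \<psi>" unfolding \<mu>2(2) by (rule pairing_shift_left[OF \<phi>0c \<psi> g\<mu>2, symmetric])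
      also have "\<dots> = AB_form S P h \<psi>" unfolding \<phi>_eq by (rule pairing_shift_left[OF h \<psi> gm2])
      finally show ?thesis .
    qed
    obtain \<mu>1 where \<mu>1: "\<mu>1 \<in> lie_gauge1 S P" "(SOME \<phi>. \<phi> \<in> a) = (\<lambda>c p. \<phi>0 c p + - nabla S P \<mu>1 c p)"
      using someI[of "\<lambda>\<phi>. \<phi> \<in> a", OF \<phi>(1)] unfolding \<phi>0 AB_class_def by blast
    note g\<mu>1 = gauge_section_lie_gauge1[OF \<mu>1(1)]
    have "(SOME k. k \<in> A) \<in> A" using someI[of "\<lambda>k. k \<in> A", OF \<phi>(2)] .
    then obtain m1 where m1: "m1 \<in> smooth_ad S P"
      "(SOME k. k \<in> A) = (\<lambda>c p. \<tau>0 c p + - part01 (nabla S P m1) c p, \<lambda>c p. \<nu>0 c p + - part10 (nabla S P m1) c p)"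
      unfolding h0(2) hyper_class_def by auto
    note gm1 = gauge_section_smooth_ad[OF m1(1)]
    define \<tau> where "\<tau> = (\<lambda>c p. \<tau>0 c p + - part01 (nabla S P m1) c p)"
    define \<nu> where "\<nu> = (\<lambda>c p. \<nu>0 c p + - part10 (nabla S P m1) c p)"
    have \<tau>\<nu>: "(\<lambda>c p. (fst (\<nu> c p), snd (\<tau> c p))) = (\<lambda>c p. h c p + - nabla S P m1 c p)"
      unfolding \<tau>_def \<nu>_def h_def part01_def part10_def by (intro ext) (simp add: prod_eq_iff)
    have \<tau>z: "fst (\<tau> c p) = 0" for c p unfolding \<tau>_def part01_def using types(1) by simp
    show ?thesis
    proof (intro exI conjI allI impI)
      show "closed_form h" by (rule h)
      show "(SOME \<phi>. \<phi> \<in> a) = (\<lambda>c p. \<phi>0 c p + - nabla S P \<mu>1 c p)" by (rule \<mu>1(2))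
      show "(SOME k. k \<in> A) = (\<tau>, \<nu>)" unfolding \<tau>_def \<nu>_def by (rule m1(2))
      show "fst (\<tau> c p) = 0" for c p by (rule \<tau>z)
      show "closed_form (\<lambda>c p. \<phi>0 c p + - nabla S P \<mu>1 c p)" by (rule closed_form_shift[OF \<phi>0c g\<mu>1])
      show "closed_form (\<lambda>c p. (fst (\<nu> c p), snd (\<tau> c p)))" unfolding \<tau>\<nu> by (rule closed_form_shift[OF h gm1])
      fix \<psi> assume \<psi>: "closed_form \<psi>"
      show "AB_form S P (\<lambda>c p. \<phi>0 c p + - nabla S P \<mu>1 c p) \<psi> = AB_form S P h \<psi>"
        unfolding pairing_shift_left[OF \<phi>0c \<psi> g\<mu>1] by (rule \<phi>0p[OF \<psi>])
      show "AB_form S P (\<lambda>c p. (fst (\<nu> c p), snd (\<tau> c p))) \<psi> = AB_form S P h \<psi>"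
        unfolding \<tau>\<nu> by (rule pairing_shift_left[OF h \<psi> gm1])
    qed
  qed
  obtain h1 m1 \<tau>1 \<nu>1 where 1: "closed_form h1" "(SOME \<phi>. \<phi> \<in> a) = m1" "(SOME k. k \<in> A) = (\<tau>1, \<nu>1)"
    "\<And>c p. fst (\<tau>1 c p) = 0" "closed_form m1" "closed_form (\<lambda>c p. (fst (\<nu>1 c p), snd (\<tau>1 c p)))"
    "\<And>\<psi>. closed_form \<psi> \<Longrightarrow> AB_form S P m1 \<psi> = AB_form S P h1 \<psi>"
    "\<And>\<psi>. closed_form \<psi> \<Longrightarrow> AB_form S P (\<lambda>c p. (fst (\<nu>1 c p), snd (\<tau>1 c p))) \<psi> = AB_form S P h1 \<psi>"
    using representatives[OF a A aA] by blast
  obtain h2 m2 \<tau>2 \<nu>2 where 2: "closed_form h2" "(SOME \<phi>. \<phi> \<in> b) = m2" "(SOME k. k \<in> B) = (\<tau>2, \<nu>2)"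
    "\<And>c p. fst (\<tau>2 c p) = 0" "closed_form m2" "closed_form (\<lambda>c p. (fst (\<nu>2 c p), snd (\<tau>2 c p)))"
    "\<And>\<psi>. closed_form \<psi> \<Longrightarrow> AB_form S P m2 \<psi> = AB_form S P h2 \<psi>"
    "\<And>\<psi>. closed_form \<psi> \<Longrightarrow> AB_form S P (\<lambda>c p. (fst (\<nu>2 c p), snd (\<tau>2 c p))) \<psi> = AB_form S P h2 \<psi>"
    using representatives[OF b B bB] by blast
  have swap: "AB_form S P h1 m2 = AB_form S P h1 (\<lambda>c p. (fst (\<nu>2 c p), snd (\<tau>2 c p)))"
    unfolding pairing_antisymmetric[OF 1(1) 2(5)] pairing_antisymmetric[OF 1(1) 2(6)]
      2(7)[OF 1(1)] 2(8)[OF 1(1)] ..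
  have "omega_AB S P a b = AB_form S P m1 m2" unfolding omega_AB_def 1(2) 2(2) ..
  also have "\<dots> = AB_form S P h1 m2" by (rule 1(7)[OF 2(5)])
  also have "\<dots> = AB_form S P h1 (\<lambda>c p. (fst (\<nu>2 c p), snd (\<tau>2 c p)))" by (rule swap)
  also have "\<dots> = AB_form S P (\<lambda>c p. (fst (\<nu>1 c p), snd (\<tau>1 c p))) (\<lambda>c p. (fst (\<nu>2 c p), snd (\<tau>2 c p)))"
    by (rule 1(8)[OF 2(6), symmetric])
  also have "\<dots> = H_form S P (\<tau>1, \<nu>1) (\<tau>2, \<nu>2)"
    by (rule H_form_eq_AB_form[OF 1(6) 2(6) 1(4) 2(4), symmetric])
  also have "\<dots> = omega_H S P A B" unfolding omega_H_def 1(3) 2(3) ..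
  finally show ?thesis .
qed

end

theorem proposition3p10:
  fixes S :: "('x::t2_space, 'n::finite) irr_setting"
    and P :: "('x, 'p, 'n) framed_conn"
    and \<epsilon> :: "(real \<Rightarrow> 'n cmat) set"
    and nf :: "nat \<Rightarrow> 'x \<Rightarrow> 'p"
  assumes "irregular_setting S"
    and "moduli_point S \<epsilon> P"
    and "\<forall>j\<in>{1..npts S}. normal_frame S P j (nf j)"
    and "a \<in> AB_tangent_space S P nf" and "b \<in> AB_tangent_space S P nf"
    and "A \<in> H_tangent_space S P" and "B \<in> H_tangent_space S P"
    and "tangent_identified a A" and "tangent_identified b B"
  shows "omega_AB S P a b = omega_H S P A B"
proof -
  interpret moduli_context S P
    using assms(1,2) unfolding moduli_point_def by unfold_locales blast+
  show ?thesis by (rule omega_agree[OF assms(4-9)])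
qed

end
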